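(* Let $n\ge1$, let $\varphi:\mathbb{D}^n\to\mathbb{D}$ be a holomorphic function and let $\Theta:\mathbb{D}\to\mathbb{D}$ be an inner function such that $K_\Theta$ is infinite dimensional. Then the following are equivalent: (i) $\displaystyle\int_{\mathbb{T}^n} N_{\varphi_\zeta}(w)\,\frac{1-|\Theta(w)|}{1-|w|}\,dm_n(\zeta)\to 0$ as $|w|\to1^-$; (ii) the composition operator $C_\varphi: K_\Theta\to H^2(\mathbb{D}^n)$, $C_\varphi f=f\circ\varphi$, is compact.
   Context: $\mathbb{D}$ is the open unit disk, $\mathbb{T}=\partial\mathbb{D}$, $m_n$ the normalized Lebesgue measure on $\mathbb{T}^n$. $H^p(\mathbb{D}^n)$ is the Hardy space of holomorphic $F$ on $\mathbb{D}^n$ with $\sup_{0<r<1}\int_{\mathbb{T}^n}|F(r\zeta)|^p\,dm_n(\zeta)<\infty$. A holomorphic $\Theta:\mathbb{D}\to\mathbb{D}$ is inner if its radial boundary values have modulus $1$ $m_1$-a.e. on $\mathbb{T}$. The model space is $K_\Theta=H^2(\mathbb{D})\ominus\Theta H^2(\mathbb{D})$. For $\zeta\in\mathbb{T}^n$, $\varphi_\zeta(\lambda)=\varphi(\lambda\zeta)$, $\lambda\in\mathbb{D}$. For holomorphic $\phi:\mathbb{D}\to\mathbb{D}$, $N_\phi(w)=\sum_{z\in\mathbb{D}:\,\phi(z)=w}\log\frac1{|z|}$ for $w\ne\phi(0)$, counted with multiplicity. *)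

theory Defs
  imports "HOL-Complex_Analysis.Complex_Analysis" "HOL-Probability.Probability"
begin

text \<open>Normalized Lebesgue measure on the unit circle T and on the torus T^n
  (the n coordinates are indexed by the finite type 'n, so n = CARD('n) >= 1).\<close>

definition circle_measure :: "complex measure" where
  "circle_measure = distr (uniform_measure lborel {0..2*pi}) borel (\<lambda>t. cis t)"

definition torus_measure :: "(complex ^ 'n) measure" where
  "torus_measure = distr (PiM UNIV (\<lambda>_::'n. uniform_measure lborel {0..2*pi})) borel
                         (\<lambda>\<theta>. \<chi> i. cis (\<theta> i))"

definition polydisc :: "(complex ^ 'n) set" where
  "polydisc = {z. \<forall>i. norm (z $ i) < 1}"

definition holomorphic_pd :: "(complex ^ 'n \<Rightarrow> complex) \<Rightarrow> bool" where
  "holomorphic_pd F \<longleftrightarrow>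
     (\<forall>z\<in>polydisc. \<exists>L. (F has_derivative L) (at z) \<and> (\<forall>c v. L (c *s v) = c * L v))"

definition H2_poly_means :: "(complex ^ 'n \<Rightarrow> complex) \<Rightarrow> ennreal" where
  "H2_poly_means F =
     (SUP r\<in>{0<..<1::real}. \<integral>\<^sup>+ \<zeta>. ennreal ((norm (F (r *\<^sub>R \<zeta>)))\<^sup>2) \<partial>torus_measure)"

definition H2_poly :: "(complex ^ 'n \<Rightarrow> complex) set" where
  "H2_poly = {F. holomorphic_pd F \<and> H2_poly_means F < \<infinity>}"

definition H2_poly_norm :: "(complex ^ 'n \<Rightarrow> complex) \<Rightarrow> real" where
  "H2_poly_norm F = sqrt (enn2real (H2_poly_means F))"

definition H2_disc_means :: "(complex \<Rightarrow> complex) \<Rightarrow> ennreal" where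
  "H2_disc_means f =
     (SUP r\<in>{0<..<1::real}. \<integral>\<^sup>+ \<zeta>. ennreal ((norm (f (r *\<^sub>R \<zeta>)))\<^sup>2) \<partial>circle_measure)"

definition H2_disc :: "(complex \<Rightarrow> complex) set" where
  "H2_disc = {f. f holomorphic_on ball 0 1 \<and> H2_disc_means f < \<infinity>}"

definition H2_disc_norm :: "(complex \<Rightarrow> complex) \<Rightarrow> real" where
  "H2_disc_norm f = sqrt (enn2real (H2_disc_means f))"

definition H2_disc_inner :: "(complex \<Rightarrow> complex) \<Rightarrow> (complex \<Rightarrow> complex) \<Rightarrow> complex" where
  "H2_disc_inner f g =
     Lim (at_left (1::real))
       (\<lambda>r. \<integral> \<zeta>. f (r *\<^sub>R \<zeta>) * cnj (g (r *\<^sub>R \<zeta>)) \<partial>circle_measure)"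

definition inner_function :: "(complex \<Rightarrow> complex) \<Rightarrow> bool" where
  "inner_function \<Theta> \<longleftrightarrow> \<Theta> holomorphic_on ball 0 1 \<and> \<Theta> ` ball 0 1 \<subseteq> ball 0 1 \<and>
     (AE \<zeta> in circle_measure. \<exists>l. ((\<lambda>r::real. \<Theta> (r *\<^sub>R \<zeta>)) \<longlongrightarrow> l) (at_left 1) \<and> norm l = 1)"

definition model_space :: "(complex \<Rightarrow> complex) \<Rightarrow> (complex \<Rightarrow> complex) set" where
  "model_space \<Theta> = {f \<in> H2_disc. \<forall>g\<in>H2_disc. H2_disc_inner f (\<lambda>z. \<Theta> z * g z) = 0}"

definition infinite_dim_on_disc :: "(complex \<Rightarrow> complex) set \<Rightarrow> bool" where
  "infinite_dim_on_disc K \<longleftrightarrow>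
     (\<forall>N. \<exists>fs::nat \<Rightarrow> complex \<Rightarrow> complex. (\<forall>k<N. fs k \<in> K) \<and>
        (\<forall>c::nat \<Rightarrow> complex. (\<forall>z\<in>ball 0 1. (\<Sum>k<N. c k * fs k z) = 0) \<longrightarrow> (\<forall>k<N. c k = 0)))"

definition nevanlinna :: "(complex \<Rightarrow> complex) \<Rightarrow> complex \<Rightarrow> ennreal" where
  "nevanlinna \<phi> w =
     (\<integral>\<^sup>+ z. ennreal (real_of_int (zorder (\<lambda>x. \<phi> x - w) z) * ln (1 / norm z))
        \<partial>count_space {z \<in> ball 0 1. \<phi> z = w})"

definition slice :: "(complex ^ 'n \<Rightarrow> complex) \<Rightarrow> complex ^ 'n \<Rightarrow> complex \<Rightarrow> complex" where
  "slice \<phi> \<zeta> = (\<lambda>t. \<phi> (t *s \<zeta>))"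

definition compact_composition ::
  "(complex \<Rightarrow> complex) \<Rightarrow> (complex ^ 'n \<Rightarrow> complex) \<Rightarrow> bool" where
  "compact_composition \<Theta> \<phi> \<longleftrightarrow>
     (\<forall>f\<in>model_space \<Theta>. (f \<circ> \<phi>) \<in> H2_poly) \<and>
     (\<forall>fs::nat \<Rightarrow> complex \<Rightarrow> complex.
        (\<forall>k. fs k \<in> model_space \<Theta>) \<and> (\<exists>B. \<forall>k. H2_disc_norm (fs k) \<le> B) \<longrightarrow>
        (\<exists>s G. strict_mono s \<and> G \<in> H2_poly \<and>
           ((\<lambda>k. H2_poly_norm (\<lambda>z. fs (s k) (\<phi> z) - G z)) \<longlongrightarrow> 0) sequentially))"

end

(* Let u = 1 - |Theta|^2 and let N be the average over the torus of the Nevanlinna counting functions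
   of the slices of phi.

   Vanishing implies compactness. By the Littlewood-Paley formula on slices, the norm of f o phi is
   |f(phi 0)|^2 plus the area integral of |f'|^2 N / c0, where c0 is the integral of log(1/|w|) over the disc.
   For f in the model space the weighted integral of |f'|^2 u^(-1/4) log(1/|w|) is bounded by the norm of f:
   with G the conjugate partner of f (f = Theta conj(G) on the circle) and h = f - Theta conj(G), the function
   u^(-1/4) |h|^2 + 20 |G|^2 - u^(3/4) |G|^2 has Laplacian at least |f'|^2 u^(-1/4) and boundary means of order
   |f|^2. Condition (i) together with Littlewood's inequality gives N <= eta u^(-1/4) log(1/|w|) near the
   boundary, so a sequence that converges locally uniformly has Cauchy images.

   Compactness implies vanishing. If (i) fails along w_k, then N(w_k) is comparable to 1 - |w_k| and
   |Theta(w_k)| stays away from 1. The normalised kernel K of the model space at w_k then has, by Schwarz-Pick, a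
   large derivative on a disc of radius rho comparable to 1 - |w_k|. Subtracting from |K o phi|^2 a small multiple
   of 2 log(|phi - w_k| / rho), with its pole smoothed inside that disc, leaves a subharmonic function, so the norm
   of K o phi is bounded below, although the kernels tend to 0 locally uniformly.

   Subharmonicity is only used through circular means, computed from second-order Taylor data, so that no Green
   formula is needed. *)
theory Submission
  imports Defs
begin

section \<open>Means over the unit circle\<close>

text \<open>Origin of the exponent 1/4: near the boundary (i) bounds N by o(1) (1 - |w|) / u, and
  Littlewood's inequality bounds it by a constant times 1 - |w|. Between them lies o(1) u^(-a) (1 -
  |w|) for every a in (0,1), and a is taken small so that the squares in the Laplacian estimate
  close. Origin of the function: f' = (f' - Theta' conj(G)) + Theta' conj(G). The first summand is
  the z-derivative of h and is controlled by u^(-1/4) |h|^2, the second by -u^(3/4) |G|^2; both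
  leave multiples of |G'|^2, which 20 |G|^2 absorbs. No boundary function is formed: G comes from
  Poisson integrals over circles of radius below 1, and bounds pass to the limit by Fatou's lemma.
  That Theta is inner enters as convergence of the circular means of |Theta|^2 to 1, which puts the
  kernels into the model space. Sub-mean inequalities pass from infinitesimal to large circles, and
  mean values pass through phi, by comparison with real parts of polynomials: these keep the mean
  value property after composition with a holomorphic map.\<close>

abbreviation angle :: "real measure" where "angle \<equiv> uniform_measure lborel {0..2*pi}"

interpretation angle: prob_space angle
  by (rule prob_space_uniform_measure) auto

lemma cis_borel_measurable [measurable]: "cis \<in> borel_measurable borel"
  by (intro borel_measurable_continuous_onI continuous_intros)

lemma integrable_angle_iff:
  fixes f :: "real \<Rightarrow> 'a::{banach,second_countable_topology}"
  assumes [measurable]: "f \<in> borel_measurable borel"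
  shows "integrable angle f \<longleftrightarrow> set_integrable lborel {0..2*pi} f"
proof -
  have "angle = density lborel (\<lambda>x. ennreal (indicator {0..2*pi} x / (2*pi)))"
    unfolding uniform_measure_def
    by (intro density_cong) (auto simp: indicator_def divide_ennreal ennreal_1[symmetric] simp del: ennreal_1)
  then have "integrable angle f \<longleftrightarrow> integrable lborel (\<lambda>x. (indicator {0..2*pi} x / (2*pi)) *\<^sub>R f x)"
    by (simp add: integrable_density indicator_def)
  also have "(\<lambda>x. (indicator {0..2*pi} x / (2*pi)) *\<^sub>R f x) = (\<lambda>x. (1/(2*pi)) *\<^sub>R (indicator {0..2*pi} x *\<^sub>R f x))"
    by auto
  also have "integrable lborel (\<lambda>x. (1/(2*pi)) *\<^sub>R (indicator {0..2*pi} x *\<^sub>R f x)) \<longleftrightarrow>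
      integrable lborel (\<lambda>x. indicator {0..2*pi} x *\<^sub>R f x)"
  proof -
    have gen: "integrable lborel (\<lambda>x. c *\<^sub>R g x) \<longleftrightarrow> integrable lborel g" if "c \<noteq> 0"
      for c :: real and g :: "real \<Rightarrow> 'a"
    proof
      assume i: "integrable lborel (\<lambda>x. c *\<^sub>R g x)"
      have "integrable lborel (\<lambda>x. inverse c *\<^sub>R (c *\<^sub>R g x))"
        by (rule integrable_scaleR_right) (rule i)
      then show "integrable lborel g" using that by simp
    qed (rule integrable_scaleR_right)
    show ?thesis by (rule gen) simp
  qed
  finally show ?thesis by (simp add: set_integrable_def)
qed

lemma integral_angle:
  fixes f :: "real \<Rightarrow> 'a::{banach,second_countable_topology}"
  assumes [measurable]: "f \<in> borel_measurable borel"
  shows "(\<integral>t. f t \<partial>angle) = (1/(2*pi)) *\<^sub>R (LBINT t:{0..2*pi}. f t)"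
proof -
  have "angle = density lborel (\<lambda>x. ennreal (indicator {0..2*pi} x / (2*pi)))"
    unfolding uniform_measure_def
    by (intro density_cong) (auto simp: indicator_def divide_ennreal ennreal_1[symmetric] simp del: ennreal_1)
  then have "(\<integral>t. f t \<partial>angle) = (\<integral>x. (indicator {0..2*pi} x / (2*pi)) *\<^sub>R f x \<partial>lborel)"
    by (simp add: integral_density indicator_def)
  also have "\<dots> = (\<integral>x. (1/(2*pi)) *\<^sub>R (indicator {0..2*pi} x *\<^sub>R f x) \<partial>lborel)"
    by (intro Bochner_Integration.integral_cong) auto
  also have "\<dots> = (1/(2*pi)) *\<^sub>R (\<integral>x. indicator {0..2*pi} x *\<^sub>R f x \<partial>lborel)"
    by (rule Bochner_Integration.integral_scaleR_right)
  finally show ?thesis unfolding set_lebesgue_integral_def .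
qed

lemma integrable_angle_continuous:
  fixes f :: "real \<Rightarrow> 'a::{banach,second_countable_topology}"
  assumes "continuous_on UNIV f"
  shows "integrable angle f"
  by (subst integrable_angle_iff)
     (use assms in \<open>auto intro!: borel_measurable_continuous_onI borel_integrable_atLeastAtMost'
        intro: continuous_on_subset\<close>)

lemma integral_angle_continuous:
  fixes f :: "real \<Rightarrow> 'a::euclidean_space"
  assumes "continuous_on UNIV f"
  shows "(\<integral>t. f t \<partial>angle) = (1/(2*pi)) *\<^sub>R integral {0..2*pi} f"
proof -
  have "set_integrable lborel {0..2*pi} f"
    using assms by (intro borel_integrable_atLeastAtMost') (auto intro: continuous_on_subset)
  then show ?thesis
    by (subst integral_angle)
      (use assms in \<open>auto intro!: borel_measurable_continuous_onI simp: set_borel_integral_eq_integral\<close>)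
qed

lemma contour_integral_circlepath_angle:
  assumes "continuous_on (sphere 0 1) q"
  shows "contour_integral (circlepath 0 1) q = 2 * of_real pi * \<i> * (\<integral>t. q (cis t) * cis t \<partial>angle)"
proof -
  have cont: "continuous_on UNIV (\<lambda>t. q (cis t) * cis t)"
    by (intro continuous_intros continuous_on_compose2[OF assms]) (auto simp: dist_norm)
  have "contour_integral (circlepath 0 1) q
     = integral {0..1} (\<lambda>x. q (circlepath 0 1 x) * vector_derivative (circlepath 0 1) (at x))"
    by (simp add: contour_integral_integral)
  also have "\<dots> = integral {0..1} (\<lambda>x. (2 * of_real pi * \<i>) * (q (cis (2*pi*x)) * cis (2*pi*x)))"
  proof (rule integral_cong)
    fix x :: real assume x: "x \<in> {0..1}"
    have e: "exp (2 * of_real pi * \<i> * of_real x) = cis (2*pi*x)"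
      unfolding cis_conv_exp by (rule arg_cong[of _ _ exp]) simp
    show "q (circlepath 0 1 x) * vector_derivative (circlepath 0 1) (at x) =
       (2 * of_real pi * \<i>) * (q (cis (2*pi*x)) * cis (2*pi*x))"
      by (simp add: vector_derivative_circlepath, simp add: circlepath e)
  qed
  also have "\<dots> = (2 * of_real pi * \<i>) * integral {0..1} (\<lambda>x. q (cis (2*pi*x)) * cis (2*pi*x))"
    by simp
  also have "integral {0..1} (\<lambda>x. q (cis (2*pi*x)) * cis (2*pi*x)) = (\<integral>t. q (cis t) * cis t \<partial>angle)"
  proof -
    define I where "I = integral {0..2*pi} (\<lambda>t. q (cis t) * cis t)"
    have "((\<lambda>t. q (cis t) * cis t) has_integral I) {0..2*pi}"
      unfolding I_def
      by (intro integrable_integral integrable_continuous_interval continuous_on_subset[OF cont]) auto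
    then have "((\<lambda>t. q (cis t) * cis t) has_integral I) (cbox 0 (2*pi))" by (simp only: cbox_interval)
    from has_integral_affinity'[OF this, where m="2*pi" and c=0]
    have "((\<lambda>x. q (cis (2*pi*x)) * cis (2*pi*x)) has_integral I /\<^sub>R (2*pi)) {0..1}" by simp
    then have "integral {0..1} (\<lambda>x. q (cis (2*pi*x)) * cis (2*pi*x)) = I /\<^sub>R (2*pi)"
      by (rule integral_unique)
    then show ?thesis unfolding integral_angle_continuous[OF cont] I_def by (simp only: divide_inverse mult_1)
  qed
  finally show ?thesis .
qed

text \<open>On the circle \<open>1 - x * cnj (cis t) = (cis t - x) / cis t\<close>, so the Cauchy
  kernel du / (u - x) turns into the Szego kernel against the normalized measure.\<close>

lemma angle_Cauchy:
  assumes "F holomorphic_on ball 0 R" "1 < R" "norm x < 1"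
  shows "(\<integral>t. F (cis t) / (1 - x * cnj (cis t)) \<partial>angle) = F x"
proof -
  have sub: "cball 0 1 \<subseteq> ball (0::complex) R" using assms by auto
  have hol: "F holomorphic_on cball 0 1" using holomorphic_on_subset[OF assms(1) sub] .
  have ne: "u \<noteq> x" if "norm u = 1" for u using that assms(3) by auto
  have c: "continuous_on (sphere 0 1) (\<lambda>u. F u / (u - x))"
    using ne by (intro continuous_intros holomorphic_on_imp_continuous_on[OF holomorphic_on_subset[OF hol]])
      (auto simp: subset_iff)
  have "2 * of_real pi * \<i> * F x = contour_integral (circlepath 0 1) (\<lambda>u. F u/(u-x))"
    using contour_integral_unique[OF Cauchy_integral_circlepath_simple[OF hol, of x]] assms(3) by simp
  also have "\<dots> = 2 * of_real pi * \<i> * (\<integral>t. F (cis t) / (cis t - x) * cis t \<partial>angle)"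
    by (rule contour_integral_circlepath_angle[OF c])
  finally have "F x = (\<integral>t. F (cis t) / (cis t - x) * cis t \<partial>angle)" by simp
  also have "\<dots> = (\<integral>t. F (cis t) / (1 - x * cnj (cis t)) \<partial>angle)"
  proof (rule Bochner_Integration.integral_cong[OF refl])
    fix t
    have n: "cis t - x \<noteq> 0" using ne[of "cis t"] by simp
    have "1 - x * cnj (cis t) = (cis t - x) / cis t"
      by (simp add: diff_divide_distrib) (simp add: cis_cnj divide_inverse)
    then show "F (cis t) / (cis t - x) * cis t = F (cis t) / (1 - x * cnj (cis t))"
      by simp
  qed
  finally show ?thesis by simp
qed

lemma angle_mean_value:
  assumes "F holomorphic_on ball a R" "0 \<le> r" "r < R"
  shows "(\<integral>t. F (a + of_real r * cis t) \<partial>angle) = F a"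
proof (cases "r = 0")
  case True then show ?thesis using angle.prob_space by simp
next
  case False
  then have "r > 0" using assms by simp
  have "(\<lambda>z. F (a + of_real r * z)) holomorphic_on ball 0 (R/r)"
    by (intro holomorphic_on_compose_gen[OF _ assms(1), unfolded o_def] holomorphic_intros)
      (use \<open>r > 0\<close> in \<open>auto simp: dist_norm norm_mult field_simps\<close>)
  from angle_Cauchy[OF this, of 0] show ?thesis using \<open>r > 0\<close> assms by simp
qed

section \<open>The Poisson kernel of the disc\<close>

definition poisson :: "complex \<Rightarrow> real \<Rightarrow> real" where
  "poisson z t = (1 - (norm z)\<^sup>2) / (norm (cis t - z))\<^sup>2"

lemma poisson_nonneg: "norm z < 1 \<Longrightarrow> 0 \<le> poisson z t"
  by (simp add: poisson_def abs_square_le_1)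

lemma norm_cis_diff: "norm (cis t - a) = norm (1 - cnj a * cis t)"
proof -
  have "cis t - a = cis t * cnj (1 - cnj a * cis t)"
    using cis_mult[of t "-t"] by (simp add: algebra_simps cis_cnj)
  then have "norm (cis t - a) = norm (cis t) * norm (1 - cnj a * cis t)"
    by (simp only: norm_mult complex_mod_cnj)
  then show ?thesis by simp
qed

lemma one_minus_cis_nz: "norm x < 1 \<Longrightarrow> 1 - x * cis t \<noteq> 0"
proof
  assume "norm x < 1" "1 - x * cis t = 0"
  from this(2) have "1 = x * cis t" by (rule right_minus_eq[THEN iffD1])
  then have "norm (1::complex) = norm (x * cis t)" by (rule arg_cong)
  then show False using \<open>norm x < 1\<close> by (simp add: norm_mult)
qed

lemma between_one_recip:
  fixes z :: "'a::real_normed_vector"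
  assumes "norm z < 1"
  shows "1 < 2 / (1 + norm z)" "norm z * (2 / (1 + norm z)) < 1"
proof -
  have "0 < 1 + norm z" by (rule add_pos_nonneg) auto
  then show "1 < 2 / (1 + norm z)" "norm z * (2 / (1 + norm z)) < 1"
    using assms by (simp_all add: pos_less_divide_eq pos_divide_less_eq)
qed

lemma one_minus_cnj_cis_nz: "norm x < 1 \<Longrightarrow> 1 - x * cnj (cis t) \<noteq> 0"
  using one_minus_cis_nz[of x "-t"] by (simp add: cis_cnj)

text \<open>Splits the kernel into the Szego kernel, holomorphic in \<open>z\<close>, and a
  conjugate-holomorphic rest that vanishes at \<open>z = 0\<close>. The first half reproduces
  holomorphic functions, the second pairs with them to 0, and both expand into geometric
  series.\<close>

lemma poisson_eq:
  assumes "norm z < 1"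
  shows "complex_of_real (poisson z t) = 1 / (1 - z * cnj (cis t)) + cnj z * cis t / (1 - cnj z * cis t)"
proof -
  let ?w = "1 - cnj z * cis t"
  have w: "?w \<noteq> 0" using one_minus_cis_nz[of "cnj z" t] assms by simp
  have w': "1 - z * cnj (cis t) = cnj ?w" by simp
  have c: "cis t * cis (- t) = 1" by (simp add: cis_mult)
  have "complex_of_real (poisson z t) = (1 - z * cnj z) / (?w * cnj ?w)"
    unfolding poisson_def norm_cis_diff of_real_divide of_real_diff complex_norm_square of_real_1 ..
  also have "1 - z * cnj z = ?w + cnj z * cis t * cnj ?w"
    using c by (simp add: algebra_simps cis_cnj)
  also have "\<dots> / (?w * cnj ?w) = 1 / cnj ?w + cnj z * cis t / ?w"
  proof -
    have "(a + b * c) / (a * c) = 1 / c + b / a" if "a \<noteq> 0" "c \<noteq> 0" for a b c :: complex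
      using that by (simp add: field_simps)
    then show ?thesis using w complex_cnj_zero_iff[of ?w] by blast
  qed
  finally show ?thesis by (simp only: w')
qed

lemma continuous_poisson: "norm z < 1 \<Longrightarrow> continuous_on UNIV (poisson z)"
  unfolding poisson_def
  by (intro continuous_intros) auto

lemma holomorphic_continuous_cis:
  assumes "F holomorphic_on ball 0 R" "0 \<le> r" "r < R"
  shows "continuous_on UNIV (\<lambda>t. F (of_real r * cis t))"
  by (rule continuous_on_compose2[OF holomorphic_on_imp_continuous_on[OF assms(1)]])
     (use assms in \<open>auto intro!: continuous_intros simp: norm_mult\<close>)

lemma poisson_holomorphic:
  assumes "F holomorphic_on ball 0 R" "1 < R" "norm z < 1"
  shows "(\<integral>t. F (cis t) * of_real (poisson z t) \<partial>angle) = F z"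
proof -
  \<comment> \<open>The second half of the kernel has its pole in \<open>u\<close> at 1 /
    \<open>cnj z\<close>, beyond radius \<open>2 / (1 + norm z)\<close>. Inside \<open>R'\<close>
    the product with \<open>F\<close> is therefore holomorphic, and it vanishes at 0, so its
    circular mean is 0.\<close>
  define R' where "R' = min R (2 / (1 + norm z))"
  have R': "1 < R'" "R' \<le> R" using assms between_one_recip(1)[of z] by (auto simp: R'_def)
  have nz: "1 - cnj z * u \<noteq> 0" if "norm u < R'" for u
  proof
    assume "1 - cnj z * u = 0"
    then have "1 = cnj z * u" by (rule right_minus_eq[THEN iffD1])
    then have "norm (1::complex) = norm (cnj z * u)" by (rule arg_cong)
    then have "norm z * norm u = 1" by (simp add: norm_mult)
    moreover have "norm z * norm u \<le> norm z * (2/(1+norm z))"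
      using that by (intro mult_left_mono) (auto simp: R'_def)
    moreover have "norm z * (2/(1+norm z)) < 1" using assms by (intro between_one_recip)
    ultimately show False by simp
  qed
  have hol: "(\<lambda>u. F u * (cnj z * u / (1 - cnj z * u))) holomorphic_on ball 0 R'"
    using nz R' by (intro holomorphic_intros holomorphic_on_subset[OF assms(1)]) auto
  have c: "continuous_on UNIV (\<lambda>t. F (cis t))"
    using holomorphic_continuous_cis[OF assms(1), of 1] assms by simp
  have "(\<integral>t. F (cis t) * of_real (poisson z t) \<partial>angle)
      = (\<integral>t. F (cis t) / (1 - z * cnj (cis t)) + F (cis t) * (cnj z * cis t / (1 - cnj z * cis t)) \<partial>angle)"
    by (simp only: poisson_eq[OF assms(3)] ring_distribs mult_1_right times_divide_eq_right)
  also have "\<dots> = (\<integral>t. F (cis t) / (1 - z * cnj (cis t)) \<partial>angle) +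
       (\<integral>t. F (cis t) * (cnj z * cis t / (1 - cnj z * cis t)) \<partial>angle)"
    using one_minus_cis_nz[of "cnj z"] one_minus_cnj_cis_nz[of z] assms(3)
    by (intro Bochner_Integration.integral_add integrable_angle_continuous continuous_intros c) auto
  also have "(\<integral>t. F (cis t) / (1 - z * cnj (cis t)) \<partial>angle) = F z"
    by (rule angle_Cauchy[OF assms])
  also have "(\<integral>t. F (cis t) * (cnj z * cis t / (1 - cnj z * cis t)) \<partial>angle) = 0"
    using angle_mean_value[OF hol, of 1] R' by simp
  finally show ?thesis by simp
qed

lemma poisson_integral: "norm z < 1 \<Longrightarrow> (\<integral>t. poisson z t \<partial>angle) = 1"
proof -
  assume z: "norm z < 1"
  have "complex_of_real (\<integral>t. poisson z t \<partial>angle) = (\<integral>t. of_real (poisson z t) \<partial>angle)"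
    by simp
  also have "\<dots> = 1" using poisson_holomorphic[of "\<lambda>_. 1" 2 z] z by simp
  finally show ?thesis by (simp only: of_real_eq_1_iff)
qed

lemma poisson_sym: "poisson (of_real r * cis s) t = poisson (of_real r * cis t) s"
proof -
  have "norm (cis t - of_real r * cis s) = norm (cis s - of_real r * cis t)"
proof -
    have "(norm (cis t - of_real r * cis s))\<^sup>2 = (norm (cis s - of_real r * cis t))\<^sup>2"
      unfolding cmod_power2 by (simp add: power2_eq_square algebra_simps) (use sin_cos_squared_add[of s] sin_cos_squared_add[of t] in algebra)
    then show ?thesis by simp
  qed
  then show ?thesis by (simp add: poisson_def norm_mult)
qed

section \<open>Circular means of logarithms\<close>

lemma log_mean_aux:
  assumes "norm b < 1"
  shows "(\<integral>t. ln (norm (1 - b * cis t)) \<partial>angle) = 0" "integrable angle (\<lambda>t. ln (norm (1 - b * cis t)))"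
proof -
  define R where "R = 2 / (1 + norm b)"
  have R: "1 < R" using assms unfolding R_def by (rule between_one_recip)
  have lt: "norm (b * u) < 1" if "norm u < R" for u
  proof -
    have "norm (b * u) \<le> norm b * (2/(1+norm b))"
      unfolding norm_mult using that by (intro mult_left_mono) (auto simp: R_def)
    also have "\<dots> < 1" using assms by (rule between_one_recip)
    finally show ?thesis .
  qed
  have nn: "1 - b * u \<notin> \<real>\<^sub>\<le>\<^sub>0" if "norm u < R" for u
  proof -
    have "Re (b * u) < 1" using lt[OF that] by (meson abs_Re_le_cmod abs_le_D1 le_less_trans)
    then show ?thesis by (auto simp: complex_nonpos_Reals_iff)
  qed
  \<comment> \<open>The principal branch applies because Re (b u) < 1 on a disc of radius above 1;
    its real part is the integrand and its value at the centre is 0.\<close>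
  have hol: "(\<lambda>u. Ln (1 - b * u)) holomorphic_on ball 0 R"
    using nn by (intro holomorphic_intros) auto
  have c: "continuous_on UNIV (\<lambda>t. Ln (1 - b * cis t))"
    using holomorphic_continuous_cis[OF hol, of 1] R by simp
  have e: "ln (norm (1 - b * cis t)) = Re (Ln (1 - b * cis t))" for t
    using one_minus_cis_nz[OF assms] by (simp add: Re_Ln)
  show "integrable angle (\<lambda>t. ln (norm (1 - b * cis t)))"
    unfolding e by (intro integrable_angle_continuous continuous_intros c)
  have "(\<integral>t. ln (norm (1 - b * cis t)) \<partial>angle) = Re (\<integral>t. Ln (1 - b * cis t) \<partial>angle)"
    unfolding e by (intro integral_Re integrable_angle_continuous c)
  also have "\<dots> = 0" using angle_mean_value[OF hol, of 1] R by simp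
  finally show "(\<integral>t. ln (norm (1 - b * cis t)) \<partial>angle) = 0" .
qed

lemma AE_angle_cis_neq: "AE t in angle. cis t \<noteq> a"
proof -
  have "{t\<in>{0..2*pi}. cis t = a} \<subseteq> {arccos (Re a), 2*pi - arccos (Re a)}"
  proof
    fix t assume "t \<in> {t\<in>{0..2*pi}. cis t = a}"
    then have t: "0 \<le> t" "t \<le> 2*pi" and a: "Re a = cos t" by auto
    show "t \<in> {arccos (Re a), 2*pi - arccos (Re a)}"
    proof (cases "t \<le> pi")
      case True then show ?thesis using t by (simp add: a arccos_cos)
    next
      case False
      have "arccos (cos (2*pi - t)) = 2*pi - t" using False t by (intro arccos_cos) auto
      moreover have "cos (2*pi - t) = cos t" by simp
      ultimately show ?thesis by (simp add: a)
    qed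
  qed
  then have "finite {t\<in>{0..2*pi}. cis t = a}" using finite_subset by blast
  then have "AE t in lborel. t \<notin> {t\<in>{0..2*pi}. cis t = a}"
    by (intro AE_not_in) (auto simp: null_sets_def intro!: emeasure_lborel_countable countable_finite borel_closed finite_imp_closed)
  then show ?thesis by (intro AE_uniform_measureI) auto
qed

lemma log_mean_unit:
  "integrable angle (\<lambda>t. ln (norm (cis t - a))) \<and> (\<integral>t. ln (norm (cis t - a)) \<partial>angle) = ln (max 1 (norm a))"
proof -
  consider "norm a < 1" | "norm a > 1" | "norm a = 1" by linarith
  then show ?thesis
  proof cases
    case 1
    then show ?thesis using log_mean_aux[of "cnj a"] by (simp add: norm_cis_diff)
  next
    case 2
    then have a0: "a \<noteq> 0" by auto
    have b: "norm (1/a) < 1" using 2 divide_less_eq_1_pos[of "norm a" 1] unfolding norm_divide norm_one by linarith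
    have e: "ln (norm (cis t - a)) = ln (norm a) + ln (norm (1 - (1/a) * cis t))" for t
    proof -
      have nz: "norm (1 - (1/a) * cis t) > 0" using one_minus_cis_nz[OF b] by (simp only: zero_less_norm_iff not_False_eq_True)
      have "cis t - a = - a * (1 - (1/a) * cis t)" using a0 by (simp add: field_simps)
      then have "norm (cis t - a) = norm a * norm (1 - (1/a) * cis t)"
        by (simp only: norm_mult norm_minus_cancel)
      then show ?thesis using nz a0 by (simp add: ln_mult)
    qed
    show ?thesis unfolding e
      using log_mean_aux[OF b] 2 angle.prob_space by (simp add: max_def)
  next
    case 3
    \<comment> \<open>A pole on the circle is approached radially from outside. For x at least 1 the
      distance from \<open>cis t\<close> to x a increases with x, so the negated logarithms increase
      with n and monotone convergence applies.\<close>
    define s where "s = (\<lambda>n::nat. 1 + 1 / real (Suc n))"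
    have s1: "s n > 1" for n by (simp add: s_def)
    have *: "integrable angle (\<lambda>t. ln (norm (cis t - of_real (s n) * a)))"
       "(\<integral>t. ln (norm (cis t - of_real (s n) * a)) \<partial>angle) = ln (s n)" for n
    proof -
      have sa: "norm (of_real (s n) * a) > 1" using s1[of n] 3 by (simp add: norm_mult)
      then have a0: "of_real (s n) * a \<noteq> 0" by auto
      let ?a = "of_real (s n) * a"
      have b: "norm (1/?a) < 1" using sa by (simp only: norm_divide norm_one) (rule divide_less_eq_1_pos[THEN iffD2], auto)
      have e: "ln (norm (cis t - ?a)) = ln (norm ?a) + ln (norm (1 - (1/?a) * cis t))" for t
      proof -
        have nz: "norm (1 - (1/?a) * cis t) > 0" using one_minus_cis_nz[OF b] by (simp only: zero_less_norm_iff not_False_eq_True)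
        have "cis t - ?a = - ?a * (1 - (1/?a) * cis t)" using a0 by (simp add: field_simps)
        then have "norm (cis t - ?a) = norm ?a * norm (1 - (1/?a) * cis t)"
          by (simp only: norm_mult norm_minus_cancel)
        then show ?thesis using nz a0 by (simp add: ln_mult)
      qed
      have ns: "norm ?a = s n" using s1[of n] 3 by (simp add: norm_mult)
      show "integrable angle (\<lambda>t. ln (norm (cis t - of_real (s n) * a)))"
        unfolding e using log_mean_aux[OF b] by simp
      show "(\<integral>t. ln (norm (cis t - of_real (s n) * a)) \<partial>angle) = ln (s n)"
        unfolding e using log_mean_aux[OF b] angle.prob_space ns by simp
    qed
    have sq: "(norm (cis t - of_real x * a))\<^sup>2 = 1 + x\<^sup>2 - 2 * x * Re (cis t * cnj a)" for x t
    proof -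
      have "(norm (cis t - of_real x * a))\<^sup>2 = Re ((cis t - of_real x * a) * cnj (cis t - of_real x * a))"
        by (metis Re_complex_of_real complex_norm_square)
      also have "\<dots> = Re (cis t * cnj (cis t)) + x\<^sup>2 * Re (a * cnj a) - 2 * x * Re (cis t * cnj a)"
        by (simp add: algebra_simps power2_eq_square)
      also have "cis t * cnj (cis t) = 1" by (simp add: cis_cnj cis_mult)
      also have "a * cnj a = 1" using 3 by (simp add: complex_eq_iff complex_norm_square[symmetric] flip: of_real_power)
      finally show ?thesis by simp
    qed
    have Re1: "Re (cis t * cnj a) \<le> 1" for t
      using complex_Re_le_cmod[of "cis t * cnj a"] 3 by (simp add: norm_mult)
    have mono: "norm (cis t - of_real x * a) \<le> norm (cis t - of_real y * a)" if "1 \<le> x" "x \<le> y" for x y t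
    proof -
      have "(y - x) * (x + y - 2 * Re (cis t * cnj a)) \<ge> 0"
        using that Re1[of t] by (intro mult_nonneg_nonneg) auto
      then have "(norm (cis t - of_real x * a))\<^sup>2 \<le> (norm (cis t - of_real y * a))\<^sup>2"
        unfolding sq by (simp add: algebra_simps power2_eq_square)
      then show ?thesis by (rule power2_le_imp_le) simp
    qed
    have sdec: "s n \<le> s m" if "m \<le> n" for m n
      using that by (auto simp: s_def field_simps)
    have slim: "s \<longlonglongrightarrow> 1" unfolding s_def
      using tendsto_add[OF tendsto_const LIMSEQ_Suc[OF lim_inverse_n'], of 1] by simp
    have AEm: "AE t in angle. mono (\<lambda>n. - ln (norm (cis t - of_real (s n) * a)))"
      using AE_angle_cis_neq[of a]
    proof eventually_elim
      case (elim t)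
      show ?case
      proof (rule monoI)
        fix m n :: nat assume mn: "m \<le> n"
        have "0 < norm (cis t - of_real 1 * a)" using elim by simp
        also have "\<dots> \<le> norm (cis t - of_real (s n) * a)" using s1[of n] by (intro mono) auto
        finally have p: "0 < norm (cis t - of_real (s n) * a)" .
        have le: "norm (cis t - of_real (s n) * a) \<le> norm (cis t - of_real (s m) * a)"
          using s1[of n] sdec[OF mn] by (intro mono) auto
        show "- ln (norm (cis t - of_real (s m) * a)) \<le> - ln (norm (cis t - of_real (s n) * a))"
          using ln_le_cancel_iff[OF p less_le_trans[OF p le]] le by simp
      qed
    qed
    have AEl: "AE t in angle. (\<lambda>n. - ln (norm (cis t - of_real (s n) * a))) \<longlonglongrightarrow> - ln (norm (cis t - a))"
      using AE_angle_cis_neq[of a]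
    proof eventually_elim
      case (elim t)
      have "(\<lambda>n. - ln (norm (cis t - of_real (s n) * a))) \<longlonglongrightarrow> - ln (norm (cis t - of_real 1 * a))"
        using elim by (intro tendsto_intros slim) auto
      then show ?case by simp
    qed
    have li: "(\<lambda>n. \<integral>t. - ln (norm (cis t - of_real (s n) * a)) \<partial>angle) \<longlonglongrightarrow> - ln 1"
      unfolding integral_minus *(2) by (intro tendsto_intros slim) auto
    have m: "(\<lambda>t. - ln (norm (cis t - a))) \<in> borel_measurable angle" by measurable
    have "integrable angle (\<lambda>t. - ln (norm (cis t - a)))"
      by (rule integrable_monotone_convergence[OF _ AEm AEl li m]) (simp add: *)
    moreover have "(\<integral>t. - ln (norm (cis t - a)) \<partial>angle) = - ln 1"
      by (rule integral_monotone_convergence[OF _ AEm AEl li m]) (simp add: *)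
    ultimately show ?thesis using 3 by simp
  qed
qed

text \<open>Rescales to the unit circle. Averaging truncates the logarithm at the radius: the
  surplus over ln |a - w| is concentrated on the disc of radius \<open>r\<close> about
  \<open>a\<close>, and this surplus is what the potential theory below integrates.\<close>

lemma log_mean:
  assumes "0 < r"
  shows "integrable angle (\<lambda>t. ln (norm (a + of_real r * cis t - w)))"
    and "(\<integral>t. ln (norm (a + of_real r * cis t - w)) \<partial>angle) = ln (max r (norm (a - w)))"
proof -
  let ?b = "(w - a) / of_real r"
  have e: "ln (norm (a + of_real r * cis t - w)) = ln r + ln (norm (cis t - ?b))" if "cis t \<noteq> ?b" for t
  proof -
    have "a + of_real r * cis t - w = of_real r * (cis t - ?b)" using assms by (simp add: field_simps)
    then have "norm (a + of_real r * cis t - w) = r * norm (cis t - ?b)"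
      using assms by (simp only: norm_mult) simp
    then show ?thesis using assms that by (simp add: ln_mult)
  qed
  have AE: "AE t in angle. ln (norm (a + of_real r * cis t - w)) = ln r + ln (norm (cis t - ?b))"
    using AE_angle_cis_neq[of ?b] by eventually_elim (rule e)
  have i: "integrable angle (\<lambda>t. ln r + ln (norm (cis t - ?b)))"
    using log_mean_unit[of ?b] by simp
  show "integrable angle (\<lambda>t. ln (norm (a + of_real r * cis t - w)))"
    by (subst integrable_cong_AE[OF _ _ AE]) (use i in auto)
  have "(\<integral>t. ln (norm (a + of_real r * cis t - w)) \<partial>angle) = (\<integral>t. ln r + ln (norm (cis t - ?b)) \<partial>angle)"
    by (rule integral_cong_AE[OF _ _ AE]) auto
  also have "\<dots> = ln r + ln (max 1 (norm ?b))"
    using log_mean_unit[of ?b] angle.prob_space by simp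
  also have "\<dots> = ln (r * max 1 (norm ?b))" using assms by (simp add: ln_mult)
  also have "r * max 1 (norm ?b) = max r (norm (a - w))"
    using assms by (simp add: norm_divide norm_minus_commute max_mult_distrib_left)
  finally show "(\<integral>t. ln (norm (a + of_real r * cis t - w)) \<partial>angle) = ln (max r (norm (a - w)))" .
qed

section \<open>Jets and sub-mean functions\<close>

text \<open>The remainder has derivative o(|z|) because \<open>deriv F\<close> is differentiable at
  the centre; the mean value inequality on the disc of radius |y| then makes the remainder
  o(|y|^2).\<close>

lemma taylor2:
  assumes "F holomorphic_on S" "open S" "c \<in> S"
  shows "(\<lambda>y. F (c + y) - (F c + deriv F c * y + deriv (deriv F) c / 2 * y\<^sup>2)) \<in> o[at 0](\<lambda>y. y\<^sup>2)"
proof (rule landau_o.smallI)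
  fix e :: real assume e: "e > 0"
  have hol': "deriv F holomorphic_on S" using assms by (intro holomorphic_deriv)
  obtain r where r: "r > 0" "ball c r \<subseteq> S" using assms openE by blast
  have "(deriv F has_field_derivative deriv (deriv F) c) (at c)"
    using hol' assms by (intro holomorphic_derivI)
  then have "(deriv F has_derivative (\<lambda>h. h * deriv (deriv F) c)) (at c)"
    by (simp add: has_field_derivative_def mult.commute[of _ "deriv (deriv F) c"])
  then obtain d where d: "d > 0" and dd: "\<And>y. norm (y - c) < d \<Longrightarrow>
      norm (deriv F y - deriv F c - (y - c) * deriv (deriv F) c) \<le> e * norm (y - c)"
    unfolding has_derivative_at_alt using e by blast
  define \<epsilon> where "\<epsilon> = (\<lambda>y. F (c + y) - (F c + deriv F c * y + deriv (deriv F) c / 2 * y\<^sup>2))"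
  have "norm (\<epsilon> y) \<le> e * norm (y\<^sup>2)" if y: "norm y < min r d" for y
  proof -
    have "norm (\<epsilon> y - \<epsilon> 0) \<le> e * norm y * norm (y - 0)"
    proof (rule field_differentiable_bound[where S = "cball (0::complex) (norm y)" and f' = "\<lambda>y. deriv F (c+y) - deriv F c - y * deriv (deriv F) c"])
      fix z :: complex assume "z \<in> cball 0 (norm y)"
      then have z: "norm z \<le> norm y" by simp
      have "c + z \<in> S" using z y r by (auto simp: subset_iff dist_norm)
      then have *: "(F has_field_derivative deriv F (c+z)) (at (c + z))"
        using assms by (intro holomorphic_derivI)
      have "((\<lambda>z. F (c + z)) has_field_derivative deriv F (c+z) * 1) (at z)"
        by (rule DERIV_chain2[where g = "\<lambda>z. c + z", OF *]) (auto intro!: derivative_eq_intros)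
      then have "(\<epsilon> has_field_derivative deriv F (c+z) - deriv F c - z * deriv (deriv F) c) (at z)"
        unfolding \<epsilon>_def by (auto intro!: derivative_eq_intros)
      then show "(\<epsilon> has_field_derivative deriv F (c+z) - deriv F c - z * deriv (deriv F) c) (at z within cball 0 (norm y))"
        by (rule has_field_derivative_at_within)
      have "norm (deriv F (c+z) - deriv F c - z * deriv (deriv F) c) \<le> e * norm z"
        using dd[of "c+z"] z y by simp
      also have "\<dots> \<le> e * norm y" using z e by (intro mult_left_mono) auto
      finally show "norm (deriv F (c+z) - deriv F c - z * deriv (deriv F) c) \<le> e * norm y" .
    qed auto
    then show ?thesis by (simp add: \<epsilon>_def norm_mult power2_eq_square mult_ac)
  qed
  then show "\<forall>\<^sub>F y in at 0. norm (F (c + y) - (F c + deriv F c * y + deriv (deriv F) c / 2 * y\<^sup>2)) \<le> e * norm (y\<^sup>2)"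
    unfolding eventually_at \<epsilon>_def using r d by (intro exI[of _ "min r d"]) auto
qed

text \<open>Second-order jets in \<^term>\<open>x\<close> and its conjugate; only the coefficient \<^term>\<open>g\<close> of \<open>x * cnj x\<close>,
  a quarter of the Laplacian, survives averaging over circles, so the coefficients of the squares
  are not recorded.\<close>

definition jet :: "(complex \<Rightarrow> complex) \<Rightarrow> complex \<Rightarrow> complex \<Rightarrow> complex \<Rightarrow> complex \<Rightarrow> bool" where
  "jet \<Phi> a p q g \<longleftrightarrow> (\<exists>b b'. (\<lambda>x. \<Phi> (a + x) -
     (\<Phi> a + (p * x + q * cnj x) + (b * x\<^sup>2 + b' * (cnj x)\<^sup>2 + g * (x * cnj x)))) \<in> o[at 0](\<lambda>x. x\<^sup>2))"

lemma id_bigo: "(\<lambda>x::complex. x) \<in> O[at 0](\<lambda>x. x)"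
  "(\<lambda>x::complex. cnj x) \<in> O[at 0](\<lambda>x. x)"
  by (auto intro!: bigoI[of _ 1])

lemma sq_bigo: "(\<lambda>x::complex. x\<^sup>2) \<in> O[at 0](\<lambda>x. x\<^sup>2)"
  "(\<lambda>x::complex. (cnj x)\<^sup>2) \<in> O[at 0](\<lambda>x. x\<^sup>2)" "(\<lambda>x::complex. x * cnj x) \<in> O[at 0](\<lambda>x. x\<^sup>2)"
  by (auto intro!: bigoI[of _ 1] simp: norm_power norm_mult power2_eq_square)

lemma lin_bigo: "(\<lambda>x::complex. p * x + q * cnj x) \<in> O[at 0](\<lambda>x. x)"
  using id_bigo by (intro sum_in_bigo) auto

lemma quad_bigo: "(\<lambda>x::complex. b * x\<^sup>2 + b' * (cnj x)\<^sup>2 + g * (x * cnj x)) \<in> O[at 0](\<lambda>x. x\<^sup>2)"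
  proof -
  have c: "(\<lambda>x. k * f x) \<in> O[at 0](\<lambda>x::complex. x\<^sup>2)" if "f \<in> O[at 0](\<lambda>x. x\<^sup>2)" for k f
    using that by (cases "k = 0") auto
  show ?thesis by (intro sum_in_bigo(1) c sq_bigo)
qed

lemma sq_bigo_id: "f \<in> O[at 0](\<lambda>x::complex. x\<^sup>2) \<Longrightarrow> f \<in> O[at 0](\<lambda>x. x)"
proof (erule landau_o.big_trans, rule bigoI[of _ 1])
  show "\<forall>\<^sub>F x::complex in at 0. norm (x\<^sup>2) \<le> 1 * norm x"
    unfolding eventually_at by (rule exI[of _ 1]) (auto simp: norm_mult power2_eq_square mult_left_le_one_le)
qed

lemma sq_times_id_smallo:
  assumes "u \<in> O[at 0](\<lambda>x::complex. x\<^sup>2)" "v \<in> O[at 0](\<lambda>x. x)"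
  shows "(\<lambda>x. u x * v x) \<in> o[at 0](\<lambda>x. x\<^sup>2)"
proof -
  have "(\<lambda>x::complex. x) \<in> o[at 0](\<lambda>_. 1)"
    by (rule smalloI_tendsto) (auto intro!: tendsto_eq_intros)
  with assms(2) have "v \<in> o[at 0](\<lambda>_. 1)" by (rule landau_o.big_small_trans)
  from landau_o.big_small_mult[OF assms(1) this] show ?thesis by simp
qed

text \<open>Unpacks a jet into the increment \<open>A\<close> and the quadratic form
  \<open>Q\<close>, with \<open>A\<close> known at the three precisions O(x), linear up to O(x^2),
  and quadratic up to o(x^2), all of which products and composites consume.\<close>

definition jet_expansion where
  "jet_expansion \<Phi> a p q g A Q b b' \<longleftrightarrow> (\<forall>x. \<Phi> (a + x) = \<Phi> a + A x) \<and> A \<in> O[at 0](\<lambda>x. x) \<and>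
    (\<lambda>x::complex. A x - (p * x + q * cnj x)) \<in> O[at 0](\<lambda>x. x\<^sup>2) \<and>
    Q = (\<lambda>x. b * x\<^sup>2 + b' * (cnj x)\<^sup>2 + g * (x * cnj x)) \<and>
    (\<lambda>x. A x - ((p * x + q * cnj x) + Q x)) \<in> o[at 0](\<lambda>x. x\<^sup>2)"

lemma jetD:
  assumes "jet \<Phi> a p q g"
  shows "\<exists>A Q b b'. jet_expansion \<Phi> a p q g A Q b b'"
proof -
  from assms obtain b b' where j: "(\<lambda>x. \<Phi> (a + x) -
     (\<Phi> a + (p * x + q * cnj x) + (b * x\<^sup>2 + b' * (cnj x)\<^sup>2 + g * (x * cnj x)))) \<in> o[at 0](\<lambda>x. x\<^sup>2)"
    unfolding jet_def by blast
  define A where "A = (\<lambda>x. \<Phi> (a + x) - \<Phi> a)"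
  define Q where "Q = (\<lambda>x. b * x\<^sup>2 + b' * (cnj x)\<^sup>2 + g * (x * cnj x))"
  have 1: "(\<lambda>x. A x - ((p * x + q * cnj x) + Q x)) \<in> o[at 0](\<lambda>x. x\<^sup>2)"
    using j by (simp add: A_def Q_def algebra_simps)
  have Qb: "Q \<in> O[at 0](\<lambda>x. x\<^sup>2)" unfolding Q_def by (rule quad_bigo)
  have "(\<lambda>x. (A x - ((p * x + q * cnj x) + Q x)) + Q x) \<in> O[at 0](\<lambda>x. x\<^sup>2)"
    by (rule sum_in_bigo(1)[OF landau_o.small_imp_big[OF 1] Qb])
  then have 2: "(\<lambda>x. A x - (p * x + q * cnj x)) \<in> O[at 0](\<lambda>x. x\<^sup>2)"
    by (simp add: algebra_simps)
  have "(\<lambda>x. (A x - (p * x + q * cnj x)) + (p * x + q * cnj x)) \<in> O[at 0](\<lambda>x. x)"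
    by (rule sum_in_bigo(1)[OF sq_bigo_id[OF 2] lin_bigo])
  then have 3: "A \<in> O[at 0](\<lambda>x. x)" by simp
  have "jet_expansion \<Phi> a p q g A Q b b'"
    unfolding jet_expansion_def by (intro conjI 1 2 3) (simp_all add: A_def Q_def)
  then show ?thesis by blast
qed

lemma jetI:
  assumes "(\<lambda>x. \<Phi> (a + x) - (\<Phi> a + (p * x + q * cnj x) + Q x)) \<in> o[at 0](\<lambda>x. x\<^sup>2)"
    "Q = (\<lambda>x. b * x\<^sup>2 + b' * (cnj x)\<^sup>2 + g * (x * cnj x))"
  shows "jet \<Phi> a p q g"
  using assms unfolding jet_def by blast

lemma jet_const: "jet (\<lambda>_. c) a 0 0 0"
  by (rule jetI[of _ _ _ _ "\<lambda>_. 0" 0 0]) auto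

lemma jet_holomorphic:
  assumes "f holomorphic_on S" "open S" "a \<in> S"
  shows "jet f a (deriv f a) 0 0"
  by (rule jetI[of _ _ _ _ "\<lambda>x. deriv (deriv f) a / 2 * x\<^sup>2" "deriv (deriv f) a / 2" 0])
     (use taylor2[OF assms] in auto)

lemma jet_cnj:
  assumes "jet \<Phi> a p q g" shows "jet (\<lambda>z. cnj (\<Phi> z)) a (cnj q) (cnj p) (cnj g)"
proof -
  from assms obtain b b' where j: "(\<lambda>x. \<Phi> (a + x) -
     (\<Phi> a + (p * x + q * cnj x) + (b * x\<^sup>2 + b' * (cnj x)\<^sup>2 + g * (x * cnj x)))) \<in> o[at 0](\<lambda>x. x\<^sup>2)"
    unfolding jet_def by blast
  have "(\<lambda>x. cnj (\<Phi> (a + x) -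
     (\<Phi> a + (p * x + q * cnj x) + (b * x\<^sup>2 + b' * (cnj x)\<^sup>2 + g * (x * cnj x))))) \<in> o[at 0](\<lambda>x. x\<^sup>2)"
  proof (rule landau_o.smallI)
    fix e :: real assume "e > 0"
    from landau_o.smallD[OF j this] show "\<forall>\<^sub>F x in at 0. norm (cnj (\<Phi> (a + x) -
     (\<Phi> a + (p * x + q * cnj x) + (b * x\<^sup>2 + b' * (cnj x)\<^sup>2 + g * (x * cnj x))))) \<le> e * norm (x\<^sup>2)"
      by (simp only: complex_mod_cnj)
  qed
  then show ?thesis
    by (intro jetI[of _ _ _ _ "\<lambda>x. cnj b' * x\<^sup>2 + cnj b * (cnj x)\<^sup>2 + cnj g * (x * cnj x)" "cnj b'" "cnj b"])
       (simp_all add: algebra_simps)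
qed

lemma jet_add:
  assumes "jet \<Phi> a p q g" "jet \<Psi> a p' q' g'"
  shows "jet (\<lambda>z. \<Phi> z + \<Psi> z) a (p + p') (q + q') (g + g')"
proof -
  from assms(1) obtain b b' where j: "(\<lambda>x. \<Phi> (a + x) -
     (\<Phi> a + (p * x + q * cnj x) + (b * x\<^sup>2 + b' * (cnj x)\<^sup>2 + g * (x * cnj x)))) \<in> o[at 0](\<lambda>x. x\<^sup>2)"
    unfolding jet_def by blast
  from assms(2) obtain c c' where k: "(\<lambda>x. \<Psi> (a + x) -
     (\<Psi> a + (p' * x + q' * cnj x) + (c * x\<^sup>2 + c' * (cnj x)\<^sup>2 + g' * (x * cnj x)))) \<in> o[at 0](\<lambda>x. x\<^sup>2)"
    unfolding jet_def by blast
  from sum_in_smallo(1)[OF j k] show ?thesis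
    by (intro jetI[of _ _ _ _ "\<lambda>x. (b+c) * x\<^sup>2 + (b'+c') * (cnj x)\<^sup>2 + (g+g') * (x * cnj x)" "b+c" "b'+c'"])
       (simp_all add: algebra_simps)
qed

lemma jet_mult:
  assumes "jet \<Phi> a p q g" "jet \<Psi> a p' q' g'"
  shows "jet (\<lambda>z. \<Phi> z * \<Psi> z) a (\<Phi> a * p' + p * \<Psi> a) (\<Phi> a * q' + q * \<Psi> a)
           (\<Phi> a * g' + g * \<Psi> a + p * q' + q * p')"
proof -
  from jetD[OF assms(1)] obtain A Q b b' where JA: "jet_expansion \<Phi> a p q g A Q b b'"
    by blast
  have A: "\<And>x. \<Phi> (a + x) = \<Phi> a + A x" "A \<in> O[at 0](\<lambda>x. x)"
    "(\<lambda>x. A x - (p * x + q * cnj x)) \<in> O[at 0](\<lambda>x. x\<^sup>2)"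
    and Q': "Q = (\<lambda>x. b * x\<^sup>2 + b' * (cnj x)\<^sup>2 + g * (x * cnj x))"
    and AQ: "(\<lambda>x. A x - ((p * x + q * cnj x) + Q x)) \<in> o[at 0](\<lambda>x. x\<^sup>2)"
    using JA unfolding jet_expansion_def by auto
  from jetD[OF assms(2)] obtain B T c c' where JB: "jet_expansion \<Psi> a p' q' g' B T c c'"
    by blast
  have B: "\<And>x. \<Psi> (a + x) = \<Psi> a + B x" "B \<in> O[at 0](\<lambda>x. x)"
    "(\<lambda>x. B x - (p' * x + q' * cnj x)) \<in> O[at 0](\<lambda>x. x\<^sup>2)"
    and T': "T = (\<lambda>x. c * x\<^sup>2 + c' * (cnj x)\<^sup>2 + g' * (x * cnj x))"
    and BT: "(\<lambda>x. B x - ((p' * x + q' * cnj x) + T x)) \<in> o[at 0](\<lambda>x. x\<^sup>2)"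
    using JB unfolding jet_expansion_def by auto
  have s1: "(\<lambda>x. (A x - (p * x + q * cnj x)) * B x) \<in> o[at 0](\<lambda>x. x\<^sup>2)"
    by (rule sq_times_id_smallo[OF A(3) B(2)])
  have s2: "(\<lambda>x. (B x - (p' * x + q' * cnj x)) * (p * x + q * cnj x)) \<in> o[at 0](\<lambda>x. x\<^sup>2)"
    by (rule sq_times_id_smallo[OF B(3) lin_bigo])
  have s3: "(\<lambda>x. \<Phi> a * (B x - ((p' * x + q' * cnj x) + T x))) \<in> o[at 0](\<lambda>x. x\<^sup>2)"
    using BT by simp
  have s4: "(\<lambda>x. \<Psi> a * (A x - ((p * x + q * cnj x) + Q x))) \<in> o[at 0](\<lambda>x. x\<^sup>2)"
    using AQ by simp
  \<comment> \<open>With L and M the linear parts, A B - L M = (A - L) B + (B - M) L is o(x^2), so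
    the product of the increments may be replaced by L M. Its coefficient of |x|^2 is
    \<open>p * q' + q * p'\<close>.\<close>
  have "(\<lambda>x. (A x - (p * x + q * cnj x)) * B x + (B x - (p' * x + q' * cnj x)) * (p * x + q * cnj x)
     + \<Phi> a * (B x - ((p' * x + q' * cnj x) + T x)) + \<Psi> a * (A x - ((p * x + q * cnj x) + Q x))) \<in> o[at 0](\<lambda>x. x\<^sup>2)"
    by (intro sum_in_smallo s1 s2 s3 s4)
  also have "(\<lambda>x. (A x - (p * x + q * cnj x)) * B x + (B x - (p' * x + q' * cnj x)) * (p * x + q * cnj x)
     + \<Phi> a * (B x - ((p' * x + q' * cnj x) + T x)) + \<Psi> a * (A x - ((p * x + q * cnj x) + Q x)))
    = (\<lambda>x. \<Phi> (a + x) * \<Psi> (a + x) - (\<Phi> a * \<Psi> a + ((\<Phi> a * p' + p * \<Psi> a) * x + (\<Phi> a * q' + q * \<Psi> a) * cnj x)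
       + ((\<Phi> a * c + b * \<Psi> a + p * p') * x\<^sup>2 + (\<Phi> a * c' + b' * \<Psi> a + q * q') * (cnj x)\<^sup>2 +
         (\<Phi> a * g' + g * \<Psi> a + p * q' + q * p') * (x * cnj x))))"
    unfolding A(1) B(1) Q' T' by (rule ext) (simp add: algebra_simps power2_eq_square)
  finally show ?thesis by (rule jetI) simp
qed

text \<open>Second-order Taylor expansion of \<open>F\<close> at \<open>\<Phi> a\<close>: the square
  of the linear part of \<open>\<Phi>\<close> contributes 2 p q to the coefficient of |x|^2. Only
  \<open>F\<close> is holomorphic; the later use has a real-valued inner function and for
  \<open>F\<close> the holomorphic continuation of a real power.\<close>

lemma jet_compose:
  assumes "jet \<Phi> a p q g" "F holomorphic_on S" "open S" "\<Phi> a \<in> S"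
  shows "jet (\<lambda>z. F (\<Phi> z)) a (deriv F (\<Phi> a) * p) (deriv F (\<Phi> a) * q)
           (deriv F (\<Phi> a) * g + deriv (deriv F) (\<Phi> a) * (p * q))"
proof -
  from jetD[OF assms(1)] obtain A Q b b' where JA: "jet_expansion \<Phi> a p q g A Q b b'"
    by blast
  have A: "\<And>x. \<Phi> (a + x) = \<Phi> a + A x" "A \<in> O[at 0](\<lambda>x. x)"
    "(\<lambda>x. A x - (p * x + q * cnj x)) \<in> O[at 0](\<lambda>x. x\<^sup>2)"
    and Q': "Q = (\<lambda>x. b * x\<^sup>2 + b' * (cnj x)\<^sup>2 + g * (x * cnj x))"
    and AQ: "(\<lambda>x. A x - ((p * x + q * cnj x) + Q x)) \<in> o[at 0](\<lambda>x. x\<^sup>2)"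
    using JA unfolding jet_expansion_def by auto
  define D where "D = deriv F (\<Phi> a)" define H where "H = deriv (deriv F) (\<Phi> a) / 2"
  define c where "c = \<Phi> a"
  define R where "R = (\<lambda>y. F (c + y) - (F c + D * y + H * y\<^sup>2))"
  have R: "R \<in> o[at 0](\<lambda>y. y\<^sup>2)"
    unfolding R_def D_def H_def c_def by (rule taylor2[OF assms(2-4)])
  have A0: "(A \<longlongrightarrow> 0) (at 0)"
  proof -
    have "(\<lambda>x::complex. x) \<in> o[at 0](\<lambda>_. 1)"
      by (rule smalloI_tendsto) (auto intro!: tendsto_eq_intros)
    with A(2) have "A \<in> o[at 0](\<lambda>_. 1)" by (rule landau_o.big_small_trans)
    then show ?thesis by (auto dest: smalloD_tendsto)
  qed
  have s1: "(\<lambda>x. R (A x)) \<in> o[at 0](\<lambda>x. x\<^sup>2)"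
  proof (rule landau_o.smallI)
    fix e :: real assume e: "e > 0"
    obtain k where k: "k > 0" and ek: "\<forall>\<^sub>F x in at 0. norm (A x) \<le> k * norm x"
      using landau_o.bigE[OF A(2)] by blast
    have "e / k\<^sup>2 > 0" using e k by simp
    from landau_o.smallD[OF R this] obtain d where d: "d > 0"
      and dd: "\<And>y. y \<noteq> 0 \<Longrightarrow> norm y < d \<Longrightarrow> norm (R y) \<le> e / k\<^sup>2 * norm (y\<^sup>2)"
      unfolding eventually_at by auto
    \<comment> \<open>The increment \<open>A x\<close> may vanish for nonzero x, whereas the filter
      at 0 excludes y = 0; there the remainder is 0.\<close>
    have dd': "norm (R y) \<le> e / k\<^sup>2 * norm (y\<^sup>2)" if "norm y < d" for y
      using dd[of y] that by (cases "y = 0") (auto simp: R_def)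
    have "\<forall>\<^sub>F x in at 0. norm (A x) < d"
      using tendstoD[OF A0 d] by simp
    with ek show "\<forall>\<^sub>F x in at 0. norm (R (A x)) \<le> e * norm (x\<^sup>2)"
    proof eventually_elim
      case (elim x)
      have "norm (R (A x)) \<le> e / k\<^sup>2 * norm ((A x)\<^sup>2)" using elim by (intro dd') auto
      also have "\<dots> \<le> e / k\<^sup>2 * (k * norm x)\<^sup>2"
        unfolding norm_power using elim e by (intro mult_left_mono power_mono) auto
      also have "e / k\<^sup>2 * (k * norm x)\<^sup>2 = e * norm (x\<^sup>2)"
        using k by (simp add: norm_power power_mult_distrib)
      finally show ?case .
    qed
  qed
  have Ap: "(\<lambda>x. A x + (p * x + q * cnj x)) \<in> O[at 0](\<lambda>x. x)"
    by (intro sum_in_bigo lin_bigo A)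
  have s2: "(\<lambda>x. H * ((A x - (p * x + q * cnj x)) * (A x + (p * x + q * cnj x)))) \<in> o[at 0](\<lambda>x. x\<^sup>2)"
    using sq_times_id_smallo[OF A(3) Ap] by simp
  have s3: "(\<lambda>x. D * (A x - ((p * x + q * cnj x) + Q x))) \<in> o[at 0](\<lambda>x. x\<^sup>2)"
    using AQ by simp
  have "(\<lambda>x. R (A x) + H * ((A x - (p * x + q * cnj x)) * (A x + (p * x + q * cnj x)))
     + D * (A x - ((p * x + q * cnj x) + Q x))) \<in> o[at 0](\<lambda>x. x\<^sup>2)"
    by (intro sum_in_smallo s1 s2 s3)
  also have "(\<lambda>x. R (A x) + H * ((A x - (p * x + q * cnj x)) * (A x + (p * x + q * cnj x)))
     + D * (A x - ((p * x + q * cnj x) + Q x))) =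
     (\<lambda>x. F (\<Phi> (a + x)) - (F (\<Phi> a) + (D * p * x + D * q * cnj x)
       + ((D * b + H * p\<^sup>2) * x\<^sup>2 + (D * b' + H * q\<^sup>2) * (cnj x)\<^sup>2 + (D * g + 2 * H * (p * q)) * (x * cnj x))))"
    unfolding A(1) R_def c_def Q' by (rule ext) (simp add: algebra_simps power2_eq_square)
  finally have "jet (\<lambda>z. F (\<Phi> z)) a (D * p) (D * q) (D * g + 2 * H * (p * q))"
    by (rule jetI) simp
  then show ?thesis by (simp add: D_def H_def)
qed

lemma angle_cis_moments: "(\<integral>t. cis t \<partial>angle) = 0" "(\<integral>t. cnj (cis t) \<partial>angle) = 0"
  "(\<integral>t. (cis t)\<^sup>2 \<partial>angle) = 0" "(\<integral>t. (cnj (cis t))\<^sup>2 \<partial>angle) = 0"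
proof -
  show 1: "(\<integral>t. cis t \<partial>angle) = 0"
    using angle_mean_value[of "\<lambda>z. z" 0 2 1] by (simp add: holomorphic_on_ident)
  show 2: "(\<integral>t. (cis t)\<^sup>2 \<partial>angle) = 0"
    using angle_mean_value[of "\<lambda>z. z\<^sup>2" 0 2 1] by (simp add: holomorphic_intros)
  have "(\<integral>t. cnj (f t) \<partial>angle) = cnj (\<integral>t. f t \<partial>angle)" for f :: "real \<Rightarrow> complex"
    by (rule Bochner_Integration.integral_cnj)
  from this[of cis] this[of "\<lambda>t. (cis t)\<^sup>2"] 1 2
  show "(\<integral>t. cnj (cis t) \<partial>angle) = 0" "(\<integral>t. (cnj (cis t))\<^sup>2 \<partial>angle) = 0" by simp_all
qed

lemma angle_trig_mean:
  "integrable angle (\<lambda>t. c + p * cis t + q * cnj (cis t) + b * (cis t)\<^sup>2 + b' * (cnj (cis t))\<^sup>2)"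
  "(\<integral>t. c + p * cis t + q * cnj (cis t) + b * (cis t)\<^sup>2 + b' * (cnj (cis t))\<^sup>2 \<partial>angle) = c"
proof -
  have i: "integrable angle cis" "integrable angle (\<lambda>t. cnj (cis t))"
    "integrable angle (\<lambda>t. (cis t)\<^sup>2)" "integrable angle (\<lambda>t. (cnj (cis t))\<^sup>2)"
    by (intro integrable_angle_continuous continuous_intros)+
  show "integrable angle (\<lambda>t. c + p * cis t + q * cnj (cis t) + b * (cis t)\<^sup>2 + b' * (cnj (cis t))\<^sup>2)"
    by (intro Bochner_Integration.integrable_add integrable_mult_right i) simp
  have "(\<integral>t. c + p * cis t + q * cnj (cis t) + b * (cis t)\<^sup>2 + b' * (cnj (cis t))\<^sup>2 \<partial>angle)
     = (\<integral>t. c \<partial>angle) + (\<integral>t. p * cis t \<partial>angle) + (\<integral>t. q * cnj (cis t) \<partial>angle)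
       + (\<integral>t. b * (cis t)\<^sup>2 \<partial>angle) + (\<integral>t. b' * (cnj (cis t))\<^sup>2 \<partial>angle)"
    by (simp only: Bochner_Integration.integral_add Bochner_Integration.integrable_add integrable_mult_right i angle.integrable_const)
  also have "\<dots> = c" using angle.prob_space angle_cis_moments by simp
  finally show "(\<integral>t. c + p * cis t + q * cnj (cis t) + b * (cis t)\<^sup>2 + b' * (cnj (cis t))\<^sup>2 \<partial>angle) = c" .
qed

lemma continuous_on_circle:
  assumes "continuous_on (ball a d) \<Phi>" "\<bar>\<tau>\<bar> < d"
  shows "continuous_on UNIV (\<lambda>t. \<Phi> (a + of_real \<tau> * cis t))"
  by (rule continuous_on_compose2[OF assms(1)])
     (use assms(2) in \<open>auto intro!: continuous_intros simp: dist_norm norm_mult\<close>)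

lemma jet_mean:
  assumes "jet \<Phi> a p q g" "continuous_on (ball a d) \<Phi>" "d > 0" "e > 0"
  shows "\<forall>\<^sub>F \<tau> in at_right 0. norm ((\<integral>t. \<Phi> (a + of_real \<tau> * cis t) \<partial>angle) - \<Phi> a - of_real (\<tau>\<^sup>2) * g) \<le> e * \<tau>\<^sup>2"
proof -
  from assms(1) obtain b b' where j: "(\<lambda>x. \<Phi> (a + x) -
     (\<Phi> a + (p * x + q * cnj x) + (b * x\<^sup>2 + b' * (cnj x)\<^sup>2 + g * (x * cnj x)))) \<in> o[at 0](\<lambda>x. x\<^sup>2)"
    unfolding jet_def by blast
  define E where "E = (\<lambda>x. \<Phi> (a + x) -
     (\<Phi> a + (p * x + q * cnj x) + (b * x\<^sup>2 + b' * (cnj x)\<^sup>2 + g * (x * cnj x))))"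
  from landau_o.smallD[OF j assms(4), folded E_def] obtain r where r: "r > 0"
    and rr: "\<And>x. x \<noteq> 0 \<Longrightarrow> norm x < r \<Longrightarrow> norm (E x) \<le> e * norm (x\<^sup>2)"
    unfolding eventually_at E_def by auto
  have "norm ((\<integral>t. \<Phi> (a + of_real \<tau> * cis t) \<partial>angle) - \<Phi> a - of_real (\<tau>\<^sup>2) * g) \<le> e * \<tau>\<^sup>2"
    if \<tau>: "0 < \<tau>" "\<tau> < min r d" for \<tau>
  proof -
    have c: "continuous_on UNIV (\<lambda>t. \<Phi> (a + of_real \<tau> * cis t))"
      by (rule continuous_on_circle[OF assms(2)]) (use \<tau> in auto)
    have cE: "continuous_on UNIV (\<lambda>t. E (of_real \<tau> * cis t))"
      unfolding E_def by (intro continuous_intros c)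
    note i = integrable_angle_continuous
    have cc: "cis t * cnj (cis t) = 1" for t by (simp add: cis_cnj cis_mult)
    define rest where "rest = (\<lambda>t. (\<Phi> a + of_real (\<tau>\<^sup>2) * g)
       + (p * of_real \<tau>) * cis t + (q * of_real \<tau>) * cnj (cis t)
       + (b * of_real (\<tau>\<^sup>2)) * (cis t)\<^sup>2 + (b' * of_real (\<tau>\<^sup>2)) * (cnj (cis t))\<^sup>2)"
    have eq: "\<Phi> (a + of_real \<tau> * cis t) = E (of_real \<tau> * cis t) + rest t" for t
    proof -
      have "(of_real \<tau> * cis t) * cnj (of_real \<tau> * cis t) = of_real (\<tau>\<^sup>2) * (cis t * cnj (cis t))"
        by (simp add: power2_eq_square)
      then have "(of_real \<tau> * cis t) * cnj (of_real \<tau> * cis t) = of_real (\<tau>\<^sup>2)" by (simp only: cc mult_1_right)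
      then have "E (of_real \<tau> * cis t) = \<Phi> (a + of_real \<tau> * cis t) - (\<Phi> a + (p * (of_real \<tau> * cis t) + q * cnj (of_real \<tau> * cis t)) +
        (b * (of_real \<tau> * cis t)\<^sup>2 + b' * (cnj (of_real \<tau> * cis t))\<^sup>2 + g * of_real (\<tau>\<^sup>2)))"
        unfolding E_def by presburger
      then show ?thesis unfolding rest_def by (simp add: algebra_simps power_mult_distrib)
    qed
    have "(\<integral>t. \<Phi> (a + of_real \<tau> * cis t) \<partial>angle) = (\<integral>t. E (of_real \<tau> * cis t) \<partial>angle) + (\<integral>t. rest t \<partial>angle)"
    proof -
      have "integrable angle rest" unfolding rest_def by (rule angle_trig_mean)
      then show ?thesis unfolding eq by (rule Bochner_Integration.integral_add[OF i[OF cE]])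
    qed
    also have "(\<integral>t. rest t \<partial>angle) = \<Phi> a + of_real (\<tau>\<^sup>2) * g"
      unfolding rest_def by (rule angle_trig_mean)
    finally have "(\<integral>t. \<Phi> (a + of_real \<tau> * cis t) \<partial>angle) = (\<integral>t. E (of_real \<tau> * cis t) \<partial>angle) + (\<Phi> a + of_real (\<tau>\<^sup>2) * g)" .
    moreover have "norm (\<integral>t. E (of_real \<tau> * cis t) \<partial>angle) \<le> e * \<tau>\<^sup>2"
    proof -
      have "norm (\<integral>t. E (of_real \<tau> * cis t) \<partial>angle) \<le> (\<integral>t. norm (E (of_real \<tau> * cis t)) \<partial>angle)"
        by (rule integral_norm_bound)
      also have "\<dots> \<le> (\<integral>t. e * \<tau>\<^sup>2 \<partial>angle)"
      proof (rule integral_mono)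
        show "integrable angle (\<lambda>t. norm (E (of_real \<tau> * cis t)))" by (intro i continuous_intros cE)
        fix t
        have "norm (E (of_real \<tau> * cis t)) \<le> e * norm ((of_real \<tau> * cis t)\<^sup>2)"
          by (rule rr) (use \<tau> in \<open>auto simp: norm_mult\<close>)
        then show "norm (E (of_real \<tau> * cis t)) \<le> e * \<tau>\<^sup>2" by (simp add: norm_power norm_mult)
      qed simp
      also have "\<dots> = e * \<tau>\<^sup>2" using angle.prob_space by simp
      finally show ?thesis .
    qed
    ultimately show ?thesis by simp
  qed
  then show ?thesis
    unfolding eventually_at_right_field using r assms(3) by (intro exI[of _ "min r d"]) auto
qed

section \<open>Maximum principle and comparison with harmonic polynomials\<close>

lemma circle_mean_max_principle:
  fixes \<Psi> :: "complex \<Rightarrow> real"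
  assumes cont: "continuous_on (cball 0 R) \<Psi>" and R: "R > 0"
    and mean: "\<And>a. norm a < R \<Longrightarrow> \<forall>\<^sub>F \<tau> in at_right 0. \<Psi> a < (\<integral>t. \<Psi> (a + of_real \<tau> * cis t) \<partial>angle)"
    and bd: "\<And>z. norm z = R \<Longrightarrow> \<Psi> z \<le> K" and z: "norm z \<le> R"
  shows "\<Psi> z \<le> K"
proof -
  obtain z0 where z0: "z0 \<in> cball 0 R" and mx: "\<And>y. y \<in> cball 0 R \<Longrightarrow> \<Psi> y \<le> \<Psi> z0"
    using continuous_attains_sup[OF _ _ cont] R by (metis compact_cball cball_eq_empty not_less order.strict_implies_order)
  have "norm z0 = R"
  proof (rule ccontr)
    assume "norm z0 \<noteq> R"
    then have lt: "norm z0 < R" using z0 by simp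
    have "\<forall>\<^sub>F \<tau> in at_right 0. 0 < \<tau> \<and> \<tau> < R - norm z0"
      using lt by (auto simp: eventually_at_right_field intro!: exI[of _ "R - norm z0"])
    with mean[OF lt] have "\<forall>\<^sub>F \<tau> in at_right (0::real). False"
    proof eventually_elim
      case (elim \<tau>)
      have c: "continuous_on UNIV (\<lambda>t. \<Psi> (z0 + of_real \<tau> * cis t))"
        by (rule continuous_on_compose2[OF cont]) (use elim z0 in \<open>auto intro!: continuous_intros norm_triangle_le simp: norm_mult\<close>)
      have "(\<integral>t. \<Psi> (z0 + of_real \<tau> * cis t) \<partial>angle) \<le> (\<integral>t. \<Psi> z0 \<partial>angle)"
      proof (rule integral_mono[OF integrable_angle_continuous[OF c]])
        fix t
        have "norm (z0 + of_real \<tau> * cis t) \<le> norm z0 + \<tau>"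
          by (rule norm_triangle_le) (use elim in \<open>auto simp: norm_mult\<close>)
        then show "\<Psi> (z0 + of_real \<tau> * cis t) \<le> \<Psi> z0" using elim by (intro mx) auto
      qed simp
      then show ?case using elim angle.prob_space by simp
    qed
    then show False by simp
  qed
  then have "\<Psi> z0 \<le> K" by (rule bd)
  then show ?thesis using mx[of z] z by simp
qed

lemma mean_norm_square: "(\<integral>t. (norm (a + of_real \<tau> * cis t))\<^sup>2 \<partial>angle) = (norm a)\<^sup>2 + \<tau>\<^sup>2"
proof -
  have e: "complex_of_real ((norm (a + of_real \<tau> * cis t))\<^sup>2) =
     of_real ((norm a)\<^sup>2 + \<tau>\<^sup>2) + (cnj a * of_real \<tau>) * cis t + (a * of_real \<tau>) * cnj (cis t) + 0 * (cis t)\<^sup>2 + 0 * (cnj (cis t))\<^sup>2" for t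
  proof -
    have "complex_of_real ((norm (a + of_real \<tau> * cis t))\<^sup>2) = (a + of_real \<tau> * cis t) * (cnj a + of_real \<tau> * cnj (cis t))"
      by (simp only: complex_norm_square) simp
    also have "\<dots> = a * cnj a + of_real (\<tau>\<^sup>2) * (cis t * cnj (cis t)) + (cnj a * of_real \<tau>) * cis t + (a * of_real \<tau>) * cnj (cis t)"
      by (simp add: algebra_simps power2_eq_square)
    also have "cis t * cnj (cis t) = 1" by (simp add: cis_cnj cis_mult)
    finally have "complex_of_real ((norm (a + of_real \<tau> * cis t))\<^sup>2)
      = of_real ((norm a)\<^sup>2) + of_real (\<tau>\<^sup>2) * 1 + (cnj a * of_real \<tau>) * cis t + (a * of_real \<tau>) * cnj (cis t)"
      unfolding complex_norm_square[of a] .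
    then show ?thesis by simp
  qed
  have "complex_of_real (\<integral>t. (norm (a + of_real \<tau> * cis t))\<^sup>2 \<partial>angle) = (\<integral>t. complex_of_real ((norm (a + of_real \<tau> * cis t))\<^sup>2) \<partial>angle)"
    by (rule integral_complex_of_real[symmetric])
  also have "\<dots> = of_real ((norm a)\<^sup>2 + \<tau>\<^sup>2)" unfolding e by (rule angle_trig_mean)
  finally show ?thesis by (simp only: of_real_eq_iff)
qed

text \<open>Nonnegativity of the generalized Laplacian in the sense of Blaschke and Privalov. The
  tolerance o(tau^2) lets it be checked one point at a time from second-order data, also for
  functions that are not twice differentiable such as potentials and the capped logarithm.\<close>

definition submean :: "(complex \<Rightarrow> real) \<Rightarrow> complex \<Rightarrow> bool" where
  "submean \<Psi> a \<longleftrightarrow> (\<forall>e>0. \<forall>\<^sub>F \<tau> in at_right 0. \<Psi> a - e * \<tau>\<^sup>2 \<le> (\<integral>t. \<Psi> (a + of_real \<tau> * cis t) \<partial>angle))"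

lemma poly_holomorphic: "poly p holomorphic_on S"
  by (intro holomorphic_intros)

text \<open>Subtracting the real part of a polynomial does not change the surplus of circular means,
  so the maximum principle compares with such harmonic functions.\<close>

lemma submean_le_poly:
  assumes cont: "continuous_on (cball 0 R) \<Psi>" and R: "R > 0"
    and sm: "\<And>a. norm a < R \<Longrightarrow> submean \<Psi> a"
    and bd: "\<And>z. norm z = R \<Longrightarrow> \<Psi> z \<le> Re (poly p z) + K" and z: "norm z \<le> R"
  shows "\<Psi> z \<le> Re (poly p z) + K"
proof (rule field_le_epsilon)
  fix e :: real assume e: "e > 0"
  \<comment> \<open>Adding eta |z|^2 raises each small circular mean by eta tau^2, while the
    sub-mean hypothesis is called with loss (eta/2) tau^2; the net gain makes the inequality strict.
    The price at the boundary is eta R^2 = e.\<close>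
  define \<eta> where "\<eta> = e / R\<^sup>2"
  have \<eta>: "\<eta> > 0" using e R by (simp add: \<eta>_def)
  define X where "X = (\<lambda>z. \<Psi> z - Re (poly p z) + \<eta> * (norm z)\<^sup>2)"
  have contX: "continuous_on (cball 0 R) X"
    unfolding X_def by (intro continuous_intros cont)
  have "X z \<le> K + \<eta> * R\<^sup>2"
  proof (rule circle_mean_max_principle[OF contX R _ _ z])
    show "X z \<le> K + \<eta> * R\<^sup>2" if "norm z = R" for z using bd[OF that] that by (simp add: X_def)
    fix a :: complex assume a: "norm a < R"
    have "\<forall>\<^sub>F \<tau> in at_right 0. 0 < \<tau> \<and> \<tau> < R - norm a"
      using a by (auto simp: eventually_at_right_field intro!: exI[of _ "R - norm a"])
    moreover have "\<forall>\<^sub>F \<tau> in at_right 0. \<Psi> a - \<eta>/2 * \<tau>\<^sup>2 \<le> (\<integral>t. \<Psi> (a + of_real \<tau> * cis t) \<partial>angle)"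
      using sm[OF a] \<eta> unfolding submean_def by (meson half_gt_zero)
    ultimately show "\<forall>\<^sub>F \<tau> in at_right 0. X a < (\<integral>t. X (a + of_real \<tau> * cis t) \<partial>angle)"
    proof eventually_elim
      case (elim \<tau>)
      have c: "continuous_on UNIV (\<lambda>t. \<Psi> (a + of_real \<tau> * cis t))"
        by (rule continuous_on_compose2[OF cont]) (use elim a in \<open>auto intro!: continuous_intros norm_triangle_le simp: norm_mult\<close>)
      have c2: "continuous_on UNIV (\<lambda>t. poly p (a + of_real \<tau> * cis t))"
        by (intro continuous_intros)
      have i1: "integrable angle (\<lambda>t. \<Psi> (a + of_real \<tau> * cis t))" by (rule integrable_angle_continuous[OF c])
      have i2: "integrable angle (\<lambda>t. Re (poly p (a + of_real \<tau> * cis t)))"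
        by (intro integrable_angle_continuous continuous_intros c2)
      have i3: "integrable angle (\<lambda>t. \<eta> * (norm (a + of_real \<tau> * cis t))\<^sup>2)"
        by (intro integrable_angle_continuous continuous_intros)
      have "(\<integral>t. X (a + of_real \<tau> * cis t) \<partial>angle) = (\<integral>t. \<Psi> (a + of_real \<tau> * cis t) \<partial>angle)
        - (\<integral>t. Re (poly p (a + of_real \<tau> * cis t)) \<partial>angle) + (\<integral>t. \<eta> * (norm (a + of_real \<tau> * cis t))\<^sup>2 \<partial>angle)"
        unfolding X_def by (simp only: Bochner_Integration.integral_add Bochner_Integration.integral_diff
            Bochner_Integration.integrable_diff i1 i2 i3)
      also have "(\<integral>t. Re (poly p (a + of_real \<tau> * cis t)) \<partial>angle) = Re (poly p a)"
        using angle_mean_value[where F="poly p" and a=a and r=\<tau> and R="\<tau>+1", OF poly_holomorphic] elim integral_Re[OF integrable_angle_continuous[OF c2]] by simp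
      also have "(\<integral>t. \<eta> * (norm (a + of_real \<tau> * cis t))\<^sup>2 \<partial>angle) = \<eta> * ((norm a)\<^sup>2 + \<tau>\<^sup>2)"
        by (simp only: integral_mult_right_zero mean_norm_square)
      finally have "(\<integral>t. X (a + of_real \<tau> * cis t) \<partial>angle) \<ge> X a + \<eta>/2 * \<tau>\<^sup>2"
        using elim by (simp add: X_def algebra_simps)
      moreover have "\<eta>/2 * \<tau>\<^sup>2 > 0" using \<eta> elim by simp
      ultimately show ?case by linarith
    qed
  qed
  also have "\<eta> * R\<^sup>2 = e" using R by (simp add: \<eta>_def)
  finally have "X z \<le> K + e" .
  moreover have "\<Psi> z \<le> X z + Re (poly p z)" using \<eta> by (simp add: X_def)
  ultimately show "\<Psi> z \<le> Re (poly p z) + K + e" by linarith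
qed

definition re_polys :: "real \<Rightarrow> (complex \<Rightarrow> real) set" where
  "re_polys R = {f. \<exists>p. \<forall>z. norm z = R \<longrightarrow> f z = Re (poly p z)}"

lemma re_polys_add: "f \<in> re_polys R \<Longrightarrow> g \<in> re_polys R \<Longrightarrow> (\<lambda>z. f z + g z) \<in> re_polys R"
  unfolding re_polys_def by clarify (rule_tac x="p + pa" in exI, simp)

lemma re_polys_sum: "(\<And>i. i \<in> I \<Longrightarrow> f i \<in> re_polys R) \<Longrightarrow> (\<lambda>z. \<Sum>i\<in>I. f i z) \<in> re_polys R"
proof (induction I rule: infinite_finite_induct)
  case (insert x F)
  then show ?case using re_polys_add[of "f x" R "\<lambda>z. \<Sum>i\<in>F. f i z"] by simp
qed (auto simp: re_polys_def intro: exI[of _ 0])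

lemma re_polys_monom: "(\<lambda>z. Re (a * z ^ j)) \<in> re_polys R"
  unfolding re_polys_def by (auto intro!: exI[of _ "monom a j"] simp: poly_monom)

text \<open>Re x Re y is half of Re (x y) + Re (x cnj y), and on |z| = R the mixed product z^j times
  the conjugate of z^k collapses to R^(2k) z^(j-k) when k is at most j. Hence boundary values of
  real parts of polynomials form an algebra.\<close>

lemma re_polys_monom_mult: "(\<lambda>z. Re (a * z ^ j) * Re (b * z ^ k)) \<in> re_polys R"
proof -
  have main: "(\<lambda>z. Re (a * z ^ j) * Re (b * z ^ k)) \<in> re_polys R" if jk: "k \<le> j" for a b j k
  proof -
    have eq: "Re (a * z ^ j) * Re (b * z ^ k) = Re ((a*b/2) * z ^ (j+k)) + Re ((a * cnj b * of_real R ^ (2*k) / 2) * z ^ (j-k))"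
      if "norm z = R" for z
    proof -
      have "Re x * Re y = (Re (x*y) + Re (x * cnj y)) / 2" for x y by simp
      from this[of "a * z ^ j" "b * z ^ k"]
      have 1: "Re (a * z ^ j) * Re (b * z ^ k) = (Re ((a * z^j) * (b * z^k)) + Re ((a * z^j) * cnj (b * z^k))) / 2" .
      have "z ^ j = z ^ (j - k) * z ^ k" using jk by (simp flip: power_add)
      moreover have "z ^ k * cnj (z ^ k) = of_real R ^ (2*k)"
        using that complex_norm_square[of z] by (simp add: power_mult flip: power_mult_distrib of_real_power)
      ultimately have 2: "(a * z^j) * cnj (b * z^k) = a * cnj b * of_real R ^ (2*k) * z ^ (j-k)"
        by (metis (no_types, lifting) complex_cnj_mult mult.assoc mult.commute)
      have 3: "(a * z^j) * (b * z^k) = a * b * z ^ (j+k)" by (simp add: power_add)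
      show ?thesis unfolding 1 2 3 by (simp add: field_simps)
    qed
    have "(\<lambda>z. Re ((a*b/2) * z ^ (j+k)) + Re ((a * cnj b * of_real R ^ (2*k) / 2) * z ^ (j-k))) \<in> re_polys R"
      by (intro re_polys_add re_polys_monom)
    then show ?thesis unfolding re_polys_def using eq by auto
  qed
  show ?thesis
  proof (cases "k \<le> j")
    case True then show ?thesis by (rule main)
  next
    case False
    then have "j \<le> k" by simp
    from main[OF this, of b a] show ?thesis by (simp add: mult.commute)
  qed
qed

lemma re_polys_mult:
  assumes "f \<in> re_polys R" "g \<in> re_polys R" shows "(\<lambda>z. f z * g z) \<in> re_polys R"
proof -
  obtain p q where p: "\<And>z. norm z = R \<Longrightarrow> f z = Re (poly p z)" and q: "\<And>z. norm z = R \<Longrightarrow> g z = Re (poly q z)"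
    using assms unfolding re_polys_def by blast
  have "(\<lambda>z. \<Sum>i\<le>degree p. \<Sum>k\<le>degree q. Re (coeff p i * z ^ i) * Re (coeff q k * z ^ k)) \<in> re_polys R"
    by (intro re_polys_sum re_polys_monom_mult)
  moreover have "f z * g z = (\<Sum>i\<le>degree p. \<Sum>k\<le>degree q. Re (coeff p i * z ^ i) * Re (coeff q k * z ^ k))"
    if "norm z = R" for z
    unfolding p[OF that] q[OF that] poly_altdef Re_sum by (simp add: sum_product)
  ultimately show ?thesis unfolding re_polys_def by simp
qed

text \<open>Stone-Weierstrass for the algebra above. It takes the place of solving the Dirichlet
  problem: continuous boundary data are matched, up to \<open>e\<close>, by a function harmonic on
  the whole plane.\<close>

lemma sphere_poly_approx:
  fixes f :: "complex \<Rightarrow> real"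
  assumes "continuous_on (sphere 0 R) f" "e > 0"
  obtains p where "\<And>z. norm z = R \<Longrightarrow> \<bar>f z - Re (poly p z)\<bar> < e"
proof -
  interpret function_ring_on "re_polys R" "sphere 0 R"
  proof
    fix f assume "f \<in> re_polys R"
    then obtain p where "\<And>z. norm z = R \<Longrightarrow> f z = Re (poly p z)" unfolding re_polys_def by blast
    then have "continuous_on (sphere 0 R) f \<longleftrightarrow> continuous_on (sphere 0 R) (\<lambda>z. Re (poly p z))"
      by (intro continuous_on_cong) auto
    then show "continuous_on (sphere 0 R) f" by (auto intro!: continuous_intros)
  next
    fix c :: real
    show "(\<lambda>_. c) \<in> re_polys R" using re_polys_monom[of "of_real c" 0 R] by simp
  next
    fix x y :: complex assume "x \<noteq> y"
    then consider "Re x \<noteq> Re y" | "Im x \<noteq> Im y" using complex_eqI by blast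
    then show "\<exists>f\<in>re_polys R. f x \<noteq> f y"
    proof cases
      case 1 then show ?thesis using re_polys_monom[of 1 1 R] by (intro bexI[of _ "\<lambda>z. Re (1 * z ^ 1)"]) auto
    next
      case 2 then show ?thesis using re_polys_monom[of "\<i>" 1 R] by (intro bexI[of _ "\<lambda>z. Re (\<i> * z ^ 1)"]) auto
    qed
  qed (auto intro: re_polys_add re_polys_mult)
  from Stone_Weierstrass[OF assms(1)] obtain F where F: "F \<in> UNIV \<rightarrow> re_polys R"
    and lim: "LIM n sequentially. F n :> uniformly_on (sphere 0 R) f" by blast
  from lim assms(2) have "\<forall>\<^sub>F n in sequentially. \<forall>x\<in>sphere 0 R. dist (F n x) (f x) < e"
    by (rule uniform_limitD)
  then obtain n where n: "\<And>x. x \<in> sphere 0 R \<Longrightarrow> dist (F n x) (f x) < e"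
    using eventually_happens'[OF sequentially_bot] by blast
  from F obtain p where "\<And>z. norm z = R \<Longrightarrow> F n z = Re (poly p z)" unfolding re_polys_def by blast
  then show ?thesis using n by (intro that[of p]) (force simp: dist_real_def abs_minus_commute)
qed

text \<open>Passes from infinitesimal circles to the circle of radius \<open>R\<close>: a polynomial
  close to \<open>\<Psi>\<close> on the circle majorizes \<open>\<Psi>\<close> at 0 up to e/2, and
  its value at 0 is its mean over the circle, which differs from the mean of \<open>\<Psi>\<close>
  by at most e/2.\<close>

lemma submean_center:
  assumes cont: "continuous_on (cball 0 R) \<Psi>" and R: "R > 0"
    and sm: "\<And>a. norm a < R \<Longrightarrow> submean \<Psi> a"
  shows "\<Psi> 0 \<le> (\<integral>t. \<Psi> (of_real R * cis t) \<partial>angle)"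
proof (rule field_le_epsilon)
  fix e :: real assume e: "e > 0"
  have "continuous_on (sphere 0 R) \<Psi>" by (rule continuous_on_subset[OF cont]) auto
  then obtain p where p: "\<And>z. norm z = R \<Longrightarrow> \<bar>\<Psi> z - Re (poly p z)\<bar> < e/2"
    using e by (elim sphere_poly_approx[of _ _ "e/2"]) auto
  have "\<Psi> 0 \<le> Re (poly p 0) + e/2"
  proof (rule submean_le_poly[OF cont R sm])
    show "\<Psi> z \<le> Re (poly p z) + e/2" if "norm z = R" for z using p[OF that] by linarith
  qed (use R in auto)
  also have "Re (poly p 0) = (\<integral>t. Re (poly p (of_real R * cis t)) \<partial>angle)"
  proof -
    have c2: "continuous_on UNIV (\<lambda>t. poly p (of_real R * cis t))" by (intro continuous_intros)
    show ?thesis using angle_mean_value[where F="poly p" and a=0 and r=R and R="R+1", OF poly_holomorphic] R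
      integral_Re[OF integrable_angle_continuous[OF c2]] by simp
  qed
  also have "\<dots> \<le> (\<integral>t. \<Psi> (of_real R * cis t) + e/2 \<partial>angle)"
  proof (rule integral_mono)
    show "integrable angle (\<lambda>t. Re (poly p (of_real R * cis t)))"
      by (intro integrable_angle_continuous continuous_intros)
    have "continuous_on UNIV (\<lambda>t. \<Psi> (of_real R * cis t))"
      by (rule continuous_on_compose2[OF cont]) (use R in \<open>auto intro!: continuous_intros simp: norm_mult\<close>)
    then show "integrable angle (\<lambda>t. \<Psi> (of_real R * cis t) + e/2)"
      by (intro integrable_angle_continuous continuous_intros)
    show "Re (poly p (of_real R * cis t)) \<le> \<Psi> (of_real R * cis t) + e/2" for t
    proof -
      have "norm (of_real R * cis t) = R" using R by (simp add: norm_mult)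
      from p[OF this] show ?thesis by linarith
    qed
  qed
  also have "\<dots> = (\<integral>t. \<Psi> (of_real R * cis t) \<partial>angle) + e/2"
  proof -
    have "continuous_on UNIV (\<lambda>t. \<Psi> (of_real R * cis t))"
      by (rule continuous_on_compose2[OF cont]) (use R in \<open>auto intro!: continuous_intros simp: norm_mult\<close>)
    from integrable_angle_continuous[OF this] show ?thesis using angle.prob_space by simp
  qed
  finally show "\<Psi> 0 \<le> (\<integral>t. \<Psi> (of_real R * cis t) \<partial>angle) + e" by simp
qed

text \<open>Both signs being sub-mean amounts to harmonicity, and then boundary approximation
  propagates inwards from above and below. The polynomial form is what survives composition with a
  holomorphic map.\<close>

lemma harmonic_poly_approx:
  assumes cont: "continuous_on (cball 0 R) \<Psi>" and R: "R > 0"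
    and sm: "\<And>a. norm a < R \<Longrightarrow> submean \<Psi> a" "\<And>a. norm a < R \<Longrightarrow> submean (\<lambda>z. - \<Psi> z) a"
    and e: "e > 0"
  shows "\<exists>p. \<forall>z. norm z \<le> R \<longrightarrow> \<bar>\<Psi> z - Re (poly p z)\<bar> \<le> e"
proof -
  have "continuous_on (sphere 0 R) \<Psi>" by (rule continuous_on_subset[OF cont]) auto
  then obtain p where p: "\<And>z. norm z = R \<Longrightarrow> \<bar>\<Psi> z - Re (poly p z)\<bar> < e"
    using e by (elim sphere_poly_approx[of _ _ "e"]) auto
  have 1: "\<Psi> z \<le> Re (poly p z) + e" if "norm z \<le> R" for z
    by (rule submean_le_poly[OF cont R sm(1) _ that]) (use p in \<open>auto simp: abs_less_iff dest: less_imp_le\<close>, use p in fastforce)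
  have 2: "- \<Psi> z \<le> Re (poly (- p) z) + e" if "norm z \<le> R" for z
    by (rule submean_le_poly[OF _ R sm(2) _ that]) (use p cont in \<open>auto intro!: continuous_intros\<close>, use p in fastforce)
  show ?thesis by (rule exI[of _ p]) (use 1 2 in \<open>fastforce simp: abs_le_iff\<close>)
qed

lemma submean_jet:
  assumes "jet (\<lambda>z. of_real (\<Phi> z)) a p q g" "continuous_on (ball a d) \<Phi>" "d > 0" "e > 0"
  shows "\<forall>\<^sub>F \<tau> in at_right 0. \<bar>(\<integral>t. \<Phi> (a + of_real \<tau> * cis t) \<partial>angle) - \<Phi> a - \<tau>\<^sup>2 * Re g\<bar> \<le> e * \<tau>\<^sup>2"
proof -
  have "continuous_on (ball a d) (\<lambda>z. complex_of_real (\<Phi> z))" by (intro continuous_intros assms)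
  from jet_mean[OF assms(1) this assms(3,4)] show ?thesis
  proof eventually_elim
    case (elim \<tau>)
    have "\<bar>Re ((\<integral>t. complex_of_real (\<Phi> (a + of_real \<tau> * cis t)) \<partial>angle) - of_real (\<Phi> a) - of_real (\<tau>\<^sup>2) * g)\<bar> \<le> e * \<tau>\<^sup>2"
      using elim abs_Re_le_cmod order_trans by blast
    then show ?case by (simp flip: of_real_power)
  qed
qed

section \<open>Logarithmic potentials\<close>

lemma ball_borel [measurable, simp]: "ball a r \<in> sets borel"
  by (rule borel_open) simp

lemma indicator_ball_borel [measurable, simp]:
  "(indicator (ball (a::'a::metric_space) r) :: 'a \<Rightarrow> 'b::{zero_neq_one,topological_space,t2_space}) \<in> borel_measurable borel"
  by (rule borel_measurable_indicator) simp

definition log_area :: ennreal where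
  "log_area = (\<integral>\<^sup>+w. ennreal (ln (1 / norm w)) * indicator (ball 0 1) w \<partial>(lborel :: complex measure))"

text \<open>The factor between a density and a quarter of the Laplacian of its logarithmic potential
  (numerically pi/2). It is kept symbolic and cancels in the final estimates.\<close>

definition c0 :: real where "c0 = enn2real log_area"

lemma nn_integral_lborel_complex_affine:
  fixes a :: complex
  assumes "\<tau> > 0" and [measurable]: "f \<in> borel_measurable borel"
  shows "(\<integral>\<^sup>+w. f w \<partial>lborel) = ennreal (\<tau>\<^sup>2) * (\<integral>\<^sup>+x. f (a + of_real \<tau> * x) \<partial>lborel)"
proof -
  have "(\<integral>\<^sup>+w. f w \<partial>lborel) = (\<integral>\<^sup>+w. f w \<partial>(density (distr lborel borel (\<lambda>x. a + \<tau> *\<^sub>R x)) (\<lambda>_. \<bar>\<tau>\<bar>^DIM(complex))))"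
    using lborel_affine[of \<tau> a] assms by simp
  also have "\<dots> = (\<integral>\<^sup>+x. ennreal (\<tau>\<^sup>2) * f (a + \<tau> *\<^sub>R x) \<partial>lborel)"
    by (subst nn_integral_density, simp, simp, subst nn_integral_distr) simp_all
  also have "\<dots> = ennreal (\<tau>\<^sup>2) * (\<integral>\<^sup>+x. f (a + of_real \<tau> * x) \<partial>lborel)"
    by (subst nn_integral_cmult) (simp_all add: scaleR_conv_of_real)
  finally show ?thesis .
qed

lemma emeasure_lborel_complex_ball:
  fixes a :: complex assumes "\<tau> > 0"
  shows "emeasure lborel (ball a \<tau>) = ennreal (\<tau>\<^sup>2) * emeasure lborel (ball (0::complex) 1)"
proof -
  have "emeasure lborel (ball a \<tau>) = (\<integral>\<^sup>+w. indicator (ball a \<tau>) w \<partial>lborel)" by simp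
  also have "\<dots> = ennreal (\<tau>\<^sup>2) * (\<integral>\<^sup>+x. indicator (ball a \<tau>) (a + of_real \<tau> * x) \<partial>lborel)"
    by (rule nn_integral_lborel_complex_affine[OF assms]) measurable
  also have "(\<lambda>x. indicator (ball a \<tau>) (a + of_real \<tau> * x) :: ennreal) = indicator (ball 0 1)"
    using assms by (auto simp: indicator_def dist_norm norm_mult)
  finally show ?thesis by simp
qed

text \<open>Layer-cake bound: on the disc ln (1/|w|) is at most the number of k with |w| < exp (-k),
  and the areas of these balls form a geometric series.\<close>

lemma log_area_less_top: "log_area < \<infinity>"
proof -
  have "log_area \<le> (\<integral>\<^sup>+w. (\<Sum>k. indicator (ball 0 (exp (- real k))) w) \<partial>(lborel :: complex measure))"
    unfolding log_area_def
  proof (rule nn_integral_mono)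
    fix w :: complex
    show "ennreal (ln (1 / norm w)) * indicator (ball 0 1) w \<le> (\<Sum>k. indicator (ball 0 (exp (- real k))) w)"
    proof (cases "w = 0 \<or> norm w \<ge> 1")
      case True then show ?thesis by (auto simp: indicator_def)
    next
      case False
      define n where "n = nat \<lceil>ln (1 / norm w)\<rceil>"
      have w: "0 < norm w" "norm w < 1" using False by auto
      have "ln (1 / norm w) \<le> real n" unfolding n_def by linarith
      then have "ennreal (ln (1 / norm w)) * indicator (ball 0 1) w \<le> ennreal (real n)"
        using w by (simp add: indicator_def ennreal_leI)
      also have "\<dots> = (\<Sum>k<n. 1)" by (simp add: ennreal_of_nat_eq_real_of_nat)
      also have "\<dots> = (\<Sum>k<n. indicator (ball 0 (exp (- real k))) w)"
      proof (rule sum.cong[OF refl])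
        fix k assume "k \<in> {..<n}"
        then have "real k < ln (1 / norm w)" unfolding n_def by simp linarith
        then have "ln (norm w) < - real k" using w by (simp add: ln_div)
        then have "norm w < exp (- real k)" using w by (metis exp_less_cancel_iff exp_ln)
        then show "(1::ennreal) = indicator (ball 0 (exp (- real k))) w" by simp
      qed
      also have "\<dots> \<le> (\<Sum>k. indicator (ball 0 (exp (- real k))) w)"
        by (rule sum_le_suminf) auto
      finally show ?thesis .
    qed
  qed
  also have "\<dots> = (\<Sum>k. emeasure lborel (ball (0::complex) (exp (- real k))))"
    by (subst nn_integral_suminf) auto
  also have "\<dots> = (\<Sum>k. ennreal (exp (-2) ^ k) * emeasure lborel (ball (0::complex) 1))"
    by (subst emeasure_lborel_complex_ball) (simp_all add: power2_eq_square flip: exp_add exp_of_nat_mult, simp add: mult.commute)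
  also have "\<dots> = (\<Sum>k. ennreal (exp (-2) ^ k)) * emeasure lborel (ball (0::complex) 1)"
    by (rule ennreal_suminf_multc)
  also have "\<dots> < \<infinity>"
  proof -
    have "(\<Sum>k. ennreal (exp (-2::real) ^ k)) = ennreal (\<Sum>k. exp (-2) ^ k)"
      by (rule suminf_ennreal2) (auto intro!: summable_geometric)
    moreover have "emeasure lborel (ball (0::complex) 1) < \<infinity>"
      using emeasure_lborel_ball_finite by simp
    ultimately show ?thesis by (simp add: ennreal_mult_less_top)
  qed
  finally show ?thesis .
qed

lemma log_area_pos: "log_area > 0"
proof -
  have "0 < ennreal (ln 2) * emeasure lborel (ball (0::complex) (1/2))"
    using unit_ball_vol_pos[of 2] by (simp add: emeasure_ball ennreal_zero_less_mult_iff)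
  also have "\<dots> = (\<integral>\<^sup>+w. ennreal (ln 2) * indicator (ball 0 (1/2)) w \<partial>(lborel :: complex measure))"
    by (subst nn_integral_cmult) auto
  \<comment> \<open>Since 1 / 0 = 0 and ln 0 = 0, the logarithm is 0 instead of infinite at the
    origin. The term at the singleton restores the pointwise inequality and has integral 0.\<close>
  also have "\<dots> \<le> (\<integral>\<^sup>+w. ennreal (ln (1 / norm w)) * indicator (ball 0 1) w + indicator {0} w * \<infinity> \<partial>(lborel :: complex measure))"
  proof (rule nn_integral_mono)
    fix w :: complex
    show "ennreal (ln 2) * indicator (ball 0 (1/2)) w \<le> ennreal (ln (1 / norm w)) * indicator (ball 0 1) w + indicator {0} w * \<infinity>"
    proof (cases "w = 0 \<or> norm w \<ge> 1/2")
      case True then show ?thesis by (auto simp: indicator_def)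
    next
      case False
      then have "2 \<le> 1 / norm w" by (simp add: field_simps)
      then have "ln 2 \<le> ln (1 / norm w)" by (subst ln_le_cancel_iff) (use False in auto)
      then show ?thesis using False by (auto simp: indicator_def intro!: ennreal_leI)
    qed
  qed
  also have "\<dots> = log_area" unfolding log_area_def by (subst nn_integral_add) (measurable, auto simp: nn_integral_multc)
  finally show ?thesis .
qed

lemma c0_pos: "c0 > 0" and ennreal_c0: "ennreal c0 = log_area"
  using log_area_pos log_area_less_top by (auto simp: c0_def enn2real_positive_iff)

lemma log_area_scaled:
  fixes a :: complex assumes "\<tau> > 0"
  shows "(\<integral>\<^sup>+w. ennreal (ln (\<tau> / norm (a - w))) * indicator (ball a \<tau>) w \<partial>lborel) = ennreal (c0 * \<tau>\<^sup>2)"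
proof -
  have "(\<integral>\<^sup>+w. ennreal (ln (\<tau> / norm (a - w))) * indicator (ball a \<tau>) w \<partial>lborel)
     = ennreal (\<tau>\<^sup>2) * (\<integral>\<^sup>+x. ennreal (ln (\<tau> / norm (a - (a + of_real \<tau> * x)))) * indicator (ball a \<tau>) (a + of_real \<tau> * x) \<partial>lborel)"
    by (rule nn_integral_lborel_complex_affine[OF assms]) measurable
  also have "(\<integral>\<^sup>+x. ennreal (ln (\<tau> / norm (a - (a + of_real \<tau> * x)))) * indicator (ball a \<tau>) (a + of_real \<tau> * x) \<partial>lborel) = log_area"
    unfolding log_area_def by (intro nn_integral_cong) (use assms in \<open>auto simp: indicator_def dist_norm norm_mult\<close>)
  finally show ?thesis using c0_pos by (simp add: ennreal_mult' mult.commute flip: ennreal_c0)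
qed

lemma integrable_log_ball:
  fixes a :: complex assumes "\<tau> > 0"
  shows "integrable lborel (\<lambda>w. ln (\<tau> / norm (a - w)) * indicator (ball a \<tau>) w)"
    and "(\<integral>w. ln (\<tau> / norm (a - w)) * indicator (ball a \<tau>) w \<partial>lborel) = c0 * \<tau>\<^sup>2"
    and "\<And>w. 0 \<le> ln (\<tau> / norm (a - w)) * indicator (ball a \<tau>) w"
proof -
  show nn: "0 \<le> ln (\<tau> / norm (a - w)) * indicator (ball a \<tau>) w" for w
    by (cases "w = a") (auto simp: indicator_def dist_norm field_simps)
  have e: "(\<integral>\<^sup>+w. ennreal (ln (\<tau> / norm (a - w)) * indicator (ball a \<tau>) w) \<partial>lborel) = ennreal (c0 * \<tau>\<^sup>2)"
    unfolding log_area_scaled[OF assms, of a, symmetric] by (intro nn_integral_cong) (auto simp: indicator_def)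
  show "integrable lborel (\<lambda>w. ln (\<tau> / norm (a - w)) * indicator (ball a \<tau>) w)"
    by (rule integrableI_nonneg) (measurable, use nn e in auto)
  show "(\<integral>w. ln (\<tau> / norm (a - w)) * indicator (ball a \<tau>) w \<partial>lborel) = c0 * \<tau>\<^sup>2"
    by (rule integral_eq_nn_integral[THEN trans]) (measurable, use nn e c0_pos in auto)
qed

lemma AE_lborel_neq: "AE w in lborel. w \<noteq> (a::complex)"
  by (rule AE_lborel_singleton)

lemma abs_ln_norm_le:
  fixes a w :: complex
  shows "\<bar>ln (norm (a - w))\<bar> \<le> ln (1 / norm (a - w)) * indicator (ball a 1) w + norm (a - w)"
proof (cases "w = a")
  case False
  then have p: "norm (a - w) > 0" by simp
  show ?thesis
  proof (cases "norm (a - w) < 1")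
    case True then show ?thesis using p by (simp add: ln_div dist_norm)
  next
    case False
    then have "ln (norm (a - w)) \<ge> 0" "ln (norm (a - w)) \<le> norm (a - w)"
      using p ln_bound[OF p] by auto
    then show ?thesis using False by (simp add: dist_norm)
  qed
qed simp

text \<open>Densities whose logarithmic potential is continuous and has an exact second-order mean
  expansion at every continuity point of the density. Subtracting such a potential cancels a
  prescribed Laplacian, which is how Green's formula is replaced.\<close>

locale bounded_density =
  fixes \<mu> :: "complex \<Rightarrow> real" and R B :: real
  assumes meas [measurable]: "\<mu> \<in> borel_measurable borel"
    and nonneg: "\<And>w. 0 \<le> \<mu> w" and le_B: "\<And>w. \<mu> w \<le> B"
    and supp: "\<And>w. w \<notin> ball 0 R \<Longrightarrow> \<mu> w = 0" and R_pos: "R > 0"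
begin

lemma B_nonneg: "0 \<le> B" using nonneg[of 0] le_B[of 0] by linarith

lemma mu_le: "\<mu> w \<le> B * indicator (ball 0 R) w"
  using supp[of w] le_B[of w] by (auto simp: indicator_def)

lemma integrable_indicator_ball: "integrable lborel (\<lambda>w::complex. c * indicator (ball 0 R) w :: real)"
  using emeasure_lborel_ball_finite[of "0::complex" R] by (intro integrable_mult_right integrable_real_indicator) auto

lemma integrable_mu: "integrable lborel \<mu>"
  by (rule Bochner_Integration.integrable_bound[OF integrable_indicator_ball[of B]])
     (use mu_le nonneg B_nonneg in \<open>auto simp: abs_of_nonneg\<close>)

text \<open>Dominating function for Fubini: the logarithmic singularity at \<open>a\<close> plus a
  constant on the support. Its integral depends on the bound \<open>\<rho>\<close> but not on
  \<open>a\<close>, so it is uniform along a bounded curve.\<close>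

definition envelope where
  "envelope a \<rho> w = B * (ln (1 / norm (a - w)) * indicator (ball a 1) w) + (B * (\<rho> + R)) * indicator (ball (0::complex) R) w"

lemma abs_le_envelope:
  assumes "norm a \<le> \<rho>"
  shows "\<bar>\<mu> w * ln (norm (a - w))\<bar> \<le> envelope a \<rho> w"
proof (cases "w \<in> ball 0 R")
  case True
  have "\<bar>\<mu> w * ln (norm (a - w))\<bar> \<le> B * (ln (1 / norm (a - w)) * indicator (ball a 1) w + norm (a - w))"
    unfolding abs_mult using abs_ln_norm_le[of a w] nonneg le_B B_nonneg by (intro mult_mono) auto
  moreover have "norm (a - w) \<le> \<rho> + R"
    using assms True norm_triangle_ineq4[of a w] by simp
  then have "B * (ln (1 / norm (a - w)) * indicator (ball a 1) w + norm (a - w)) \<le>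
     B * (ln (1 / norm (a - w)) * indicator (ball a 1) w + (\<rho> + R))"
    using B_nonneg by (intro mult_left_mono) auto
  ultimately have "\<bar>\<mu> w * ln (norm (a - w))\<bar> \<le> B * (ln (1 / norm (a - w)) * indicator (ball a 1) w + (\<rho> + R))"
    by linarith
  then show ?thesis using True by (simp add: envelope_def algebra_simps)
next
  case False
  then show ?thesis using supp[OF False] B_nonneg integrable_log_ball(3)[of 1 a w] by (simp add: envelope_def)
qed

lemma integrable_envelope: "integrable lborel (envelope a \<rho>)"
  unfolding envelope_def using integrable_log_ball(1)[of 1 a]
  by (intro Bochner_Integration.integrable_add integrable_mult_right integrable_indicator_ball) auto

lemma integral_envelope: "(\<integral>w. envelope a \<rho> w \<partial>lborel) = B * c0 + (\<integral>w. (B * (\<rho> + R)) * indicator (ball (0::complex) R) w \<partial>lborel)"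
proof -
  have "integrable lborel (\<lambda>w. B * (ln (1 / norm (a - w)) * indicator (ball a 1) w))"
    by (intro integrable_mult_right integrable_log_ball) simp
  from Bochner_Integration.integral_add[OF this integrable_indicator_ball]
  show ?thesis unfolding envelope_def using integrable_log_ball(2)[of 1 a] by (simp only: integral_mult_right_zero zero_less_one) simp
qed

definition V where "V a = (\<integral>w. \<mu> w * ln (norm (a - w)) \<partial>lborel)"

lemma integrable_V: "integrable lborel (\<lambda>w. \<mu> w * ln (norm (a - w)))"
  by (rule Bochner_Integration.integrable_bound[OF integrable_envelope[of a "norm a"]])
     (use abs_le_envelope[of a "norm a"] in \<open>auto intro!: AE_I2 order_trans[OF _ abs_ge_self]\<close>)

lemma Fubini_V:
  fixes \<gamma> :: "real \<Rightarrow> complex"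
  assumes [measurable]: "\<gamma> \<in> borel_measurable borel" and bd: "\<And>t. norm (\<gamma> t) \<le> \<rho>"
  shows "integrable angle (\<lambda>t. V (\<gamma> t))"
    and "integrable lborel (\<lambda>w. \<mu> w * (\<integral>t. ln (norm (\<gamma> t - w)) \<partial>angle))"
    and "(\<integral>t. V (\<gamma> t) \<partial>angle) = (\<integral>w. \<mu> w * (\<integral>t. ln (norm (\<gamma> t - w)) \<partial>angle) \<partial>lborel)"
proof -
  interpret pair_sigma_finite angle "lborel :: complex measure"
    by (intro pair_sigma_finite.intro) (unfold_locales)
  have int: "integrable (angle \<Otimes>\<^sub>M lborel) (\<lambda>(t, w). \<mu> w * ln (norm (\<gamma> t - w)))"
  proof (rule Fubini_integrable)
    show "(\<lambda>(t, w). \<mu> w * ln (norm (\<gamma> t - w))) \<in> borel_measurable (angle \<Otimes>\<^sub>M lborel)" by measurable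
    show "AE t in angle. integrable lborel (\<lambda>w. (\<lambda>(t, w). \<mu> w * ln (norm (\<gamma> t - w))) (t, w))"
      using integrable_V by simp
    show "integrable angle (\<lambda>t. \<integral>w. norm ((\<lambda>(t, w). \<mu> w * ln (norm (\<gamma> t - w))) (t, w)) \<partial>lborel)"
    proof (rule angle.integrable_const_bound[where B = "B * c0 + (\<integral>w. (B * (\<rho> + R)) * indicator (ball (0::complex) R) w \<partial>lborel)"])
      show "AE t in angle. norm (\<integral>w. norm ((\<lambda>(t, w). \<mu> w * ln (norm (\<gamma> t - w))) (t, w)) \<partial>lborel)
          \<le> B * c0 + (\<integral>w. (B * (\<rho> + R)) * indicator (ball (0::complex) R) w \<partial>lborel)"
      proof (rule AE_I2)
        fix t
        have "(\<integral>w. norm (\<mu> w * ln (norm (\<gamma> t - w))) \<partial>lborel) \<le> (\<integral>w. envelope (\<gamma> t) \<rho> w \<partial>lborel)"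
          by (rule integral_mono[OF integrable_norm[OF integrable_V] integrable_envelope])
             (use abs_le_envelope[OF bd] in auto)
        then show "norm (\<integral>w. norm ((\<lambda>(t, w). \<mu> w * ln (norm (\<gamma> t - w))) (t, w)) \<partial>lborel)
          \<le> B * c0 + (\<integral>w. (B * (\<rho> + R)) * indicator (ball (0::complex) R) w \<partial>lborel)"
          by (simp add: integral_envelope)
      qed
    qed measurable
  qed
  from integrable_fst[OF int] show "integrable angle (\<lambda>t. V (\<gamma> t))" by (simp add: V_def)
  from integrable_snd[OF int] show "integrable lborel (\<lambda>w. \<mu> w * (\<integral>t. ln (norm (\<gamma> t - w)) \<partial>angle))" by simp
  from Fubini_integral[OF int] show "(\<integral>t. V (\<gamma> t) \<partial>angle) = (\<integral>w. \<mu> w * (\<integral>t. ln (norm (\<gamma> t - w)) \<partial>angle) \<partial>lborel)"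
    by (simp add: V_def)
qed

text \<open>By \<open>log_mean\<close>, truncating the kernel at scale \<open>\<tau>\<close> is the
  same as averaging \<open>V\<close> over the circle of radius \<open>\<tau>\<close>.\<close>

definition Vmax where "Vmax \<tau> a = (\<integral>w. \<mu> w * ln (max \<tau> (norm (a - w))) \<partial>lborel)"

lemma mean_V:
  assumes "\<tau> > 0"
  shows "(\<integral>t. V (a + of_real \<tau> * cis t) \<partial>angle) = Vmax \<tau> a"
    and "integrable lborel (\<lambda>w. \<mu> w * ln (max \<tau> (norm (a - w))))"
proof -
  have m: "(\<lambda>t. a + of_real \<tau> * cis t) \<in> borel_measurable borel" by measurable
  have b: "norm (a + of_real \<tau> * cis t) \<le> norm a + \<tau>" for t
    by (rule norm_triangle_le) (use assms in \<open>auto simp: norm_mult\<close>)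
  show "(\<integral>t. V (a + of_real \<tau> * cis t) \<partial>angle) = Vmax \<tau> a"
    unfolding Fubini_V(3)[OF m b] Vmax_def log_mean(2)[OF assms] ..
  show "integrable lborel (\<lambda>w. \<mu> w * ln (max \<tau> (norm (a - w))))"
    using Fubini_V(2)[OF m b] unfolding log_mean(2)[OF assms] .
qed

lemma Vmax_diff:
  assumes "\<tau> > 0"
  shows "Vmax \<tau> a - V a = (\<integral>w. \<mu> w * (ln (\<tau> / norm (a - w)) * indicator (ball a \<tau>) w) \<partial>lborel)"
    and "integrable lborel (\<lambda>w. \<mu> w * (ln (\<tau> / norm (a - w)) * indicator (ball a \<tau>) w))"
proof -
  have AE: "AE w in lborel. \<mu> w * ln (max \<tau> (norm (a - w))) - \<mu> w * ln (norm (a - w))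
       = \<mu> w * (ln (\<tau> / norm (a - w)) * indicator (ball a \<tau>) w)"
    using AE_lborel_neq[of a]
  proof eventually_elim
    case (elim w)
    then have "norm (a - w) > 0" by simp
    then show ?case using assms by (auto simp: indicator_def dist_norm max_def ln_div algebra_simps)
  qed
  have "Vmax \<tau> a - V a = (\<integral>w. \<mu> w * ln (max \<tau> (norm (a - w))) - \<mu> w * ln (norm (a - w)) \<partial>lborel)"
    unfolding Vmax_def V_def by (rule Bochner_Integration.integral_diff[symmetric, OF mean_V(2)[OF assms] integrable_V])
  also have "\<dots> = (\<integral>w. \<mu> w * (ln (\<tau> / norm (a - w)) * indicator (ball a \<tau>) w) \<partial>lborel)"
    by (rule integral_cong_AE[OF _ _ AE]) measurable
  finally show "Vmax \<tau> a - V a = (\<integral>w. \<mu> w * (ln (\<tau> / norm (a - w)) * indicator (ball a \<tau>) w) \<partial>lborel)" .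
  have "integrable lborel (\<lambda>w. \<mu> w * ln (max \<tau> (norm (a - w))) - \<mu> w * ln (norm (a - w)))"
    by (rule Bochner_Integration.integrable_diff[OF mean_V(2)[OF assms] integrable_V])
  then show "integrable lborel (\<lambda>w. \<mu> w * (ln (\<tau> / norm (a - w)) * indicator (ball a \<tau>) w))"
    by (subst integrable_cong_AE[OF _ _ AE, symmetric]) measurable
qed

text \<open>The difference integrates the density against ln (tau / |a - w|) over the disc of radius
  tau, and this weight has total mass c0 tau^2. With \<open>k = 0\<close> it shows that truncation
  converges uniformly, with \<open>k = \<mu> a\<close> it is the second-order mean
  expansion.\<close>

lemma Vmax_diff_near:
  assumes "\<tau> > 0" "\<And>w. norm (w - a) < \<tau> \<Longrightarrow> \<bar>\<mu> w - k\<bar> \<le> e"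
  shows "\<bar>Vmax \<tau> a - V a - k * (c0 * \<tau>\<^sup>2)\<bar> \<le> e * (c0 * \<tau>\<^sup>2)"
proof -
  let ?L = "\<lambda>w. ln (\<tau> / norm (a - w)) * indicator (ball a \<tau>) w"
  note L = integrable_log_ball[OF assms(1), of a]
  have "Vmax \<tau> a - V a - k * (c0 * \<tau>\<^sup>2) = (\<integral>w. \<mu> w * ?L w \<partial>lborel) - (\<integral>w. k * ?L w \<partial>lborel)"
    using L by (simp add: Vmax_diff(1)[OF assms(1)])
  also have "\<dots> = (\<integral>w. (\<mu> w - k) * ?L w \<partial>lborel)"
    using Vmax_diff(2)[OF assms(1), of a] L by (subst Bochner_Integration.integral_diff[symmetric]) (auto simp: left_diff_distrib)
  finally have eq: "Vmax \<tau> a - V a - k * (c0 * \<tau>\<^sup>2) = (\<integral>w. (\<mu> w - k) * ?L w \<partial>lborel)" .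
  have int: "integrable lborel (\<lambda>w. (\<mu> w - k) * ?L w)"
    using Vmax_diff(2)[OF assms(1), of a] L(1) unfolding left_diff_distrib by (intro Bochner_Integration.integrable_diff integrable_mult_right)
  have "\<bar>\<integral>w. (\<mu> w - k) * ?L w \<partial>lborel\<bar> \<le> (\<integral>w. \<bar>(\<mu> w - k) * ?L w\<bar> \<partial>lborel)"
    using integral_norm_bound[of lborel "\<lambda>w. (\<mu> w - k) * ?L w"] by simp
  also have "\<dots> \<le> (\<integral>w. e * ?L w \<partial>lborel)"
  proof (rule integral_mono)
    show "integrable lborel (\<lambda>w. \<bar>(\<mu> w - k) * ?L w\<bar>)" using int by (rule integrable_abs)
    show "integrable lborel (\<lambda>w. e * ?L w)" using L(1) by (rule integrable_mult_right)
    fix w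
    show "\<bar>(\<mu> w - k) * ?L w\<bar> \<le> e * ?L w"
      unfolding abs_mult[of _ "?L w"] abs_of_nonneg[OF L(3)] 
      using L(3)[of w] assms(2)[of w]
      by (cases "w \<in> ball a \<tau>") (auto intro!: mult_right_mono simp: dist_norm norm_minus_commute)
  qed
  also have "\<dots> = e * (c0 * \<tau>\<^sup>2)" using L by simp
  finally show ?thesis using eq by simp
qed

lemma continuous_Vmax:
  assumes \<tau>: "\<tau> > 0" shows "continuous_on UNIV (Vmax \<tau>)"
proof -
  have lip: "\<bar>ln (max \<tau> x) - ln (max \<tau> y)\<bar> \<le> \<bar>x - y\<bar> / \<tau>" for x y
  proof -
    have *: "ln (max \<tau> x) - ln (max \<tau> y) \<le> \<bar>x - y\<bar> / \<tau>" for x y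
    proof -
      have p: "max \<tau> x > 0" "max \<tau> y > 0" "max \<tau> y \<ge> \<tau>" using \<tau> by auto
      have "ln (max \<tau> x) - ln (max \<tau> y) = ln (max \<tau> x / max \<tau> y)" using p by (simp add: ln_div)
      also have "\<dots> \<le> max \<tau> x / max \<tau> y - 1" using p by (intro ln_le_minus_one) simp
      also have "\<dots> = (max \<tau> x - max \<tau> y) / max \<tau> y" using p by (simp add: field_simps)
      also have "\<dots> \<le> \<bar>x - y\<bar> / max \<tau> y" using p by (intro divide_right_mono) auto
      also have "\<dots> \<le> \<bar>x - y\<bar> / \<tau>" using p \<tau> by (intro divide_left_mono) auto
      finally show ?thesis .
    qed
    from *[of x y] *[of y x] show ?thesis by (simp add: abs_le_iff abs_minus_commute)
  qed
  define M where "M = (\<integral>w. \<mu> w \<partial>lborel)"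
  have "dist (Vmax \<tau> a) (Vmax \<tau> b) \<le> (M / \<tau>) * dist a b" for a b
  proof -
    have "Vmax \<tau> a - Vmax \<tau> b = (\<integral>w. \<mu> w * ln (max \<tau> (norm (a - w))) - \<mu> w * ln (max \<tau> (norm (b - w))) \<partial>lborel)"
      unfolding Vmax_def by (rule Bochner_Integration.integral_diff[symmetric, OF mean_V(2)[OF \<tau>] mean_V(2)[OF \<tau>]])
    also have "\<bar>\<dots>\<bar> \<le> (\<integral>w. \<bar>\<mu> w * ln (max \<tau> (norm (a - w))) - \<mu> w * ln (max \<tau> (norm (b - w)))\<bar> \<partial>lborel)"
      using integral_norm_bound[of lborel "\<lambda>w. \<mu> w * ln (max \<tau> (norm (a - w))) - \<mu> w * ln (max \<tau> (norm (b - w)))"] by simp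
    also have "\<dots> \<le> (\<integral>w. \<mu> w * (dist a b / \<tau>) \<partial>lborel)"
    proof (rule integral_mono)
      show "integrable lborel (\<lambda>w. \<bar>\<mu> w * ln (max \<tau> (norm (a - w))) - \<mu> w * ln (max \<tau> (norm (b - w)))\<bar>)"
        by (intro integrable_abs Bochner_Integration.integrable_diff mean_V(2)[OF \<tau>])
      show "integrable lborel (\<lambda>w. \<mu> w * (dist a b / \<tau>))" using integrable_mu by simp
      fix w
      have "\<bar>ln (max \<tau> (norm (a - w))) - ln (max \<tau> (norm (b - w)))\<bar> \<le> \<bar>norm (a - w) - norm (b - w)\<bar> / \<tau>" by (rule lip)
      also have "\<dots> \<le> dist a b / \<tau>"
        using \<tau> norm_triangle_ineq3[of "a - w" "b - w"] by (intro divide_right_mono) (auto simp: dist_norm)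
      finally show "\<bar>\<mu> w * ln (max \<tau> (norm (a - w))) - \<mu> w * ln (max \<tau> (norm (b - w)))\<bar> \<le> \<mu> w * (dist a b / \<tau>)"
        using nonneg[of w] by (simp only: right_diff_distrib[symmetric] abs_mult abs_of_nonneg) (rule mult_left_mono)
    qed
    also have "\<dots> = (M / \<tau>) * dist a b" by (simp add: M_def)
    finally show ?thesis by (simp add: dist_real_def)
  qed
  moreover have "M / \<tau> \<ge> 0" using \<tau> nonneg by (simp add: M_def)
  ultimately have "(M/\<tau>)-lipschitz_on UNIV (Vmax \<tau>)" by (intro lipschitz_onI) auto
  then show ?thesis by (rule lipschitz_on_continuous_on)
qed

text \<open>The truncated potentials are Lipschitz, and their distance to \<open>V\<close> is at
  most B c0 tau^2 uniformly in the plane.\<close>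

lemma continuous_V: "continuous_on UNIV V"
proof (rule uniform_limit_theorem)
  show "\<forall>\<^sub>F n in sequentially. continuous_on UNIV (Vmax (1 / real (Suc n)))"
    by (intro always_eventually allI continuous_Vmax) simp
  show "uniform_limit UNIV (\<lambda>n. Vmax (1 / real (Suc n))) V sequentially"
  proof (rule uniform_limitI)
    fix e :: real assume e: "e > 0"
    have "(\<lambda>n. B * (c0 * (1 / real (Suc n))\<^sup>2)) \<longlonglongrightarrow> B * (c0 * 0\<^sup>2)"
      by (intro tendsto_intros LIMSEQ_Suc[OF lim_1_over_n])
    then have "\<forall>\<^sub>F n in sequentially. B * (c0 * (1 / real (Suc n))\<^sup>2) < e"
      using e by (intro order_tendstoD(2)) auto
    then show "\<forall>\<^sub>F n in sequentially. \<forall>x\<in>UNIV. dist (Vmax (1 / real (Suc n)) x) (V x) < e"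
    proof eventually_elim
      case (elim n)
      have "\<bar>Vmax (1 / real (Suc n)) x - V x - 0 * (c0 * (1 / real (Suc n))\<^sup>2)\<bar> \<le> B * (c0 * (1 / real (Suc n))\<^sup>2)" for x
        by (rule Vmax_diff_near) (use nonneg le_B in auto)
      then show ?case using elim by (auto simp: dist_real_def intro: le_less_trans)
    qed
  qed
qed simp

lemma mean_V_expansion:
  assumes "isCont \<mu> a" "e > 0"
  shows "\<forall>\<^sub>F \<tau> in at_right 0. \<bar>(\<integral>t. V (a + of_real \<tau> * cis t) \<partial>angle) - V a - \<tau>\<^sup>2 * (c0 * \<mu> a)\<bar> \<le> e * \<tau>\<^sup>2"
proof -
  have "e / c0 > 0" using assms c0_pos by simp
  with assms(1) obtain d where d: "d > 0" "\<And>w. norm (w - a) < d \<Longrightarrow> \<bar>\<mu> w - \<mu> a\<bar> < e / c0"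
    unfolding continuous_at_eps_delta by (metis dist_norm dist_real_def)
  have "\<bar>(\<integral>t. V (a + of_real \<tau> * cis t) \<partial>angle) - V a - \<tau>\<^sup>2 * (c0 * \<mu> a)\<bar> \<le> e * \<tau>\<^sup>2" if \<tau>: "0 < \<tau>" "\<tau> < d" for \<tau>
  proof -
    have "\<bar>Vmax \<tau> a - V a - \<mu> a * (c0 * \<tau>\<^sup>2)\<bar> \<le> (e / c0) * (c0 * \<tau>\<^sup>2)"
      by (rule Vmax_diff_near[OF \<tau>(1)]) (use d \<tau> in \<open>force intro: less_imp_le\<close>)
    then show ?thesis using c0_pos mean_V(1)[OF \<tau>(1), of a] by (simp add: mult_ac)
  qed
  then show ?thesis unfolding eventually_at_right_field using d by (intro exI[of _ d]) auto
qed

end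

text \<open>The surplus in Jensen's formula for phi - w. It equals the counting function truncated
  at radius \<open>r\<close>, with weights ln (r/|z|), but being an integral over a circle it can be
  averaged, estimated and tested for measurability without looking at zeros.\<close>

definition mean_log :: "(complex \<Rightarrow> complex) \<Rightarrow> real \<Rightarrow> complex \<Rightarrow> real" where
  "mean_log \<phi> r w = (\<integral>t. ln (norm (\<phi> (of_real r * cis t) - w)) \<partial>angle) - ln (norm (\<phi> 0 - w))"

section \<open>The Littlewood-Paley formula and Green's inequality\<close>

lemma bounded_density_indicator:
  assumes "continuous_on (cball 0 R) \<kappa>" "R > 0" "\<And>w. norm w < R \<Longrightarrow> 0 \<le> \<kappa> w"
  obtains B where "bounded_density (\<lambda>w. indicator (ball 0 R) w * \<kappa> w) R B"
proof -
  have "compact (\<kappa> ` cball 0 R)" by (intro compact_continuous_image assms) auto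
  then have "bounded (\<kappa> ` cball 0 R)" by (rule compact_imp_bounded)
  then obtain B where "\<forall>x\<in>\<kappa> ` cball 0 R. norm x \<le> B" unfolding bounded_iff by blast
  then have B: "\<And>w. w \<in> cball 0 R \<Longrightarrow> \<bar>\<kappa> w\<bar> \<le> B" by auto
  have "\<bar>\<kappa> 0\<bar> \<le> B" using B[of 0] assms by simp
  then have B0: "B \<ge> 0" by linarith
  have m: "(\<lambda>w. indicator (ball 0 R) w *\<^sub>R \<kappa> w) \<in> borel_measurable borel"
    by (rule borel_measurable_continuous_on_indicator) (auto intro: continuous_on_subset[OF assms(1)])
  have "bounded_density (\<lambda>w. indicator (ball 0 R) w * \<kappa> w) R B"
  proof
    show "(\<lambda>w. indicator (ball 0 R) w * \<kappa> w) \<in> borel_measurable borel" using m by simp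
    show "indicator (ball 0 R) w * \<kappa> w \<le> B" for w
      using B[of w] B0 by (auto simp: indicator_def abs_le_iff)
  qed (use assms in \<open>auto simp: indicator_def\<close>)
  then show ?thesis by (rule that)
qed

lemma isCont_indicator_ball:
  assumes "continuous_on (cball 0 R) \<kappa>" "norm a < R"
  shows "isCont (\<lambda>w. indicator (ball 0 R) w * \<kappa> w :: real) a"
proof -
  have o: "open (ball 0 R)" "a \<in> ball 0 R" using assms by auto
  have "continuous_on (ball 0 R) \<kappa>" by (rule continuous_on_subset[OF assms(1)]) auto
  then have c: "isCont \<kappa> a" using o by (simp add: continuous_on_eq_continuous_at)
  have "\<forall>\<^sub>F w in nhds a. indicator (ball 0 R) w * \<kappa> w = \<kappa> w"
    using eventually_nhds_in_open[OF o] by eventually_elim simp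
  from isCont_cong[OF this] c show ?thesis by blast
qed

lemma jet_norm_square:
  assumes "f holomorphic_on S" "open S" "a \<in> S"
  shows "jet (\<lambda>z. of_real ((norm (f z))\<^sup>2)) a (cnj (f a) * deriv f a) (f a * cnj (deriv f a)) (of_real ((norm (deriv f a))\<^sup>2))"
proof -
  have j: "jet f a (deriv f a) 0 0" by (rule jet_holomorphic[OF assms])
  from jet_mult[OF j jet_cnj[OF j]] show ?thesis unfolding complex_norm_square by (simp add: mult.commute)
qed

lemma mean_expansion_norm_square:
  assumes "f holomorphic_on S" "open S" "a \<in> S" "e > 0"
  shows "\<forall>\<^sub>F \<tau> in at_right 0. \<bar>(\<integral>t. (norm (f (a + of_real \<tau> * cis t)))\<^sup>2 \<partial>angle) - (norm (f a))\<^sup>2 - \<tau>\<^sup>2 * (norm (deriv f a))\<^sup>2\<bar> \<le> e * \<tau>\<^sup>2"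
proof -
  obtain d where d: "d > 0" "ball a d \<subseteq> S" using assms openE by blast
  have "continuous_on (ball a d) f"
    using assms(1) d by (meson continuous_on_subset holomorphic_on_imp_continuous_on)
  then have "continuous_on (ball a d) (\<lambda>z. (norm (f z))\<^sup>2)" by (intro continuous_intros)
  from submean_jet[OF jet_norm_square[OF assms(1-3)] this d(1) assms(4)] show ?thesis by (simp only: Re_complex_of_real)
qed

lemma abs_half_bounds:
  fixes t :: real
  assumes "x = A - B" "\<bar>B\<bar> \<le> e/2 * t" "\<bar>A\<bar> \<le> e/2 * t"
  shows "\<bar>x\<bar> \<le> e * t"
proof -
  have "\<bar>x\<bar> \<le> \<bar>A\<bar> + \<bar>B\<bar>" unfolding assms(1) by (rule abs_triangle_ineq4)
  also have "\<dots> \<le> e/2 * t + e/2 * t" using assms by (intro add_mono)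
  finally show ?thesis by (simp add: field_simps)
qed

lemma mean_difference_identity:
  fixes c :: real
  assumes "c \<noteq> 0"
  shows "(P - W / c) - (P' - W' / c) - s * (g - k) = (P - P' - s * g) - (W - W' - s * (c * k)) / c"
  using assms by (simp add: field_simps)

lemma rescale_difference_le:
  fixes c :: real
  assumes "c > 0" "P' - W' / c \<le> P - W / c"
  shows "W - W' \<le> c * (P - P')"
proof -
  have "(W - W') / c \<le> P - P'" using assms(2) by (simp add: diff_divide_distrib)
  then show ?thesis using assms(1) by (simp add: pos_divide_le_eq mult.commute)
qed

text \<open>Let \<open>V\<close> be the potential of |f'|^2 cut off to the disc of radius
  \<open>R\<close>. Then |f|^2 - V / c0 is harmonic there, so its mean along the curve phi(r cis t)
  is its value at phi(0); by Fubini the same difference for \<open>V\<close> is the integral of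
  |f'|^2 against \<open>mean_log\<close>.\<close>

lemma Littlewood_Paley:
  assumes f: "f holomorphic_on ball 0 1" and \<phi>: "\<phi> holomorphic_on ball 0 1"
    and r: "0 < r" "r < 1" and R: "R < 1" "\<And>z. norm z \<le> r \<Longrightarrow> norm (\<phi> z) < R"
  shows "integrable lborel (\<lambda>w. indicator (ball 0 R) w * (norm (deriv f w))\<^sup>2 * mean_log \<phi> r w)"
    and "(\<integral>t. (norm (f (\<phi> (of_real r * cis t))))\<^sup>2 \<partial>angle) = (norm (f (\<phi> 0)))\<^sup>2
      + (1/c0) * (\<integral>w. indicator (ball 0 R) w * (norm (deriv f w))\<^sup>2 * mean_log \<phi> r w \<partial>lborel)"
proof -
  have R0: "R > 0" using le_less_trans[OF norm_ge_zero R(2)[of 0]] r by simp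
  have sub: "cball 0 R \<subseteq> ball (0::complex) 1" using R by auto
  have f': "deriv f holomorphic_on ball 0 1" using f by (intro holomorphic_deriv) auto
  define \<kappa> where "\<kappa> = (\<lambda>w. (norm (deriv f w))\<^sup>2)"
  have cf: "continuous_on (cball 0 R) f" "continuous_on (cball 0 R) (deriv f)"
    using f f' sub by (meson continuous_on_subset holomorphic_on_imp_continuous_on)+
  then have c\<kappa>: "continuous_on (cball 0 R) \<kappa>" unfolding \<kappa>_def by (intro continuous_intros)
  obtain B where "bounded_density (\<lambda>w. indicator (ball 0 R) w * \<kappa> w) R B"
    by (rule bounded_density_indicator[OF c\<kappa> R0]) (auto simp: \<kappa>_def)
  then interpret bounded_density "\<lambda>w. indicator (ball 0 R) w * \<kappa> w" R B .
  define \<Psi> where "\<Psi> = (\<lambda>z. (norm (f z))\<^sup>2 - V z / c0)"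
  have c\<Psi>: "continuous_on (cball 0 R) \<Psi>"
    unfolding \<Psi>_def using c0_pos by (intro continuous_intros cf continuous_on_subset[OF continuous_V]) auto
  have sm: "submean \<Psi> a \<and> submean (\<lambda>z. - \<Psi> z) a" if a: "norm a < R" for a
  proof -
    have ev: "\<forall>\<^sub>F \<tau> in at_right 0. \<bar>(\<integral>t. \<Psi> (a + of_real \<tau> * cis t) \<partial>angle) - \<Psi> a\<bar> \<le> e * \<tau>\<^sup>2" if e: "e > 0" for e
    proof -
      have aS: "a \<in> ball 0 1" using a R by simp
      have e1: "e/2 > 0" "e * c0 / 2 > 0" using e c0_pos by auto
      have \<mu>a: "indicator (ball 0 R) a * \<kappa> a = \<kappa> a" using a by simp
      have "\<forall>\<^sub>F \<tau> in at_right 0. 0 < \<tau> \<and> \<tau> < R - norm a"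
        using a by (auto simp: eventually_at_right_field intro!: exI[of _ "R - norm a"])
      with mean_expansion_norm_square[OF f open_ball aS e1(1)] mean_V_expansion[OF isCont_indicator_ball[OF c\<kappa> a] e1(2)]
      show ?thesis
      proof eventually_elim
        case (elim \<tau>)
        have c: "continuous_on UNIV (\<lambda>t. f (a + of_real \<tau> * cis t))"
          by (rule continuous_on_compose2[OF cf(1)]) (use elim a in \<open>auto intro!: continuous_intros norm_triangle_le simp: norm_mult\<close>)
        have i1: "integrable angle (\<lambda>t. (norm (f (a + of_real \<tau> * cis t)))\<^sup>2)"
          by (intro integrable_angle_continuous continuous_intros c)
        have i2: "integrable angle (\<lambda>t. V (a + of_real \<tau> * cis t) / c0)"
          by (intro integrable_angle_continuous continuous_intros continuous_on_compose2[OF continuous_V]) (use c0_pos in auto)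
        have "(\<integral>t. \<Psi> (a + of_real \<tau> * cis t) \<partial>angle) = (\<integral>t. (norm (f (a + of_real \<tau> * cis t)))\<^sup>2 \<partial>angle) - (\<integral>t. V (a + of_real \<tau> * cis t) \<partial>angle) / c0"
          unfolding \<Psi>_def using Bochner_Integration.integral_diff[OF i1 i2] by simp
        then have "(\<integral>t. \<Psi> (a + of_real \<tau> * cis t) \<partial>angle) - \<Psi> a =
          ((\<integral>t. (norm (f (a + of_real \<tau> * cis t)))\<^sup>2 \<partial>angle) - (norm (f a))\<^sup>2 - \<tau>\<^sup>2 * (norm (deriv f a))\<^sup>2)
          - ((\<integral>t. V (a + of_real \<tau> * cis t) \<partial>angle) - V a - \<tau>\<^sup>2 * (c0 * \<kappa> a)) / c0"
          using c0_pos by (simp add: \<Psi>_def \<kappa>_def field_simps)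
        moreover have "\<bar>((\<integral>t. V (a + of_real \<tau> * cis t) \<partial>angle) - V a - \<tau>\<^sup>2 * (c0 * \<kappa> a)) / c0\<bar> \<le> e/2 * \<tau>\<^sup>2"
          using elim(2) c0_pos unfolding \<mu>a by (simp add: abs_divide field_simps)
        ultimately show ?case by (rule abs_half_bounds[OF _ _ elim(1)])
      qed
    qed
    have "submean \<Psi> a" unfolding submean_def
    proof (intro allI impI)
      fix e :: real assume "e > 0"
      from ev[OF this] show "\<forall>\<^sub>F \<tau> in at_right 0. \<Psi> a - e * \<tau>\<^sup>2 \<le> (\<integral>t. \<Psi> (a + of_real \<tau> * cis t) \<partial>angle)"
        by eventually_elim linarith
    qed
    moreover have "submean (\<lambda>z. - \<Psi> z) a" unfolding submean_def
    proof (intro allI impI)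
      fix e :: real assume "e > 0"
      from ev[OF this] show "\<forall>\<^sub>F \<tau> in at_right 0. - \<Psi> a - e * \<tau>\<^sup>2 \<le> (\<integral>t. - \<Psi> (a + of_real \<tau> * cis t) \<partial>angle)"
        by eventually_elim simp
    qed
    ultimately show ?thesis by blast
  qed
  define \<gamma> where "\<gamma> = (\<lambda>t. \<phi> (of_real r * cis t))"
  have c\<gamma>: "continuous_on UNIV \<gamma>"
    unfolding \<gamma>_def using holomorphic_continuous_cis[OF \<phi>, of r] r by simp
  then have m\<gamma>: "\<gamma> \<in> borel_measurable borel" by (rule borel_measurable_continuous_onI)
  have \<gamma>R: "norm (\<gamma> t) < R" for t unfolding \<gamma>_def using r by (intro R(2)) (simp add: norm_mult)
  then have \<gamma>R': "norm (\<gamma> t) \<le> R" for t by (simp add: less_imp_le)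
  have c\<Psi>\<gamma>: "continuous_on UNIV (\<lambda>t. \<Psi> (\<gamma> t))"
    by (rule continuous_on_compose2[OF c\<Psi> c\<gamma>]) (use \<gamma>R' in auto)
  \<comment> \<open>The circle is mapped to an arbitrary curve, so mean values of
    \<open>\<Psi>\<close> over circles do not apply. The approximating polynomial composed with phi
    is holomorphic and has the exact mean value, and the error is uniform.\<close>
  have mean\<Psi>: "(\<integral>t. \<Psi> (\<gamma> t) \<partial>angle) = \<Psi> (\<phi> 0)"
  proof -
    have bnd: "\<bar>(\<integral>t. \<Psi> (\<gamma> t) \<partial>angle) - \<Psi> (\<phi> 0)\<bar> \<le> 2 * e" if e: "e > 0" for e
    proof -
      obtain p where p: "\<And>z. norm z \<le> R \<Longrightarrow> \<bar>\<Psi> z - Re (poly p z)\<bar> \<le> e"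
        using harmonic_poly_approx[OF c\<Psi> R0 sm[THEN conjunct1] sm[THEN conjunct2] e] by blast
      have hp: "(\<lambda>z. poly p (\<phi> z)) holomorphic_on ball 0 1"
        using \<phi> by (intro holomorphic_intros)
      have cp: "continuous_on UNIV (\<lambda>t. poly p (\<gamma> t))" by (intro continuous_intros c\<gamma>)
      have ip: "integrable angle (\<lambda>t. Re (poly p (\<gamma> t)))" by (intro integrable_angle_continuous continuous_intros cp)
      have "(\<integral>t. Re (poly p (\<gamma> t)) \<partial>angle) = Re (poly p (\<phi> 0))"
        using angle_mean_value[OF hp, of r] r integral_Re[OF integrable_angle_continuous[OF cp]] by (simp add: \<gamma>_def)
      then have "(\<integral>t. \<Psi> (\<gamma> t) \<partial>angle) - Re (poly p (\<phi> 0)) = (\<integral>t. \<Psi> (\<gamma> t) - Re (poly p (\<gamma> t)) \<partial>angle)"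
        using ip integrable_angle_continuous[OF c\<Psi>\<gamma>] by simp
      also have "\<bar>\<dots>\<bar> \<le> (\<integral>t. e \<partial>angle)"
      proof -
        have "\<bar>\<integral>t. \<Psi> (\<gamma> t) - Re (poly p (\<gamma> t)) \<partial>angle\<bar> \<le> (\<integral>t. \<bar>\<Psi> (\<gamma> t) - Re (poly p (\<gamma> t))\<bar> \<partial>angle)"
          using integral_norm_bound[of angle "\<lambda>t. \<Psi> (\<gamma> t) - Re (poly p (\<gamma> t))"] by simp
        also have "\<dots> \<le> (\<integral>t. e \<partial>angle)"
          by (rule integral_mono) (use p \<gamma>R' ip integrable_angle_continuous[OF c\<Psi>\<gamma>] in \<open>auto intro!: integrable_abs\<close>)
        finally show ?thesis .
      qed
      also have "(\<integral>t. e \<partial>angle) = e" using angle.prob_space by simp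
      finally show ?thesis using p[of "\<phi> 0"] R(2)[of 0] r by simp
    qed
    have "\<bar>(\<integral>t. \<Psi> (\<gamma> t) \<partial>angle) - \<Psi> (\<phi> 0)\<bar> \<le> 0"
    proof (rule field_le_epsilon)
      fix e :: real assume "e > 0"
      then show "\<bar>(\<integral>t. \<Psi> (\<gamma> t) \<partial>angle) - \<Psi> (\<phi> 0)\<bar> \<le> 0 + e" using bnd[of "e/2"] by simp
    qed
    then show ?thesis by simp
  qed
  let ?\<mu> = "\<lambda>w. indicator (ball 0 R) w * \<kappa> w"
  have i1: "integrable lborel (\<lambda>w. ?\<mu> w * (\<integral>t. ln (norm (\<gamma> t - w)) \<partial>angle))"
    by (rule Fubini_V(2)[OF m\<gamma> \<gamma>R'])
  have i2: "integrable lborel (\<lambda>w. ?\<mu> w * ln (norm (\<phi> 0 - w)))" by (rule integrable_V)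
  have eqN: "indicator (ball 0 R) w * (norm (deriv f w))\<^sup>2 * mean_log \<phi> r w
     = ?\<mu> w * (\<integral>t. ln (norm (\<gamma> t - w)) \<partial>angle) - ?\<mu> w * ln (norm (\<phi> 0 - w))" for w
    by (simp add: mean_log_def \<gamma>_def \<kappa>_def algebra_simps)
  show "integrable lborel (\<lambda>w. indicator (ball 0 R) w * (norm (deriv f w))\<^sup>2 * mean_log \<phi> r w)"
    unfolding eqN by (rule Bochner_Integration.integrable_diff[OF i1 i2])
  have VV: "(\<integral>w. indicator (ball 0 R) w * (norm (deriv f w))\<^sup>2 * mean_log \<phi> r w \<partial>lborel)
      = (\<integral>t. V (\<gamma> t) \<partial>angle) - V (\<phi> 0)"
    unfolding eqN Bochner_Integration.integral_diff[OF i1 i2] Fubini_V(3)[OF m\<gamma> \<gamma>R'] V_def[of "\<phi> 0"] ..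
  have cf\<gamma>: "continuous_on UNIV (\<lambda>t. f (\<gamma> t))"
    by (rule continuous_on_compose2[OF cf(1) c\<gamma>]) (use \<gamma>R' in auto)
  have "integrable angle (\<lambda>t. (norm (f (\<gamma> t)))\<^sup>2)"
    by (intro integrable_angle_continuous continuous_on_power continuous_on_norm cf\<gamma>)
  then have "(\<integral>t. \<Psi> (\<gamma> t) \<partial>angle) = (\<integral>t. (norm (f (\<gamma> t)))\<^sup>2 \<partial>angle) - (\<integral>t. V (\<gamma> t) \<partial>angle) / c0"
    unfolding \<Psi>_def using Fubini_V(1)[OF m\<gamma> \<gamma>R'] by simp
  with mean\<Psi> show "(\<integral>t. (norm (f (\<phi> (of_real r * cis t))))\<^sup>2 \<partial>angle) = (norm (f (\<phi> 0)))\<^sup>2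
      + (1/c0) * (\<integral>w. indicator (ball 0 R) w * (norm (deriv f w))\<^sup>2 * mean_log \<phi> r w \<partial>lborel)"
    unfolding VV by (simp add: \<Psi>_def \<gamma>_def diff_divide_distrib)
qed

text \<open>Subtracting the potential of \<open>\<kappa>\<close> from \<open>\<Phi>\<close> leaves a
  sub-mean function, because \<open>Re g\<close> is a quarter of the Laplacian of
  \<open>\<Phi>\<close>. Its inequality over the circle of radius \<open>R\<close> is the claim,
  since \<open>Vmax R 0 - V 0\<close> is the integral of \<open>\<kappa>\<close> against ln
  (R/|w|).\<close>

lemma Green_lower:
  fixes \<Phi> \<kappa> :: "complex \<Rightarrow> real"
  assumes c\<Phi>: "continuous_on (ball 0 1) \<Phi>" and c\<kappa>: "continuous_on (ball 0 1) \<kappa>"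
    and nonneg: "\<And>a. norm a < 1 \<Longrightarrow> 0 \<le> \<kappa> a"
    and j: "\<And>a. norm a < 1 \<Longrightarrow> \<exists>p q g. jet (\<lambda>z. of_real (\<Phi> z)) a p q g \<and> \<kappa> a \<le> Re g"
    and R: "0 < R" "R < 1"
  shows "(\<integral>\<^sup>+w. ennreal (\<kappa> w * ln (R / norm w)) * indicator (ball 0 R) w \<partial>lborel)
    \<le> ennreal (c0 * ((\<integral>t. \<Phi> (of_real R * cis t) \<partial>angle) - \<Phi> 0))"
proof -
  have sub: "cball 0 R \<subseteq> ball (0::complex) 1" using R by auto
  have c: "continuous_on (cball 0 R) \<Phi>" "continuous_on (cball 0 R) \<kappa>"
    using c\<Phi> c\<kappa> sub continuous_on_subset by blast+
  obtain B where "bounded_density (\<lambda>w. indicator (ball 0 R) w * \<kappa> w) R B"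
    by (rule bounded_density_indicator[OF c(2) R(1)]) (use nonneg R in auto)
  then interpret bounded_density "\<lambda>w. indicator (ball 0 R) w * \<kappa> w" R B .
  let ?\<mu> = "\<lambda>w. indicator (ball 0 R) w * \<kappa> w"
  define \<Psi> where "\<Psi> = (\<lambda>z. \<Phi> z - V z / c0)"
  have c\<Psi>: "continuous_on (cball 0 R) \<Psi>"
    unfolding \<Psi>_def using c0_pos by (intro continuous_intros c continuous_on_subset[OF continuous_V]) auto
  have int\<Psi>: "(\<integral>t. \<Psi> (a + of_real \<tau> * cis t) \<partial>angle) = (\<integral>t. \<Phi> (a + of_real \<tau> * cis t) \<partial>angle) - (\<integral>t. V (a + of_real \<tau> * cis t) \<partial>angle) / c0"
    if "0 < \<tau>" "norm a + \<tau> \<le> R" for a \<tau>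
  proof -
    have "continuous_on UNIV (\<lambda>t. \<Phi> (a + of_real \<tau> * cis t))"
      by (rule continuous_on_compose2[OF c(1)]) (use that in \<open>auto intro!: continuous_intros norm_triangle_le simp: norm_mult\<close>)
    then have i1: "integrable angle (\<lambda>t. \<Phi> (a + of_real \<tau> * cis t))" by (rule integrable_angle_continuous)
    have i2: "integrable angle (\<lambda>t. V (a + of_real \<tau> * cis t) / c0)"
      by (intro integrable_angle_continuous continuous_intros continuous_on_compose2[OF continuous_V]) (use c0_pos in auto)
    show ?thesis unfolding \<Psi>_def using Bochner_Integration.integral_diff[OF i1 i2] by simp
  qed
  have sm: "submean \<Psi> a" if a: "norm a < R" for a
    unfolding submean_def
  proof (intro allI impI)
    fix e :: real assume e: "e > 0"
    have a1: "norm a < 1" using a R by simp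
    from j[OF this] obtain p q g where g: "jet (\<lambda>z. of_real (\<Phi> z)) a p q g" "\<kappa> a \<le> Re g" by blast
    have cb: "continuous_on (ball a (R - norm a)) \<Phi>"
    proof (rule continuous_on_subset[OF c(1)], rule subsetI)
      fix y assume "y \<in> ball a (R - norm a)"
      then show "y \<in> cball 0 R" using norm_triangle_sub[of y a] by (simp add: dist_norm norm_minus_commute)
    qed
    have Ra: "R - norm a > 0" using a by simp
    have e1: "e/2 > 0" "e * c0 / 2 > 0" using e c0_pos by auto
    have \<mu>a: "indicator (ball 0 R) a * \<kappa> a = \<kappa> a" using a by simp
    have "\<forall>\<^sub>F \<tau> in at_right 0. 0 < \<tau> \<and> \<tau> < R - norm a"
      using a by (auto simp: eventually_at_right_field intro!: exI[of _ "R - norm a"])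
    with submean_jet[OF g(1) cb Ra e1(1)] mean_V_expansion[OF isCont_indicator_ball[OF c(2) a] e1(2)]
    show "\<forall>\<^sub>F \<tau> in at_right 0. \<Psi> a - e * \<tau>\<^sup>2 \<le> (\<integral>t. \<Psi> (a + of_real \<tau> * cis t) \<partial>angle)"
    proof eventually_elim
      case (elim \<tau>)
      have eq: "(\<integral>t. \<Psi> (a + of_real \<tau> * cis t) \<partial>angle) - \<Psi> a - \<tau>\<^sup>2 * (Re g - \<kappa> a) =
          ((\<integral>t. \<Phi> (a + of_real \<tau> * cis t) \<partial>angle) - \<Phi> a - \<tau>\<^sup>2 * Re g)
          - ((\<integral>t. V (a + of_real \<tau> * cis t) \<partial>angle) - V a - \<tau>\<^sup>2 * (c0 * \<kappa> a)) / c0"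
      proof -
        have "(\<integral>t. \<Psi> (a + of_real \<tau> * cis t) \<partial>angle)
           = (\<integral>t. \<Phi> (a + of_real \<tau> * cis t) \<partial>angle) - (\<integral>t. V (a + of_real \<tau> * cis t) \<partial>angle) / c0"
          using elim by (intro int\<Psi>) auto
        then show ?thesis using mean_difference_identity[of c0] c0_pos by (simp only: \<Psi>_def)
      qed
      have le: "\<bar>((\<integral>t. V (a + of_real \<tau> * cis t) \<partial>angle) - V a - \<tau>\<^sup>2 * (c0 * \<kappa> a)) / c0\<bar> \<le> e/2 * \<tau>\<^sup>2"
        using elim(2) c0_pos unfolding \<mu>a by (simp add: abs_divide field_simps)
      have "0 \<le> \<tau>\<^sup>2 * (Re g - \<kappa> a)" using g by simp
      then show ?case using abs_half_bounds[OF eq le elim(1)] by linarith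
    qed
  qed
  have "\<Psi> 0 \<le> (\<integral>t. \<Psi> (of_real R * cis t) \<partial>angle)" by (rule submean_center[OF c\<Psi> R(1) sm])
  then have "\<Phi> 0 - V 0 / c0 \<le> (\<integral>t. \<Phi> (of_real R * cis t) \<partial>angle) - Vmax R 0 / c0"
    using int\<Psi>[of R 0] R mean_V(1)[of R 0] by (simp add: \<Psi>_def)
  then have le: "Vmax R 0 - V 0 \<le> c0 * ((\<integral>t. \<Phi> (of_real R * cis t) \<partial>angle) - \<Phi> 0)"
    by (rule rescale_difference_le[OF c0_pos])
  note L = integrable_log_ball[OF R(1), of 0]
  have "(\<integral>\<^sup>+w. ennreal (\<kappa> w * ln (R / norm w)) * indicator (ball 0 R) w \<partial>lborel)
     = (\<integral>\<^sup>+w. ennreal (?\<mu> w * (ln (R / norm (0 - w)) * indicator (ball 0 R) w)) \<partial>lborel)"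
    by (intro nn_integral_cong) (auto simp: indicator_def)
  also have "\<dots> = ennreal (Vmax R 0 - V 0)"
    unfolding Vmax_diff(1)[OF R(1)]
    by (rule nn_integral_eq_integral[OF Vmax_diff(2)[OF R(1)]]) (use nonneg L(3) R in \<open>auto intro!: mult_nonneg_nonneg simp: indicator_def\<close>)
  also have "\<dots> \<le> ennreal (c0 * ((\<integral>t. \<Phi> (of_real R * cis t) \<partial>angle) - \<Phi> 0))"
    using le by (rule ennreal_leI)
  finally show ?thesis .
qed

section \<open>Jensen's formula\<close>

lemma Jensen_zero_free:
  assumes g: "g holomorphic_on ball 0 1" and r: "0 < r" "r < 1"
    and nz: "\<And>z. norm z \<le> r \<Longrightarrow> g z \<noteq> 0"
  shows "integrable angle (\<lambda>t. ln (norm (g (of_real r * cis t))))"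
    and "(\<integral>t. ln (norm (g (of_real r * cis t))) \<partial>angle) = ln (norm (g 0))"
proof -
  \<comment> \<open>A branch of log g is required on a disc strictly larger than the closed one;
    compactness of the closed disc inside the zero-free set supplies the margin
    \<open>e\<close>.\<close>
  define U where "U = ball 0 1 \<inter> g -` (- {0})"
  have "open U" unfolding U_def
    using holomorphic_on_imp_continuous_on[OF g] by (intro continuous_open_preimage) auto
  moreover have "cball 0 r \<subseteq> U" using nz r by (auto simp: U_def)
  ultimately obtain e where e: "e > 0" "(\<Union>x\<in>cball 0 r. ball x e) \<subseteq> U"
    using compact_subset_open_imp_ball_epsilon_subset[of "cball 0 r" U] by auto
  have sub: "ball 0 (r + e) \<subseteq> U"
  proof
    fix z :: complex assume z: "z \<in> ball 0 (r + e)"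
    show "z \<in> U"
    proof (cases "norm z \<le> r")
      case True then show ?thesis using \<open>cball 0 r \<subseteq> U\<close> by auto
    next
      case False
      then have nz: "norm z > 0" "norm z > r" using r by auto
      let ?x = "of_real (r / norm z) * z"
      have "norm ?x = r" using nz r by (simp add: norm_mult norm_divide)
      moreover have "dist ?x z < e"
      proof -
        have "?x - z = of_real (r / norm z - 1) * z" by (simp add: algebra_simps)
        then have "dist ?x z = \<bar>r / norm z - 1\<bar> * norm z" by (simp only: dist_norm norm_mult norm_of_real)
        also have "\<dots> = norm z - r" using nz by (simp add: abs_if field_simps)
        finally show ?thesis using z by simp
      qed
      ultimately have "?x \<in> cball 0 r" "z \<in> ball ?x e" by (simp_all only: mem_cball_0 mem_ball)
      then show ?thesis using e(2) by blast
    qed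
  qed
  have gh: "g holomorphic_on ball 0 (r + e)"
    by (rule holomorphic_on_subset[OF g]) (use sub in \<open>auto simp: U_def\<close>)
  have nzU: "\<And>z. z \<in> ball 0 (r + e) \<Longrightarrow> g z \<noteq> 0" using sub by (auto simp: U_def)
  obtain L where L: "L holomorphic_on ball 0 (r + e)" "\<And>z. z \<in> ball 0 (r + e) \<Longrightarrow> g z = exp (L z)"
    using contractible_imp_holomorphic_log[OF gh convex_imp_contractible[OF convex_ball] nzU] by blast
  have c: "continuous_on UNIV (\<lambda>t. L (of_real r * cis t))"
    by (rule holomorphic_continuous_cis[OF L(1)]) (use r e in auto)
  have eq: "ln (norm (g (of_real r * cis t))) = Re (L (of_real r * cis t))" for t
    using L(2)[of "of_real r * cis t"] r e by (simp add: norm_mult)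
  show "integrable angle (\<lambda>t. ln (norm (g (of_real r * cis t))))"
    unfolding eq by (intro integrable_angle_continuous continuous_intros c)
  have "(\<integral>t. ln (norm (g (of_real r * cis t))) \<partial>angle) = Re (\<integral>t. L (of_real r * cis t) \<partial>angle)"
    unfolding eq by (rule integral_Re[OF integrable_angle_continuous[OF c]])
  also have "\<dots> = Re (L 0)" using angle_mean_value[OF L(1), of r] r e by simp
  also have "\<dots> = ln (norm (g 0))" using L(2)[of 0] r e by simp
  finally show "(\<integral>t. ln (norm (g (of_real r * cis t))) \<partial>angle) = ln (norm (g 0))" .
qed

lemma finite_zeros_disc:
  assumes g: "g holomorphic_on ball 0 1" "g 0 \<noteq> 0" and r: "r < 1"
  shows "finite {z \<in> cball 0 r. g z = 0}"
proof (cases "g constant_on ball 0 1")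
  case True
  then have "{z \<in> cball 0 r. g z = 0} = {}" using g r by (force simp: constant_on_def)
  then show ?thesis by (simp only: finite.emptyI)
next
  case False
  then show ?thesis using r by (intro holomorphic_compact_finite_zeros[OF g(1)]) auto
qed

lemma eventually_nonzero_disc:
  assumes g: "g holomorphic_on ball 0 1" "g 0 \<noteq> 0" and z: "norm z < 1"
  shows "\<forall>\<^sub>F w in at z. g w \<noteq> 0"
proof -
  have "\<forall>\<^sub>F w in at z. g w \<noteq> 0 \<and> w \<in> ball 0 1"
    by (rule non_zero_neighbour_alt[where \<beta> = 0]) (use assms in auto)
  then show ?thesis by eventually_elim simp
qed

lemma analytic_at_disc: "g holomorphic_on ball 0 1 \<Longrightarrow> norm z < 1 \<Longrightarrow> g analytic_on {z}"
  by (rule analytic_at[THEN iffD2]) (intro exI[of _ "ball 0 1"], auto)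

lemma zorder_zero_pos:
  assumes g: "g holomorphic_on ball 0 1" "g 0 \<noteq> 0" and z: "norm z < 1" "g z = 0"
  shows "zorder g z > 0"
  using zorder_pos_iff'[OF analytic_at_disc[OF g(1) z(1)]] eventually_nonzero_disc[OF g z(1)] z(2)
  by (simp add: eventually_frequently)

text \<open>Zeros are divided out one at a time, by induction on their number with multiplicity in
  the closed disc. A factor z - a has logarithmic mean ln r, which is ln |a| + ln (r/|a|): the first
  part goes into ln |g 0|, the second is the contribution of the zero, equal to 0 when |a| =
  r.\<close>

lemma Jensen:
  assumes "g holomorphic_on ball 0 1" "g 0 \<noteq> 0" and r: "0 < r" "r < 1"
  shows "integrable angle (\<lambda>t. ln (norm (g (of_real r * cis t)))) \<and>
    (\<integral>t. ln (norm (g (of_real r * cis t))) \<partial>angle) =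
      ln (norm (g 0)) + (\<Sum>z\<in>{z \<in> cball 0 r. g z = 0}. of_int (zorder g z) * ln (r / norm z))"
  using assms(1,2)
proof (induction "nat (\<Sum>z\<in>{z \<in> cball 0 r. g z = 0}. zorder g z)" arbitrary: g)
  case 0
  have fin: "finite {z \<in> cball 0 r. g z = 0}" by (rule finite_zeros_disc[OF 0(2,3) r(2)])
  have e: "{z \<in> cball 0 r. g z = 0} = {}"
  proof (rule ccontr)
    assume "{z \<in> cball 0 r. g z = 0} \<noteq> {}"
    then have "0 < (\<Sum>z\<in>{z \<in> cball 0 r. g z = 0}. zorder g z)"
      using fin r by (intro sum_pos) (auto intro!: zorder_zero_pos[OF 0(2,3)])
    then show False using 0(1) by simp
  qed
  then have "\<And>z. norm z \<le> r \<Longrightarrow> g z \<noteq> 0" by auto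
  then show ?case unfolding e using Jensen_zero_free[OF 0(2) r] by simp
next
  case (Suc n)
  let ?Z = "\<lambda>g::complex\<Rightarrow>complex. {z \<in> cball 0 r. g z = 0}"
  have fin: "finite (?Z g)" by (rule finite_zeros_disc[OF Suc(3,4) r(2)])
  have "?Z g \<noteq> {}"
  proof
    assume e: "?Z g = {}" from Suc(2) show False unfolding e by simp
  qed
  then obtain a where a: "norm a \<le> r" "g a = 0" by auto
  then have a0: "a \<noteq> 0" "norm a < 1" using Suc(4) r by auto
  define h where "h = (\<lambda>z. if z = a then deriv g a else (g z - g a) / (z - a))"
  have h: "h holomorphic_on ball 0 1" unfolding h_def by (rule pole_lemma_open[OF Suc(3)]) simp
  have gh: "g z = (z - a) * h z" for z using a by (auto simp: h_def)
  have gfun: "g = (\<lambda>z. (z - a) * h z)" using gh by blast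
  have h0: "h 0 \<noteq> 0" using Suc(4) gh[of 0] by auto
  have finh: "finite (?Z h)" by (rule finite_zeros_disc[OF h h0 r(2)])
  have sub: "?Z h \<subseteq> ?Z g" using gh by auto
  have lin: "zorder (\<lambda>w. w - a) z = (if z = a then 1 else 0)" for z
  proof (cases "z = a")
    case True then show ?thesis by (simp add: zorder_eqI[of UNIV a "\<lambda>_. 1"] )
  next
    case False then show ?thesis by (simp, intro zorder_eq_0I) (auto intro!: analytic_intros)
  qed
  have ord: "zorder g z = (if z = a then 1 else 0) + zorder h z" if z: "norm z < 1" for z
  proof -
    have "zorder (\<lambda>z. (z - a) * h z) z = zorder (\<lambda>z. z - a) z + zorder h z"
      by (rule zorder_times_analytic) (use eventually_nonzero_disc[OF Suc(3,4) z] analytic_at_disc[OF h z] in \<open>auto intro!: analytic_intros simp: gh\<close>)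
    then show ?thesis using lin gfun by simp
  qed
  have hz: "zorder h z = 0" if "z \<in> ?Z g - ?Z h" for z
    using that r by (intro zorder_eq_0I analytic_at_disc[OF h]) auto
  \<comment> \<open>Stated over an arbitrary ring because it is used twice: in the integers with
    weight 1 for the induction measure, and in the reals with the logarithmic weights.\<close>
  have sumeq: "(\<Sum>z\<in>?Z g. of_int (zorder g z) * c z) = c a + (\<Sum>z\<in>?Z h. of_int (zorder h z) * c z)" for c :: "complex \<Rightarrow> 'x::comm_ring_1"
  proof -
    have "(\<Sum>z\<in>?Z g. of_int (zorder g z) * c z) = (\<Sum>z\<in>?Z g. (if z = a then c a else 0) + of_int (zorder h z) * c z)"
      by (rule sum.cong) (use r ord in \<open>auto simp: algebra_simps\<close>)
    also have "\<dots> = c a + (\<Sum>z\<in>?Z g. of_int (zorder h z) * c z)"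
      using fin a by (simp add: sum.distrib sum.delta)
    also have "(\<Sum>z\<in>?Z g. of_int (zorder h z) * c z) = (\<Sum>z\<in>?Z h. of_int (zorder h z) * c z)"
      by (rule sum.mono_neutral_right[OF fin sub]) (use hz in auto)
    finally show ?thesis .
  qed
  have hn: "0 \<le> (\<Sum>z\<in>?Z h. zorder h z)"
    using r by (intro sum_nonneg) (auto intro!: less_imp_le zorder_zero_pos[OF h h0])
  have "(\<Sum>z\<in>?Z g. zorder g z) = 1 + (\<Sum>z\<in>?Z h. zorder h z)"
    using sumeq[of "\<lambda>_. 1::int"] by simp
  then have "n = nat (\<Sum>z\<in>?Z h. zorder h z)" using Suc(2) hn by simp
  from Suc(1)[OF this h h0] have IH: "integrable angle (\<lambda>t. ln (norm (h (of_real r * cis t))))"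
    "(\<integral>t. ln (norm (h (of_real r * cis t))) \<partial>angle) = ln (norm (h 0)) + (\<Sum>z\<in>?Z h. of_int (zorder h z) * ln (r / norm z))" by auto
  note lm = log_mean[OF r(1), of 0 a, simplified]
  have AE: "AE t in angle. ln (norm (g (of_real r * cis t))) = ln (norm (of_real r * cis t - a)) + ln (norm (h (of_real r * cis t)))"
  proof -
    have "AE t in angle. \<forall>z\<in>?Z g. cis t \<noteq> z / of_real r"
      by (subst AE_ball_countable) (use fin AE_angle_cis_neq in \<open>auto intro: countable_finite\<close>)
    then show ?thesis
    proof eventually_elim
      case (elim t)
      have "g (of_real r * cis t) \<noteq> 0"
      proof
        assume "g (of_real r * cis t) = 0"
        then have "of_real r * cis t \<in> ?Z g" using r by (simp add: norm_mult)
        then show False using elim r by force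
      qed
      then show ?case unfolding gh norm_mult by (subst ln_mult) auto
    qed
  qed
  have m: "(\<lambda>t. ln (norm (g (of_real r * cis t)))) \<in> borel_measurable angle"
  proof -
    have [measurable]: "(\<lambda>t. g (of_real r * cis t)) \<in> borel_measurable borel"
      using r by (intro borel_measurable_continuous_onI holomorphic_continuous_cis[OF Suc(3)]) auto
    show ?thesis by measurable
  qed
  have m2: "(\<lambda>t. ln (norm (of_real r * cis t - a)) + ln (norm (h (of_real r * cis t)))) \<in> borel_measurable angle"
    using lm(1) IH(1) by (intro borel_measurable_add) auto
  have int: "integrable angle (\<lambda>t. ln (norm (of_real r * cis t - a)) + ln (norm (h (of_real r * cis t))))"
    using lm(1) IH(1) by (rule Bochner_Integration.integrable_add)
  have "integrable angle (\<lambda>t. ln (norm (g (of_real r * cis t))))"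
    by (subst integrable_cong_AE[OF m m2 AE]) (rule int)
  moreover have "(\<integral>t. ln (norm (g (of_real r * cis t))) \<partial>angle) =
      ln (norm (g 0)) + (\<Sum>z\<in>?Z g. of_int (zorder g z) * ln (r / norm z))"
  proof -
    have "(\<integral>t. ln (norm (g (of_real r * cis t))) \<partial>angle) = (\<integral>t. ln (norm (of_real r * cis t - a)) + ln (norm (h (of_real r * cis t))) \<partial>angle)"
      by (rule integral_cong_AE[OF m m2 AE])
    also have "\<dots> = ln r + (ln (norm (h 0)) + (\<Sum>z\<in>?Z h. of_int (zorder h z) * ln (r / norm z)))"
      using Bochner_Integration.integral_add[OF lm(1) IH(1)] lm(2) IH(2) a by (simp add: max_def)
    finally have 1: "(\<integral>t. ln (norm (g (of_real r * cis t))) \<partial>angle) =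
       ln r + (ln (norm (h 0)) + (\<Sum>z\<in>?Z h. of_int (zorder h z) * ln (r / norm z)))" .
    have "ln r + ln (norm (h 0)) = ln (norm (g 0)) + ln (r / norm a)"
      using gh[of 0] h0 a0 r by (simp add: norm_mult ln_mult ln_div)
    then show ?thesis unfolding 1 sumeq[of "\<lambda>z. ln (r / norm z)"] by linarith
  qed
  ultimately show ?case by blast
qed

text \<open>Radii increasing to 1, starting at 1/2. A fixed sequence makes monotone convergence and
  Fatou's lemma available for suprema and limits over all r below 1.\<close>

definition radius :: "nat \<Rightarrow> real" where "radius k = 1 - 1 / real (k + 2)"

lemma radius: "0 < radius k" "radius k < 1" "radius k \<le> radius (Suc k)"
  by (auto simp: radius_def field_simps)

lemma radius_tendsto: "radius \<longlonglongrightarrow> 1"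
  unfolding radius_def by real_asymp

lemma radius_at_left: "filterlim radius (at_left 1) sequentially"
  using radius_tendsto radius(2) less_imp_neq[OF radius(2)] by (auto simp: filterlim_at intro!: always_eventually)

section \<open>The counting function as a monotone limit\<close>

lemma mean_log_eq_sum:
  assumes \<phi>: "\<phi> holomorphic_on ball 0 1" and w: "\<phi> 0 \<noteq> w" and r: "0 < r" "r < 1"
  shows "mean_log \<phi> r w = (\<Sum>z\<in>{z \<in> cball 0 r. \<phi> z = w}. of_int (zorder (\<lambda>x. \<phi> x - w) z) * ln (r / norm z))"
proof -
  have "(\<lambda>x. \<phi> x - w) holomorphic_on ball 0 1" using \<phi> by (intro holomorphic_intros)
  from Jensen[OF this _ r] w show ?thesis by (simp add: mean_log_def)
qed

lemma mean_log_nonneg: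
  assumes \<phi>: "\<phi> holomorphic_on ball 0 1" and w: "\<phi> 0 \<noteq> w" and r: "0 < r" "r < 1"
  shows "0 \<le> mean_log \<phi> r w"
  unfolding mean_log_eq_sum[OF assms]
proof (rule sum_nonneg)
  fix z assume z: "z \<in> {z \<in> cball 0 r. \<phi> z = w}"
  have h: "(\<lambda>x. \<phi> x - w) holomorphic_on ball 0 1" using \<phi> by (intro holomorphic_intros)
  have "zorder (\<lambda>x. \<phi> x - w) z > 0" using z w r by (intro zorder_zero_pos[OF h]) auto
  moreover have "ln (r / norm z) \<ge> 0" using z w by (cases "z = 0") (auto simp: field_simps)
  ultimately show "0 \<le> of_int (zorder (\<lambda>x. \<phi> x - w) z) * ln (r / norm z)" by simp
qed

text \<open>A zero z contributes multiplicity times ln (radius k / |z|). For zeros beyond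
  \<open>radius k\<close> this is negative and \<open>ennreal\<close> cuts it to 0, so the
  contributions increase with k and monotone convergence over the zero set applies.\<close>

lemma nevanlinna_eq_SUP:
  assumes \<phi>: "\<phi> holomorphic_on ball 0 1" and w: "\<phi> 0 \<noteq> w"
  shows "nevanlinna \<phi> w = (SUP k. ennreal (mean_log \<phi> (radius k) w))"
    and "incseq (\<lambda>k. ennreal (mean_log \<phi> (radius k) w))"
proof -
  have h: "(\<lambda>x. \<phi> x - w) holomorphic_on ball 0 1" using \<phi> by (intro holomorphic_intros)
  let ?Z = "{z \<in> ball 0 1. \<phi> z = w}"
  have zp: "zorder (\<lambda>x. \<phi> x - w) z > 0" "z \<noteq> 0" if "z \<in> ?Z" for z
  proof -
    have z: "norm z < 1" "\<phi> z = w" using that by auto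
    show "zorder (\<lambda>x. \<phi> x - w) z > 0" by (rule zorder_zero_pos[OF h]) (use z w in simp_all)
    show "z \<noteq> 0" using z w by auto
  qed
  define F where "F = (\<lambda>k z. ennreal (of_int (zorder (\<lambda>x. \<phi> x - w) z) * ln (radius k / norm z)))"
  have F0: "F k z = 0" if "z \<in> ?Z" "norm z > radius k" for k z
  proof -
    have "norm z > 0" using that radius(1)[of k] by linarith
    then have "0 < radius k / norm z" "radius k / norm z \<le> 1"
      using that radius(1)[of k] by (simp_all add: divide_le_eq)
    then have "ln (radius k / norm z) \<le> 0" by simp
    then show ?thesis unfolding F_def using zp(1)[OF that(1)] by (intro ennreal_neg mult_nonneg_nonpos) auto
  qed
  have Fmono: "F k z \<le> F (Suc k) z" if "z \<in> ?Z" for k z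
    unfolding F_def using zp[OF that] radius[of k] radius[of "Suc k"]
    by (intro ennreal_leI mult_left_mono) (auto simp: ln_div)
  have int: "(\<integral>\<^sup>+z. F k z \<partial>count_space ?Z) = ennreal (mean_log \<phi> (radius k) w)" for k
  proof -
    let ?S = "{z \<in> cball 0 (radius k). \<phi> z = w}"
    have fin: "finite ?S" using finite_zeros_disc[OF h _ radius(2)[of k]] w by simp
    have "(\<integral>\<^sup>+z. F k z \<partial>count_space ?Z) = (\<Sum>z\<in>?S. F k z)"
      by (rule nn_integral_count_space') (use fin F0 radius(2)[of k] in \<open>auto simp: not_le\<close>)
    also have "\<dots> = ennreal (mean_log \<phi> (radius k) w)"
      unfolding mean_log_eq_sum[OF \<phi> w radius(1,2)] F_def
    proof (rule sum_ennreal)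
      fix z assume "z \<in> ?S"
      then have z: "z \<in> ?Z" "norm z \<le> radius k" using radius(2)[of k] by auto
      show "0 \<le> of_int (zorder (\<lambda>x. \<phi> x - w) z) * ln (radius k / norm z)"
        using zp[OF z(1)] z(2) by (intro mult_nonneg_nonneg) (auto simp: field_simps)
    qed
    finally show ?thesis .
  qed
  have inc: "incseq (\<lambda>k. \<lambda>z. if z \<in> ?Z then F k z else 0)"
    by (rule incseq_SucI) (use Fmono in \<open>auto simp: le_fun_def\<close>)
  have "(SUP k. ennreal (mean_log \<phi> (radius k) w)) = (SUP k. \<integral>\<^sup>+z. (if z \<in> ?Z then F k z else 0) \<partial>count_space ?Z)"
    unfolding int[symmetric] by (intro SUP_cong refl nn_integral_cong) auto
  also have "\<dots> = (\<integral>\<^sup>+z. (SUP k. if z \<in> ?Z then F k z else 0) \<partial>count_space ?Z)"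
    by (rule nn_integral_monotone_convergence_SUP[symmetric, OF inc]) simp
  also have "\<dots> = nevanlinna \<phi> w"
    unfolding nevanlinna_def
  proof (rule nn_integral_cong)
    fix z assume "z \<in> space (count_space ?Z)"
    then have z: "z \<in> ?Z" by simp
    have "(\<lambda>k. F k z) \<longlonglongrightarrow> ennreal (of_int (zorder (\<lambda>x. \<phi> x - w) z) * ln (1 / norm z))"
      unfolding F_def using zp[OF z] by (intro tendsto_intros radius_tendsto) auto
    moreover have "(\<lambda>k. F k z) \<longlonglongrightarrow> (SUP k. F k z)"
      by (rule LIMSEQ_SUP) (use Fmono[OF z] in \<open>auto intro: incseq_SucI\<close>)
    ultimately show "(SUP k. if z \<in> ?Z then F k z else 0) = ennreal (real_of_int (zorder (\<lambda>x. \<phi> x - w) z) * ln (1 / norm z))"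
      using z LIMSEQ_unique by fastforce
  qed
  finally show "nevanlinna \<phi> w = (SUP k. ennreal (mean_log \<phi> (radius k) w))" by simp
  show "incseq (\<lambda>k. ennreal (mean_log \<phi> (radius k) w))"
    unfolding int[symmetric] by (intro incseq_SucI nn_integral_mono) (use Fmono in auto)
qed

text \<open>Littlewood's inequality: the function \<open>1 - cnj w * \<phi>\<close> has no zeros, so its logarithmic means
  equal the value at the centre, and it dominates \<open>\<phi> - w\<close>.\<close>

lemma mean_log_le_pseudohyperbolic:
  assumes \<phi>: "\<phi> holomorphic_on ball 0 1" "\<phi> ` ball 0 1 \<subseteq> ball 0 1" and w: "\<phi> 0 \<noteq> w" "norm w < 1"
    and r: "0 < r" "r < 1"
  shows "mean_log \<phi> r w \<le> ln (norm (1 - cnj w * \<phi> 0) / norm (\<phi> 0 - w))"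
proof -
  have b: "norm (\<phi> z) < 1" if "norm z < 1" for z using \<phi>(2) that by (auto simp: image_subset_iff)
  have nz: "1 - cnj w * \<phi> z \<noteq> 0" if "norm z < 1" for z
  proof
    assume "1 - cnj w * \<phi> z = 0"
    then have "1 = cnj w * \<phi> z" by (rule right_minus_eq[THEN iffD1])
    then have "norm (1::complex) = norm (cnj w * \<phi> z)" by (rule arg_cong)
    moreover have "norm w * norm (\<phi> z) \<le> norm w * 1" using b[OF that] by (intro mult_left_mono) auto
    ultimately show False using w(2) by (simp add: norm_mult)
  qed
  have h: "(\<lambda>z. 1 - cnj w * \<phi> z) holomorphic_on ball 0 1" using \<phi> by (intro holomorphic_intros)
  have h2: "(\<lambda>x. \<phi> x - w) holomorphic_on ball 0 1" using \<phi> by (intro holomorphic_intros)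
  have J: "integrable angle (\<lambda>t. ln (norm (1 - cnj w * \<phi> (of_real r * cis t))))"
    "(\<integral>t. ln (norm (1 - cnj w * \<phi> (of_real r * cis t))) \<partial>angle) = ln (norm (1 - cnj w * \<phi> 0))"
    using Jensen_zero_free[OF h r] nz r by auto
  have J2: "integrable angle (\<lambda>t. ln (norm (\<phi> (of_real r * cis t) - w)))"
    using Jensen[OF h2 _ r] w by simp
  have le: "norm (a - w) \<le> norm (1 - cnj w * a)" if a: "norm a < 1" for a
  proof (rule power2_le_imp_le)
    have 1: "(norm (a - w))\<^sup>2 = (norm a)\<^sup>2 + (norm w)\<^sup>2 - 2 * Re (cnj w * a)"
      by (simp only: cmod_power2) (simp add: power2_eq_square algebra_simps)
    have 2: "(norm (1 - cnj w * a))\<^sup>2 = 1 + (norm a)\<^sup>2 * (norm w)\<^sup>2 - 2 * Re (cnj w * a)"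
      by (simp only: cmod_power2) (simp add: power2_eq_square algebra_simps)
    have "(1 - (norm a)\<^sup>2) * (1 - (norm w)\<^sup>2) \<ge> 0"
      using a w by (intro mult_nonneg_nonneg) (auto simp: abs_square_le_1)
    then show "(norm (a - w))\<^sup>2 \<le> (norm (1 - cnj w * a))\<^sup>2" unfolding 1 2 by (simp add: algebra_simps)
  qed simp
  have "(\<integral>t. ln (norm (\<phi> (of_real r * cis t) - w)) \<partial>angle) \<le> (\<integral>t. ln (norm (1 - cnj w * \<phi> (of_real r * cis t))) \<partial>angle)"
  proof (rule integral_mono_AE[OF J2 J(1)])
    have fin: "finite {z \<in> cball 0 r. \<phi> z - w = 0}" by (rule finite_zeros_disc[OF h2 _ r(2)]) (use w in auto)
    have "AE t in angle. \<forall>z\<in>{z \<in> cball 0 r. \<phi> z - w = 0}. cis t \<noteq> z / of_real r"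
      by (subst AE_ball_countable) (use fin AE_angle_cis_neq in \<open>auto intro: countable_finite\<close>)
    then show "AE t in angle. ln (norm (\<phi> (of_real r * cis t) - w)) \<le> ln (norm (1 - cnj w * \<phi> (of_real r * cis t)))"
    proof eventually_elim
      case (elim t)
      let ?z = "of_real r * cis t"
      have n: "norm ?z = r" using r by (simp add: norm_mult)
      have "\<phi> ?z - w \<noteq> 0"
      proof
        assume "\<phi> ?z - w = 0"
        then have "?z \<in> {z \<in> cball 0 r. \<phi> z - w = 0}" using n by simp
        then show False using elim r by force
      qed
      then have p: "0 < norm (\<phi> ?z - w)" by simp
      have l: "norm (\<phi> ?z - w) \<le> norm (1 - cnj w * \<phi> ?z)" using b[of ?z] n r by (intro le) auto
      show ?case using ln_le_cancel_iff[OF p less_le_trans[OF p l]] l by simp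
    qed
  qed
  then show ?thesis using J(2) w nz[of 0] by (simp add: mean_log_def ln_div)
qed

section \<open>The Bellman function\<close>

text \<open>The holomorphic continuation of u^(-1/4) to the right half-plane, so that the weight in
  the Bellman function can be differentiated by the chain rule for jets.\<close>

definition recip_root4 :: "complex \<Rightarrow> complex" where "recip_root4 y = exp (- (Ln y) / 4)"

lemma recip_root4_deriv:
  assumes "Re y > 0"
  shows "(recip_root4 has_field_derivative (- recip_root4 y / (4 * y))) (at y)"
proof -
  have "y \<notin> \<real>\<^sub>\<le>\<^sub>0" using assms by (auto simp: complex_nonpos_Reals_iff)
  moreover have "y \<noteq> 0" using assms by auto
  ultimately show ?thesis
    unfolding recip_root4_def by (auto intro!: derivative_eq_intros simp: field_simps)
qed

lemma recip_root4_holomorphic: "recip_root4 holomorphic_on {y. Re y > 0}"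
  by (rule holomorphic_onI, rule field_differentiable_at_within)
     (auto simp: field_differentiable_def intro: recip_root4_deriv)

lemma recip_root4_derivs:
  assumes "u > 0"
  shows "recip_root4 (of_real u) = of_real (u powr (-1/4))"
    "deriv recip_root4 (of_real u) = of_real (- (u powr (-1/4)) / (4 * u))"
    "deriv (deriv recip_root4) (of_real u) = of_real (5 * u powr (-1/4) / (16 * u\<^sup>2))"
proof -
  show v: "recip_root4 (of_real u) = of_real (u powr (-1/4))"
    using assms by (simp add: recip_root4_def Ln_of_real powr_def exp_of_real[symmetric] del: exp_of_real)
  have Re: "Re (of_real u) > 0" using assms by simp
  show "deriv recip_root4 (of_real u) = of_real (- (u powr (-1/4)) / (4 * u))"
    using DERIV_imp_deriv[OF recip_root4_deriv[OF Re]] v by simp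
  have ev: "\<forall>\<^sub>F y in nhds (of_real u). deriv recip_root4 y = - recip_root4 y / (4 * y)"
  proof -
    have "\<forall>\<^sub>F y in nhds (complex_of_real u). y \<in> {y. Re y > 0}"
      using assms by (intro eventually_nhds_in_open open_halfspace_Re_gt) auto
    then show ?thesis by eventually_elim (rule DERIV_imp_deriv, rule recip_root4_deriv, simp)
  qed
  have "((\<lambda>y. - recip_root4 y / (4 * y)) has_field_derivative
     (5 * recip_root4 (of_real u) / (16 * (of_real u)\<^sup>2))) (at (of_real u))"
    using assms by (auto intro!: derivative_eq_intros recip_root4_deriv simp: field_simps power2_eq_square)
  then have "deriv (\<lambda>y. - recip_root4 y / (4 * y)) (of_real u) = 5 * recip_root4 (of_real u) / (16 * (of_real u)\<^sup>2)"
    by (rule DERIV_imp_deriv)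
  then show "deriv (deriv recip_root4) (of_real u) = of_real (5 * u powr (-1/4) / (16 * u\<^sup>2))"
    using deriv_cong_ev[OF ev refl] v by simp
qed

text \<open>Completing squares: the cross terms of the Laplacian of \<open>u powr (-1/4) * |h|^2\<close> are absorbed
  because the exponent \<open>1/4\<close> is small.\<close>

lemma bellman_inequality_h:
  fixes \<theta> e k x u :: real
  assumes u: "u = 1 - \<theta>\<^sup>2" "u > 0"
  shows "1/2 * x\<^sup>2 - 16 * u\<^sup>2 * e\<^sup>2 \<le> x\<^sup>2 + \<theta>\<^sup>2 * e\<^sup>2 - 2 * k * e - \<theta> * k * (x + \<theta> * e) / (2 * u)
     + k\<^sup>2 * (1 / (4 * u) + 5 * \<theta>\<^sup>2 / (16 * u\<^sup>2))"
proof -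
  \<comment> \<open>Here theta = |Theta|, e = |G'|, k = |h Theta'| and x is the modulus of the
    z-derivative of h. After scaling by u^2 three squares remain; the term 16 u^4 e^2 is what the
    square containing 4 u^2 e - k/4 demands, and the rest k^2 (3/16 - theta^2 / 8) is nonnegative as
    theta < 1.\<close>
  have "u\<^sup>2 * (x\<^sup>2 + \<theta>\<^sup>2 * e\<^sup>2 - 2 * k * e - \<theta> * k * (x + \<theta> * e) / (2 * u)
     + k\<^sup>2 * (1 / (4 * u) + 5 * \<theta>\<^sup>2 / (16 * u\<^sup>2)) - (1/2 * x\<^sup>2 - 16 * u\<^sup>2 * e\<^sup>2))
     = u\<^sup>2 * x\<^sup>2 / 2 + u\<^sup>2 * \<theta>\<^sup>2 * e\<^sup>2 - 2 * u\<^sup>2 * k * e - u * \<theta> * k * (x + \<theta> * e) / 2 + k\<^sup>2 * (u / 4 + 5 * \<theta>\<^sup>2 / 16) + 16 * u^4 * e\<^sup>2"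
    using u(2) by (simp add: field_simps power2_eq_square power4_eq_xxxx)
  also have "u / 4 + 5 * \<theta>\<^sup>2 / 16 = 1/4 + \<theta>\<^sup>2 / 16" by (simp add: u(1) field_simps)
  also have "u\<^sup>2 * x\<^sup>2 / 2 + u\<^sup>2 * \<theta>\<^sup>2 * e\<^sup>2 - 2 * u\<^sup>2 * k * e - u * \<theta> * k * (x + \<theta> * e) / 2 + k\<^sup>2 * (1/4 + \<theta>\<^sup>2 / 16) + 16 * u^4 * e\<^sup>2
     = (u * x - \<theta> * k / 2)\<^sup>2 / 2 + \<theta>\<^sup>2 * (u * e - k / 4)\<^sup>2 + (4 * u\<^sup>2 * e - k / 4)\<^sup>2 + k\<^sup>2 * (3/16 - \<theta>\<^sup>2 / 8)"
    by (simp add: field_simps power2_eq_square power4_eq_xxxx)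
  also have "\<dots> \<ge> 0" using u by (intro add_nonneg_nonneg mult_nonneg_nonneg) auto
  finally show ?thesis using u(2) by (simp add: zero_le_mult_iff)
qed

text \<open>The difference of the two sides is a multiple of one square. Here e = |G'| and k =
  |Theta' G|; the term 3/4 k^2 is the gain that pays for the part Theta' conj(G) of f'.\<close>

lemma bellman_inequality_G:
  fixes \<theta> e k u :: real
  assumes "u > 0"
  shows "3/4 * k\<^sup>2 - 4 * u * e\<^sup>2 \<le> - u * e\<^sup>2 + k\<^sup>2 * (3/4 + 3 * \<theta>\<^sup>2 / (16 * u)) - 3/2 * \<theta> * k * e"
proof -
  have "- u * e\<^sup>2 + k\<^sup>2 * (3/4 + 3 * \<theta>\<^sup>2 / (16 * u)) - 3/2 * \<theta> * k * e - (3/4 * k\<^sup>2 - 4 * u * e\<^sup>2)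
     = 3 / u * (\<theta> * k / 4 - u * e)\<^sup>2"
    using assms by (simp add: field_simps power2_eq_square)
  also have "\<dots> \<ge> 0" using assms by simp
  finally show ?thesis by (rule diff_ge_0_iff_ge[THEN iffD1])
qed

text \<open>The constant 20 is 16 + 4, the multiples of |G'|^2 lost in the two preceding
  inequalities. The last weight u^(3/4) is written as \<open>u * W\<close> so that its jet follows
  from the product rule.\<close>

definition bellman :: "(complex \<Rightarrow> complex) \<Rightarrow> (complex \<Rightarrow> complex) \<Rightarrow> (complex \<Rightarrow> complex) \<Rightarrow> complex \<Rightarrow> real" where
  "bellman \<Theta> f G z = (let u = 1 - (norm (\<Theta> z))\<^sup>2; W = u powr (-1/4) in
     W * (norm (f z - \<Theta> z * cnj (G z)))\<^sup>2 + 20 * (norm (G z))\<^sup>2 - u * W * (norm (G z))\<^sup>2)"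

lemma Re_cross_ge: "Re (a * cnj b + b * cnj a) \<ge> - 2 * (norm a * norm b)"
proof -
  have "Re (a * cnj b + b * cnj a) = 2 * Re (a * cnj b)" by simp
  moreover have "\<bar>Re (a * cnj b)\<bar> \<le> norm a * norm b" using abs_Re_le_cmod[of "a * cnj b"] by (simp add: norm_mult)
  ultimately show ?thesis by linarith
qed

text \<open>The rules for jets split the mixed coefficient into the contributions of the three
  terms. Cross terms are bounded by products of moduli, which reduces the estimate to the two real
  inequalities; W u <= 1 turns their losses into plain multiples of |G'|^2.\<close>

lemma bellman_jet:
  assumes hol: "\<Theta> holomorphic_on ball 0 1" "f holomorphic_on ball 0 1" "G holomorphic_on ball 0 1"
    and a: "norm a < 1" and \<Theta>1: "norm (\<Theta> a) < 1"
  shows "\<exists>p q g. jet (\<lambda>z. of_real (bellman \<Theta> f G z)) a p q g \<and>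
     1/4 * (1 - (norm (\<Theta> a))\<^sup>2) powr (-1/4) * (norm (deriv f a))\<^sup>2 \<le> Re g"
proof -
  have S: "open (ball (0::complex) 1)" "a \<in> ball 0 1" using a by auto
  define u where "u = 1 - (norm (\<Theta> a))\<^sup>2"
  have u: "0 < u" "u \<le> 1" using \<Theta>1 by (auto simp: u_def power_less_one_iff abs_square_less_1)
  define W where "W = u powr (-1/4)"
  have W: "W > 0" using u by (simp add: W_def)
  have Wu: "W * u \<le> 1"
  proof -
    have "W * u = u powr (-1/4) * u powr 1" using u by (simp add: W_def)
    also have "\<dots> = u powr (3/4)" using powr_add[of u "-1/4" 1] by simp
    also have "\<dots> \<le> 1 powr (3/4)" using u by (intro powr_mono2) auto
    finally show ?thesis by simp
  qed
  define \<Theta>' where "\<Theta>' = deriv \<Theta> a" define G' where "G' = deriv G a"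
  define h where "h = f a - \<Theta> a * cnj (G a)"
  \<comment> \<open>\<open>X\<close>, \<open>Y\<close> and \<open>Z\<close> are the coefficients of
    x, \<open>cnj x\<close> and |x|^2 in the jet of h = f - Theta conj(G); thus f' = X + Theta'
    conj(G).\<close>
  define X where "X = deriv f a - \<Theta>' * cnj (G a)"
  define Y where "Y = - \<Theta> a * cnj G'"
  define Z where "Z = - \<Theta>' * cnj G'"
  note j\<Theta> = jet_holomorphic[OF hol(1) S, folded \<Theta>'_def]
  note jf = jet_holomorphic[OF hol(2) S]
  note jG = jet_holomorphic[OF hol(3) S, folded G'_def]
  note jm1 = jet_const[of "-1" a]
  have ju: "jet (\<lambda>z. 1 + (- 1) * (\<Theta> z * cnj (\<Theta> z))) a (- \<Theta>' * cnj (\<Theta> a)) (- \<Theta> a * cnj \<Theta>') (- \<Theta>' * cnj \<Theta>')"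
    using jet_add[OF jet_const[of 1 a] jet_mult[OF jm1 jet_mult[OF j\<Theta> jet_cnj[OF j\<Theta>]]]] by simp
  have uc: "1 + (- 1) * (\<Theta> a * cnj (\<Theta> a)) = of_real u"
    by (simp add: u_def complex_norm_square del: of_real_power)
  have jW: "jet (\<lambda>z. recip_root4 (1 + (- 1) * (\<Theta> z * cnj (\<Theta> z)))) a
     (of_real (W / (4*u)) * (\<Theta>' * cnj (\<Theta> a))) (of_real (W / (4*u)) * (\<Theta> a * cnj \<Theta>'))
     (of_real (W / (4*u)) * (\<Theta>' * cnj \<Theta>') + of_real (5 * W / (16 * u\<^sup>2)) * (\<Theta>' * cnj (\<Theta> a) * (\<Theta> a * cnj \<Theta>')))"
    using jet_compose[OF ju recip_root4_holomorphic open_halfspace_Re_gt] u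
    unfolding uc recip_root4_derivs[OF u(1)] W_def by simp
  have Wc: "recip_root4 (1 + (- 1) * (\<Theta> a * cnj (\<Theta> a))) = of_real W"
    unfolding uc recip_root4_derivs[OF u(1)] W_def ..
  have jh: "jet (\<lambda>z. f z + (- 1) * (\<Theta> z * cnj (G z))) a X Y Z"
    using jet_add[OF jf jet_mult[OF jm1 jet_mult[OF j\<Theta> jet_cnj[OF jG]]]] by (simp add: X_def Y_def Z_def)
  have hc: "f a + (- 1) * (\<Theta> a * cnj (G a)) = h" by (simp add: h_def)
  define pN where "pN = h * cnj Y + X * cnj h"
  have jhh: "jet (\<lambda>z. (f z + (- 1) * (\<Theta> z * cnj (G z))) * cnj (f z + (- 1) * (\<Theta> z * cnj (G z)))) a
     pN (cnj pN) (h * cnj Z + Z * cnj h + X * cnj X + Y * cnj Y)"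
    using jet_mult[OF jh jet_cnj[OF jh]] unfolding hc by (simp add: pN_def mult.commute add_ac)
  define pW where "pW = of_real (W / (4*u)) * (\<Theta>' * cnj (\<Theta> a))"
  define gW where "gW = of_real (W / (4*u)) * (\<Theta>' * cnj \<Theta>') + of_real (5 * W / (16 * u\<^sup>2)) * (\<Theta>' * cnj (\<Theta> a) * (\<Theta> a * cnj \<Theta>'))"
  have jW': "jet (\<lambda>z. recip_root4 (1 + (- 1) * (\<Theta> z * cnj (\<Theta> z)))) a pW (cnj pW) gW"
    using jW by (simp add: pW_def gW_def mult_ac)
  note j1 = jet_mult[OF jW' jhh, unfolded Wc hc]
  have jGG: "jet (\<lambda>z. G z * cnj (G z)) a (G' * cnj (G a)) (G a * cnj G') (G' * cnj G')"
    using jet_mult[OF jG jet_cnj[OF jG]] by simp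
  note j2 = jet_mult[OF jet_const[of 20 a] jGG]
  note juW = jet_mult[OF ju jW', unfolded Wc, unfolded uc]
  note j3 = jet_mult[OF jm1 jet_mult[OF juW jGG, unfolded Wc, unfolded uc]]
  note J = jet_add[OF j1 jet_add[OF j2 j3]]
  let ?F = "\<lambda>z. recip_root4 (1 + (- 1) * (\<Theta> z * cnj (\<Theta> z))) * ((f z + (- 1) * (\<Theta> z * cnj (G z))) * cnj (f z + (- 1) * (\<Theta> z * cnj (G z))))
    + (20 * (G z * cnj (G z)) + (- 1) * ((1 + (- 1) * (\<Theta> z * cnj (\<Theta> z))) * recip_root4 (1 + (- 1) * (\<Theta> z * cnj (\<Theta> z))) * (G z * cnj (G z))))"
  have Fe: "of_real (bellman \<Theta> f G z) = ?F z" if "norm (\<Theta> z) < 1" for z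
  proof -
    define v where "v = 1 - (norm (\<Theta> z))\<^sup>2"
    have v: "v > 0" using that by (auto simp: v_def power_less_one_iff abs_square_less_1)
    have vc: "1 + (- 1) * (\<Theta> z * cnj (\<Theta> z)) = of_real v"
      by (simp add: v_def complex_norm_square del: of_real_power)
    show ?thesis unfolding vc recip_root4_derivs(1)[OF v] bellman_def Let_def v_def[symmetric]
      of_real_add of_real_diff of_real_mult complex_norm_square
      by (simp add: algebra_simps)
  qed
  have ev: "\<forall>\<^sub>F x in at 0. norm (\<Theta> (a + x)) < 1"
  proof -
    have "isCont \<Theta> a" using hol(1) S holomorphic_on_imp_continuous_on continuous_on_eq_continuous_at by blast
    then have "((\<lambda>x. \<Theta> (a + x)) \<longlongrightarrow> \<Theta> a) (at 0)" by (simp add: isCont_def LIM_offset_zero_iff)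
    then have "((\<lambda>x. norm (\<Theta> (a + x))) \<longlongrightarrow> norm (\<Theta> a)) (at 0)" by (rule tendsto_norm)
    from order_tendstoD(2)[OF this \<Theta>1] show ?thesis .
  qed
  \<comment> \<open>The complex expression agrees with the Bellman function where |Theta| < 1, that
    is near \<open>a\<close>; jets only see a neighbourhood of the base point.\<close>
  have jet_cong: "jet (\<lambda>z. of_real (bellman \<Theta> f G z)) a p q g" if "jet ?F a p q g" for p q g
  proof -
    from that obtain b b' where "(\<lambda>x. ?F (a + x) -
     (?F a + (p * x + q * cnj x) + (b * x\<^sup>2 + b' * (cnj x)\<^sup>2 + g * (x * cnj x)))) \<in> o[at 0](\<lambda>x. x\<^sup>2)"
      unfolding jet_def by blast
    moreover have "\<forall>\<^sub>F x in at 0. ?F (a + x) -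
     (?F a + (p * x + q * cnj x) + (b * x\<^sup>2 + b' * (cnj x)\<^sup>2 + g * (x * cnj x)))
      = of_real (bellman \<Theta> f G (a + x)) -
     (of_real (bellman \<Theta> f G a) + (p * x + q * cnj x) + (b * x\<^sup>2 + b' * (cnj x)\<^sup>2 + g * (x * cnj x)))"
      using ev by eventually_elim (simp only: Fe[OF \<Theta>1] Fe)
    ultimately show ?thesis unfolding jet_def
      by (intro exI[of _ b] exI[of _ b']) (erule landau_o.small.in_cong[THEN iffD1, rotated])
  qed
  define T where "T = norm \<Theta>'" define \<theta> where "\<theta> = norm (\<Theta> a)" define e where "e = norm G'"
  have nsq: "x * cnj x = of_real ((norm x)\<^sup>2)" for x by (simp only: complex_norm_square)
  have RegW: "Re gW = W * T\<^sup>2 * (1/(4*u) + 5 * \<theta>\<^sup>2 / (16 * u\<^sup>2))" and gWr: "gW = of_real (Re gW)"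
  proof -
    have "\<Theta>' * cnj (\<Theta> a) * (\<Theta> a * cnj \<Theta>') = (\<Theta>' * cnj \<Theta>') * (\<Theta> a * cnj (\<Theta> a))" by (simp add: mult_ac)
    then have "gW = of_real (W * T\<^sup>2 * (1/(4*u) + 5 * \<theta>\<^sup>2 / (16 * u\<^sup>2)))"
      unfolding gW_def nsq T_def \<theta>_def by (simp add: algebra_simps)
    then show "Re gW = W * T\<^sup>2 * (1/(4*u) + 5 * \<theta>\<^sup>2 / (16 * u\<^sup>2))" "gW = of_real (Re gW)" by simp_all
  qed
  have npW: "norm pW = W / (4*u) * (T * \<theta>)" unfolding pW_def norm_mult norm_of_real T_def \<theta>_def using W u by simp
  have nY: "norm Y = \<theta> * e" by (simp add: Y_def norm_mult \<theta>_def e_def)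
  have nZ: "norm Z = T * e" by (simp add: Z_def norm_mult T_def e_def)
  have npN: "norm pN \<le> norm h * (norm X + \<theta> * e)"
    unfolding pN_def using norm_triangle_ineq[of "h * cnj Y" "X * cnj h"] by (simp add: norm_mult nY algebra_simps)
  let ?g1 = "of_real W * (h * cnj Z + Z * cnj h + X * cnj X + Y * cnj Y) + gW * (h * cnj h) + pW * cnj pN + cnj pW * pN"
  have g1: "W / 2 * (norm X)\<^sup>2 - 16 * e\<^sup>2 \<le> Re ?g1"
  proof -
    define k where "k = norm h * T"
    have r1: "Re (h * cnj Z + Z * cnj h) \<ge> - 2 * k * e"
      using Re_cross_ge[of h Z] by (simp add: nZ k_def mult_ac)
    have r2: "Re (pW * cnj pN + cnj pW * pN) \<ge> - 2 * (W / (4*u) * (T * \<theta>)) * (norm h * (norm X + \<theta> * e))"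
    proof -
      have "Re (pW * cnj pN + cnj pW * pN) \<ge> - 2 * (norm pW * norm pN)"
        using Re_cross_ge[of pW pN] by (simp add: mult.commute)
      moreover have "norm pW * norm pN \<le> norm pW * (norm h * (norm X + \<theta> * e))" using npN by (intro mult_left_mono) auto
      ultimately have "- 2 * (norm pW * (norm h * (norm X + \<theta> * e))) \<le> Re (pW * cnj pN + cnj pW * pN)" by linarith
      then show ?thesis unfolding npW[symmetric] by (simp only: mult.assoc)
    qed
    have "Re ?g1 = W * (Re (h * cnj Z + Z * cnj h) + (norm X)\<^sup>2 + (norm Y)\<^sup>2) + Re gW * (norm h)\<^sup>2 + Re (pW * cnj pN + cnj pW * pN)"
      unfolding nsq by (subst gWr) simp
    also have "\<dots> \<ge> W * (- 2 * k * e + (norm X)\<^sup>2 + (norm Y)\<^sup>2) + Re gW * (norm h)\<^sup>2 + (- 2 * (W / (4*u) * (T * \<theta>)) * (norm h * (norm X + \<theta> * e)))"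
    proof -
      have "W * (- 2 * k * e + (norm X)\<^sup>2 + (norm Y)\<^sup>2) \<le> W * (Re (h * cnj Z + Z * cnj h) + (norm X)\<^sup>2 + (norm Y)\<^sup>2)"
        using r1 W by (intro mult_left_mono) auto
      then show ?thesis using r2 by linarith
    qed
    also have "W * (- 2 * k * e + (norm X)\<^sup>2 + (norm Y)\<^sup>2) + Re gW * (norm h)\<^sup>2 + (- 2 * (W / (4*u) * (T * \<theta>)) * (norm h * (norm X + \<theta> * e)))
      = W * ((norm X)\<^sup>2 + \<theta>\<^sup>2 * e\<^sup>2 - 2 * k * e - \<theta> * k * (norm X + \<theta> * e) / (2 * u) + k\<^sup>2 * (1 / (4 * u) + 5 * \<theta>\<^sup>2 / (16 * u\<^sup>2)))"
      unfolding RegW nY k_def using u by (simp add: field_simps power2_eq_square)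
    also have "\<dots> \<ge> W * (1/2 * (norm X)\<^sup>2 - 16 * u\<^sup>2 * e\<^sup>2)"
      using W u by (intro mult_left_mono bellman_inequality_h) (auto simp: u_def \<theta>_def)
    finally have "Re ?g1 \<ge> W * (1/2 * (norm X)\<^sup>2 - 16 * u\<^sup>2 * e\<^sup>2)" .
    moreover have "W * u\<^sup>2 \<le> 1"
    proof -
      have "W * u * u \<le> 1 * 1" using Wu W u by (intro mult_mono) auto
      then show ?thesis by (simp add: power2_eq_square)
    qed
    then have "16 * e\<^sup>2 * (W * u\<^sup>2) \<le> 16 * e\<^sup>2 * 1" by (intro mult_left_mono) auto
    ultimately show ?thesis by (simp add: algebra_simps)
  qed
  let ?puW = "of_real u * pW + - \<Theta>' * cnj (\<Theta> a) * of_real W"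
  let ?quW = "of_real u * cnj pW + - \<Theta> a * cnj \<Theta>' * of_real W"
  let ?guW = "of_real u * gW + - \<Theta>' * cnj \<Theta>' * of_real W + - \<Theta>' * cnj (\<Theta> a) * cnj pW + - \<Theta> a * cnj \<Theta>' * pW"
  let ?g3 = "of_real u * of_real W * (G' * cnj G') + ?guW * (G a * cnj (G a)) + ?puW * (G a * cnj G') + ?quW * (G' * cnj (G a))"
  have g3: "3/4 * W * (T * norm (G a))\<^sup>2 - 4 * e\<^sup>2 \<le> - Re ?g3"
  proof -
    define k where "k = T * norm (G a)"
    have puW: "?puW = of_real (-3/4 * W) * (\<Theta>' * cnj (\<Theta> a))"
      unfolding pW_def using u by (simp add: field_simps)
    have quW: "?quW = cnj ?puW" by (simp add: mult_ac)
    have guW: "?guW = of_real (- W * T\<^sup>2 * (3/4 + 3 * \<theta>\<^sup>2 / (16 * u)))"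
    proof -
      have 1: "- \<Theta>' * cnj (\<Theta> a) * cnj pW = - of_real (W / (4*u)) * of_real (T\<^sup>2 * \<theta>\<^sup>2)"
        unfolding pW_def T_def \<theta>_def of_real_mult[of "(norm \<Theta>')\<^sup>2"] nsq[symmetric] by (simp add: mult_ac)
      have 2: "- \<Theta> a * cnj \<Theta>' * pW = - of_real (W / (4*u)) * of_real (T\<^sup>2 * \<theta>\<^sup>2)"
        unfolding pW_def T_def \<theta>_def of_real_mult[of "(norm \<Theta>')\<^sup>2"] nsq[symmetric] by (simp add: mult_ac)
      have 3: "- \<Theta>' * cnj \<Theta>' * of_real W = of_real (- (T\<^sup>2) * W)" unfolding T_def of_real_mult of_real_minus nsq[symmetric] by simp
      have "?guW = of_real (u * (W * T\<^sup>2 * (1/(4*u) + 5 * \<theta>\<^sup>2 / (16 * u\<^sup>2))) + - (T\<^sup>2) * W + - (W / (4*u)) * (T\<^sup>2 * \<theta>\<^sup>2) + - (W / (4*u)) * (T\<^sup>2 * \<theta>\<^sup>2))"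
        unfolding 1 2 3 by (subst gWr) (simp add: RegW)
      also have "u * (W * T\<^sup>2 * (1/(4*u) + 5 * \<theta>\<^sup>2 / (16 * u\<^sup>2))) + - (T\<^sup>2) * W + - (W / (4*u)) * (T\<^sup>2 * \<theta>\<^sup>2) + - (W / (4*u)) * (T\<^sup>2 * \<theta>\<^sup>2)
         = - W * T\<^sup>2 * (3/4 + 3 * \<theta>\<^sup>2 / (16 * u))"
        using u by (simp add: field_simps power2_eq_square)
      finally show ?thesis .
    qed
    have r: "Re (?puW * (G a * cnj G') + ?quW * (G' * cnj (G a))) \<le> 3/2 * W * \<theta> * k * e"
    proof -
      have "Re (?puW * (G a * cnj G') + ?quW * (G' * cnj (G a))) = 2 * Re (?puW * (G a * cnj G'))"
        unfolding quW by (simp add: algebra_simps)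
      also have "\<dots> \<le> 2 * norm (?puW * (G a * cnj G'))" by (intro mult_left_mono complex_Re_le_cmod) simp
      also have "norm (?puW * (G a * cnj G')) = 3/4 * W * (T * \<theta>) * (norm (G a) * e)"
        unfolding puW using W by (simp add: norm_mult T_def \<theta>_def e_def abs_mult)
      finally show ?thesis by (simp add: k_def mult_ac)
    qed
    have "Re ?g3 = u * W * e\<^sup>2 - W * T\<^sup>2 * (3/4 + 3 * \<theta>\<^sup>2 / (16 * u)) * (norm (G a))\<^sup>2 + Re (?puW * (G a * cnj G') + ?quW * (G' * cnj (G a)))"
      unfolding guW nsq e_def by simp
    then have "- Re ?g3 \<ge> W * (- u * e\<^sup>2 + k\<^sup>2 * (3/4 + 3 * \<theta>\<^sup>2 / (16 * u)) - 3/2 * \<theta> * k * e)"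
      using r by (simp add: k_def algebra_simps power_mult_distrib)
    moreover have "W * (- u * e\<^sup>2 + k\<^sup>2 * (3/4 + 3 * \<theta>\<^sup>2 / (16 * u)) - 3/2 * \<theta> * k * e) \<ge> W * (3/4 * k\<^sup>2 - 4 * u * e\<^sup>2)"
      using W bellman_inequality_G[OF u(1), of k e \<theta>] by (intro mult_left_mono) auto
    moreover have "4 * e\<^sup>2 * (W * u) \<le> 4 * e\<^sup>2 * 1" using Wu by (intro mult_left_mono) auto
    ultimately show ?thesis by (simp add: k_def algebra_simps)
  qed
  \<comment> \<open>The square of a sum is at most twice the sum of squares, so the gains W/2 and
    3/4 W leave a quarter of the weight on |f'|^2.\<close>
  have "1/4 * W * (norm (deriv f a))\<^sup>2 \<le> W / 2 * (norm X)\<^sup>2 + 3/4 * W * (T * norm (G a))\<^sup>2"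
  proof -
    have "norm (deriv f a) \<le> norm X + T * norm (G a)"
      using norm_triangle_ineq[of X "\<Theta>' * cnj (G a)"] by (simp add: X_def T_def norm_mult)
    then have "(norm (deriv f a))\<^sup>2 \<le> (norm X + T * norm (G a))\<^sup>2" by (intro power_mono) auto
    also have "\<dots> \<le> 2 * (norm X)\<^sup>2 + 2 * (T * norm (G a))\<^sup>2"
      using sum_squares_bound[of "norm X" "T * norm (G a)"] by (simp add: power2_sum)
    finally have "1/4 * W * (norm (deriv f a))\<^sup>2 \<le> 1/4 * W * (2 * (norm X)\<^sup>2 + 2 * (T * norm (G a))\<^sup>2)"
      using W by (intro mult_left_mono) auto
    also have "\<dots> \<le> W / 2 * (norm X)\<^sup>2 + 3/4 * W * (T * norm (G a))\<^sup>2"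
      using W by (simp add: algebra_simps)
    finally show ?thesis .
  qed
  moreover have "Re (20 * (G' * cnj G')) = 20 * e\<^sup>2" unfolding nsq e_def by simp
  ultimately have main: "1/4 * W * (norm (deriv f a))\<^sup>2 \<le> Re (?g1 + (20 * (G' * cnj G') + (- ?g3)))"
    using g1 g3 by simp
  have fin: ?thesis if "jet (\<lambda>z. of_real (bellman \<Theta> f G z)) a p q g" "g = ?g1 + (20 * (G' * cnj G') + (- ?g3))" for p q g
    using main that unfolding W_def u_def by blast
  show ?thesis by (rule fin[OF jet_cong[OF J]]) (simp add: algebra_simps)
qed

section \<open>Hardy space and model space\<close>

lemma AE_circle_measure: "AE \<zeta> in circle_measure. norm \<zeta> = 1"
  unfolding circle_measure_def by (subst AE_distr_iff) auto

text \<open>\<open>F\<close> is controlled on the circle only and may fail to be Borel on the plane,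
  where \<open>circle_measure\<close> lives; it is replaced by its cut-off to the circle, equal
  almost everywhere.\<close>

lemma nn_integral_circle_measure:
  assumes "continuous_on (sphere 0 1) F"
  shows "(\<integral>\<^sup>+\<zeta>. ennreal (F \<zeta>) \<partial>circle_measure) = (\<integral>\<^sup>+t. ennreal (F (cis t)) \<partial>angle)"
proof -
  have m: "(\<lambda>\<zeta>. indicator (sphere 0 1) \<zeta> *\<^sub>R F \<zeta>) \<in> borel_measurable borel"
    by (rule borel_measurable_continuous_on_indicator[OF _ assms]) (auto intro: borel_closed)
  have "(\<integral>\<^sup>+\<zeta>. ennreal (F \<zeta>) \<partial>circle_measure) = (\<integral>\<^sup>+\<zeta>. ennreal (indicator (sphere 0 1) \<zeta> *\<^sub>R F \<zeta>) \<partial>circle_measure)"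
    by (rule nn_integral_cong_AE) (use AE_circle_measure in \<open>auto elim!: eventually_mono\<close>)
  also have "\<dots> = (\<integral>\<^sup>+t. ennreal (F (cis t)) \<partial>angle)"
    unfolding circle_measure_def by (subst nn_integral_distr) (use m in auto)
  finally show ?thesis .
qed

section \<open>Mean squares over circles and the Hardy norm\<close>

definition sqmean :: "(complex \<Rightarrow> complex) \<Rightarrow> real \<Rightarrow> real" where
  "sqmean f r = (\<integral>t. (norm (f (of_real r * cis t)))\<^sup>2 \<partial>angle)"

lemma sqmean_nonneg: "0 \<le> sqmean f r"
  unfolding sqmean_def by (rule integral_nonneg_AE) auto

lemma integrable_sqmean:
  assumes "f holomorphic_on ball 0 1" "0 < r" "r < 1"
  shows "integrable angle (\<lambda>t. (norm (f (of_real r * cis t)))\<^sup>2)"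
  by (intro integrable_angle_continuous continuous_on_power continuous_on_norm holomorphic_continuous_cis[OF assms(1)])
     (use assms in auto)

lemma nn_integral_sqmean:
  assumes "f holomorphic_on ball 0 1" "0 < r" "r < 1"
  shows "(\<integral>\<^sup>+t. ennreal ((norm (f (of_real r * cis t)))\<^sup>2) \<partial>angle) = ennreal (sqmean f r)"
  unfolding sqmean_def by (rule nn_integral_eq_integral[OF integrable_sqmean[OF assms]]) auto

lemma H2_disc_means_eq:
  assumes "f holomorphic_on ball 0 1"
  shows "H2_disc_means f = (SUP r\<in>{0<..<1}. ennreal (sqmean f r))"
  unfolding H2_disc_means_def
proof (rule SUP_cong[OF refl])
  fix r :: real assume r: "r \<in> {0<..<1}"
  have c: "continuous_on (sphere 0 1) (\<lambda>\<zeta>. (norm (f (r *\<^sub>R \<zeta>)))\<^sup>2)"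
    by (intro continuous_intros continuous_on_compose2[OF holomorphic_on_imp_continuous_on[OF assms]]) (use r in auto)
  show "(\<integral>\<^sup>+\<zeta>. ennreal ((norm (f (r *\<^sub>R \<zeta>)))\<^sup>2) \<partial>circle_measure) = ennreal (sqmean f r)"
    by (subst nn_integral_circle_measure[OF c]) (use r nn_integral_sqmean[OF assms, of r] in \<open>simp add: scaleR_conv_of_real\<close>)
qed

lemma sqmean_le_H2_norm:
  assumes "f \<in> H2_disc" "0 < r" "r < 1"
  shows "sqmean f r \<le> (H2_disc_norm f)\<^sup>2"
proof -
  have h: "f holomorphic_on ball 0 1" "H2_disc_means f < \<infinity>" using assms by (auto simp: H2_disc_def)
  have "ennreal (sqmean f r) \<le> H2_disc_means f"
    unfolding H2_disc_means_eq[OF h(1)] by (rule SUP_upper) (use assms in auto)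
  from enn2real_mono[OF this] have "sqmean f r \<le> enn2real (H2_disc_means f)"
    using h(2) sqmean_nonneg by simp
  then show ?thesis by (simp add: H2_disc_norm_def)
qed

lemma H2_disc_norm_le:
  assumes "f holomorphic_on ball 0 1" "0 \<le> K" "\<And>r. 0 < r \<Longrightarrow> r < 1 \<Longrightarrow> sqmean f r \<le> K\<^sup>2"
  shows "f \<in> H2_disc" "H2_disc_norm f \<le> K"
proof -
  have le: "H2_disc_means f \<le> ennreal (K\<^sup>2)"
    unfolding H2_disc_means_eq[OF assms(1)] by (rule SUP_least) (use assms(3) in \<open>auto intro!: ennreal_leI\<close>)
  then show "f \<in> H2_disc" using assms(1) by (auto simp: H2_disc_def less_top[symmetric] top_unique)
  have "enn2real (H2_disc_means f) \<le> K\<^sup>2" using le by (rule enn2real_leI[rotated]) simp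
  then have "H2_disc_norm f \<le> sqrt (K\<^sup>2)" unfolding H2_disc_norm_def by (rule real_sqrt_le_mono)
  then show "H2_disc_norm f \<le> K" using assms(2) by simp
qed

section \<open>Cauchy-Schwarz and Poisson averaging\<close>

lemma angle_Cauchy_Schwarz:
  fixes a b :: "real \<Rightarrow> real"
  assumes "continuous_on UNIV a" "continuous_on UNIV b"
  shows "(\<integral>t. a t * b t \<partial>angle)\<^sup>2 \<le> (\<integral>t. (a t)\<^sup>2 \<partial>angle) * (\<integral>t. (b t)\<^sup>2 \<partial>angle)"
proof -
  define A B C where "A = (\<integral>t. (a t)\<^sup>2 \<partial>angle)" and "B = (\<integral>t. (b t)\<^sup>2 \<partial>angle)" and "C = (\<integral>t. a t * b t \<partial>angle)"
  have i: "integrable angle (\<lambda>t. (a t)\<^sup>2)" "integrable angle (\<lambda>t. (b t)\<^sup>2)" "integrable angle (\<lambda>t. a t * b t)"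
    using assms by (intro integrable_angle_continuous continuous_intros; simp)+
  have quad: "0 \<le> A - 2 * s * C + s\<^sup>2 * B" for s
  proof -
    have "0 \<le> (\<integral>t. (a t - s * b t)\<^sup>2 \<partial>angle)" by (rule integral_nonneg_AE) auto
    also have "(\<lambda>t. (a t - s * b t)\<^sup>2) = (\<lambda>t. (a t)\<^sup>2 - (2 * s) * (a t * b t) + s\<^sup>2 * (b t)\<^sup>2)"
      by (rule ext) (simp add: power2_eq_square algebra_simps)
    also have "(\<integral>t. (a t)\<^sup>2 - (2 * s) * (a t * b t) + s\<^sup>2 * (b t)\<^sup>2 \<partial>angle) = A - 2 * s * C + s\<^sup>2 * B"
      using i by (simp add: A_def B_def C_def)
    finally show ?thesis .
  qed
  have B: "0 \<le> B" unfolding B_def by (rule integral_nonneg_AE) auto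
  show ?thesis
  proof (cases "B = 0")
    case True
    have "C = 0"
    proof (rule ccontr)
      assume "C \<noteq> 0"
      then show False using quad[of "(A + 1) / (2 * C)"] True by simp
    qed
    then show ?thesis using True by (simp add: A_def B_def C_def)
  next
    case False
    then have "B > 0" using B by simp
    then have "0 \<le> A - C\<^sup>2 / B"
      using quad[of "C / B"] by (simp add: power2_eq_square field_simps)
    then have "C\<^sup>2 \<le> A * B" using \<open>B > 0\<close> by (simp add: field_simps)
    then show ?thesis by (simp add: A_def B_def C_def)
  qed
qed

lemma poisson_Cauchy_Schwarz:
  fixes x y :: "real \<Rightarrow> complex"
  assumes "continuous_on UNIV x" "continuous_on UNIV y" and z: "norm z < 1"
  shows "(norm (\<integral>t. x t * y t * of_real (poisson z t) \<partial>angle))\<^sup>2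
    \<le> (\<integral>t. (norm (x t))\<^sup>2 * poisson z t \<partial>angle) * (\<integral>t. (norm (y t))\<^sup>2 * poisson z t \<partial>angle)"
proof -
  note P = poisson_nonneg[OF z]
  have c: "continuous_on UNIV (\<lambda>t. norm (x t) * sqrt (poisson z t))" "continuous_on UNIV (\<lambda>t. norm (y t) * sqrt (poisson z t))"
    by (intro continuous_intros assms continuous_poisson)+
  have "norm (\<integral>t. x t * y t * of_real (poisson z t) \<partial>angle) \<le> (\<integral>t. norm (x t * y t * of_real (poisson z t)) \<partial>angle)"
    by (rule integral_norm_bound)
  also have "\<dots> = (\<integral>t. (norm (x t) * sqrt (poisson z t)) * (norm (y t) * sqrt (poisson z t)) \<partial>angle)"
    by (intro Bochner_Integration.integral_cong) (use P in \<open>simp_all add: norm_mult\<close>)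
  finally have "(norm (\<integral>t. x t * y t * of_real (poisson z t) \<partial>angle))\<^sup>2
     \<le> (\<integral>t. (norm (x t) * sqrt (poisson z t)) * (norm (y t) * sqrt (poisson z t)) \<partial>angle)\<^sup>2"
    by (intro power_mono) auto
  also have "\<dots> \<le> (\<integral>t. (norm (x t) * sqrt (poisson z t))\<^sup>2 \<partial>angle) * (\<integral>t. (norm (y t) * sqrt (poisson z t))\<^sup>2 \<partial>angle)"
    by (rule angle_Cauchy_Schwarz[OF c])
  finally show ?thesis using P by (simp add: power_mult_distrib)
qed

lemma poisson_measurable [measurable]: "(\<lambda>(\<theta>, t). poisson (of_real \<rho> * cis \<theta>) t) \<in> borel_measurable (borel \<Otimes>\<^sub>M borel)"
  unfolding poisson_def by measurable

lemma nn_integral_poisson: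
  assumes "norm z < 1" shows "(\<integral>\<^sup>+t. ennreal (poisson z t) \<partial>angle) = 1"
  using nn_integral_eq_integral[OF integrable_angle_continuous[OF continuous_poisson[OF assms]]]
  by (simp add: poisson_integral[OF assms] poisson_nonneg[OF assms])

text \<open>For points on a circle about 0 the Poisson kernel is symmetric in the two angles. After
  Fubini the inner integral over \<open>\<theta>\<close> is therefore again the total mass 1 of a
  Poisson kernel.\<close>

lemma poisson_averaging:
  assumes [measurable]: "q \<in> borel_measurable borel" and q: "\<And>t. 0 \<le> q t" and \<rho>: "0 \<le> \<rho>" "\<rho> < 1"
  shows "(\<integral>\<^sup>+\<theta>. \<integral>\<^sup>+t. ennreal (q t * poisson (of_real \<rho> * cis \<theta>) t) \<partial>angle \<partial>angle) = (\<integral>\<^sup>+t. ennreal (q t) \<partial>angle)"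
proof -
  have nz: "norm (of_real \<rho> * cis \<theta>) < 1" for \<theta> using \<rho> by (simp add: norm_mult)
  interpret pair_sigma_finite angle angle by (intro pair_sigma_finite.intro) unfold_locales
  have m: "(\<lambda>(\<theta>, t). ennreal (q t * poisson (of_real \<rho> * cis \<theta>) t)) \<in> borel_measurable (angle \<Otimes>\<^sub>M angle)"
    by measurable
  have "(\<integral>\<^sup>+\<theta>. \<integral>\<^sup>+t. ennreal (q t * poisson (of_real \<rho> * cis \<theta>) t) \<partial>angle \<partial>angle)
     = (\<integral>\<^sup>+t. \<integral>\<^sup>+\<theta>. ennreal (q t * poisson (of_real \<rho> * cis \<theta>) t) \<partial>angle \<partial>angle)"
    using Fubini'[OF m] by simp
  also have "\<dots> = (\<integral>\<^sup>+t. ennreal (q t) * (\<integral>\<^sup>+\<theta>. ennreal (poisson (of_real \<rho> * cis t) \<theta>) \<partial>angle) \<partial>angle)"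
  proof (rule nn_integral_cong)
    fix t
    have "(\<integral>\<^sup>+\<theta>. ennreal (q t * poisson (of_real \<rho> * cis \<theta>) t) \<partial>angle) = (\<integral>\<^sup>+\<theta>. ennreal (q t) * ennreal (poisson (of_real \<rho> * cis t) \<theta>) \<partial>angle)"
      by (intro nn_integral_cong) (subst poisson_sym, simp add: ennreal_mult q poisson_nonneg[OF nz])
    also have "\<dots> = ennreal (q t) * (\<integral>\<^sup>+\<theta>. ennreal (poisson (of_real \<rho> * cis t) \<theta>) \<partial>angle)"
      by (rule nn_integral_cmult) (use borel_measurable_continuous_onI[OF continuous_poisson[OF nz]] in simp)
    finally show "(\<integral>\<^sup>+\<theta>. ennreal (q t * poisson (of_real \<rho> * cis \<theta>) t) \<partial>angle) = ennreal (q t) * (\<integral>\<^sup>+\<theta>. ennreal (poisson (of_real \<rho> * cis t) \<theta>) \<partial>angle)" .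
  qed
  also have "\<dots> = (\<integral>\<^sup>+t. ennreal (q t) \<partial>angle)" by (simp add: nn_integral_poisson[OF nz])
  finally show ?thesis .
qed

text \<open>With rho = s/r, the value f(s cis theta) is a Poisson average of f over the circle of
  radius \<open>r\<close>. Cauchy-Schwarz moves the square inside the average, and averaging over
  theta removes the kernel.\<close>

lemma sqmean_mono:
  assumes f: "f holomorphic_on ball 0 1" and rs: "0 < s" "s < r" "r < 1"
  shows "sqmean f s \<le> sqmean f r"
proof -
  define \<rho> where "\<rho> = s / r"
  have \<rho>: "0 \<le> \<rho>" "\<rho> < 1" using rs by (auto simp: \<rho>_def)
  have c: "continuous_on UNIV (\<lambda>t. f (of_real r * cis t))" by (rule holomorphic_continuous_cis[OF f]) (use rs in auto)
  have c2: "continuous_on UNIV (\<lambda>t. (norm (f (of_real r * cis t)))\<^sup>2)" by (intro continuous_on_power continuous_on_norm c)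
  have nz: "norm (of_real \<rho> * cis \<theta>) < 1" for \<theta> using \<rho> by (simp add: norm_mult)
  have hol: "(\<lambda>z. f (of_real r * z)) holomorphic_on ball 0 (1/r)"
    by (intro holomorphic_on_compose_gen[OF _ f, unfolded o_def] holomorphic_intros)
       (use rs in \<open>auto simp: norm_mult field_simps\<close>)
  have pt: "ennreal ((norm (f (of_real s * cis \<theta>)))\<^sup>2) \<le> (\<integral>\<^sup>+t. ennreal ((norm (f (of_real r * cis t)))\<^sup>2 * poisson (of_real \<rho> * cis \<theta>) t) \<partial>angle)" for \<theta>
  proof -
    have e: "of_real r * (of_real \<rho> * cis \<theta>) = of_real s * cis \<theta>" using rs by (simp add: \<rho>_def)
    have "f (of_real s * cis \<theta>) = (\<integral>t. f (of_real r * cis t) * of_real (poisson (of_real \<rho> * cis \<theta>) t) \<partial>angle)"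
    proof -
      have "1 < 1 / r" using rs by simp
      from poisson_holomorphic[OF hol this nz[of \<theta>], unfolded e] show ?thesis by simp
    qed
    then have "(norm (f (of_real s * cis \<theta>)))\<^sup>2 \<le> (\<integral>t. (norm (1::complex))\<^sup>2 * poisson (of_real \<rho> * cis \<theta>) t \<partial>angle) * (\<integral>t. (norm (f (of_real r * cis t)))\<^sup>2 * poisson (of_real \<rho> * cis \<theta>) t \<partial>angle)"
      using poisson_Cauchy_Schwarz[OF continuous_on_const c nz, of 1 \<theta>] by simp
    also have "\<dots> = (\<integral>t. (norm (f (of_real r * cis t)))\<^sup>2 * poisson (of_real \<rho> * cis \<theta>) t \<partial>angle)"
      by (simp add: poisson_integral[OF nz])
    finally have "ennreal ((norm (f (of_real s * cis \<theta>)))\<^sup>2) \<le> ennreal (\<integral>t. (norm (f (of_real r * cis t)))\<^sup>2 * poisson (of_real \<rho> * cis \<theta>) t \<partial>angle)"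
      by (rule ennreal_leI)
    also have "\<dots> = (\<integral>\<^sup>+t. ennreal ((norm (f (of_real r * cis t)))\<^sup>2 * poisson (of_real \<rho> * cis \<theta>) t) \<partial>angle)"
      by (rule nn_integral_eq_integral[symmetric])
         (auto intro!: integrable_angle_continuous continuous_on_mult c2 continuous_poisson[OF nz] mult_nonneg_nonneg poisson_nonneg[OF nz])
    finally show ?thesis .
  qed
  have "ennreal (sqmean f s) = (\<integral>\<^sup>+\<theta>. ennreal ((norm (f (of_real s * cis \<theta>)))\<^sup>2) \<partial>angle)"
    using nn_integral_sqmean[OF f] rs by simp
  also have "\<dots> \<le> (\<integral>\<^sup>+\<theta>. \<integral>\<^sup>+t. ennreal ((norm (f (of_real r * cis t)))\<^sup>2 * poisson (of_real \<rho> * cis \<theta>) t) \<partial>angle \<partial>angle)"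
    by (rule nn_integral_mono) (rule pt)
  also have "\<dots> = (\<integral>\<^sup>+t. ennreal ((norm (f (of_real r * cis t)))\<^sup>2) \<partial>angle)"
    by (rule poisson_averaging[OF borel_measurable_continuous_onI[OF c2] _ \<rho>]) simp
  also have "\<dots> = ennreal (sqmean f r)" using nn_integral_sqmean[OF f] rs by simp
  finally show ?thesis using sqmean_nonneg by (simp add: ennreal_le_iff)
qed

lemma mono_bounded_at_left:
  fixes g :: "real \<Rightarrow> real"
  assumes mono: "\<And>s r. 0 < s \<Longrightarrow> s < r \<Longrightarrow> r < 1 \<Longrightarrow> g s \<le> g r" and bd: "\<And>r. 0 < r \<Longrightarrow> r < 1 \<Longrightarrow> g r \<le> K"
  shows "\<exists>l. (g \<longlongrightarrow> l) (at_left 1)"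
proof -
  define l where "l = (SUP r\<in>{0<..<1}. g r)"
  have bdd: "bdd_above (g ` {0<..<1})" using bd by (intro bdd_aboveI[of _ K]) auto
  have ev: "\<forall>\<^sub>F r in at_left (1::real). s < r \<and> r < 1" if "s < 1" for s
    using that by (auto simp: eventually_at_left_field)
  have "(g \<longlongrightarrow> l) (at_left 1)"
  proof (rule increasing_tendsto)
    show "\<forall>\<^sub>F r in at_left 1. g r \<le> l"
      using ev[OF zero_less_one] by eventually_elim (auto simp: l_def intro!: cSUP_upper bdd)
    fix x assume "x < l"
    then obtain s where s: "s \<in> {0<..<1}" "x < g s"
      unfolding l_def by (subst (asm) less_cSUP_iff) (auto simp: bdd intro: exI[of _ "1/2"])
    then have "s < 1" by simp
    from ev[OF this] show "\<forall>\<^sub>F r in at_left 1. x < g r"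
      by eventually_elim (use s mono in \<open>force intro: less_le_trans\<close>)
  qed
  then show ?thesis by blast
qed

lemma polarization:
  "4 * (f * cnj h) = of_real ((norm (f + h))\<^sup>2) - of_real ((norm (f - h))\<^sup>2)
     + \<i> * of_real ((norm (f + \<i> * h))\<^sup>2) - \<i> * of_real ((norm (f - \<i> * h))\<^sup>2)"
  unfolding complex_norm_square by (simp add: algebra_simps)

text \<open>Polarization expresses the mean of f conj(h) by four mean squares, each increasing and
  bounded in r. Existence has to be settled because \<open>H2_disc_inner\<close> is defined through
  \<open>Lim\<close>, which carries information only under convergence.\<close>

lemma H2_limit_exists:
  assumes f: "f holomorphic_on ball 0 1" "\<And>r. 0 < r \<Longrightarrow> r < 1 \<Longrightarrow> sqmean f r \<le> K"
    and h: "h holomorphic_on ball 0 1" "\<And>r. 0 < r \<Longrightarrow> r < 1 \<Longrightarrow> sqmean h r \<le> K'"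
  shows "\<exists>l. ((\<lambda>r. \<integral>t. f (of_real r * cis t) * cnj (h (of_real r * cis t)) \<partial>angle) \<longlongrightarrow> l) (at_left 1)"
proof -
  have ex: "\<exists>l. ((\<lambda>r. sqmean (\<lambda>z. f z + c * h z) r) \<longlongrightarrow> l) (at_left 1)" if c: "norm c = 1" for c
  proof (rule mono_bounded_at_left)
    have hol: "(\<lambda>z. f z + c * h z) holomorphic_on ball 0 1" using f h by (intro holomorphic_intros)
    then show "sqmean (\<lambda>z. f z + c * h z) s \<le> sqmean (\<lambda>z. f z + c * h z) r" if "0 < s" "s < r" "r < 1" for s r
      using that by (rule sqmean_mono)
    fix r :: real assume r: "0 < r" "r < 1"
    have "sqmean (\<lambda>z. f z + c * h z) r \<le> (\<integral>t. 2 * (norm (f (of_real r * cis t)))\<^sup>2 + 2 * (norm (h (of_real r * cis t)))\<^sup>2 \<partial>angle)"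
      unfolding sqmean_def
    proof (rule integral_mono)
      show "integrable angle (\<lambda>t. (norm (f (of_real r * cis t) + c * h (of_real r * cis t)))\<^sup>2)"
        by (rule integrable_sqmean[OF hol r])
      show "integrable angle (\<lambda>t. 2 * (norm (f (of_real r * cis t)))\<^sup>2 + 2 * (norm (h (of_real r * cis t)))\<^sup>2)"
        by (intro Bochner_Integration.integrable_add integrable_mult_right integrable_sqmean f h r)
      fix t
      let ?z = "of_real r * cis t"
      have "norm (f ?z + c * h ?z) \<le> norm (f ?z) + norm (h ?z)"
        using norm_triangle_ineq[of "f ?z" "c * h ?z"] c by (simp add: norm_mult)
      then have "(norm (f ?z + c * h ?z))\<^sup>2 \<le> (norm (f ?z) + norm (h ?z))\<^sup>2" by (intro power_mono) auto
      also have "\<dots> \<le> 2 * (norm (f ?z))\<^sup>2 + 2 * (norm (h ?z))\<^sup>2"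
        using sum_squares_bound[of "norm (f ?z)" "norm (h ?z)"] by (simp add: power2_sum)
      finally show "(norm (f ?z + c * h ?z))\<^sup>2 \<le> 2 * (norm (f ?z))\<^sup>2 + 2 * (norm (h ?z))\<^sup>2" .
    qed
    also have "\<dots> = 2 * sqmean f r + 2 * sqmean h r"
      using integrable_sqmean[OF f(1) r] integrable_sqmean[OF h(1) r] by (simp add: sqmean_def)
    also have "\<dots> \<le> 2 * K + 2 * K'" using f(2)[OF r] h(2)[OF r] by simp
    finally show "sqmean (\<lambda>z. f z + c * h z) r \<le> 2 * K + 2 * K'" .
  qed
  from ex[of 1] ex[of "-1"] ex[of \<i>] ex[of "-\<i>"] obtain l1 l2 l3 l4 where
    l: "((\<lambda>r. sqmean (\<lambda>z. f z + h z) r) \<longlongrightarrow> l1) (at_left 1)" "((\<lambda>r. sqmean (\<lambda>z. f z - h z) r) \<longlongrightarrow> l2) (at_left 1)"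
     "((\<lambda>r. sqmean (\<lambda>z. f z + \<i> * h z) r) \<longlongrightarrow> l3) (at_left 1)" "((\<lambda>r. sqmean (\<lambda>z. f z - \<i> * h z) r) \<longlongrightarrow> l4) (at_left 1)"
    by auto
  have L: "((\<lambda>r. (of_real (sqmean (\<lambda>z. f z + h z) r) - of_real (sqmean (\<lambda>z. f z - h z) r)
      + \<i> * of_real (sqmean (\<lambda>z. f z + \<i> * h z) r) - \<i> * of_real (sqmean (\<lambda>z. f z - \<i> * h z) r)) / 4)
     \<longlongrightarrow> (of_real l1 - of_real l2 + \<i> * of_real l3 - \<i> * of_real l4) / 4) (at_left 1)"
    by (intro tendsto_intros l) auto
  have E: "\<forall>\<^sub>F r in at_left 1. (of_real (sqmean (\<lambda>z. f z + h z) r) - of_real (sqmean (\<lambda>z. f z - h z) r)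
      + \<i> * of_real (sqmean (\<lambda>z. f z + \<i> * h z) r) - \<i> * of_real (sqmean (\<lambda>z. f z - \<i> * h z) r)) / 4
      = (\<integral>t. f (of_real r * cis t) * cnj (h (of_real r * cis t)) \<partial>angle)"
  proof -
    have "\<forall>\<^sub>F r in at_left (1::real). 0 < r \<and> r < 1" by (auto simp: eventually_at_left_field intro: exI[of _ 0])
    then show ?thesis
    proof eventually_elim
      case (elim r)
      have hol: "(\<lambda>z. f z + h z) holomorphic_on ball 0 1" "(\<lambda>z. f z - h z) holomorphic_on ball 0 1"
        "(\<lambda>z. f z + \<i> * h z) holomorphic_on ball 0 1" "(\<lambda>z. f z - \<i> * h z) holomorphic_on ball 0 1"
        using f h by (auto intro!: holomorphic_intros)
      note i = hol[THEN integrable_sqmean, of r, OF conjunct1[OF elim] conjunct2[OF elim]]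
      note i' = i[THEN integrable_of_real[where 'a=complex]]
      have "4 * (\<integral>t. f (of_real r * cis t) * cnj (h (of_real r * cis t)) \<partial>angle)
        = (\<integral>t. 4 * (f (of_real r * cis t) * cnj (h (of_real r * cis t))) \<partial>angle)" by simp
      also have "\<dots> = of_real (sqmean (\<lambda>z. f z + h z) r) - of_real (sqmean (\<lambda>z. f z - h z) r)
      + \<i> * of_real (sqmean (\<lambda>z. f z + \<i> * h z) r) - \<i> * of_real (sqmean (\<lambda>z. f z - \<i> * h z) r)"
        unfolding polarization sqmean_def using i'
        by (simp only: Bochner_Integration.integral_add Bochner_Integration.integral_diff Bochner_Integration.integrable_add
             Bochner_Integration.integrable_diff integrable_mult_right integral_mult_right_zero integral_complex_of_real)
      finally have four: "4 * (\<integral>t. f (of_real r * cis t) * cnj (h (of_real r * cis t)) \<partial>angle) = of_real (sqmean (\<lambda>z. f z + h z) r) - of_real (sqmean (\<lambda>z. f z - h z) r)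
      + \<i> * of_real (sqmean (\<lambda>z. f z + \<i> * h z) r) - \<i> * of_real (sqmean (\<lambda>z. f z - \<i> * h z) r)" .
      show ?case unfolding four[symmetric] by simp
    qed
  qed
  show ?thesis by (rule exI, rule Lim_transform_eventually[OF L E])
qed

section \<open>Orthogonality through Fourier coefficients\<close>

lemma norm_le_one_plus_square: "x \<le> 1 + x\<^sup>2" for x :: real
proof -
  have "0 \<le> (x - 1/2)\<^sup>2 + 3/4" by simp
  then show ?thesis by (simp add: power2_eq_square algebra_simps)
qed

lemma eventually_at_left_1: "\<forall>\<^sub>F r in at_left (1::real). 0 < r \<and> r < 1"
  by (auto simp: eventually_at_left_field intro: exI[of _ 0])

lemma model_space_orthogonal:
  assumes \<Theta>: "\<Theta> holomorphic_on ball 0 1" "\<And>z. norm z < 1 \<Longrightarrow> norm (\<Theta> z) < 1" and f: "f \<in> model_space \<Theta>"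
  shows "((\<lambda>r. \<integral>t. f (of_real r * cis t) * cnj (\<Theta> (of_real r * cis t)) * cnj (cis t) ^ n \<partial>angle) \<longlongrightarrow> 0) (at_left 1)"
proof -
  have fh: "f holomorphic_on ball 0 1" and fH: "f \<in> H2_disc"
    using f by (auto simp: model_space_def H2_disc_def)
  \<comment> \<open>The test function z^n is cut off outside the disc: the integrand then vanishes
    where f and Theta are arbitrary, so it is Borel on the plane and its integral can be pulled back
    to the angle.\<close>
  define g :: "complex \<Rightarrow> complex" where "g = (\<lambda>z. indicator (ball 0 1) z * z ^ n)"
  have gh: "g holomorphic_on ball 0 1"
    by (rule holomorphic_transform[of "\<lambda>z. z ^ n"]) (auto simp: g_def intro!: holomorphic_intros)
  have prob: "sqmean k r \<le> 1" if "0 < r" "r < 1" "k holomorphic_on ball 0 1" "\<And>z. norm z < 1 \<Longrightarrow> norm (k z) \<le> 1" for k r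
  proof -
    have "sqmean k r \<le> (\<integral>t. 1 \<partial>angle)" unfolding sqmean_def
      by (rule integral_mono[OF integrable_sqmean[OF that(3,1,2)]]) (use that in \<open>auto simp: norm_mult abs_square_le_1\<close>)
    then show ?thesis using angle.prob_space by simp
  qed
  have gH: "g \<in> H2_disc"
  proof (rule H2_disc_norm_le(1)[OF gh, of 1])
    have gb: "norm (g z) \<le> 1" if "norm z < 1" for z using that by (simp add: g_def norm_power power_le_one)
    fix r :: real assume r: "0 < r" "r < 1"
    show "sqmean g r \<le> 1\<^sup>2" using prob[OF r gh gb] by simp
  qed simp
  let ?h = "\<lambda>z. \<Theta> z * z ^ n"
  have hh: "?h holomorphic_on ball 0 1" using \<Theta> by (intro holomorphic_intros)
  have hb: "norm (\<Theta> z * z ^ n) \<le> 1" if "norm z < 1" for z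
    using \<Theta>(2)[OF that] that by (auto simp: norm_mult norm_power intro!: mult_le_one power_le_one)
  have hb': "sqmean ?h r \<le> 1" if "0 < r" "r < 1" for r by (rule prob[OF that hh hb])
  obtain l where l: "((\<lambda>r. \<integral>t. f (of_real r * cis t) * cnj (?h (of_real r * cis t)) \<partial>angle) \<longlongrightarrow> l) (at_left 1)"
    using H2_limit_exists[OF fh sqmean_le_H2_norm[OF fH] hh hb'] by blast
  have ev: "\<forall>\<^sub>F r in at_left 1. (\<integral>t. f (of_real r * cis t) * cnj (?h (of_real r * cis t)) \<partial>angle)
      = (\<integral>\<zeta>. f (r *\<^sub>R \<zeta>) * cnj (\<Theta> (r *\<^sub>R \<zeta>) * g (r *\<^sub>R \<zeta>)) \<partial>circle_measure)"
    using eventually_at_left_1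
  proof eventually_elim
    case (elim r)
    have eq: "f (r *\<^sub>R \<zeta>) * cnj (\<Theta> (r *\<^sub>R \<zeta>) * g (r *\<^sub>R \<zeta>)) = indicator (ball 0 (1/r)) \<zeta> *\<^sub>R (f (r *\<^sub>R \<zeta>) * cnj (?h (r *\<^sub>R \<zeta>)))" for \<zeta>
      using elim by (auto simp: g_def indicator_def field_simps)
    have c: "continuous_on (ball 0 (1/r)) (\<lambda>\<zeta>. f (r *\<^sub>R \<zeta>) * cnj (?h (r *\<^sub>R \<zeta>)))"
      by (intro continuous_intros continuous_on_compose2[OF holomorphic_on_imp_continuous_on[OF fh]] continuous_on_compose2[OF holomorphic_on_imp_continuous_on[OF \<Theta>(1)]])
         (use elim in \<open>auto simp: field_simps\<close>)
    have m: "(\<lambda>\<zeta>. f (r *\<^sub>R \<zeta>) * cnj (\<Theta> (r *\<^sub>R \<zeta>) * g (r *\<^sub>R \<zeta>))) \<in> borel_measurable borel"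
      unfolding eq by (rule borel_measurable_continuous_on_indicator[OF _ c]) simp
    have "(\<integral>\<zeta>. f (r *\<^sub>R \<zeta>) * cnj (\<Theta> (r *\<^sub>R \<zeta>) * g (r *\<^sub>R \<zeta>)) \<partial>circle_measure)
      = (\<integral>t. f (r *\<^sub>R cis t) * cnj (\<Theta> (r *\<^sub>R cis t) * g (r *\<^sub>R cis t)) \<partial>angle)"
      unfolding circle_measure_def by (subst integral_distr) (use m in auto)
    also have "\<dots> = (\<integral>t. f (of_real r * cis t) * cnj (?h (of_real r * cis t)) \<partial>angle)"
      by (rule Bochner_Integration.integral_cong[OF refl]) (use elim in \<open>simp add: g_def scaleR_conv_of_real norm_mult\<close>)
    finally show ?case ..
  qed
  have "H2_disc_inner f (\<lambda>z. \<Theta> z * g z) = l"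
    unfolding H2_disc_inner_def by (rule tendsto_Lim[OF _ Lim_transform_eventually[OF l ev]]) simp
  moreover have "H2_disc_inner f (\<lambda>z. \<Theta> z * g z) = 0" using f gH by (auto simp: model_space_def)
  ultimately have l0: "((\<lambda>r. \<integral>t. f (of_real r * cis t) * cnj (?h (of_real r * cis t)) \<partial>angle) \<longlongrightarrow> 0) (at_left 1)" using l by simp
  have L: "((\<lambda>r. (\<integral>t. f (of_real r * cis t) * cnj (?h (of_real r * cis t)) \<partial>angle) / of_real r ^ n) \<longlongrightarrow> 0 / of_real 1 ^ n) (at_left 1)"
    by (intro tendsto_intros l0) auto
  have E: "\<forall>\<^sub>F r in at_left 1. (\<integral>t. f (of_real r * cis t) * cnj (?h (of_real r * cis t)) \<partial>angle) / of_real r ^ n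
     = (\<integral>t. f (of_real r * cis t) * cnj (\<Theta> (of_real r * cis t)) * cnj (cis t) ^ n \<partial>angle)"
    using eventually_at_left_1
  proof eventually_elim
    case (elim r)
    have "(\<integral>t. f (of_real r * cis t) * cnj (?h (of_real r * cis t)) \<partial>angle)
       = (\<integral>t. (f (of_real r * cis t) * cnj (\<Theta> (of_real r * cis t)) * cnj (cis t) ^ n) * of_real r ^ n \<partial>angle)"
      by (rule Bochner_Integration.integral_cong[OF refl]) (simp add: power_mult_distrib mult_ac)
    then show ?case using elim by simp
  qed
  show ?thesis using Lim_transform_eventually[OF L E] by simp
qed

text \<open>Unlike \<open>model_space\<close>, this superspace is visibly closed under differences: membership in \<open>model_space\<close>
  involves integrals over the whole plane of functions that may be non-measurable outside the disc.\<close>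

definition fourier_model_space :: "(complex \<Rightarrow> complex) \<Rightarrow> (complex \<Rightarrow> complex) set" where
  "fourier_model_space \<Theta> = {f \<in> H2_disc. \<forall>n.
     ((\<lambda>r. \<integral>t. f (of_real r * cis t) * cnj (\<Theta> (of_real r * cis t)) * cnj (cis t) ^ n \<partial>angle) \<longlongrightarrow> 0) (at_left 1)}"

lemma model_space_subset_fourier:
  assumes "\<Theta> holomorphic_on ball 0 1" "\<And>z. norm z < 1 \<Longrightarrow> norm (\<Theta> z) < 1"
  shows "model_space \<Theta> \<subseteq> fourier_model_space \<Theta>"
  using model_space_orthogonal[OF assms] by (auto simp: fourier_model_space_def model_space_def)

lemma fourier_model_space_diff:
  assumes \<Theta>: "\<Theta> holomorphic_on ball 0 1" and f: "f \<in> fourier_model_space \<Theta>" and g: "g \<in> fourier_model_space \<Theta>"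
    and le: "H2_disc_norm f \<le> B" "H2_disc_norm g \<le> B" "0 \<le> B"
  shows "(\<lambda>z. f z - g z) \<in> fourier_model_space \<Theta>" "H2_disc_norm (\<lambda>z. f z - g z) \<le> 2 * B"
proof -
  have H: "f \<in> H2_disc" "g \<in> H2_disc" using f g by (auto simp: fourier_model_space_def)
  then have h: "f holomorphic_on ball 0 1" "g holomorphic_on ball 0 1" by (auto simp: H2_disc_def)
  have hd: "(\<lambda>z. f z - g z) holomorphic_on ball 0 1" by (intro holomorphic_intros h)
  have sq: "sqmean (\<lambda>z. f z - g z) r \<le> (2 * B)\<^sup>2" if r: "0 < r" "r < 1" for r
  proof -
    have "sqmean (\<lambda>z. f z - g z) r \<le> (\<integral>t. 2 * (norm (f (of_real r * cis t)))\<^sup>2 + 2 * (norm (g (of_real r * cis t)))\<^sup>2 \<partial>angle)"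
      unfolding sqmean_def
    proof (rule integral_mono[OF integrable_sqmean[OF hd r]])
      show "integrable angle (\<lambda>t. 2 * (norm (f (of_real r * cis t)))\<^sup>2 + 2 * (norm (g (of_real r * cis t)))\<^sup>2)"
        using integrable_sqmean[OF h(1) r] integrable_sqmean[OF h(2) r] by simp
      fix t
      have "(norm (x - y))\<^sup>2 \<le> 2 * (norm x)\<^sup>2 + 2 * (norm y)\<^sup>2" for x y :: complex
      proof -
        have "(norm (x - y))\<^sup>2 \<le> (norm x + norm y)\<^sup>2" by (intro power_mono norm_triangle_ineq4) auto
        also have "\<dots> \<le> 2 * (norm x)\<^sup>2 + 2 * (norm y)\<^sup>2"
          using zero_le_power2[of "norm x - norm y"] by (simp add: power2_eq_square algebra_simps)
        finally show ?thesis .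
      qed
      then show "(norm (f (of_real r * cis t) - g (of_real r * cis t)))\<^sup>2 \<le> 2 * (norm (f (of_real r * cis t)))\<^sup>2 + 2 * (norm (g (of_real r * cis t)))\<^sup>2" .
    qed
    also have "\<dots> = 2 * sqmean f r + 2 * sqmean g r"
      using integrable_sqmean[OF h(1) r] integrable_sqmean[OF h(2) r] by (simp add: sqmean_def)
    also have "\<dots> \<le> 2 * B\<^sup>2 + 2 * B\<^sup>2"
    proof -
      have "sqmean f r \<le> B\<^sup>2" using sqmean_le_H2_norm[OF H(1) r] power_mono[OF le(1), of 2] by (simp add: H2_disc_norm_def)
      moreover have "sqmean g r \<le> B\<^sup>2" using sqmean_le_H2_norm[OF H(2) r] power_mono[OF le(2), of 2] by (simp add: H2_disc_norm_def)
      ultimately show ?thesis by simp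
    qed
    finally show ?thesis by (simp add: power2_eq_square)
  qed
  show "H2_disc_norm (\<lambda>z. f z - g z) \<le> 2 * B" by (rule H2_disc_norm_le(2)[OF hd _ sq]) (use le in auto)
  have m: "(\<lambda>z. f z - g z) \<in> H2_disc" by (rule H2_disc_norm_le(1)[OF hd _ sq]) (use le in auto)
  have "((\<lambda>r. \<integral>t. (f (of_real r * cis t) - g (of_real r * cis t)) * cnj (\<Theta> (of_real r * cis t)) * cnj (cis t) ^ n \<partial>angle) \<longlongrightarrow> 0) (at_left 1)" for n
  proof (rule Lim_transform_eventually)
    let ?I = "\<lambda>f r. \<integral>t. f (of_real r * cis t) * cnj (\<Theta> (of_real r * cis t)) * cnj (cis t) ^ n \<partial>angle"
    have "((\<lambda>r. ?I f r - ?I g r) \<longlongrightarrow> 0 - 0) (at_left 1)"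
      by (intro tendsto_diff) (use f g in \<open>auto simp: fourier_model_space_def\<close>)
    then show "((\<lambda>r. ?I f r - ?I g r) \<longlongrightarrow> 0) (at_left 1)" by simp
    show "\<forall>\<^sub>F r in at_left 1. ?I f r - ?I g r = ?I (\<lambda>z. f z - g z) r"
      using eventually_at_left_1
    proof eventually_elim
      case (elim r)
      have c: "continuous_on UNIV (\<lambda>t. k (of_real r * cis t))" if "k holomorphic_on ball 0 1" for k
        by (rule holomorphic_continuous_cis[OF that]) (use elim in auto)
      have "?I f r - ?I g r = (\<integral>t. f (of_real r * cis t) * cnj (\<Theta> (of_real r * cis t)) * cnj (cis t) ^ n
          - g (of_real r * cis t) * cnj (\<Theta> (of_real r * cis t)) * cnj (cis t) ^ n \<partial>angle)"
        by (intro Bochner_Integration.integral_diff[symmetric] integrable_angle_continuous continuous_intros c h \<Theta>)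
      then show ?case by (simp add: left_diff_distrib)
    qed
  qed
  then show "(\<lambda>z. f z - g z) \<in> fourier_model_space \<Theta>" using m by (simp add: fourier_model_space_def)
qed

text \<open>Polarization applied to f z^n and Theta. The limits for positive n are the conjugates of
  the Taylor coefficients of the conjugate partner G.\<close>

lemma fourier_limit_exists:
  assumes \<Theta>: "\<Theta> holomorphic_on ball 0 1" "\<And>z. norm z < 1 \<Longrightarrow> norm (\<Theta> z) < 1"
    and f: "f holomorphic_on ball 0 1" "\<And>r. 0 < r \<Longrightarrow> r < 1 \<Longrightarrow> sqmean f r \<le> K"
  shows "\<exists>l. ((\<lambda>r. \<integral>t. f (of_real r * cis t) * cnj (\<Theta> (of_real r * cis t)) * cis t ^ n \<partial>angle) \<longlongrightarrow> l) (at_left 1)"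
proof -
  let ?h = "\<lambda>z. f z * z ^ n"
  have hh: "?h holomorphic_on ball 0 1" using f by (intro holomorphic_intros)
  have hb: "sqmean ?h r \<le> K" if r: "0 < r" "r < 1" for r
  proof -
    have "sqmean ?h r \<le> sqmean f r" unfolding sqmean_def
    proof (rule integral_mono[OF integrable_sqmean[OF hh r] integrable_sqmean[OF f(1) r]])
      fix t
      have "norm (f (of_real r * cis t) * (of_real r * cis t) ^ n) \<le> norm (f (of_real r * cis t)) * 1"
        unfolding norm_mult norm_power using r by (intro mult_left_mono power_le_one) (auto simp: norm_mult)
      then show "(norm (f (of_real r * cis t) * (of_real r * cis t) ^ n))\<^sup>2 \<le> (norm (f (of_real r * cis t)))\<^sup>2"
        by (intro power_mono) auto
    qed
    then show ?thesis using f(2)[OF r] by simp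
  qed
  have tb: "sqmean \<Theta> r \<le> 1" if r: "0 < r" "r < 1" for r
  proof -
    have "norm (\<Theta> (of_real r * cis t)) \<le> 1" for t using \<Theta>(2)[of "of_real r * cis t"] r by (simp add: norm_mult)
    then have "sqmean \<Theta> r \<le> (\<integral>t. 1 \<partial>angle)" unfolding sqmean_def
      by (intro integral_mono[OF integrable_sqmean[OF \<Theta>(1) r]]) (auto simp: abs_square_le_1)
    then show ?thesis using angle.prob_space by simp
  qed
  obtain l where l: "((\<lambda>r. \<integral>t. ?h (of_real r * cis t) * cnj (\<Theta> (of_real r * cis t)) \<partial>angle) \<longlongrightarrow> l) (at_left 1)"
    using H2_limit_exists[OF hh hb \<Theta>(1) tb] by blast
  have L: "((\<lambda>r. (\<integral>t. ?h (of_real r * cis t) * cnj (\<Theta> (of_real r * cis t)) \<partial>angle) / of_real r ^ n) \<longlongrightarrow> l / of_real 1 ^ n) (at_left 1)"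
    by (intro tendsto_intros l) auto
  have E: "\<forall>\<^sub>F r in at_left 1. (\<integral>t. ?h (of_real r * cis t) * cnj (\<Theta> (of_real r * cis t)) \<partial>angle) / of_real r ^ n
     = (\<integral>t. f (of_real r * cis t) * cnj (\<Theta> (of_real r * cis t)) * cis t ^ n \<partial>angle)"
    using eventually_at_left_1
  proof eventually_elim
    case (elim r)
    have "(\<integral>t. ?h (of_real r * cis t) * cnj (\<Theta> (of_real r * cis t)) \<partial>angle)
       = (\<integral>t. (f (of_real r * cis t) * cnj (\<Theta> (of_real r * cis t)) * cis t ^ n) * of_real r ^ n \<partial>angle)"
      by (rule Bochner_Integration.integral_cong[OF refl]) (simp add: power_mult_distrib mult_ac)
    then show ?case using elim by simp
  qed
  show ?thesis by (rule exI, rule Lim_transform_eventually[OF L E])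
qed

text \<open>Both halves of \<open>poisson_eq\<close> expand into geometric series, integrated
  termwise. Frequency 0 belongs to the first sum, so the second starts at exponent 1 and a limit in
  which the first sum disappears vanishes at 0.\<close>

lemma poisson_expansion:
  fixes q :: "real \<Rightarrow> complex"
  assumes q: "continuous_on UNIV q" and z: "norm z < 1"
  shows "(\<integral>t. q t * of_real (poisson z t) \<partial>angle) =
    (\<Sum>n. z ^ n * (\<integral>t. q t * cnj (cis t) ^ n \<partial>angle)) + (\<Sum>n. cnj z ^ Suc n * (\<integral>t. q t * cis t ^ Suc n \<partial>angle))"
proof -
  have gen: "(\<integral>t. q t * (x t / (1 - y t)) \<partial>angle) = (\<Sum>n. \<integral>t. q t * (x t * y t ^ n) \<partial>angle)"
    if c: "continuous_on UNIV x" "continuous_on UNIV y" and ny: "\<And>t. norm (y t) = norm z" and nx: "\<And>t. norm (x t) \<le> 1" for x y :: "real \<Rightarrow> complex"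
  proof -
    have i: "integrable angle (\<lambda>t. q t * (x t * y t ^ n))" for n
      by (intro integrable_angle_continuous continuous_intros q c)
    have iq: "integrable angle (\<lambda>t. norm (q t))" by (intro integrable_angle_continuous continuous_intros q)
    have le: "norm (q t * (x t * y t ^ n)) \<le> norm (q t) * norm z ^ n" for t n
      unfolding norm_mult norm_power ny using nx[of t] by (intro mult_left_mono mult_left_le_one_le) auto
    have sg: "summable (\<lambda>n. norm z ^ n)" using z by (intro summable_geometric) simp
    have "(\<lambda>n. \<integral>t. q t * (x t * y t ^ n) \<partial>angle) sums (\<integral>t. (\<Sum>n. q t * (x t * y t ^ n)) \<partial>angle)"
    proof (rule sums_integral[OF i])
      show "AE t in angle. summable (\<lambda>n. norm (q t * (x t * y t ^ n)))"
      proof (rule AE_I2)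
        fix t show "summable (\<lambda>n. norm (q t * (x t * y t ^ n)))"
          by (rule summable_comparison_test'[OF summable_mult[OF sg, of "norm (q t)"], of 0]) (use le in auto)
      qed
      have "(\<integral>t. norm (q t * (x t * y t ^ n)) \<partial>angle) \<le> (\<integral>t. norm (q t) \<partial>angle) * norm z ^ n" for n
        using integral_mono[OF integrable_norm[OF i[of n]] integrable_mult_left[OF iq, of "norm z ^ n"] le] by simp
      moreover have "0 \<le> (\<integral>t. norm (q t * (x t * y t ^ n)) \<partial>angle)" for n by (rule integral_nonneg_AE) auto
      ultimately show "summable (\<lambda>n. \<integral>t. norm (q t * (x t * y t ^ n)) \<partial>angle)"
        by (intro summable_comparison_test'[OF summable_mult[OF sg, of "\<integral>t. norm (q t) \<partial>angle"], of 0]) auto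
    qed
    moreover have "(\<Sum>n. q t * (x t * y t ^ n)) = q t * (x t / (1 - y t))" for t
    proof -
      have "norm (y t) < 1" using ny z by simp
      then have "(\<lambda>n. (q t * x t) * y t ^ n) sums ((q t * x t) * (1 / (1 - y t)))" by (intro sums_mult geometric_sums)
      then show ?thesis by (simp add: sums_iff mult.assoc)
    qed
    ultimately show ?thesis by (simp add: sums_iff)
  qed
  have c1: "continuous_on UNIV (\<lambda>t. 1 / (1 - z * cnj (cis t)))" "continuous_on UNIV (\<lambda>t. cnj z * cis t / (1 - cnj z * cis t))"
    using one_minus_cnj_cis_nz[OF z] one_minus_cis_nz[of "cnj z"] z by (auto intro!: continuous_intros)
  have "(\<integral>t. q t * of_real (poisson z t) \<partial>angle) = (\<integral>t. q t * (1 / (1 - z * cnj (cis t))) + q t * (cnj z * cis t / (1 - cnj z * cis t)) \<partial>angle)"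
    by (simp only: poisson_eq[OF z] distrib_left)
  also have "\<dots> = (\<integral>t. q t * (1 / (1 - z * cnj (cis t))) \<partial>angle) + (\<integral>t. q t * (cnj z * cis t / (1 - cnj z * cis t)) \<partial>angle)"
    by (intro Bochner_Integration.integral_add integrable_angle_continuous continuous_on_mult q c1)
  also have "(\<integral>t. q t * (1 / (1 - z * cnj (cis t))) \<partial>angle) = (\<Sum>n. \<integral>t. q t * (1 * (z * cnj (cis t)) ^ n) \<partial>angle)"
    by (rule gen) (auto intro!: continuous_intros simp: norm_mult)
  also have "\<dots> = (\<Sum>n. z ^ n * (\<integral>t. q t * cnj (cis t) ^ n \<partial>angle))"
    by (subst integral_mult_right_zero[symmetric]) (simp add: power_mult_distrib mult_ac)
  also have "(\<integral>t. q t * (cnj z * cis t / (1 - cnj z * cis t)) \<partial>angle) = (\<Sum>n. \<integral>t. q t * ((cnj z * cis t) * (cnj z * cis t) ^ n) \<partial>angle)"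
    by (rule gen) (use z in \<open>auto intro!: continuous_intros simp: norm_mult\<close>)
  also have "\<dots> = (\<Sum>n. cnj z ^ Suc n * (\<integral>t. q t * cis t ^ Suc n \<partial>angle))"
    by (subst integral_mult_right_zero[symmetric]) (simp add: power_mult_distrib mult_ac)
  finally show ?thesis .
qed

text \<open>The function \<open>G\<close> plays the role of the conjugate partner of \<open>f\<close>: on the circle \<open>f = \<Theta> * cnj G\<close>.
  To avoid boundary values it is obtained from the Poisson integrals of \<open>f * cnj \<Theta>\<close> over smaller circles,
  whose negative-frequency part disappears in the limit because \<open>f\<close> is orthogonal to \<open>\<Theta> H\<^sup>2\<close>.\<close>

lemma conjugate_partner:
  assumes \<Theta>: "\<Theta> holomorphic_on ball 0 1" "\<And>z. norm z < 1 \<Longrightarrow> norm (\<Theta> z) < 1" and f: "f \<in> fourier_model_space \<Theta>"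
  obtains G where "G holomorphic_on ball 0 1"
    "\<And>z. norm z < 1 \<Longrightarrow> (\<lambda>k. \<integral>t. f (of_real (radius k) * cis t) * cnj (\<Theta> (of_real (radius k) * cis t)) * of_real (poisson z t) \<partial>angle) \<longlonglongrightarrow> cnj (G z)"
proof -
  have fh: "f holomorphic_on ball 0 1" and fH: "f \<in> H2_disc"
    using f by (auto simp: fourier_model_space_def H2_disc_def)
  define K where "K = (H2_disc_norm f)\<^sup>2"
  have fK: "sqmean f r \<le> K" if "0 < r" "r < 1" for r unfolding K_def by (rule sqmean_le_H2_norm[OF fH that])
  define q where "q = (\<lambda>k t. f (of_real (radius k) * cis t) * cnj (\<Theta> (of_real (radius k) * cis t)))"
  have cf: "continuous_on UNIV (\<lambda>t. f (of_real (radius k) * cis t))" for k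
    by (rule holomorphic_continuous_cis[OF fh]) (use radius[of k] in auto)
  have c\<Theta>: "continuous_on UNIV (\<lambda>t. \<Theta> (of_real (radius k) * cis t))" for k
    by (rule holomorphic_continuous_cis[OF \<Theta>(1)]) (use radius[of k] in auto)
  have cq: "continuous_on UNIV (q k)" for k unfolding q_def by (intro continuous_intros cf c\<Theta>)
  have ex: "\<forall>n. \<exists>l. ((\<lambda>r. \<integral>t. f (of_real r * cis t) * cnj (\<Theta> (of_real r * cis t)) * cis t ^ Suc n \<partial>angle) \<longlongrightarrow> l) (at_left 1)"
    using fourier_limit_exists[OF \<Theta> fh fK] by blast
  obtain \<beta> where \<beta>: "\<And>n. ((\<lambda>r. \<integral>t. f (of_real r * cis t) * cnj (\<Theta> (of_real r * cis t)) * cis t ^ Suc n \<partial>angle) \<longlongrightarrow> \<beta> n) (at_left 1)"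
    using choice[OF ex] by blast
  have B: "(\<lambda>k. \<integral>t. q k t * cis t ^ Suc n \<partial>angle) \<longlonglongrightarrow> \<beta> n" for n
    unfolding q_def by (rule filterlim_compose[OF \<beta> radius_at_left])
  have A: "(\<lambda>k. \<integral>t. q k t * cnj (cis t) ^ n \<partial>angle) \<longlonglongrightarrow> 0" for n
    unfolding q_def by (rule filterlim_compose[OF _ radius_at_left]) (use f in \<open>auto simp: fourier_model_space_def\<close>)
  \<comment> \<open>A bound on all Fourier coefficients that is uniform in the frequency and in the
    circle; the crude x <= 1 + x^2 avoids a square root and is enough for domination.\<close>
  have bd: "norm (\<integral>t. q k t * x t \<partial>angle) \<le> 1 + K" if x: "continuous_on UNIV x" "\<And>t. norm (x t) = 1" for k x
  proof -
    have "norm (\<integral>t. q k t * x t \<partial>angle) \<le> (\<integral>t. norm (q k t * x t) \<partial>angle)" by (rule integral_norm_bound)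
    also have "\<dots> \<le> (\<integral>t. 1 + (norm (f (of_real (radius k) * cis t)))\<^sup>2 \<partial>angle)"
    proof (rule integral_mono)
      show "integrable angle (\<lambda>t. norm (q k t * x t))" by (intro integrable_angle_continuous continuous_intros cq x)
      show "integrable angle (\<lambda>t. 1 + (norm (f (of_real (radius k) * cis t)))\<^sup>2)"
        by (intro integrable_angle_continuous continuous_intros cf)
      fix t
      have "norm (\<Theta> (of_real (radius k) * cis t)) \<le> 1"
        using \<Theta>(2)[of "of_real (radius k) * cis t"] radius[of k] by (simp add: norm_mult)
      then have "norm (q k t * x t) \<le> norm (f (of_real (radius k) * cis t)) * 1"
        unfolding q_def norm_mult x(2) by (simp add: mult_left_le)
      then show "norm (q k t * x t) \<le> 1 + (norm (f (of_real (radius k) * cis t)))\<^sup>2"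
        using norm_le_one_plus_square[of "norm (f (of_real (radius k) * cis t))"] by simp
    qed
    also have "\<dots> = 1 + sqmean f (radius k)"
      using integrable_sqmean[OF fh radius(1,2)[of k]] angle.prob_space by (simp add: sqmean_def)
    also have "\<dots> \<le> 1 + K" using fK[OF radius(1,2)[of k]] by simp
    finally show ?thesis .
  qed
  have bA: "norm (\<integral>t. q k t * cnj (cis t) ^ n \<partial>angle) \<le> 1 + K" for k n
    by (rule bd) (auto intro!: continuous_intros simp: norm_power)
  have bB: "norm (\<integral>t. q k t * cis t ^ Suc n \<partial>angle) \<le> 1 + K" for k n
    by (rule bd) (auto intro!: continuous_intros simp: norm_power norm_mult simp del: power_Suc)
  have \<beta>b: "norm (\<beta> n) \<le> 1 + K" for n
    by (rule Lim_bounded[OF tendsto_norm[OF B], of 0]) (use bB in auto)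
  have sg: "summable (\<lambda>n. norm z ^ n * (1 + K))" if "norm z < 1" for z :: complex
    using that by (intro summable_mult2 summable_geometric) simp
  define G where "G = (\<lambda>z. \<Sum>n. cnj (\<beta> n) * z ^ Suc n)"
  have sumG: "(\<lambda>n. cnj (\<beta> n) * z ^ Suc n) sums G z" if z: "norm z < 1" for z
    unfolding G_def
  proof (rule summable_sums, rule summable_comparison_test'[OF sg[OF z], of 0])
    fix n :: nat
    have "norm (cnj (\<beta> n) * z ^ Suc n) = norm z * (norm z ^ n * norm (\<beta> n))" by (simp add: norm_mult norm_power)
    also have "\<dots> \<le> 1 * (norm z ^ n * (1 + K))" using z \<beta>b[of n] by (intro mult_mono mult_left_mono) auto
    finally show "norm (cnj (\<beta> n) * z ^ Suc n) \<le> norm z ^ n * (1 + K)" by simp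
  qed
  have Ghol: "G holomorphic_on ball 0 1"
  proof (rule power_series_holomorphic[of 0 1 "\<lambda>n. if n = 0 then 0 else cnj (\<beta> (n - 1))"])
    fix w :: complex assume "w \<in> ball 0 1"
    then have "(\<lambda>n. cnj (\<beta> n) * w ^ Suc n) sums G w" by (intro sumG) simp
    then have "(\<lambda>n. (if Suc n = 0 then 0 else cnj (\<beta> (Suc n - 1))) * (w - 0) ^ Suc n) sums G w" by simp
    then show "(\<lambda>n. (if n = 0 then 0 else cnj (\<beta> (n - 1))) * (w - 0) ^ n) sums G w"
      by (subst (asm) sums_Suc_iff) simp
  qed
  have lim: "(\<lambda>k. \<integral>t. q k t * of_real (poisson z t) \<partial>angle) \<longlonglongrightarrow> cnj (G z)" if z: "norm z < 1" for z
  proof -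
    \<comment> \<open>Tannery's theorem: termwise limits are allowed because the terms are dominated
      by |z|^n (1 + K). All limits here are 0 by orthogonality, so only the conjugate-holomorphic
      half survives.\<close>
    have T1: "(\<lambda>k. \<Sum>n. z ^ n * (\<integral>t. q k t * cnj (cis t) ^ n \<partial>angle)) \<longlonglongrightarrow> (\<Sum>n. z ^ n * 0)"
    proof (rule tannerys_theorem[THEN conjunct2, THEN conjunct2, OF _ _ sg[OF z]])
      show "\<forall>\<^sub>F x in sequentially \<times>\<^sub>F sequentially. case x of (n, k) \<Rightarrow> norm (z ^ n * (\<integral>t. q k t * cnj (cis t) ^ n \<partial>angle)) \<le> norm z ^ n * (1 + K)"
        using bA by (intro always_eventually) (auto simp: norm_mult norm_power intro!: mult_left_mono)
      show "(\<lambda>k. z ^ n * (\<integral>t. q k t * cnj (cis t) ^ n \<partial>angle)) \<longlonglongrightarrow> z ^ n * 0" for n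
        by (intro tendsto_mult tendsto_const A)
    qed simp
    have T2: "(\<lambda>k. \<Sum>n. cnj z ^ Suc n * (\<integral>t. q k t * cis t ^ Suc n \<partial>angle)) \<longlonglongrightarrow> (\<Sum>n. cnj z ^ Suc n * \<beta> n)"
    proof (rule tannerys_theorem[THEN conjunct2, THEN conjunct2, OF _ _ sg[OF z]])
      have "norm (cnj z ^ Suc n * (\<integral>t. q k t * cis t ^ Suc n \<partial>angle)) \<le> norm z ^ n * (1 + K)" for n k
      proof -
        have "norm (cnj z ^ Suc n * (\<integral>t. q k t * cis t ^ Suc n \<partial>angle)) = norm z * (norm z ^ n * norm (\<integral>t. q k t * cis t ^ Suc n \<partial>angle))"
          by (simp add: norm_mult norm_power del: power_Suc) (simp add: mult.assoc)
        also have "\<dots> \<le> 1 * (norm z ^ n * (1 + K))" using z bB[of k n] by (intro mult_mono mult_left_mono) (auto simp del: power_Suc)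
        finally show ?thesis by simp
      qed
      then show "\<forall>\<^sub>F x in sequentially \<times>\<^sub>F sequentially. case x of (n, k) \<Rightarrow> norm (cnj z ^ Suc n * (\<integral>t. q k t * cis t ^ Suc n \<partial>angle)) \<le> norm z ^ n * (1 + K)"
        by (intro always_eventually) auto
      show "(\<lambda>k. cnj z ^ Suc n * (\<integral>t. q k t * cis t ^ Suc n \<partial>angle)) \<longlonglongrightarrow> cnj z ^ Suc n * \<beta> n" for n
        by (intro tendsto_mult tendsto_const B)
    qed simp
    have "(\<lambda>n. cnj (cnj (\<beta> n) * z ^ Suc n)) sums cnj (G z)" using sumG[OF z] by (simp only: sums_cnj)
    then have "(\<Sum>n. cnj z ^ Suc n * \<beta> n) = cnj (G z)" by (simp add: sums_iff mult_ac)
    then show ?thesis unfolding poisson_expansion[OF cq z] using tendsto_add[OF T1 T2] by simp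
  qed
  show ?thesis by (rule that[OF Ghol]) (use lim in \<open>simp add: q_def\<close>)
qed

text \<open>On the circle of radius r_k, \<open>L\<close> is the Poisson integral of f conj(Theta),
  and \<open>D\<close> = f(r_k z) - Theta(z) L is the Poisson integral of (1 - Theta(z) conj(T)) F.
  Cauchy-Schwarz bounds |L|^2 by \<open>M\<close> and |D|^2 by \<open>X\<close> times
  \<open>M\<close>, where \<open>M\<close> is the Poisson integral of |F|^2. As W X is eventually at
  most 2, the total is at most 2 + 20 = 22 times \<open>M\<close>.\<close>

lemma bellman_le_Liminf:
  assumes \<Theta>: "\<Theta> holomorphic_on ball 0 1" "\<And>z. norm z < 1 \<Longrightarrow> norm (\<Theta> z) < 1" and fh: "f holomorphic_on ball 0 1"
    and G: "\<And>z. norm z < 1 \<Longrightarrow> (\<lambda>k. \<integral>t. f (of_real (radius k) * cis t) * cnj (\<Theta> (of_real (radius k) * cis t)) * of_real (poisson z t) \<partial>angle) \<longlonglongrightarrow> cnj (G z)"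
    and z: "norm z < 1"
  shows "ennreal (bellman \<Theta> f G z) \<le> liminf (\<lambda>k. \<integral>\<^sup>+t. ennreal (22 * (norm (f (of_real (radius k) * cis t)))\<^sup>2 * poisson z t) \<partial>angle)"
proof -
  define F where "F = (\<lambda>k t. f (of_real (radius k) * cis t))"
  define T where "T = (\<lambda>k t. \<Theta> (of_real (radius k) * cis t))"
  have cF: "continuous_on UNIV (F k)" for k unfolding F_def
    by (rule holomorphic_continuous_cis[OF fh]) (use radius[of k] in auto)
  have cT: "continuous_on UNIV (T k)" for k unfolding T_def
    by (rule holomorphic_continuous_cis[OF \<Theta>(1)]) (use radius[of k] in auto)
  have T1: "norm (T k t) \<le> 1" for k t unfolding T_def
    using \<Theta>(2)[of "of_real (radius k) * cis t"] radius[of k] by (simp add: norm_mult)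
  note P = poisson_nonneg[OF z] and cP = continuous_poisson[OF z]
  define u where "u = 1 - (norm (\<Theta> z))\<^sup>2"
  have u: "0 < u" "u \<le> 1" using \<Theta>(2)[OF z] by (auto simp: u_def abs_square_less_1)
  define W where "W = u powr (-1/4)"
  have W: "W > 0" using u by (simp add: W_def)
  have uW: "u * W \<le> 1"
  proof -
    have "u * W = u powr (3/4)" using powr_add[of u 1 "-1/4"] u by (simp add: W_def)
    also have "\<dots> \<le> 1 powr (3/4)" using u by (intro powr_mono2) auto
    finally show ?thesis by simp
  qed
  define M where "M = (\<lambda>k. \<integral>t. (norm (F k t))\<^sup>2 * poisson z t \<partial>angle)"
  define L where "L = (\<lambda>k. \<integral>t. F k t * cnj (T k t) * of_real (poisson z t) \<partial>angle)"
  have L: "L \<longlonglongrightarrow> cnj (G z)" unfolding L_def F_def T_def by (rule G[OF z])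
  have M0: "0 \<le> M k" for k unfolding M_def by (rule integral_nonneg_AE) (use P in auto)
  have holr: "(\<lambda>x. g (of_real (radius k) * x)) holomorphic_on ball 0 (1 / radius k)" if "g holomorphic_on ball 0 1" for g k
    by (intro holomorphic_on_compose_gen[OF _ that, unfolded o_def] holomorphic_intros)
       (use radius[of k] in \<open>auto simp: norm_mult field_simps\<close>)
  have pm: "(\<integral>t. g (of_real (radius k) * cis t) * of_real (poisson z t) \<partial>angle) = g (of_real (radius k) * z)" if "g holomorphic_on ball 0 1" for g k
    using poisson_holomorphic[OF holr[OF that] _ z] radius[of k] by simp
  have mT: "(\<integral>t. (norm (T k t))\<^sup>2 * poisson z t \<partial>angle) \<le> 1" for k
  proof -
    have "(\<integral>t. (norm (T k t))\<^sup>2 * poisson z t \<partial>angle) \<le> (\<integral>t. poisson z t \<partial>angle)"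
      by (rule integral_mono) (use T1 P in \<open>auto intro!: integrable_angle_continuous continuous_intros cT cP mult_left_le_one_le simp: abs_square_le_1\<close>)
    then show ?thesis by (simp add: poisson_integral[OF z])
  qed
  have LG: "(norm (L k))\<^sup>2 \<le> M k" for k
  proof -
    have "(norm (L k))\<^sup>2 \<le> (\<integral>t. (norm (F k t))\<^sup>2 * poisson z t \<partial>angle) * (\<integral>t. (norm (cnj (T k t)))\<^sup>2 * poisson z t \<partial>angle)"
      unfolding L_def by (rule poisson_Cauchy_Schwarz[OF cF _ z]) (intro continuous_intros cT)
    also have "\<dots> \<le> M k * 1" using mult_left_mono[OF mT[of k] M0[of k]] by (simp add: M_def)
    finally show ?thesis by simp
  qed
  define X where "X = (\<lambda>k. \<integral>t. (norm (1 - \<Theta> z * cnj (T k t)))\<^sup>2 * poisson z t \<partial>angle)"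
  define D where "D = (\<lambda>k. f (of_real (radius k) * z) - \<Theta> z * L k)"
  have DX: "(norm (D k))\<^sup>2 \<le> X k * M k" for k
  proof -
    have "D k = (\<integral>t. (1 - \<Theta> z * cnj (T k t)) * F k t * of_real (poisson z t) \<partial>angle)"
    proof -
      have "(\<integral>t. (1 - \<Theta> z * cnj (T k t)) * F k t * of_real (poisson z t) \<partial>angle)
         = (\<integral>t. F k t * of_real (poisson z t) - \<Theta> z * (F k t * cnj (T k t) * of_real (poisson z t)) \<partial>angle)"
        by (rule Bochner_Integration.integral_cong) (auto simp: algebra_simps)
      also have "\<dots> = (\<integral>t. F k t * of_real (poisson z t) \<partial>angle) - (\<integral>t. \<Theta> z * (F k t * cnj (T k t) * of_real (poisson z t)) \<partial>angle)"
        by (intro Bochner_Integration.integral_diff integrable_angle_continuous continuous_intros cF cT cP)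
      also have "\<dots> = D k" using pm[OF fh, of k] by (simp add: D_def L_def F_def)
      finally show ?thesis ..
    qed
    then show ?thesis unfolding X_def M_def
      by (simp only:) (rule poisson_Cauchy_Schwarz[OF _ cF z], intro continuous_intros cT)
  qed
  have Xle: "X k \<le> 1 + (norm (\<Theta> z))\<^sup>2 - 2 * Re (\<Theta> z * cnj (\<Theta> (of_real (radius k) * z)))" for k
  proof -
    have e: "(norm (1 - \<Theta> z * cnj w))\<^sup>2 = 1 + (norm (\<Theta> z))\<^sup>2 * (norm w)\<^sup>2 - 2 * Re (cnj (\<Theta> z) * w)" for w
      by (simp only: cmod_power2) (simp add: power2_eq_square algebra_simps)
    have i: "integrable angle (\<lambda>t. T k t * of_real (poisson z t))" "integrable angle (\<lambda>t. (norm (T k t))\<^sup>2 * poisson z t)" "integrable angle (poisson z)"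
      by (intro integrable_angle_continuous continuous_intros cT cP)+
    have "X k = (\<integral>t. poisson z t + (norm (\<Theta> z))\<^sup>2 * ((norm (T k t))\<^sup>2 * poisson z t) - 2 * Re (cnj (\<Theta> z) * (T k t * of_real (poisson z t))) \<partial>angle)"
      unfolding X_def e by (rule Bochner_Integration.integral_cong) (auto simp: algebra_simps)
    also have "\<dots> = (\<integral>t. poisson z t \<partial>angle) + (norm (\<Theta> z))\<^sup>2 * (\<integral>t. (norm (T k t))\<^sup>2 * poisson z t \<partial>angle)
        - 2 * Re (cnj (\<Theta> z) * (\<integral>t. T k t * of_real (poisson z t) \<partial>angle))"
    proof -
      have i4: "integrable angle (\<lambda>t. cnj (\<Theta> z) * (T k t * of_real (poisson z t)))" using i(1) by (rule integrable_mult_right)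
      have "(\<integral>t. Re (cnj (\<Theta> z) * (T k t * of_real (poisson z t))) \<partial>angle) = Re (cnj (\<Theta> z) * (\<integral>t. T k t * of_real (poisson z t) \<partial>angle))"
        by (subst integral_Re[OF i4]) (simp only: integral_mult_right_zero)
      moreover have "integrable angle (\<lambda>t. Re (cnj (\<Theta> z) * (T k t * of_real (poisson z t))))" using i4 by (rule integrable_Re)
      ultimately show ?thesis using i(2,3)
        by (simp only: Bochner_Integration.integral_add Bochner_Integration.integral_diff Bochner_Integration.integrable_add
             integrable_mult_right integral_mult_right_zero)
    qed
    also have "(\<integral>t. T k t * of_real (poisson z t) \<partial>angle) = \<Theta> (of_real (radius k) * z)" unfolding T_def by (rule pm[OF \<Theta>(1)])
    also have "(\<integral>t. poisson z t \<partial>angle) + (norm (\<Theta> z))\<^sup>2 * (\<integral>t. (norm (T k t))\<^sup>2 * poisson z t \<partial>angle)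
        - 2 * Re (cnj (\<Theta> z) * \<Theta> (of_real (radius k) * z)) \<le> 1 + (norm (\<Theta> z))\<^sup>2 * 1 - 2 * Re (cnj (\<Theta> z) * \<Theta> (of_real (radius k) * z))"
      using mult_left_mono[OF mT[of k], of "(norm (\<Theta> z))\<^sup>2"] by (simp add: poisson_integral[OF z])
    finally show ?thesis by simp
  qed
  have rz: "(\<lambda>k. g (of_real (radius k) * z)) \<longlonglongrightarrow> g z" if "g holomorphic_on ball 0 1" for g
  proof -
    have "isCont g z" using that z by (intro field_differentiable_imp_continuous_at holomorphic_on_imp_differentiable_at[of g "ball 0 1"]) auto
    moreover have "(\<lambda>k. of_real (radius k) * z) \<longlonglongrightarrow> of_real 1 * z" by (intro tendsto_intros radius_tendsto)
    ultimately show ?thesis using isCont_tendsto_compose by fastforce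
  qed
  have D: "D \<longlonglongrightarrow> f z - \<Theta> z * cnj (G z)" unfolding D_def by (intro tendsto_intros rz fh L)
  \<comment> \<open>The bound for \<open>X\<close> tends to 1 - |Theta(z)|^2 = u, and u W <= 1. The
    threshold 2 is slack, since \<open>X\<close> is compared with u only in the limit.\<close>
  have "(\<lambda>k. W * (1 + (norm (\<Theta> z))\<^sup>2 - 2 * Re (\<Theta> z * cnj (\<Theta> (of_real (radius k) * z)))))
      \<longlonglongrightarrow> W * (1 + (norm (\<Theta> z))\<^sup>2 - 2 * Re (\<Theta> z * cnj (\<Theta> z)))"
    by (intro tendsto_intros rz \<Theta>(1))
  also have "W * (1 + (norm (\<Theta> z))\<^sup>2 - 2 * Re (\<Theta> z * cnj (\<Theta> z))) = u * W"
    by (simp add: u_def complex_mult_cnj cmod_power2 algebra_simps)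
  finally have "\<forall>\<^sub>F k in sequentially. W * (1 + (norm (\<Theta> z))\<^sup>2 - 2 * Re (\<Theta> z * cnj (\<Theta> (of_real (radius k) * z)))) < 2"
    by (rule order_tendstoD(2)) (use uW in linarith)
  then have evX: "\<forall>\<^sub>F k in sequentially. W * X k \<le> 2"
  proof eventually_elim
    case (elim k)
    have "W * X k \<le> W * (1 + (norm (\<Theta> z))\<^sup>2 - 2 * Re (\<Theta> z * cnj (\<Theta> (of_real (radius k) * z))))"
      using Xle[of k] W by (intro mult_left_mono) auto
    then show ?case using elim by linarith
  qed
  define \<Phi> where "\<Phi> = (\<lambda>k. W * (norm (D k))\<^sup>2 + 20 * (norm (L k))\<^sup>2)"
  have \<Phi>lim: "\<Phi> \<longlonglongrightarrow> W * (norm (f z - \<Theta> z * cnj (G z)))\<^sup>2 + 20 * (norm (cnj (G z)))\<^sup>2"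
    unfolding \<Phi>_def by (intro tendsto_intros D L)
  have ev: "\<forall>\<^sub>F k in sequentially. ennreal (\<Phi> k) \<le> (\<integral>\<^sup>+t. ennreal (22 * (norm (f (of_real (radius k) * cis t)))\<^sup>2 * poisson z t) \<partial>angle)"
    using evX
  proof eventually_elim
    case (elim k)
    have "W * (norm (D k))\<^sup>2 \<le> W * (X k * M k)" using DX[of k] W by (intro mult_left_mono) auto
    also have "\<dots> \<le> 2 * M k" using mult_right_mono[OF elim M0[of k]] by (simp add: mult.assoc)
    finally have "\<Phi> k \<le> 22 * M k" using LG[of k] by (simp add: \<Phi>_def)
    also have "22 * M k = (\<integral>t. 22 * (norm (F k t))\<^sup>2 * poisson z t \<partial>angle)" by (simp add: M_def mult.assoc)
    finally have "ennreal (\<Phi> k) \<le> ennreal (\<integral>t. 22 * (norm (F k t))\<^sup>2 * poisson z t \<partial>angle)" by (rule ennreal_leI)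
    also have "\<dots> = (\<integral>\<^sup>+t. ennreal (22 * (norm (F k t))\<^sup>2 * poisson z t) \<partial>angle)"
      by (rule nn_integral_eq_integral[symmetric]) (use P in \<open>auto intro!: integrable_angle_continuous continuous_intros cF cP\<close>)
    finally show ?case by (simp add: F_def)
  qed
  have "bellman \<Theta> f G z \<le> W * (norm (f z - \<Theta> z * cnj (G z)))\<^sup>2 + 20 * (norm (cnj (G z)))\<^sup>2"
    unfolding bellman_def Let_def u_def[symmetric] W_def[symmetric] using u W by simp
  then have "ennreal (bellman \<Theta> f G z) \<le> ennreal (W * (norm (f z - \<Theta> z * cnj (G z)))\<^sup>2 + 20 * (norm (cnj (G z)))\<^sup>2)"
    by (rule ennreal_leI)
  also have "\<dots> = liminf (\<lambda>k. ennreal (\<Phi> k))"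
    by (rule lim_imp_Liminf[symmetric, OF sequentially_bot tendsto_ennrealI[OF \<Phi>lim]])
  also have "\<dots> \<le> liminf (\<lambda>k. \<integral>\<^sup>+t. ennreal (22 * (norm (f (of_real (radius k) * cis t)))\<^sup>2 * poisson z t) \<partial>angle)"
    by (rule Liminf_mono[OF ev])
  finally show ?thesis .
qed

section \<open>The weighted area estimate\<close>

lemma bellman_nonneg:
  assumes "norm (\<Theta> z) < 1" shows "0 \<le> bellman \<Theta> f G z"
proof -
  define u where "u = 1 - (norm (\<Theta> z))\<^sup>2"
  have u: "0 < u" "u \<le> 1" using assms by (auto simp: u_def abs_square_less_1)
  have "u * u powr (-1/4) = u powr (3/4)" using powr_add[of u 1 "-1/4"] u by simp
  also have "\<dots> \<le> 1 powr (3/4)" using u by (intro powr_mono2) auto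
  finally have "u * u powr (-1/4) * (norm (G z))\<^sup>2 \<le> 1 * (norm (G z))\<^sup>2" by (intro mult_right_mono) auto
  moreover have "0 \<le> u powr (-1/4) * (norm (f z - \<Theta> z * cnj (G z)))\<^sup>2" by simp
  ultimately have "0 \<le> u powr (-1/4) * (norm (f z - \<Theta> z * cnj (G z)))\<^sup>2 + 20 * (norm (G z))\<^sup>2 - u * u powr (-1/4) * (norm (G z))\<^sup>2"
    by (smt (verit) zero_le_power2)
  then show ?thesis by (simp add: bellman_def Let_def u_def)
qed

lemma bellman_continuous:
  assumes "\<Theta> holomorphic_on ball 0 1" "\<And>z. norm z < 1 \<Longrightarrow> norm (\<Theta> z) < 1" "f holomorphic_on ball 0 1" "G holomorphic_on ball 0 1"
  shows "continuous_on (ball 0 1) (bellman \<Theta> f G)"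
proof -
  have "1 - (norm (\<Theta> z))\<^sup>2 \<noteq> 0" if "norm z < 1" for z
    using assms(2)[OF that] abs_square_less_1[of "norm (\<Theta> z)"] by auto
  then show ?thesis unfolding bellman_def Let_def
    by (intro continuous_intros holomorphic_on_imp_continuous_on assms) auto
qed

text \<open>Averaging the pointwise liminf bound over |z| = R, with Fatou's lemma and Poisson
  averaging, gives a mean of at most 22 times the squared norm. \<open>Green_lower\<close> with the
  quarter-weighted density turns this into an area bound up to radius R, and a second use of Fatou's
  lemma lets R tend to 1; 88 = 4 * 22.\<close>

lemma weighted_derivative_bound:
  assumes \<Theta>: "\<Theta> holomorphic_on ball 0 1" "\<And>z. norm z < 1 \<Longrightarrow> norm (\<Theta> z) < 1" and f: "f \<in> fourier_model_space \<Theta>"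
  shows "(\<integral>\<^sup>+w. ennreal ((norm (deriv f w))\<^sup>2 * (1 - (norm (\<Theta> w))\<^sup>2) powr (-1/4) * ln (1 / norm w)) * indicator (ball 0 1) w \<partial>lborel)
    \<le> ennreal (88 * c0 * (H2_disc_norm f)\<^sup>2)"
proof -
  have fh: "f holomorphic_on ball 0 1" and fH: "f \<in> H2_disc"
    using f by (auto simp: fourier_model_space_def H2_disc_def)
  define K where "K = (H2_disc_norm f)\<^sup>2"
  have fK: "sqmean f r \<le> K" if "0 < r" "r < 1" for r unfolding K_def by (rule sqmean_le_H2_norm[OF fH that])
  obtain G where Gh: "G holomorphic_on ball 0 1"
    and G: "\<And>z. norm z < 1 \<Longrightarrow> (\<lambda>k. \<integral>t. f (of_real (radius k) * cis t) * cnj (\<Theta> (of_real (radius k) * cis t)) * of_real (poisson z t) \<partial>angle) \<longlonglongrightarrow> cnj (G z)"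
    using conjugate_partner[OF \<Theta> f] by blast
  have mean: "(\<integral>t. bellman \<Theta> f G (of_real R * cis t) \<partial>angle) \<le> 22 * K" if R: "0 < R" "R < 1" for R
  proof -
    have nz: "norm (of_real R * cis t) < 1" for t using R by (simp add: norm_mult)
    have cb: "continuous_on UNIV (\<lambda>t. bellman \<Theta> f G (of_real R * cis t))"
      by (rule continuous_on_compose2[OF bellman_continuous[OF \<Theta> fh Gh]]) (use R in \<open>auto intro!: continuous_intros simp: norm_mult\<close>)
    have q: "(\<lambda>t. 22 * (norm (f (of_real (radius k) * cis t)))\<^sup>2) \<in> borel_measurable borel" for k
      by (intro borel_measurable_continuous_onI continuous_intros holomorphic_continuous_cis[OF fh]) (use radius[of k] in auto)
    note q' [measurable] = q
    have "ennreal (\<integral>t. bellman \<Theta> f G (of_real R * cis t) \<partial>angle) = (\<integral>\<^sup>+t. ennreal (bellman \<Theta> f G (of_real R * cis t)) \<partial>angle)"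
      by (rule nn_integral_eq_integral[symmetric, OF integrable_angle_continuous[OF cb]]) (use bellman_nonneg \<Theta>(2)[OF nz] in auto)
    also have "\<dots> \<le> (\<integral>\<^sup>+\<theta>. liminf (\<lambda>k. \<integral>\<^sup>+t. ennreal (22 * (norm (f (of_real (radius k) * cis t)))\<^sup>2 * poisson (of_real R * cis \<theta>) t) \<partial>angle) \<partial>angle)"
      by (intro nn_integral_mono bellman_le_Liminf[OF \<Theta> fh G] nz)
    also have "\<dots> \<le> liminf (\<lambda>k. \<integral>\<^sup>+\<theta>. \<integral>\<^sup>+t. ennreal (22 * (norm (f (of_real (radius k) * cis t)))\<^sup>2 * poisson (of_real R * cis \<theta>) t) \<partial>angle \<partial>angle)"
      by (rule nn_integral_liminf) measurable
    also have "\<dots> = liminf (\<lambda>k. \<integral>\<^sup>+t. ennreal (22 * (norm (f (of_real (radius k) * cis t)))\<^sup>2) \<partial>angle)"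
      using R by (subst poisson_averaging[OF q]) auto
    also have "\<dots> = liminf (\<lambda>k. ennreal (22 * sqmean f (radius k)))"
    proof -
      have "(\<integral>\<^sup>+t. ennreal (22 * (norm (f (of_real (radius k) * cis t)))\<^sup>2) \<partial>angle) = ennreal (22 * sqmean f (radius k))" for k
        using nn_integral_eq_integral[OF integrable_mult_right[OF integrable_sqmean[OF fh radius(1,2)[of k]], of 22]] by (simp add: sqmean_def)
      then show ?thesis by simp
    qed
    also have "\<dots> \<le> liminf (\<lambda>k. ennreal (22 * K))"
      by (intro Liminf_mono always_eventually allI ennreal_leI) (use fK[OF radius(1,2)] in auto)
    also have "\<dots> = ennreal (22 * K)" by (simp add: Liminf_const)
    finally show ?thesis by (simp add: K_def)
  qed
  define \<kappa> where "\<kappa> = (\<lambda>a. 1/4 * (1 - (norm (\<Theta> a))\<^sup>2) powr (-1/4) * (norm (deriv f a))\<^sup>2)"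
  have u0: "1 - (norm (\<Theta> z))\<^sup>2 > 0" if "norm z < 1" for z
    using \<Theta>(2)[OF that] by (auto simp: abs_square_less_1)
  have c\<kappa>: "continuous_on (ball 0 1) \<kappa>"
    unfolding \<kappa>_def using u0 by (intro continuous_intros holomorphic_on_imp_continuous_on \<Theta> holomorphic_deriv fh) (auto simp: less_imp_neq[symmetric])
  have \<kappa>0: "0 \<le> \<kappa> a" for a by (simp add: \<kappa>_def)
  define H where "H = (\<lambda>k w. ennreal (\<kappa> w * ln (radius k / norm w)) * indicator (ball 0 (radius k)) w)"
  have b0: "0 \<le> bellman \<Theta> f G 0" by (rule bellman_nonneg) (use \<Theta>(2)[of 0] in simp)
  have Hle: "(\<integral>\<^sup>+w. H k w \<partial>lborel) \<le> ennreal (22 * c0 * K)" for k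
  proof -
    have "(\<integral>\<^sup>+w. H k w \<partial>lborel) \<le> ennreal (c0 * ((\<integral>t. bellman \<Theta> f G (of_real (radius k) * cis t) \<partial>angle) - bellman \<Theta> f G 0))"
      unfolding H_def
      by (rule Green_lower[OF bellman_continuous[OF \<Theta> fh Gh] c\<kappa> \<kappa>0 _ radius(1,2)])
         (use bellman_jet[OF \<Theta>(1) fh Gh] \<Theta>(2) in \<open>auto simp: \<kappa>_def\<close>)
    also have "\<dots> \<le> ennreal (c0 * (22 * K))"
      using mean[OF radius(1,2)[of k]] b0 less_imp_le[OF c0_pos] by (intro ennreal_leI mult_left_mono) auto
    finally show ?thesis by (simp add: mult_ac)
  qed
  have mH: "H k \<in> borel_measurable borel" for k
  proof -
    have "(\<lambda>w. indicator (ball 0 1) w *\<^sub>R \<kappa> w) \<in> borel_measurable borel"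
      by (rule borel_measurable_continuous_on_indicator[OF _ c\<kappa>]) simp
    then have [measurable]: "(\<lambda>w. indicator (ball 0 1) w * \<kappa> w) \<in> borel_measurable borel" by simp
    have "H k = (\<lambda>w. ennreal ((indicator (ball 0 1) w * \<kappa> w) * ln (radius k / norm w)) * indicator (ball 0 (radius k)) w)"
      using radius(2)[of k] by (auto simp: H_def fun_eq_iff indicator_def)
    then show ?thesis by simp
  qed
  have lim: "(\<lambda>k. H k w) \<longlonglongrightarrow> ennreal (\<kappa> w * ln (1 / norm w)) * indicator (ball 0 1) w" for w
  proof (cases "norm w < 1")
    case True
    show ?thesis
    proof (cases "w = 0")
      case True then show ?thesis by (simp add: H_def)
    next
      case False
      have "\<forall>\<^sub>F k in sequentially. norm w < radius k" by (rule order_tendstoD(1)[OF radius_tendsto True])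
      then have "\<forall>\<^sub>F k in sequentially. ennreal (\<kappa> w * ln (radius k / norm w)) = H k w"
        by eventually_elim (simp add: H_def)
      moreover have "(\<lambda>k. ennreal (\<kappa> w * ln (radius k / norm w))) \<longlonglongrightarrow> ennreal (\<kappa> w * ln (1 / norm w))"
        using False by (intro tendsto_ennrealI tendsto_intros radius_tendsto) auto
      ultimately show ?thesis using True by (auto intro: Lim_transform_eventually)
    qed
  next
    case False
    then have "H k w = 0" for k using radius(2)[of k] by (auto simp: H_def indicator_def)
    then show ?thesis using False by simp
  qed
  have "(\<integral>\<^sup>+w. ennreal (\<kappa> w * ln (1 / norm w)) * indicator (ball 0 1) w \<partial>lborel) = (\<integral>\<^sup>+w. liminf (\<lambda>k. H k w) \<partial>lborel)"
    by (intro nn_integral_cong lim_imp_Liminf[symmetric] lim) simp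
  also have "\<dots> \<le> liminf (\<lambda>k. \<integral>\<^sup>+w. H k w \<partial>lborel)" by (rule nn_integral_liminf) (use mH in simp)
  also have "\<dots> \<le> liminf (\<lambda>k. ennreal (22 * c0 * K))" by (intro Liminf_mono always_eventually allI Hle)
  also have "\<dots> = ennreal (22 * c0 * K)" by (simp add: Liminf_const)
  finally have le: "(\<integral>\<^sup>+w. ennreal (\<kappa> w * ln (1 / norm w)) * indicator (ball 0 1) w \<partial>lborel) \<le> ennreal (22 * c0 * K)" .
  have m\<kappa>: "(\<lambda>w. ennreal (\<kappa> w * ln (1 / norm w)) * indicator (ball 0 1) w) \<in> borel_measurable lborel"
  proof -
    have "(\<lambda>w. indicator (ball 0 1) w *\<^sub>R \<kappa> w) \<in> borel_measurable borel"
      by (rule borel_measurable_continuous_on_indicator[OF _ c\<kappa>]) simp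
    then have [measurable]: "(\<lambda>w. indicator (ball 0 1) w * \<kappa> w) \<in> borel_measurable borel" by simp
    have "(\<lambda>w. ennreal (\<kappa> w * ln (1 / norm w)) * indicator (ball 0 1) w) = (\<lambda>w. ennreal ((indicator (ball 0 1) w * \<kappa> w) * ln (1 / norm w)))"
      by (auto simp: fun_eq_iff indicator_def)
    then show ?thesis by simp
  qed
  have "(\<integral>\<^sup>+w. ennreal ((norm (deriv f w))\<^sup>2 * (1 - (norm (\<Theta> w))\<^sup>2) powr (-1/4) * ln (1 / norm w)) * indicator (ball 0 1) w \<partial>lborel)
     = (\<integral>\<^sup>+w. ennreal 4 * (ennreal (\<kappa> w * ln (1 / norm w)) * indicator (ball 0 1) w) \<partial>lborel)"
    by (intro nn_integral_cong) (simp add: \<kappa>_def ennreal_mult'[symmetric] mult.assoc[symmetric] del: ennreal_numeral, simp add: mult_ac)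
  also have "\<dots> = ennreal 4 * (\<integral>\<^sup>+w. ennreal (\<kappa> w * ln (1 / norm w)) * indicator (ball 0 1) w \<partial>lborel)"
    by (rule nn_integral_cmult[OF m\<kappa>])
  also have "\<dots> \<le> ennreal 4 * ennreal (22 * c0 * K)" using le by (rule mult_left_mono) simp
  also have "\<dots> = ennreal (88 * c0 * K)" using c0_pos by (subst ennreal_mult'[symmetric]) (auto simp: K_def)
  finally show ?thesis by (simp add: K_def)
qed

section \<open>Slices of the torus\<close>

definition torus :: "(complex ^ 'n) set" where "torus = {\<zeta>. \<forall>i. norm (\<zeta> $ i) = 1}"

abbreviation angles :: "('n \<Rightarrow> real) measure" where "angles \<equiv> PiM UNIV (\<lambda>_::'n. angle)"

lemma cis_vec_measurable [measurable]:
  "(\<lambda>\<theta>. \<chi> i. cis (\<theta> i)) \<in> borel_measurable (angles :: ('n::finite \<Rightarrow> real) measure)"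
proof (rule borel_measurable_euclidean_space[THEN iffD2], rule ballI)
  fix b :: "complex ^ 'n" assume "b \<in> Basis"
  then obtain i u where "b = axis i u" by (auto simp: Basis_vec_def)
  then show "(\<lambda>\<theta>. (\<chi> i. cis (\<theta> i)) \<bullet> b) \<in> borel_measurable angles"
    by (simp add: inner_axis)
qed

lemma prob_space_angles: "prob_space (angles :: ('n::finite \<Rightarrow> real) measure)"
  by (intro prob_space_PiM angle.prob_space_axioms)

lemma torus_measure_eq: "torus_measure = distr angles borel (\<lambda>\<theta>. \<chi> i. cis (\<theta> i))"
  by (simp add: torus_measure_def)

lemma sets_torus_measure [measurable_cong, simp]: "sets torus_measure = sets borel"
  by (simp add: torus_measure_def)

lemma space_torus_measure [simp]: "space torus_measure = UNIV"
  by (simp add: torus_measure_def)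

interpretation torus: prob_space torus_measure
  unfolding torus_measure_eq by (rule prob_space.prob_space_distr[OF prob_space_angles]) measurable

lemma closed_torus: "closed (torus :: (complex ^ 'n::finite) set)"
proof -
  have "torus = (\<Inter>i. {\<zeta>::complex^'n. norm (\<zeta> $ i) = 1})" by (auto simp: torus_def)
  also have "closed \<dots>" by (intro closed_INT ballI closed_Collect_eq continuous_intros)
  finally show ?thesis .
qed

lemma torus_borel [measurable, simp]: "(torus :: (complex ^ 'n::finite) set) \<in> sets borel"
  by (rule borel_closed[OF closed_torus])

lemma AE_torus: "AE \<zeta> in (torus_measure :: (complex ^ 'n::finite) measure). \<zeta> \<in> torus"
proof -
  have "{x \<in> space borel. x \<in> (torus :: (complex ^ 'n) set)} \<in> sets borel" using torus_borel by simp
  then show ?thesis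
    unfolding torus_measure_eq by (subst AE_distr_iff[OF cis_vec_measurable]) (auto simp: torus_def)
qed

lemma emeasure_torus_measure [simp]: "emeasure (torus_measure :: (complex ^ 'n::finite) measure) UNIV = 1"
proof -
  have "emeasure (torus_measure :: (complex ^ 'n) measure) (space torus_measure) = 1" by (rule torus.emeasure_space_1)
  then show ?thesis by simp
qed

text \<open>Rotation by \<open>s\<close> on the representatives in [0, 2 pi] that carry
  \<open>angle\<close>; the circle measure is the image of an interval, so its invariance has to be
  proved there.\<close>

definition angle_shift :: "real \<Rightarrow> real \<Rightarrow> real" where
  "angle_shift s x = (if x + s \<le> 2*pi then x + s else x + s - 2*pi)"

lemma angle_shift_measurable [measurable]: "angle_shift s \<in> borel_measurable borel"
  unfolding angle_shift_def by measurable

lemma cis_angle_shift: "cis (angle_shift s x) = cis s * cis x"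
proof -
  have "cis (x + s - 2*pi) = cis (x + s) / cis (2*pi)" by (rule cis_divide[symmetric])
  then have "cis (x + s - 2*pi) = cis (x + s)" by simp
  moreover have "cis s * cis x = cis (x + s)" by (simp add: cis_mult add.commute)
  ultimately show ?thesis by (simp only: angle_shift_def if_cancel split: if_split) simp
qed

lemma nn_integral_angle_shift:
  assumes s: "0 \<le> s" "s \<le> 2*pi" and [measurable]: "f \<in> borel_measurable borel"
  shows "(\<integral>\<^sup>+x. f (angle_shift s x) \<partial>angle) = (\<integral>\<^sup>+x. f x \<partial>angle)"
proof -
  have nn: "(\<integral>\<^sup>+x. g x \<partial>angle) = (\<integral>\<^sup>+x. g x * indicator {0..2*pi} x \<partial>lborel) / emeasure lborel {0..2*pi}"
    if "g \<in> borel_measurable borel" for g :: "real \<Rightarrow> ennreal"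
    using that by (intro nn_integral_uniform_measure) auto
  have "(\<integral>\<^sup>+x. f (angle_shift s x) * indicator {0..2*pi} x \<partial>lborel)
     = (\<integral>\<^sup>+x. f (x + s) * indicator {0..2*pi - s} x + f (x + s - 2*pi) * indicator {2*pi - s<..2*pi} x \<partial>lborel)"
    by (rule nn_integral_cong) (use s in \<open>auto simp: angle_shift_def indicator_def\<close>)
  also have "\<dots> = (\<integral>\<^sup>+x. f (x + s) * indicator {0..2*pi - s} x \<partial>lborel) + (\<integral>\<^sup>+x. f (x + s - 2*pi) * indicator {2*pi - s<..2*pi} x \<partial>lborel)"
    by (rule nn_integral_add) measurable
  also have "(\<integral>\<^sup>+x. f (x + s) * indicator {0..2*pi - s} x \<partial>lborel) = (\<integral>\<^sup>+x. f x * indicator {s..2*pi} x \<partial>lborel)"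
    by (subst nn_integral_real_affine[where t="-s" and c=1 and f="\<lambda>x. f (x + s) * indicator {0..2*pi - s} x"])
       (auto intro!: nn_integral_cong simp: indicator_def)
  also have "(\<integral>\<^sup>+x. f (x + s - 2*pi) * indicator {2*pi - s<..2*pi} x \<partial>lborel) = (\<integral>\<^sup>+x. f x * indicator {0<..s} x \<partial>lborel)"
    by (subst nn_integral_real_affine[where t="2*pi - s" and c=1 and f="\<lambda>x. f (x + s - 2*pi) * indicator {2*pi - s<..2*pi} x"])
       (auto intro!: nn_integral_cong simp: indicator_def)
  also have "(\<integral>\<^sup>+x. f x * indicator {s..2*pi} x \<partial>lborel) + (\<integral>\<^sup>+x. f x * indicator {0<..s} x \<partial>lborel)
     = (\<integral>\<^sup>+x. f x * indicator {s..2*pi} x + f x * indicator {0<..s} x \<partial>lborel)"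
    by (rule nn_integral_add[symmetric]) measurable
  also have "\<dots> = (\<integral>\<^sup>+x. f x * indicator {0..2*pi} x \<partial>lborel)"
  proof (rule nn_integral_cong_AE)
    have "AE x in lborel. x \<noteq> s \<and> x \<noteq> (0::real)" using AE_lborel_singleton[of s] AE_lborel_singleton[of "0::real"] by eventually_elim simp
    then show "AE x in lborel. f x * indicator {s..2*pi} x + f x * indicator {0<..s} x = f x * indicator {0..2*pi} x"
      by eventually_elim (use s in \<open>auto simp: indicator_def\<close>)
  qed
  finally show ?thesis by (simp add: nn)
qed

lemma distr_angle_shift:
  assumes "0 \<le> s" "s \<le> 2*pi" shows "distr angle angle (angle_shift s) = angle"
proof (rule measure_eqI)
  fix A assume "A \<in> sets (distr angle angle (angle_shift s))"
  then have A [measurable]: "A \<in> sets borel" by simp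
  have "emeasure (distr angle angle (angle_shift s)) A = (\<integral>\<^sup>+x. indicator A x \<partial>distr angle angle (angle_shift s))" by simp
  also have "\<dots> = (\<integral>\<^sup>+x. indicator A (angle_shift s x) \<partial>angle)" by (rule nn_integral_distr) auto
  also have "\<dots> = (\<integral>\<^sup>+x. indicator A x \<partial>angle)" by (rule nn_integral_angle_shift[OF assms]) simp
  also have "\<dots> = emeasure angle A" by (rule nn_integral_indicator) simp
  finally show "emeasure (distr angle angle (angle_shift s)) A = emeasure angle A" .
qed simp

text \<open>Shifting every angle by the same amount preserves the product measure factor by factor,
  and on the torus it is multiplication by the unimodular scalar \<open>cis s\<close>.\<close>

lemma torus_rotation:
  fixes F :: "complex ^ 'n::finite \<Rightarrow> ennreal"
  assumes s: "0 \<le> s" "s \<le> 2*pi" and [measurable]: "F \<in> borel_measurable borel"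
  shows "(\<integral>\<^sup>+\<zeta>. F (cis s *s \<zeta>) \<partial>torus_measure) = (\<integral>\<^sup>+\<zeta>. F \<zeta> \<partial>torus_measure)"
proof -
  have c: "continuous_on UNIV (\<lambda>\<zeta>::complex^'n. cis s *s \<zeta>)"
    unfolding vector_scalar_mult_def by (intro continuous_intros)
  have [measurable]: "(\<lambda>\<zeta>::complex^'n. cis s *s \<zeta>) \<in> borel_measurable borel" by (rule borel_measurable_continuous_onI[OF c])
  have e: "distr (angles :: ('n \<Rightarrow> real) measure) angles (compose UNIV (angle_shift s)) = angles"
    by (subst distr_PiM_finite_prob_space') (auto simp: distr_angle_shift[OF s] angle.prob_space_axioms)
  have m: "compose UNIV (angle_shift s) \<in> (angles :: ('n \<Rightarrow> real) measure) \<rightarrow>\<^sub>M angles"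
    unfolding compose_def restrict_UNIV
  proof (rule measurable_PiM_single')
    show "(\<lambda>\<omega>. angle_shift s (\<omega> i)) \<in> (angles :: ('n \<Rightarrow> real) measure) \<rightarrow>\<^sub>M angle" for i
      by measurable
  qed (auto simp: space_PiM)
  have "(\<integral>\<^sup>+\<zeta>. F \<zeta> \<partial>torus_measure) = (\<integral>\<^sup>+\<theta>. F (\<chi> i. cis (\<theta> i)) \<partial>angles)"
    unfolding torus_measure_eq by (rule nn_integral_distr) auto
  also have "\<dots> = (\<integral>\<^sup>+\<theta>. F (\<chi> i. cis (\<theta> i)) \<partial>distr angles angles (compose UNIV (angle_shift s)))" by (simp only: e)
  also have "\<dots> = (\<integral>\<^sup>+\<theta>. F (\<chi> i. cis (compose UNIV (angle_shift s) \<theta> i)) \<partial>angles)"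
    by (rule nn_integral_distr[OF m]) measurable
  also have "\<dots> = (\<integral>\<^sup>+\<theta>. F (cis s *s (\<chi> i. cis (\<theta> i))) \<partial>angles)"
    by (simp add: compose_def cis_angle_shift vector_scalar_mult_def)
  also have "\<dots> = (\<integral>\<^sup>+\<zeta>. F (cis s *s \<zeta>) \<partial>torus_measure)"
    unfolding torus_measure_eq by (rule nn_integral_distr[symmetric]) auto
  finally show ?thesis ..
qed

section \<open>Disintegration of the torus into circles\<close>

lemma continuous_scalar_mult_vec:
  "continuous_on S f \<Longrightarrow> continuous_on S g \<Longrightarrow> continuous_on S (\<lambda>x. f x *s (g x :: complex ^ 'n::finite))"
  unfolding vector_scalar_mult_def by (intro continuous_intros)

text \<open>Rotation invariance averaged over the rotation angle, followed by Fubini. It reduces a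
  mean over the torus to means of one-variable slices, to which the disc theory applies.\<close>

lemma torus_slice_integral:
  fixes F :: "complex ^ 'n::finite \<Rightarrow> ennreal"
  assumes [measurable]: "F \<in> borel_measurable borel"
  shows "(\<integral>\<^sup>+\<zeta>. F \<zeta> \<partial>torus_measure) = (\<integral>\<^sup>+\<zeta>. \<integral>\<^sup>+t. F (cis t *s \<zeta>) \<partial>angle \<partial>torus_measure)"
proof -
  interpret pair_sigma_finite "torus_measure :: (complex ^ 'n) measure" angle
    by (intro pair_sigma_finite.intro) unfold_locales
  have c: "continuous_on UNIV (\<lambda>x::(complex ^ 'n) \<times> real. cis (snd x) *s fst x)"
    by (intro continuous_scalar_mult_vec continuous_intros)
  have "(\<lambda>x::(complex ^ 'n) \<times> real. cis (snd x) *s fst x) \<in> borel_measurable borel" by (rule borel_measurable_continuous_onI[OF c])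
  then have [measurable]: "(\<lambda>x::(complex ^ 'n) \<times> real. cis (snd x) *s fst x) \<in> borel_measurable (borel \<Otimes>\<^sub>M borel)"
    by (simp add: borel_prod)
  have m: "(\<lambda>(\<zeta>, t). F (cis t *s \<zeta>)) \<in> borel_measurable (torus_measure \<Otimes>\<^sub>M angle)"
    unfolding case_prod_beta by measurable
  have "(\<integral>\<^sup>+\<zeta>. \<integral>\<^sup>+t. F (cis t *s \<zeta>) \<partial>angle \<partial>torus_measure) = (\<integral>\<^sup>+t. \<integral>\<^sup>+\<zeta>. F (cis t *s \<zeta>) \<partial>torus_measure \<partial>angle)"
    using Fubini'[OF m] by simp
  also have "\<dots> = (\<integral>\<^sup>+t. (\<integral>\<^sup>+\<zeta>. F \<zeta> \<partial>torus_measure) \<partial>angle)"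
  proof (rule nn_integral_cong_AE)
    have "AE t in angle. t \<in> {0..2*pi}" by (rule AE_uniform_measureI) auto
    then show "AE t in angle. (\<integral>\<^sup>+\<zeta>. F (cis t *s \<zeta>) \<partial>torus_measure) = (\<integral>\<^sup>+\<zeta>. F \<zeta> \<partial>torus_measure)"
      by eventually_elim (rule torus_rotation, auto)
  qed
  also have "\<dots> = (\<integral>\<^sup>+\<zeta>. F \<zeta> \<partial>torus_measure)" using angle.emeasure_space_1 by simp
  finally show ?thesis ..
qed

lemma scale_torus_polydisc: "\<zeta> \<in> torus \<Longrightarrow> norm t < 1 \<Longrightarrow> t *s \<zeta> \<in> polydisc"
  by (auto simp: torus_def polydisc_def norm_mult)

lemma holomorphic_pd_continuous: "holomorphic_pd F \<Longrightarrow> continuous_on polydisc F"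
  unfolding holomorphic_pd_def
  by (meson continuous_at_imp_continuous_on has_derivative_continuous)

lemma slice_holomorphic:
  fixes \<phi> :: "complex ^ 'n::finite \<Rightarrow> complex"
  assumes "holomorphic_pd \<phi>" "\<zeta> \<in> torus"
  shows "slice \<phi> \<zeta> holomorphic_on ball 0 1"
proof (rule holomorphic_onI, rule field_differentiable_at_within)
  fix z :: complex assume z: "z \<in> ball 0 1"
  then have "z *s \<zeta> \<in> polydisc" using scale_torus_polydisc[OF assms(2)] by simp
  then obtain L where L: "(\<phi> has_derivative L) (at (z *s \<zeta>))" and lin: "\<And>c v. L (c *s v) = c * L v"
    using assms(1) unfolding holomorphic_pd_def by blast
  have "bounded_linear (\<lambda>t::complex. t *s \<zeta>)"
  proof (rule bounded_linear_intro[where K = "norm \<zeta>"])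
    show "norm (x *s \<zeta>) \<le> norm x * norm \<zeta>" for x :: complex
    proof -
      have "(\<lambda>i. norm ((x *s \<zeta>) $ i)) = (\<lambda>i. norm x * norm (\<zeta> $ i))" by (simp add: norm_mult)
      then show ?thesis unfolding norm_vec_def by (simp add: L2_set_right_distrib)
    qed
  qed (auto simp: vec_eq_iff algebra_simps)
  then have d: "((\<lambda>t. t *s \<zeta>) has_derivative (\<lambda>t. t *s \<zeta>)) (at z)" by (rule bounded_linear_imp_has_derivative)
  have "(slice \<phi> \<zeta> has_derivative (\<lambda>t. L (t *s \<zeta>))) (at z)"
    unfolding slice_def by (rule has_derivative_compose[OF d L])
  moreover have "(\<lambda>t. L (t *s \<zeta>)) = (*) (L \<zeta>)" by (rule ext) (simp add: lin mult.commute)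
  ultimately have "(slice \<phi> \<zeta> has_field_derivative L \<zeta>) (at z)"
    unfolding has_field_derivative_def by simp
  then show "slice \<phi> \<zeta> field_differentiable at z" by (auto simp: field_differentiable_def)
qed

lemma slice_compose: "slice (f \<circ> \<phi>) \<zeta> = (\<lambda>z. f (slice \<phi> \<zeta> z))"
  by (simp add: slice_def fun_eq_iff)

lemma torus_mean_slice:
  fixes F :: "complex ^ 'n::finite \<Rightarrow> complex"
  assumes F: "continuous_on polydisc F" and r: "0 < r" "r < 1"
  shows "(\<integral>\<^sup>+\<zeta>. ennreal ((norm (F (r *\<^sub>R \<zeta>)))\<^sup>2) \<partial>torus_measure)
    = (\<integral>\<^sup>+\<zeta>. \<integral>\<^sup>+t. ennreal ((norm (slice F \<zeta> (of_real r * cis t)))\<^sup>2) \<partial>angle \<partial>torus_measure)"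
proof -
  have c: "continuous_on torus (\<lambda>\<zeta>. (norm (F (r *\<^sub>R \<zeta>)))\<^sup>2)"
    by (intro continuous_intros continuous_on_compose2[OF F]) (use r in \<open>auto simp: torus_def polydisc_def\<close>)
  define F0 where "F0 = (\<lambda>\<zeta>. ennreal (indicator torus \<zeta> *\<^sub>R (norm (F (r *\<^sub>R \<zeta>)))\<^sup>2))"
  have m: "F0 \<in> borel_measurable borel" unfolding F0_def
    by (intro measurable_compose[OF borel_measurable_continuous_on_indicator[OF torus_borel c] measurable_ennreal])
  have "(\<integral>\<^sup>+\<zeta>. ennreal ((norm (F (r *\<^sub>R \<zeta>)))\<^sup>2) \<partial>torus_measure) = (\<integral>\<^sup>+\<zeta>. F0 \<zeta> \<partial>torus_measure)"
    by (rule nn_integral_cong_AE) (use AE_torus in \<open>eventually_elim, simp add: F0_def\<close>)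
  also have "\<dots> = (\<integral>\<^sup>+\<zeta>. \<integral>\<^sup>+t. F0 (cis t *s \<zeta>) \<partial>angle \<partial>torus_measure)" by (rule torus_slice_integral[OF m])
  also have "\<dots> = (\<integral>\<^sup>+\<zeta>. \<integral>\<^sup>+t. ennreal ((norm (slice F \<zeta> (of_real r * cis t)))\<^sup>2) \<partial>angle \<partial>torus_measure)"
  proof (rule nn_integral_cong_AE)
    show "AE \<zeta> in torus_measure. (\<integral>\<^sup>+t. F0 (cis t *s \<zeta>) \<partial>angle) = (\<integral>\<^sup>+t. ennreal ((norm (slice F \<zeta> (of_real r * cis t)))\<^sup>2) \<partial>angle)"
      using AE_torus
    proof eventually_elim
      case (elim \<zeta>)
      have "r *\<^sub>R (cis t *s \<zeta>) = (of_real r * cis t) *s \<zeta>" for t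
        by (simp add: vec_eq_iff scaleR_conv_of_real[where 'a=complex] mult.assoc)
      moreover have "cis t *s \<zeta> \<in> torus" for t using elim by (simp add: torus_def norm_mult)
      ultimately show ?case by (simp add: F0_def slice_def)
    qed
  qed
  finally show ?thesis .
qed

definition slice_values :: "(complex ^ 'n \<Rightarrow> complex) \<Rightarrow> real \<Rightarrow> complex ^ 'n \<Rightarrow> real \<Rightarrow> complex" where
  "slice_values \<phi> r \<zeta> t = indicator torus \<zeta> *\<^sub>R slice \<phi> \<zeta> (of_real r * cis t)"

lemma slice_values_measurable:
  fixes \<phi> :: "complex ^ 'n::finite \<Rightarrow> complex"
  assumes \<phi>: "continuous_on polydisc \<phi>" and r: "0 < r" "r < 1"
  shows "(\<lambda>x. slice_values \<phi> r (fst x) (snd x)) \<in> borel_measurable (borel \<Otimes>\<^sub>M borel)"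
proof -
  have c: "continuous_on (torus \<times> UNIV) (\<lambda>x. slice \<phi> (fst x) (of_real r * cis (snd x)))"
    unfolding slice_def
    by (intro continuous_on_compose2[OF \<phi>] continuous_scalar_mult_vec continuous_intros)
       (use r in \<open>auto intro!: scale_torus_polydisc simp: norm_mult\<close>)
  have cl: "closed (torus \<times> (UNIV :: real set) :: ((complex ^ 'n) \<times> real) set)" by (intro closed_Times closed_torus closed_UNIV)
  have "(\<lambda>x. indicator (torus \<times> UNIV) x *\<^sub>R slice \<phi> (fst x) (of_real r * cis (snd x))) \<in> borel_measurable borel"
    by (rule borel_measurable_continuous_on_indicator[OF borel_closed[OF cl] c])
  also have "(\<lambda>x. indicator (torus \<times> UNIV) x *\<^sub>R slice \<phi> (fst x) (of_real r * cis (snd x))) = (\<lambda>x. slice_values \<phi> r (fst x) (snd x))"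
    by (auto simp: fun_eq_iff slice_values_def indicator_def)
  finally show ?thesis by (simp add: borel_prod)
qed

text \<open>\<open>mean_log\<close> of the slice at \<open>\<zeta>\<close>, with slice values cut
  off outside the torus and with \<open>\<phi> 0\<close> in place of the common centre value; in
  this form it is jointly Borel in \<open>\<zeta>\<close> and \<open>w\<close>.\<close>

definition slice_log :: "(complex ^ 'n \<Rightarrow> complex) \<Rightarrow> real \<Rightarrow> complex ^ 'n \<Rightarrow> complex \<Rightarrow> real" where
  "slice_log \<phi> r \<zeta> w = (\<integral>t. ln (norm (slice_values \<phi> r \<zeta> t - w)) \<partial>angle) - ln (norm (\<phi> 0 - w))"

lemma slice_log_eq: "\<zeta> \<in> torus \<Longrightarrow> slice_log \<phi> r \<zeta> w = mean_log (slice \<phi> \<zeta>) r w"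
  by (simp add: slice_log_def slice_values_def mean_log_def slice_def)

lemma slice_log_measurable:
  fixes \<phi> :: "complex ^ 'n::finite \<Rightarrow> complex"
  assumes \<phi>: "continuous_on polydisc \<phi>" and r: "0 < r" "r < 1"
  shows "(\<lambda>x. slice_log \<phi> r (fst x) (snd x)) \<in> borel_measurable (borel \<Otimes>\<^sub>M borel)"
proof -
  have "(\<lambda>x. slice_values \<phi> r (fst x) (snd x)) \<in> borel_measurable (borel \<Otimes>\<^sub>M borel)" by (rule slice_values_measurable[OF assms])
  from measurable_compose[OF _ this, where f = "\<lambda>y. (fst (fst y), snd y)" and M = "(borel \<Otimes>\<^sub>M borel) \<Otimes>\<^sub>M borel"]
  have [measurable]: "(\<lambda>y::((complex^'n) \<times> complex) \<times> real. slice_values \<phi> r (fst (fst y)) (snd y)) \<in> borel_measurable ((borel \<Otimes>\<^sub>M borel) \<Otimes>\<^sub>M borel)"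
    by simp
  have "(\<lambda>x::(complex^'n) \<times> complex. \<integral>t. ln (norm (slice_values \<phi> r (fst x) t - snd x)) \<partial>angle) \<in> borel_measurable (borel \<Otimes>\<^sub>M borel)"
  proof (rule angle.borel_measurable_lebesgue_integral)
    have "(\<lambda>y::((complex^'n) \<times> complex) \<times> real. ln (norm (slice_values \<phi> r (fst (fst y)) (snd y) - snd (fst y)))) \<in> borel_measurable ((borel \<Otimes>\<^sub>M borel) \<Otimes>\<^sub>M borel)"
      by measurable
    then show "(\<lambda>(x, t). ln (norm (slice_values \<phi> r (fst x) t - snd x))) \<in> borel_measurable ((borel \<Otimes>\<^sub>M borel) \<Otimes>\<^sub>M angle)"
      by (simp add: case_prod_beta cong: measurable_cong_sets sets_pair_measure_cong)
  qed
  then show ?thesis unfolding slice_log_def by measurable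
qed

definition mean_counting :: "(complex ^ 'n \<Rightarrow> complex) \<Rightarrow> nat \<Rightarrow> complex \<Rightarrow> ennreal" where
  "mean_counting \<phi> k w = (\<integral>\<^sup>+\<zeta>. ennreal (slice_log \<phi> (radius k) \<zeta> w) \<partial>torus_measure)"

text \<open>The torus average N of the Nevanlinna functions, built from truncated logarithmic means
  because these are visibly measurable in \<open>\<zeta>\<close>. \<open>nevanlinna_slices\<close>
  makes the identification for \<open>w\<close> different from \<open>\<phi> 0\<close>.\<close>

definition counting :: "(complex ^ 'n \<Rightarrow> complex) \<Rightarrow> complex \<Rightarrow> ennreal" where
  "counting \<phi> w = (SUP k. mean_counting \<phi> k w)"

lemma mean_counting_le: "mean_counting \<phi> k w \<le> counting \<phi> w"
  unfolding counting_def by (rule SUP_upper) simp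

section \<open>Averaged counting functions and composition\<close>

locale polydisc_self_map =
  fixes \<phi> :: "complex ^ 'n::finite \<Rightarrow> complex"
  assumes hol: "holomorphic_pd \<phi>" and maps: "\<phi> ` polydisc \<subseteq> ball 0 1"
begin

lemma cont: "continuous_on polydisc \<phi>" by (rule holomorphic_pd_continuous[OF hol])

lemma slice_hol: "\<zeta> \<in> torus \<Longrightarrow> slice \<phi> \<zeta> holomorphic_on ball 0 1"
  by (rule slice_holomorphic[OF hol])

lemma slice_maps: "\<zeta> \<in> torus \<Longrightarrow> slice \<phi> \<zeta> ` ball 0 1 \<subseteq> ball 0 1"
  using maps scale_torus_polydisc by (fastforce simp: slice_def)

lemma slice_0 [simp]: "slice \<phi> \<zeta> 0 = \<phi> 0" by (simp add: slice_def)

lemma norm_phi0: "norm (\<phi> 0) < 1"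
proof -
  have "(0 :: complex ^ 'n) \<in> polydisc" by (simp add: polydisc_def)
  then show ?thesis using maps by (auto simp: image_subset_iff)
qed

lemma slice_log_meas1 [measurable]: "(\<lambda>\<zeta>. slice_log \<phi> (radius k) \<zeta> w) \<in> borel_measurable borel"
proof -
  have m: "(\<lambda>x. slice_log \<phi> (radius k) (fst x) (snd x)) \<in> borel_measurable (borel \<Otimes>\<^sub>M borel)"
    by (rule slice_log_measurable[OF cont radius(1,2)])
  from measurable_compose[OF _ m, where f = "\<lambda>\<zeta>. (\<zeta>, w)" and M = borel] show ?thesis by simp
qed

lemma nevanlinna_slices:
  assumes w: "w \<noteq> \<phi> 0"
  shows "(\<integral>\<^sup>+\<zeta>. nevanlinna (slice \<phi> \<zeta>) w * c \<partial>torus_measure) = counting \<phi> w * c"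
proof -
  \<comment> \<open>The cut-off makes the sequence Borel and increasing at every point rather than
    at almost every point, as monotone convergence is used in its pointwise form.\<close>
  define S where "S = (\<lambda>k \<zeta>. ennreal (indicator torus \<zeta> * slice_log \<phi> (radius k) \<zeta> w))"
  have S: "S k \<zeta> = ennreal (mean_log (slice \<phi> \<zeta>) (radius k) w)" if "\<zeta> \<in> torus" for k \<zeta>
    using that by (simp add: S_def slice_log_eq)
  have S0: "S k \<zeta> = 0" if "\<zeta> \<notin> torus" for k \<zeta> using that by (simp add: S_def)
  have [measurable]: "S k \<in> borel_measurable borel" for k unfolding S_def by measurable
  have inc: "incseq S"
  proof (rule incseq_SucI, rule le_funI)
    fix k \<zeta>
    show "S k \<zeta> \<le> S (Suc k) \<zeta>"
      using nevanlinna_eq_SUP(2)[OF slice_hol, of \<zeta> w] w S S0 by (cases "\<zeta> \<in> torus") (auto simp: incseq_Suc_iff)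
  qed
  have "(\<integral>\<^sup>+\<zeta>. nevanlinna (slice \<phi> \<zeta>) w * c \<partial>torus_measure) = (\<integral>\<^sup>+\<zeta>. (SUP k. S k \<zeta>) * c \<partial>torus_measure)"
  proof (rule nn_integral_cong_AE)
    show "AE \<zeta> in torus_measure. nevanlinna (slice \<phi> \<zeta>) w * c = (SUP k. S k \<zeta>) * c"
      using AE_torus
    proof eventually_elim
      case (elim \<zeta>)
      show ?case using nevanlinna_eq_SUP(1)[OF slice_hol[OF elim], of w] w S[OF elim] by simp
    qed
  qed
  also have "\<dots> = (\<integral>\<^sup>+\<zeta>. (SUP k. S k \<zeta>) \<partial>torus_measure) * c" by (rule nn_integral_multc) measurable
  also have "(\<integral>\<^sup>+\<zeta>. (SUP k. S k \<zeta>) \<partial>torus_measure) = (SUP k. \<integral>\<^sup>+\<zeta>. S k \<zeta> \<partial>torus_measure)"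
    by (rule nn_integral_monotone_convergence_SUP[OF inc]) simp
  also have "\<dots> = counting \<phi> w"
    unfolding counting_def mean_counting_def
  proof (intro SUP_cong refl nn_integral_cong_AE)
    show "AE \<zeta> in torus_measure. S k \<zeta> = ennreal (slice_log \<phi> (radius k) \<zeta> w)" for k
      using AE_torus by eventually_elim (simp add: S_def)
  qed
  finally show ?thesis .
qed

lemma counting_le:
  assumes w: "w \<noteq> \<phi> 0" "norm w < 1"
  shows "counting \<phi> w \<le> ennreal (ln (norm (1 - cnj w * \<phi> 0) / norm (\<phi> 0 - w)))" (is "_ \<le> ennreal ?c")
  unfolding counting_def
proof (rule SUP_least)
  fix k
  have "mean_counting \<phi> k w \<le> (\<integral>\<^sup>+\<zeta>. ennreal ?c \<partial>(torus_measure :: (complex ^ 'n) measure))"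
    unfolding mean_counting_def
  proof (rule nn_integral_mono_AE)
    show "AE \<zeta> in torus_measure. ennreal (slice_log \<phi> (radius k) \<zeta> w) \<le> ennreal ?c"
      using AE_torus
    proof eventually_elim
      case (elim \<zeta>)
      show ?case using mean_log_le_pseudohyperbolic[OF slice_hol[OF elim] slice_maps[OF elim] _ w(2) radius(1,2)[of k]] w(1)
        by (auto intro!: ennreal_leI simp: slice_log_eq[OF elim])
    qed
  qed
  then show "mean_counting \<phi> k w \<le> ennreal ?c" by simp
qed

lemma torus_mean_mono:
  fixes F :: "complex ^ 'n \<Rightarrow> complex"
  assumes F: "holomorphic_pd F" and rs: "0 < s" "s < r" "r < 1"
  shows "(\<integral>\<^sup>+\<zeta>. ennreal ((norm (F (s *\<^sub>R \<zeta>)))\<^sup>2) \<partial>torus_measure) \<le> (\<integral>\<^sup>+\<zeta>. ennreal ((norm (F (r *\<^sub>R \<zeta>)))\<^sup>2) \<partial>torus_measure)"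
proof -
  have rs': "s < 1" "0 < r" using rs by auto
  show ?thesis
    unfolding torus_mean_slice[OF holomorphic_pd_continuous[OF F] rs(1) rs'(1)] torus_mean_slice[OF holomorphic_pd_continuous[OF F] rs'(2) rs(3)]
  proof (rule nn_integral_mono_AE)
    show "AE \<zeta> in torus_measure. (\<integral>\<^sup>+t. ennreal ((norm (slice F \<zeta> (of_real s * cis t)))\<^sup>2) \<partial>angle) \<le> (\<integral>\<^sup>+t. ennreal ((norm (slice F \<zeta> (of_real r * cis t)))\<^sup>2) \<partial>angle)"
      using AE_torus
    proof eventually_elim
      case (elim \<zeta>)
      have h: "slice F \<zeta> holomorphic_on ball 0 1" by (rule slice_holomorphic[OF F elim])
      show ?case unfolding nn_integral_sqmean[OF h rs(1) rs'(1)] nn_integral_sqmean[OF h rs'(2) rs(3)]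
        by (rule ennreal_leI) (rule sqmean_mono[OF h rs])
    qed
  qed
qed

text \<open>The torus means increase with the radius, slice by slice, so a cofinal sequence of radii
  decides the supremum.\<close>

lemma H2_poly_means_le:
  fixes F :: "complex ^ 'n \<Rightarrow> complex"
  assumes F: "holomorphic_pd F" and le: "\<And>k. (\<integral>\<^sup>+\<zeta>. ennreal ((norm (F (radius k *\<^sub>R \<zeta>)))\<^sup>2) \<partial>torus_measure) \<le> K"
  shows "H2_poly_means F \<le> K"
  unfolding H2_poly_means_def
proof (rule SUP_least)
  fix r :: real assume "r \<in> {0<..<1}"
  then have r: "0 < r" "r < 1" by auto
  have "\<forall>\<^sub>F k in sequentially. r < radius k" by (rule order_tendstoD(1)[OF radius_tendsto r(2)])
  then obtain k where "r < radius k" by (auto simp: eventually_sequentially)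
  from torus_mean_mono[OF F r(1) this radius(2)] le[of k]
  show "(\<integral>\<^sup>+\<zeta>. ennreal ((norm (F (r *\<^sub>R \<zeta>)))\<^sup>2) \<partial>torus_measure) \<le> K" by (rule order_trans)
qed

lemma holomorphic_pd_compose:
  assumes f: "f holomorphic_on ball 0 1" shows "holomorphic_pd (f \<circ> \<phi>)"
  unfolding holomorphic_pd_def
proof
  fix z :: "complex ^ 'n" assume z: "z \<in> polydisc"
  then obtain L where L: "(\<phi> has_derivative L) (at z)" and lin: "\<And>c v. L (c *s v) = c * L v"
    using hol unfolding holomorphic_pd_def by blast
  have "\<phi> z \<in> ball 0 1" using maps z by auto
  then have "(f has_field_derivative deriv f (\<phi> z)) (at (\<phi> z))" using f by (intro holomorphic_derivI) auto
  then have "(f has_derivative (\<lambda>h. deriv f (\<phi> z) * h)) (at (\<phi> z))" by (simp add: has_field_derivative_def)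
  from has_derivative_compose[OF L this] have "(f \<circ> \<phi> has_derivative (\<lambda>v. deriv f (\<phi> z) * L v)) (at z)" by (simp add: o_def)
  then show "\<exists>L. (f \<circ> \<phi> has_derivative L) (at z) \<and> (\<forall>c v. L (c *s v) = c * L v)"
    using lin by (intro exI[of _ "\<lambda>v. deriv f (\<phi> z) * L v"]) (simp add: mult_ac)
qed

text \<open>Littlewood-Paley on each slice, then Tonelli to move the torus average onto the
  logarithmic means. Enlarging the slice-dependent disc to the unit disc costs equality but makes
  the domain of integration common to all slices.\<close>

lemma composition_mean_le:
  assumes f: "f holomorphic_on ball 0 1"
  shows "(\<integral>\<^sup>+\<zeta>. ennreal ((norm (f (\<phi> (radius k *\<^sub>R \<zeta>))))\<^sup>2) \<partial>torus_measure)
    \<le> ennreal ((norm (f (\<phi> 0)))\<^sup>2) + ennreal (1/c0) * (\<integral>\<^sup>+w. ennreal ((norm (deriv f w))\<^sup>2) * indicator (ball 0 1) w * mean_counting \<phi> k w \<partial>lborel)"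
proof -
  have fp: "continuous_on polydisc (f \<circ> \<phi>)" by (rule holomorphic_pd_continuous[OF holomorphic_pd_compose[OF f]])
  define r where "r = radius k"
  have r: "0 < r" "r < 1" by (auto simp: r_def radius)
  define D where "D = (\<lambda>w. indicator (ball 0 1) w * (norm (deriv f w))\<^sup>2)"
  have D0: "0 \<le> D w" for w by (simp add: D_def)
  have cD: "continuous_on (ball 0 1) (\<lambda>w. (norm (deriv f w))\<^sup>2)"
    by (intro continuous_intros holomorphic_on_imp_continuous_on holomorphic_deriv f) auto
  have [measurable]: "D \<in> borel_measurable borel"
    using borel_measurable_continuous_on_indicator[OF _ cD] by (simp add: D_def)
  have sl: "(\<lambda>x. slice_log \<phi> r (fst x) (snd x)) \<in> borel_measurable (borel \<Otimes>\<^sub>M borel)" by (rule slice_log_measurable[OF cont r])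
  interpret pair_sigma_finite "torus_measure :: (complex ^ 'n) measure" "lborel :: complex measure"
    by (intro pair_sigma_finite.intro) unfold_locales
  have mm: "(\<lambda>(\<zeta>, w). ennreal (D w) * ennreal (slice_log \<phi> r \<zeta> w)) \<in> borel_measurable (torus_measure \<Otimes>\<^sub>M lborel)"
  proof -
    have "(\<lambda>x. ennreal (D (snd x)) * ennreal (slice_log \<phi> r (fst x) (snd x))) \<in> borel_measurable (borel \<Otimes>\<^sub>M (borel :: complex measure))"
      using sl by measurable
    then show ?thesis by (simp add: case_prod_beta cong: measurable_cong_sets sets_pair_measure_cong)
  qed
  have mI: "(\<lambda>\<zeta>. \<integral>\<^sup>+w. ennreal (D w) * ennreal (slice_log \<phi> r \<zeta> w) \<partial>lborel) \<in> borel_measurable torus_measure"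
    using lborel.borel_measurable_nn_integral[OF mm] by simp
  have pt: "(\<integral>\<^sup>+t. ennreal ((norm (slice (f \<circ> \<phi>) \<zeta> (of_real r * cis t)))\<^sup>2) \<partial>angle)
     \<le> ennreal ((norm (f (\<phi> 0)))\<^sup>2) + ennreal (1/c0) * (\<integral>\<^sup>+w. ennreal (D w) * ennreal (slice_log \<phi> r \<zeta> w) \<partial>lborel)" if \<zeta>: "\<zeta> \<in> torus" for \<zeta>
  proof -
    let ?g = "slice \<phi> \<zeta>"
    note gh = slice_hol[OF \<zeta>]
    have h: "slice (f \<circ> \<phi>) \<zeta> holomorphic_on ball 0 1" by (rule slice_holomorphic[OF holomorphic_pd_compose[OF f] \<zeta>])
    have cg: "compact (?g ` cball 0 r)"
      by (intro compact_continuous_image continuous_on_subset[OF holomorphic_on_imp_continuous_on[OF gh]]) (use r in auto)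
    have "compact (norm ` ?g ` cball 0 r)" by (rule compact_continuous_image[OF _ cg]) (intro continuous_intros)
    moreover have "norm ` ?g ` cball 0 r \<noteq> {}" using r by auto
    ultimately obtain m where m: "m \<in> norm ` ?g ` cball 0 r" "\<And>x. x \<in> norm ` ?g ` cball 0 r \<Longrightarrow> x \<le> m"
      using compact_attains_sup[of "norm ` ?g ` cball 0 r"] by blast
    from m(1) obtain z where "norm z \<le> r" "m = norm (?g z)" by auto
    then have "m < 1" using slice_maps[OF \<zeta>] r by (auto simp: image_subset_iff)
    \<comment> \<open>The image of the closed disc of radius r is compact in the unit disc, hence
      has maximal modulus m < 1; any radius strictly between m and 1 serves.\<close>
    define R where "R = (m + 1) / 2"
    have R: "R < 1" "m < R" using \<open>m < 1\<close> by (auto simp: R_def)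
    have gR: "norm (?g z) < R" if "norm z \<le> r" for z using m(2)[of "norm (?g z)"] that R by (auto intro: le_less_trans)
    note LP = Littlewood_Paley[OF f gh r R(1) gR]
    let ?I = "\<lambda>w. indicator (ball 0 R) w * (norm (deriv f w))\<^sup>2 * mean_log ?g r w"
    have AE0: "AE w in lborel. 0 \<le> ?I w"
      using AE_lborel_singleton[of "\<phi> 0"]
    proof eventually_elim
      case (elim w)
      then show ?case using mean_log_nonneg[OF gh _ r, of w] by simp
    qed
    have "(\<integral>w. ?I w \<partial>lborel) \<ge> 0" by (rule integral_nonneg_AE[OF AE0])
    define J where "J = (\<integral>w. ?I w \<partial>lborel)"
    have J0: "0 \<le> J" unfolding J_def by (rule integral_nonneg_AE[OF AE0])
    have "ennreal J = (\<integral>\<^sup>+w. ennreal (?I w) \<partial>lborel)"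
      unfolding J_def by (rule nn_integral_eq_integral[symmetric, OF LP(1) AE0])
    also have "\<dots> \<le> (\<integral>\<^sup>+w. ennreal (D w) * ennreal (slice_log \<phi> r \<zeta> w) \<partial>lborel)"
    proof (rule nn_integral_mono)
      fix w
      show "ennreal (?I w) \<le> ennreal (D w) * ennreal (slice_log \<phi> r \<zeta> w)"
        unfolding slice_log_eq[OF \<zeta>] using R
        by (cases "norm w < R") (auto simp: D_def ennreal_mult'[symmetric])
    qed
    finally have Jle: "ennreal J \<le> (\<integral>\<^sup>+w. ennreal (D w) * ennreal (slice_log \<phi> r \<zeta> w) \<partial>lborel)" .
    have "sqmean (slice (f \<circ> \<phi>) \<zeta>) r = (norm (f (\<phi> 0)))\<^sup>2 + (1/c0) * J"
      using LP(2) by (simp add: sqmean_def slice_compose J_def)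
    then have "ennreal (sqmean (slice (f \<circ> \<phi>) \<zeta>) r) = ennreal ((norm (f (\<phi> 0)))\<^sup>2) + ennreal (1/c0) * ennreal J"
      using J0 c0_pos by (simp only: ennreal_mult'[symmetric] zero_le_divide_1_iff less_imp_le ennreal_plus[symmetric] zero_le_power2 mult_nonneg_nonneg)
    then show ?thesis
      unfolding nn_integral_sqmean[OF h r] using Jle by (simp only:) (intro add_left_mono mult_left_mono, auto)
  qed
  have "(\<integral>\<^sup>+\<zeta>. ennreal ((norm (f (\<phi> (r *\<^sub>R \<zeta>))))\<^sup>2) \<partial>torus_measure) = (\<integral>\<^sup>+\<zeta>. \<integral>\<^sup>+t. ennreal ((norm (slice (f \<circ> \<phi>) \<zeta> (of_real r * cis t)))\<^sup>2) \<partial>angle \<partial>torus_measure)"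
    using torus_mean_slice[OF fp r] by simp
  also have "\<dots> \<le> (\<integral>\<^sup>+\<zeta>. ennreal ((norm (f (\<phi> 0)))\<^sup>2) + ennreal (1/c0) * (\<integral>\<^sup>+w. ennreal (D w) * ennreal (slice_log \<phi> r \<zeta> w) \<partial>lborel) \<partial>(torus_measure :: (complex ^ 'n) measure))"
  proof (rule nn_integral_mono_AE)
    show "AE \<zeta> in torus_measure. (\<integral>\<^sup>+t. ennreal ((norm (slice (f \<circ> \<phi>) \<zeta> (of_real r * cis t)))\<^sup>2) \<partial>angle)
     \<le> ennreal ((norm (f (\<phi> 0)))\<^sup>2) + ennreal (1/c0) * (\<integral>\<^sup>+w. ennreal (D w) * ennreal (slice_log \<phi> r \<zeta> w) \<partial>lborel)"
      using AE_torus by eventually_elim (rule pt)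
  qed
  also have "\<dots> = ennreal ((norm (f (\<phi> 0)))\<^sup>2) + ennreal (1/c0) * (\<integral>\<^sup>+\<zeta>. \<integral>\<^sup>+w. ennreal (D w) * ennreal (slice_log \<phi> r \<zeta> w) \<partial>lborel \<partial>(torus_measure :: (complex ^ 'n) measure))"
    using mI by (subst nn_integral_add) (auto simp: nn_integral_cmult)
  also have "(\<integral>\<^sup>+\<zeta>. \<integral>\<^sup>+w. ennreal (D w) * ennreal (slice_log \<phi> r \<zeta> w) \<partial>lborel \<partial>(torus_measure :: (complex ^ 'n) measure))
    = (\<integral>\<^sup>+w. \<integral>\<^sup>+\<zeta>. ennreal (D w) * ennreal (slice_log \<phi> r \<zeta> w) \<partial>(torus_measure :: (complex ^ 'n) measure) \<partial>lborel)"
    using Fubini'[OF mm] by simp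
  also have "\<dots> = (\<integral>\<^sup>+w. ennreal ((norm (deriv f w))\<^sup>2) * indicator (ball 0 1) w * mean_counting \<phi> k w \<partial>lborel)"
  proof (rule nn_integral_cong)
    fix w
    have Dw: "ennreal (D w) = ennreal ((norm (deriv f w))\<^sup>2) * indicator (ball 0 1) w" by (simp add: D_def indicator_def)
    show "(\<integral>\<^sup>+\<zeta>. ennreal (D w) * ennreal (slice_log \<phi> r \<zeta> w) \<partial>(torus_measure :: (complex ^ 'n) measure)) = ennreal ((norm (deriv f w))\<^sup>2) * indicator (ball 0 1) w * mean_counting \<phi> k w"
      unfolding Dw[symmetric] mean_counting_def r_def by (rule nn_integral_cmult) simp
  qed
  finally show ?thesis unfolding r_def .
qed

end

section \<open>Lower bounds for composition operators\<close>

lemma AE_circle_nonzero: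
  assumes g: "g holomorphic_on ball 0 1" "g 0 \<noteq> 0" and r: "0 < r" "r < 1"
  shows "AE t in angle. g (of_real r * cis t) \<noteq> 0"
proof -
  have fin: "finite {z \<in> cball 0 r. g z = 0}" by (rule finite_zeros_disc[OF g r(2)])
  have "AE t in angle. \<forall>z\<in>{z \<in> cball 0 r. g z = 0}. cis t \<noteq> z / of_real r"
    by (subst AE_ball_countable) (use fin AE_angle_cis_neq in \<open>auto intro: countable_finite\<close>)
  then show ?thesis
  proof eventually_elim
    case (elim t)
    show ?case
    proof
      assume "g (of_real r * cis t) = 0"
      then have "of_real r * cis t \<in> {z \<in> cball 0 r. g z = 0}" using r by (simp add: norm_mult)
      then show False using elim r by force
    qed
  qed
qed

text \<open>The function \<open>2 ln s\<close> with its pole replaced by a tangent parabola: the positive Laplacian of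
  \<open>s\<^sup>2\<close> is confined to \<open>s \<le> 1\<close>, where the lower bound on the derivative pays for subtracting it.\<close>

definition capped_log :: "real \<Rightarrow> real" where
  "capped_log s = (if s \<le> 1 then s\<^sup>2 - 1 else 2 * ln s)"

lemma two_ln_le: "0 < s \<Longrightarrow> 2 * ln s \<le> s\<^sup>2 - 1" for s :: real
  using ln_le_minus_one[of "s\<^sup>2"] by (simp add: ln_realpow)

lemma capped_log_le: "0 \<le> s \<Longrightarrow> capped_log s \<le> s\<^sup>2 - 1"
  using two_ln_le[of s] by (auto simp: capped_log_def)

lemma capped_log_ge: "0 < s \<Longrightarrow> 2 * ln s \<le> capped_log s"
  using two_ln_le[of s] by (auto simp: capped_log_def)

lemma capped_log_eq_ln: "1 \<le> s \<Longrightarrow> capped_log s = 2 * ln s"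
  by (auto simp: capped_log_def)

lemma continuous_capped_log: "continuous_on {0..} capped_log"
proof -
  have "continuous_on ({0..1} \<union> {1..}) (\<lambda>s::real. if s \<le> 1 then s\<^sup>2 - 1 else 2 * ln s)"
    by (rule continuous_on_cases) (auto intro!: continuous_intros)
  also have "{0..1} \<union> {1..} = {0::real..}" by auto
  finally show ?thesis unfolding capped_log_def .
qed

text \<open>Where |g - w| > rho the capped logarithm is twice the real part of a branch of log (g -
  w) up to a constant, hence harmonic, and |F|^2 is sub-mean.\<close>

lemma submean_minus_log:
  fixes F g :: "complex \<Rightarrow> complex"
  assumes F: "F holomorphic_on ball 0 1" and g: "g holomorphic_on ball 0 1" and a: "norm a < r" "r < 1"
    and gt: "\<rho> < norm (g a - w)" and \<rho>: "0 < \<rho>" and k: "0 \<le> k"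
  shows "submean (\<lambda>z. (norm (F z))\<^sup>2 - k * capped_log (norm (g z - w) / \<rho>)) a"
proof -
  have a1: "a \<in> ball 0 1" using a by simp
  define U where "U = ball 0 1 \<inter> (\<lambda>z. norm (g z - w)) -` {\<rho><..}"
  have "open U" unfolding U_def
    by (intro continuous_open_preimage continuous_intros holomorphic_on_imp_continuous_on[OF g]) auto
  moreover have "a \<in> U" using a1 gt by (simp add: U_def)
  ultimately obtain d where d: "d > 0" "ball a d \<subseteq> U" using openE by blast
  have big: "\<rho> < norm (g z - w)" "norm z < 1" if "z \<in> ball a d" for z using d that by (auto simp: U_def)
  have gh: "(\<lambda>z. g z - w) holomorphic_on ball a d"
    by (intro holomorphic_intros holomorphic_on_subset[OF g]) (use big in auto)
  have nz: "g z - w \<noteq> 0" if "z \<in> ball a d" for z using big[OF that] \<rho> by auto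
  obtain L where L: "L holomorphic_on ball a d" "\<And>z. z \<in> ball a d \<Longrightarrow> g z - w = exp (L z)"
    using contractible_imp_holomorphic_log[OF gh convex_imp_contractible[OF convex_ball] nz] by blast
  have eq: "capped_log (norm (g z - w) / \<rho>) = 2 * (Re (L z) - ln \<rho>)" if z: "z \<in> ball a d" for z
  proof -
    have "1 \<le> norm (g z - w) / \<rho>" using big[OF z] \<rho> by (simp add: le_divide_eq)
    then have "capped_log (norm (g z - w) / \<rho>) = 2 * ln (norm (g z - w) / \<rho>)" by (rule capped_log_eq_ln)
    also have "\<dots> = 2 * (ln (norm (g z - w)) - ln \<rho>)" using nz[OF z] \<rho> by (simp add: ln_div)
    also have "ln (norm (g z - w)) = Re (L z)" using L(2)[OF z] by simp
    finally show ?thesis .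
  qed
  show ?thesis unfolding submean_def
  proof (intro allI impI)
    fix e :: real assume e: "e > 0"
    have "\<forall>\<^sub>F \<tau> in at_right 0. 0 < \<tau> \<and> \<tau> < d"
      using d by (auto simp: eventually_at_right_field intro!: exI[of _ d])
    with mean_expansion_norm_square[OF F open_ball a1 e]
    show "\<forall>\<^sub>F \<tau> in at_right 0. (norm (F a))\<^sup>2 - k * capped_log (norm (g a - w) / \<rho>) - e * \<tau>\<^sup>2
       \<le> (\<integral>t. (norm (F (a + of_real \<tau> * cis t)))\<^sup>2 - k * capped_log (norm (g (a + of_real \<tau> * cis t) - w) / \<rho>) \<partial>angle)"
    proof eventually_elim
      case (elim \<tau>)
      have inb: "a + of_real \<tau> * cis t \<in> ball a d" for t using elim by (simp add: dist_norm norm_mult)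
      have cL: "continuous_on UNIV (\<lambda>t. L (a + of_real \<tau> * cis t))"
        by (rule continuous_on_circle[OF holomorphic_on_imp_continuous_on[OF L(1)]]) (use elim in auto)
      have cF: "continuous_on UNIV (\<lambda>t. F (a + of_real \<tau> * cis t))"
        by (rule continuous_on_compose2[OF holomorphic_on_imp_continuous_on[OF F]]) (use big inb in \<open>auto intro!: continuous_intros\<close>)
      have i1: "integrable angle (\<lambda>t. (norm (F (a + of_real \<tau> * cis t)))\<^sup>2)"
        by (intro integrable_angle_continuous continuous_on_power continuous_on_norm cF)
      have i2: "integrable angle (\<lambda>t. Re (L (a + of_real \<tau> * cis t)))"
        by (intro integrable_angle_continuous continuous_on_Re cL)
      have ReL: "(\<integral>t. Re (L (a + of_real \<tau> * cis t)) \<partial>angle) = Re (L a)"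
        using angle_mean_value[OF L(1), of \<tau>] elim integral_Re[OF integrable_angle_continuous[OF cL]] by simp
      have "(\<integral>t. (norm (F (a + of_real \<tau> * cis t)))\<^sup>2 - k * capped_log (norm (g (a + of_real \<tau> * cis t) - w) / \<rho>) \<partial>angle)
         = (\<integral>t. (norm (F (a + of_real \<tau> * cis t)))\<^sup>2 - k * (2 * (Re (L (a + of_real \<tau> * cis t)) - ln \<rho>)) \<partial>angle)"
        by (simp only: eq[OF inb])
      also have "\<dots> = (\<integral>t. (norm (F (a + of_real \<tau> * cis t)))\<^sup>2 \<partial>angle) - k * (2 * (Re (L a) - ln \<rho>))"
        using i1 i2 angle.prob_space by (simp add: ReL)
      also have "k * (2 * (Re (L a) - ln \<rho>)) = k * capped_log (norm (g a - w) / \<rho>)" using eq[of a] d by simp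
      finally have "(\<integral>t. (norm (F (a + of_real \<tau> * cis t)))\<^sup>2 - k * capped_log (norm (g (a + of_real \<tau> * cis t) - w) / \<rho>) \<partial>angle)
        = (\<integral>t. (norm (F (a + of_real \<tau> * cis t)))\<^sup>2 \<partial>angle) - k * capped_log (norm (g a - w) / \<rho>)" .
      moreover have "0 \<le> \<tau>\<^sup>2 * (norm (deriv F a))\<^sup>2" by simp
      ultimately show ?case using elim(1) unfolding abs_le_iff by linarith
    qed
  qed
qed

text \<open>The capped logarithm lies below its parabola everywhere and meets it at
  \<open>a\<close>, so it may be replaced by it. What is then subtracted is kappa (|g - w|^2 -
  rho^2), whose quarter Laplacian kappa |g'|^2 is covered by |F'|^2. Touching from above also
  handles |g a - w| = rho, where the cap changes formula.\<close>

lemma submean_minus_square: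
  fixes F g :: "complex \<Rightarrow> complex"
  assumes F: "F holomorphic_on ball 0 1" and g: "g holomorphic_on ball 0 1" and a: "norm a < r" "r < 1"
    and le: "norm (g a - w) \<le> \<rho>" and \<rho>: "0 < \<rho>" and \<kappa>: "0 \<le> \<kappa>"
    and deriv_ge: "\<kappa> * (norm (deriv g a))\<^sup>2 \<le> (norm (deriv F a))\<^sup>2"
  shows "submean (\<lambda>z. (norm (F z))\<^sup>2 - \<kappa> * \<rho>\<^sup>2 * capped_log (norm (g z - w) / \<rho>)) a"
proof -
  have a1: "a \<in> ball 0 1" using a by simp
  have gw: "(\<lambda>z. g z - w) holomorphic_on ball 0 1" using g by (intro holomorphic_intros)
  have dgw: "deriv (\<lambda>z. g z - w) a = deriv g a"
    using g a1 by (subst deriv_diff) (auto intro: holomorphic_on_imp_differentiable_at)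
  have at_a: "\<kappa> * \<rho>\<^sup>2 * capped_log (norm (g a - w) / \<rho>) = \<kappa> * ((norm (g a - w))\<^sup>2 - \<rho>\<^sup>2)"
  proof -
    have "norm (g a - w) / \<rho> \<le> 1" using le \<rho> by (simp add: divide_le_eq)
    then have "capped_log (norm (g a - w) / \<rho>) = (norm (g a - w))\<^sup>2 / \<rho>\<^sup>2 - 1" by (simp add: capped_log_def power_divide)
    then show ?thesis using \<rho> by (simp add: right_diff_distrib)
  qed
  have le_all: "\<kappa> * \<rho>\<^sup>2 * capped_log (norm (g z - w) / \<rho>) \<le> \<kappa> * ((norm (g z - w))\<^sup>2 - \<rho>\<^sup>2)" for z
  proof -
    have "\<kappa> * \<rho>\<^sup>2 * capped_log (norm (g z - w) / \<rho>) \<le> \<kappa> * \<rho>\<^sup>2 * ((norm (g z - w) / \<rho>)\<^sup>2 - 1)"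
      using \<rho> \<kappa> by (intro mult_left_mono capped_log_le) auto
    also have "\<dots> = \<kappa> * ((norm (g z - w))\<^sup>2 - \<rho>\<^sup>2)" using \<rho> by (simp add: power_divide right_diff_distrib)
    finally show ?thesis .
  qed
  show ?thesis unfolding submean_def
  proof (intro allI impI)
    fix e :: real assume e: "e > 0"
    \<comment> \<open>The second error is multiplied by kappa later; kappa / (kappa + 1) <= 1 keeps
      the product below e/2, also for kappa = 0.\<close>
    have e1: "e/2 > 0" "e / (2 * (\<kappa> + 1)) > 0" using e \<kappa> by auto
    have "\<forall>\<^sub>F \<tau> in at_right 0. 0 < \<tau> \<and> \<tau> < 1 - norm a"
      using a by (auto simp: eventually_at_right_field intro!: exI[of _ "1 - norm a"])
    with mean_expansion_norm_square[OF F open_ball a1 e1(1)] mean_expansion_norm_square[OF gw open_ball a1 e1(2)]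
    show "\<forall>\<^sub>F \<tau> in at_right 0. (norm (F a))\<^sup>2 - \<kappa> * \<rho>\<^sup>2 * capped_log (norm (g a - w) / \<rho>) - e * \<tau>\<^sup>2
       \<le> (\<integral>t. (norm (F (a + of_real \<tau> * cis t)))\<^sup>2 - \<kappa> * \<rho>\<^sup>2 * capped_log (norm (g (a + of_real \<tau> * cis t) - w) / \<rho>) \<partial>angle)"
    proof eventually_elim
      case (elim \<tau>)
      have nb: "norm (a + of_real \<tau> * cis t) < 1" for t
        using norm_triangle_ineq[of a "of_real \<tau> * cis t"] elim by (simp add: norm_mult)
      have cF: "continuous_on UNIV (\<lambda>t. F (a + of_real \<tau> * cis t))" "continuous_on UNIV (\<lambda>t. g (a + of_real \<tau> * cis t))"
        by (rule continuous_on_compose2[OF holomorphic_on_imp_continuous_on], rule F g, use nb in \<open>auto intro!: continuous_intros\<close>)+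
      define A where "A = (\<integral>t. (norm (F (a + of_real \<tau> * cis t)))\<^sup>2 \<partial>angle)"
      define B where "B = (\<integral>t. (norm (g (a + of_real \<tau> * cis t) - w))\<^sup>2 \<partial>angle)"
      have i1: "integrable angle (\<lambda>t. (norm (F (a + of_real \<tau> * cis t)))\<^sup>2)"
        and i2: "integrable angle (\<lambda>t. (norm (g (a + of_real \<tau> * cis t) - w))\<^sup>2)"
        by (intro integrable_angle_continuous continuous_intros cF)+
      have i3: "integrable angle (\<lambda>t. (norm (F (a + of_real \<tau> * cis t)))\<^sup>2 - \<kappa> * \<rho>\<^sup>2 * capped_log (norm (g (a + of_real \<tau> * cis t) - w) / \<rho>))"
        by (intro integrable_angle_continuous continuous_on_diff continuous_on_mult continuous_on_const continuous_on_compose2[OF continuous_capped_log] continuous_on_power continuous_on_norm continuous_on_divide cF)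
           (use \<rho> in auto)
      have "A - \<kappa> * (B - \<rho>\<^sup>2) = (\<integral>t. (norm (F (a + of_real \<tau> * cis t)))\<^sup>2 - \<kappa> * ((norm (g (a + of_real \<tau> * cis t) - w))\<^sup>2 - \<rho>\<^sup>2) \<partial>angle)"
        using i1 i2 angle.prob_space by (simp add: A_def B_def)
      also have "\<dots> \<le> (\<integral>t. (norm (F (a + of_real \<tau> * cis t)))\<^sup>2 - \<kappa> * \<rho>\<^sup>2 * capped_log (norm (g (a + of_real \<tau> * cis t) - w) / \<rho>) \<partial>angle)"
        by (rule integral_mono[OF _ i3]) (use i1 i2 le_all in auto)
      finally have low: "A - \<kappa> * (B - \<rho>\<^sup>2) \<le> (\<integral>t. (norm (F (a + of_real \<tau> * cis t)))\<^sup>2 - \<kappa> * \<rho>\<^sup>2 * capped_log (norm (g (a + of_real \<tau> * cis t) - w) / \<rho>) \<partial>angle)" .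
      have hA: "A \<ge> (norm (F a))\<^sup>2 + \<tau>\<^sup>2 * (norm (deriv F a))\<^sup>2 - e/2 * \<tau>\<^sup>2"
        using elim(1) unfolding A_def abs_le_iff by linarith
      have hB: "B \<le> (norm (g a - w))\<^sup>2 + \<tau>\<^sup>2 * (norm (deriv g a))\<^sup>2 + e / (2 * (\<kappa> + 1)) * \<tau>\<^sup>2"
        using elim(2) unfolding dgw B_def abs_le_iff by linarith
      have "\<kappa> * (B - \<rho>\<^sup>2) \<le> \<kappa> * ((norm (g a - w))\<^sup>2 + \<tau>\<^sup>2 * (norm (deriv g a))\<^sup>2 + e / (2 * (\<kappa> + 1)) * \<tau>\<^sup>2 - \<rho>\<^sup>2)"
        using hB \<kappa> by (intro mult_left_mono) auto
      also have "\<dots> = \<kappa> * ((norm (g a - w))\<^sup>2 - \<rho>\<^sup>2) + \<tau>\<^sup>2 * (\<kappa> * (norm (deriv g a))\<^sup>2) + (\<kappa> / (\<kappa> + 1)) * (e / 2 * \<tau>\<^sup>2)"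
      proof -
        have "\<kappa> * (e / (2 * (\<kappa> + 1)) * \<tau>\<^sup>2) = (\<kappa> / (\<kappa> + 1)) * (e / 2 * \<tau>\<^sup>2)" by simp
        then show ?thesis by (simp only: distrib_left right_diff_distrib mult.left_commute[of \<kappa> "\<tau>\<^sup>2"])
      qed
      also have "\<dots> \<le> \<kappa> * ((norm (g a - w))\<^sup>2 - \<rho>\<^sup>2) + \<tau>\<^sup>2 * (norm (deriv F a))\<^sup>2 + 1 * (e / 2 * \<tau>\<^sup>2)"
        using \<kappa> e deriv_ge by (intro add_mono mult_left_mono mult_right_mono) (auto simp: divide_le_eq)
      finally show ?case using hA low unfolding at_a by linarith
    qed
  qed
qed

text \<open>The two preceding lemmas make |f o g|^2 - kappa rho^2 times the capped logarithm
  sub-mean on the whole disc. At the centre |g 0 - w| >= rho, so the cap equals 2 ln (|g 0 - w| /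
  rho), while on the circle it dominates 2 ln (|g - w| / rho); the difference of the two is twice
  \<open>mean_log\<close>.\<close>

lemma sqmean_lower_bound:
  assumes f: "f holomorphic_on ball 0 1" and g: "g holomorphic_on ball 0 1" "g ` ball 0 1 \<subseteq> ball 0 1"
    and r: "0 < r" "r < 1" and \<rho>: "0 < \<rho>" "\<rho> \<le> norm (g 0 - w)" and \<kappa>: "0 \<le> \<kappa>"
    and deriv_ge: "\<And>z. norm (z - w) \<le> \<rho> \<Longrightarrow> norm z < 1 \<Longrightarrow> \<kappa> \<le> (norm (deriv f z))\<^sup>2"
  shows "2 * (\<kappa> * \<rho>\<^sup>2) * mean_log g r w \<le> sqmean (\<lambda>z. f (g z)) r"
proof -
  let ?F = "\<lambda>z. f (g z)"
  have F: "?F holomorphic_on ball 0 1"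
    using holomorphic_on_compose_gen[OF g(1) f] g(2) by (simp add: o_def)
  define \<Psi> where "\<Psi> = (\<lambda>z. (norm (?F z))\<^sup>2 - \<kappa> * \<rho>\<^sup>2 * capped_log (norm (g z - w) / \<rho>))"
  have sub: "cball 0 r \<subseteq> ball (0::complex) 1" using r by auto
  have c: "continuous_on (cball 0 r) ?F" "continuous_on (cball 0 r) g"
    using F g(1) sub by (meson continuous_on_subset holomorphic_on_imp_continuous_on)+
  have c\<Psi>: "continuous_on (cball 0 r) \<Psi>" unfolding \<Psi>_def
    by (intro continuous_on_diff continuous_on_mult continuous_on_const continuous_on_compose2[OF continuous_capped_log] continuous_on_power continuous_on_norm continuous_on_divide c)
       (use \<rho> in auto)
  have sm: "submean \<Psi> a" if a: "norm a < r" for a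
  proof (cases "norm (g a - w) \<le> \<rho>")
    case True
    have a1: "a \<in> ball 0 1" using a r by simp
    have "g a \<in> ball 0 1" by (rule g(2)[THEN subsetD, OF imageI[OF a1]])
    then have "deriv ?F a = deriv f (g a) * deriv g a"
      using deriv_chain[of g a f] holomorphic_on_imp_differentiable_at[OF f] holomorphic_on_imp_differentiable_at[OF g(1)] a1
      by (simp add: o_def)
    moreover have "\<kappa> \<le> (norm (deriv f (g a)))\<^sup>2" using deriv_ge[OF True] \<open>g a \<in> ball 0 1\<close> by simp
    ultimately have "\<kappa> * (norm (deriv g a))\<^sup>2 \<le> (norm (deriv ?F a))\<^sup>2"
      by (simp add: norm_mult power_mult_distrib mult_right_mono)
    from submean_minus_square[OF F g(1) a r(2) True \<rho>(1) \<kappa> this] show ?thesis by (simp add: \<Psi>_def)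
  next
    case False
    then show ?thesis unfolding \<Psi>_def
      by (intro submean_minus_log[OF F g(1) a r(2) _ \<rho>(1)]) (use \<kappa> in auto)
  qed
  have gw: "(\<lambda>z. g z - w) holomorphic_on ball 0 1" using g by (intro holomorphic_intros)
  have nz: "g 0 - w \<noteq> 0" using \<rho> by auto
  have J: "integrable angle (\<lambda>t. ln (norm (g (of_real r * cis t) - w)))" using Jensen[OF gw nz r] by blast
  have cg: "continuous_on UNIV (\<lambda>t. g (of_real r * cis t))" by (rule holomorphic_continuous_cis[OF g(1)]) (use r in auto)
  have icap: "integrable angle (\<lambda>t. capped_log (norm (g (of_real r * cis t) - w) / \<rho>))"
    by (intro integrable_angle_continuous continuous_on_compose2[OF continuous_capped_log] continuous_on_divide continuous_on_norm continuous_on_diff continuous_on_const cg)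
       (use \<rho> in auto)
  have "2 * ((\<integral>t. ln (norm (g (of_real r * cis t) - w)) \<partial>angle) - ln \<rho>) = (\<integral>t. 2 * (ln (norm (g (of_real r * cis t) - w)) - ln \<rho>) \<partial>angle)"
    using J angle.prob_space by simp
  also have "\<dots> \<le> (\<integral>t. capped_log (norm (g (of_real r * cis t) - w) / \<rho>) \<partial>angle)"
  proof (rule integral_mono_AE[OF _ icap])
    show "integrable angle (\<lambda>t. 2 * (ln (norm (g (of_real r * cis t) - w)) - ln \<rho>))" using J by simp
    show "AE t in angle. 2 * (ln (norm (g (of_real r * cis t) - w)) - ln \<rho>) \<le> capped_log (norm (g (of_real r * cis t) - w) / \<rho>)"
      using AE_circle_nonzero[OF gw nz r]
    proof eventually_elim
      case (elim t)
      then have "2 * ln (norm (g (of_real r * cis t) - w) / \<rho>) \<le> capped_log (norm (g (of_real r * cis t) - w) / \<rho>)"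
        using \<rho> by (intro capped_log_ge) auto
      then show ?case using elim \<rho> by (simp add: ln_div)
    qed
  qed
  finally have cap: "2 * ((\<integral>t. ln (norm (g (of_real r * cis t) - w)) \<partial>angle) - ln \<rho>) \<le> (\<integral>t. capped_log (norm (g (of_real r * cis t) - w) / \<rho>) \<partial>angle)" .
  have cap0: "capped_log (norm (g 0 - w) / \<rho>) = 2 * (ln (norm (g 0 - w)) - ln \<rho>)"
    using \<rho> nz by (subst capped_log_eq_ln) (auto simp: le_divide_eq ln_div)
  have "\<Psi> 0 \<le> (\<integral>t. \<Psi> (of_real r * cis t) \<partial>angle)" by (rule submean_center[OF c\<Psi> r(1) sm])
  also have "\<dots> = sqmean ?F r - \<kappa> * \<rho>\<^sup>2 * (\<integral>t. capped_log (norm (g (of_real r * cis t) - w) / \<rho>) \<partial>angle)"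
    unfolding \<Psi>_def sqmean_def using integrable_sqmean[OF F r] icap by simp
  finally have "\<kappa> * \<rho>\<^sup>2 * (\<integral>t. capped_log (norm (g (of_real r * cis t) - w) / \<rho>) \<partial>angle) - \<kappa> * \<rho>\<^sup>2 * capped_log (norm (g 0 - w) / \<rho>) + (norm (?F 0))\<^sup>2 \<le> sqmean ?F r"
    by (simp add: \<Psi>_def)
  moreover have "\<kappa> * \<rho>\<^sup>2 * (2 * ((\<integral>t. ln (norm (g (of_real r * cis t) - w)) \<partial>angle) - ln \<rho>)) \<le> \<kappa> * \<rho>\<^sup>2 * (\<integral>t. capped_log (norm (g (of_real r * cis t) - w) / \<rho>) \<partial>angle)"
    using cap \<kappa> by (intro mult_left_mono) auto
  moreover have "2 * (\<kappa> * \<rho>\<^sup>2) * mean_log g r w = \<kappa> * \<rho>\<^sup>2 * (2 * ((\<integral>t. ln (norm (g (of_real r * cis t) - w)) \<partial>angle) - ln \<rho>)) - \<kappa> * \<rho>\<^sup>2 * capped_log (norm (g 0 - w) / \<rho>)"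
    unfolding cap0 mean_log_def by (simp add: algebra_simps)
  ultimately show ?thesis using zero_le_power2[of "norm (?F 0)"] by linarith
qed

context polydisc_self_map
begin

lemma composition_mean_ge:
  assumes f: "f holomorphic_on ball 0 1" and \<rho>: "0 < \<rho>" "\<rho> \<le> norm (\<phi> 0 - w)" and \<kappa>: "0 \<le> \<kappa>"
    and deriv_ge: "\<And>z. norm (z - w) \<le> \<rho> \<Longrightarrow> norm z < 1 \<Longrightarrow> \<kappa> \<le> (norm (deriv f z))\<^sup>2"
  shows "ennreal (2 * (\<kappa> * \<rho>\<^sup>2)) * counting \<phi> w \<le> H2_poly_means (f \<circ> \<phi>)"
proof -
  have fh: "holomorphic_pd (f \<circ> \<phi>)" by (rule holomorphic_pd_compose[OF f])
  have "ennreal (2 * (\<kappa> * \<rho>\<^sup>2)) * mean_counting \<phi> k w \<le> H2_poly_means (f \<circ> \<phi>)" for k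
  proof -
    have "ennreal (2 * (\<kappa> * \<rho>\<^sup>2)) * mean_counting \<phi> k w = (\<integral>\<^sup>+\<zeta>. ennreal (2 * (\<kappa> * \<rho>\<^sup>2)) * ennreal (slice_log \<phi> (radius k) \<zeta> w) \<partial>torus_measure)"
      unfolding mean_counting_def by (rule nn_integral_cmult[symmetric]) simp
    also have "\<dots> \<le> (\<integral>\<^sup>+\<zeta>. \<integral>\<^sup>+t. ennreal ((norm (slice (f \<circ> \<phi>) \<zeta> (of_real (radius k) * cis t)))\<^sup>2) \<partial>angle \<partial>torus_measure)"
    proof (rule nn_integral_mono_AE)
      show "AE \<zeta> in torus_measure. ennreal (2 * (\<kappa> * \<rho>\<^sup>2)) * ennreal (slice_log \<phi> (radius k) \<zeta> w)
         \<le> (\<integral>\<^sup>+t. ennreal ((norm (slice (f \<circ> \<phi>) \<zeta> (of_real (radius k) * cis t)))\<^sup>2) \<partial>angle)"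
        using AE_torus
      proof eventually_elim
        case (elim \<zeta>)
        have "2 * (\<kappa> * \<rho>\<^sup>2) * mean_log (slice \<phi> \<zeta>) (radius k) w \<le> sqmean (slice (f \<circ> \<phi>) \<zeta>) (radius k)"
          unfolding slice_compose
          by (rule sqmean_lower_bound[OF f slice_hol[OF elim] slice_maps[OF elim] radius(1,2) \<rho>(1) _ \<kappa> deriv_ge]) (use \<rho> in auto)
        then show ?case
          unfolding nn_integral_sqmean[OF slice_holomorphic[OF fh elim] radius(1,2)] slice_log_eq[OF elim]
          using \<kappa> by (subst ennreal_mult'[symmetric]) (auto intro: ennreal_leI)
      qed
    qed
    also have "\<dots> = (\<integral>\<^sup>+\<zeta>. ennreal ((norm ((f \<circ> \<phi>) (radius k *\<^sub>R \<zeta>)))\<^sup>2) \<partial>torus_measure)"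
      by (rule torus_mean_slice[symmetric, OF holomorphic_pd_continuous[OF fh] radius(1,2)])
    also have "\<dots> \<le> H2_poly_means (f \<circ> \<phi>)"
      unfolding H2_poly_means_def by (rule SUP_upper) (use radius[of k] in auto)
    finally show ?thesis .
  qed
  then show ?thesis unfolding counting_def SUP_mult_left_ennreal by (intro SUP_least)
qed

text \<open>With p = phi(0), A = |1 - conj(w) p| and B = |p - w| one has A^2 - B^2 = (1 - |w|^2) (1
  - |p|^2), of order 1 - |w|. Then ln (A/B) <= A/B - 1 = (A^2 - B^2) / (B (A + B)), and B >= (1 -
  |p|)/2 because |w| is beyond the midpoint between |p| and 1.\<close>

lemma counting_linear_bound:
  obtains C where "C > 0" "\<And>w::complex. (1 + norm (\<phi> 0)) / 2 \<le> norm w \<Longrightarrow> norm w < 1 \<Longrightarrow> counting \<phi> w \<le> ennreal (C * (1 - norm w))"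
proof
  define p where "p = \<phi> 0"
  have p: "norm p < 1" using norm_phi0 by (simp add: p_def)
  show "4 / (1 - norm (\<phi> 0))\<^sup>2 > 0" using norm_phi0 by simp
  fix w :: complex assume w: "(1 + norm (\<phi> 0)) / 2 \<le> norm w" "norm w < 1"
  define A where "A = norm (1 - cnj w * p)" define B where "B = norm (p - w)"
  have Bge: "B \<ge> (1 - norm p) / 2" using w norm_triangle_ineq3[of w p] by (simp add: B_def p_def norm_minus_commute abs_le_iff)
  have Bp: "B > 0" by (rule less_le_trans[OF _ Bge]) (use p in simp)
  have AB: "A\<^sup>2 - B\<^sup>2 = (1 - (norm w)\<^sup>2) * (1 - (norm p)\<^sup>2)"
    unfolding A_def B_def cmod_power2 by (simp add: power2_eq_square algebra_simps)
  also have "\<dots> \<le> (2 * (1 - norm w)) * 1"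
  proof (rule mult_mono)
    have "1 - (norm w)\<^sup>2 = (1 + norm w) * (1 - norm w)" by (simp add: power2_eq_square algebra_simps)
    also have "\<dots> \<le> 2 * (1 - norm w)" using w by (intro mult_right_mono) auto
    finally show "1 - (norm w)\<^sup>2 \<le> 2 * (1 - norm w)" .
  qed (use w p in \<open>auto simp: abs_square_le_1\<close>)
  finally have d: "A\<^sup>2 - B\<^sup>2 \<le> 2 * (1 - norm w)" by simp
  have "0 \<le> A\<^sup>2 - B\<^sup>2" unfolding AB using w p by (intro mult_nonneg_nonneg) (auto simp: abs_square_le_1)
  then have "B\<^sup>2 \<le> A\<^sup>2" by simp
  moreover have "0 \<le> A" by (simp add: A_def)
  ultimately have "B \<le> A" by (rule power2_le_imp_le)
  have "0 < A / B" using Bp \<open>B \<le> A\<close> by simp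
  then have "ln (A / B) \<le> A / B - 1" by (rule ln_le_minus_one)
  also have "\<dots> = (A\<^sup>2 - B\<^sup>2) / (B * (A + B))" using Bp \<open>B \<le> A\<close> 
  proof -
    have "A / B - 1 = (A - B) / B" using Bp by (simp add: diff_divide_distrib)
    also have "\<dots> = ((A - B) * (A + B)) / (B * (A + B))" using Bp \<open>B \<le> A\<close> by simp
    also have "(A - B) * (A + B) = A\<^sup>2 - B\<^sup>2" by (simp add: power2_eq_square algebra_simps)
    finally show ?thesis .
  qed
  also have "\<dots> \<le> 2 * (1 - norm w) / (B * (A + B))" using d Bp \<open>B \<le> A\<close> by (intro divide_right_mono) auto
  also have "\<dots> \<le> 2 * (1 - norm w) / (2 * ((1 - norm p) / 2)\<^sup>2)"
  proof (rule divide_left_mono)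
    have "2 * ((1 - norm p) / 2)\<^sup>2 \<le> 2 * B\<^sup>2" using Bge p by (intro mult_left_mono power_mono) auto
    also have "\<dots> \<le> B * (A + B)" using Bp \<open>B \<le> A\<close> by (simp add: power2_eq_square algebra_simps)
    finally show "2 * ((1 - norm p) / 2)\<^sup>2 \<le> B * (A + B)" .
  qed (use w p Bp \<open>B \<le> A\<close> in \<open>auto intro!: mult_pos_pos\<close>)
  also have "\<dots> = 4 / (1 - norm p)\<^sup>2 * (1 - norm w)" by (simp add: power_divide)
  finally have "ln (A / B) \<le> 4 / (1 - norm p)\<^sup>2 * (1 - norm w)" .
  moreover have "counting \<phi> w \<le> ennreal (ln (A / B))"
    using counting_le[of w] w Bp by (auto simp: A_def B_def p_def)
  ultimately show "counting \<phi> w \<le> ennreal (4 / (1 - norm (\<phi> 0))\<^sup>2 * (1 - norm w))"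
    unfolding p_def by (auto intro: order_trans ennreal_leI)
qed

end

section \<open>Kernels of the model space\<close>

lemma Moebius_function_derivative:
  assumes "1 - cnj w * z \<noteq> 0"
  shows "(Moebius_function 0 w has_field_derivative (1 - of_real ((norm w)\<^sup>2)) / (1 - cnj w * z)\<^sup>2) (at z)"
proof -
  have "((\<lambda>z. (z - w) / (1 - cnj w * z)) has_field_derivative
      (1 * (1 - cnj w * z) - (z - w) * (- cnj w)) / ((1 - cnj w * z) * (1 - cnj w * z))) (at z)"
    using assms by (auto intro!: derivative_eq_intros)
  moreover have "1 * (1 - cnj w * z) - (z - w) * (- cnj w) = 1 - of_real ((norm w)\<^sup>2)"
    unfolding complex_norm_square by (simp add: algebra_simps)
  ultimately show ?thesis unfolding Moebius_function_simple[abs_def] power2_eq_square[of "1 - cnj w * z"] by (simp only:)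
qed

text \<open>Automorphisms of the disc move \<open>w\<close> and \<open>f w\<close> to 0; the Schwarz
  lemma bounds the derivative of the conjugated map there, and the chain rule translates
  back.\<close>

lemma Schwarz_Pick:
  assumes f: "f holomorphic_on ball 0 1" "\<And>z. norm z < 1 \<Longrightarrow> norm (f z) < 1" and w: "norm w < 1"
  shows "norm (deriv f w) * (1 - (norm w)\<^sup>2) \<le> 1 - (norm (f w))\<^sup>2"
proof -
  let ?A = "Moebius_function 0 (- w)" and ?B = "Moebius_function 0 (f w)"
  have A1: "norm (?A z) < 1" if "norm z < 1" for z using Moebius_function_norm_lt_1[of "- w" z 0] w that by simp
  have A0: "?A 0 = w" by (simp add: Moebius_function_simple)
  have B1: "norm (?B z) < 1" if "norm z < 1" for z using Moebius_function_norm_lt_1[OF f(2)[OF w] that] .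
  have hA: "?A holomorphic_on ball 0 1" using Moebius_function_holomorphic[of "- w"] w by simp
  have hB: "?B holomorphic_on ball 0 1" by (rule Moebius_function_holomorphic[OF f(2)[OF w]])
  define g where "g = ?B \<circ> (f \<circ> ?A)"
  have g: "g holomorphic_on ball 0 1" unfolding g_def
    by (intro holomorphic_on_compose_gen[OF _ hB] holomorphic_on_compose_gen[OF hA f(1)]) (use A1 f in auto)
  have g1: "norm (g z) < 1" if "norm z < 1" for z unfolding g_def using B1[OF f(2)[OF A1[OF that]]] by simp
  have g0: "g 0 = 0" by (simp add: g_def A0 Moebius_function_eq_zero)
  have n: "norm (deriv g 0) \<le> 1" by (rule Schwarz_Lemma(2)[OF g g0 g1, of 0]) auto
  have fw: "(norm (f w))\<^sup>2 < 1" "(norm w)\<^sup>2 < 1" using f(2)[OF w] w by (auto simp: abs_square_less_1)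
  have e: "1 - cnj (f w) * f w = of_real (1 - (norm (f w))\<^sup>2)"
    by (simp only: of_real_diff complex_norm_square) (simp add: mult.commute)
  have nz: "1 - cnj (f w) * f w \<noteq> 0" unfolding e using fw by (simp only: of_real_eq_0_iff)
  have dA: "(?A has_field_derivative of_real (1 - (norm w)\<^sup>2)) (at 0)"
    using Moebius_function_derivative[of "- w" 0] by simp
  have df: "(f has_field_derivative deriv f w) (at (?A 0))" unfolding A0 using f w by (intro holomorphic_derivI) auto
  have dB: "(?B has_field_derivative 1 / of_real (1 - (norm (f w))\<^sup>2)) (at ((f \<circ> ?A) 0))"
  proof -
    have "(1 - of_real ((norm (f w))\<^sup>2)) / (1 - cnj (f w) * f w)\<^sup>2 = 1 / (of_real (1 - (norm (f w))\<^sup>2) :: complex)"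
      unfolding e using fw by (simp add: power2_eq_square del: of_real_power)
    then show ?thesis using Moebius_function_derivative[OF nz] by (simp add: A0 del: of_real_diff of_real_power)
  qed
  have "(g has_field_derivative 1 / of_real (1 - (norm (f w))\<^sup>2) * (deriv f w * of_real (1 - (norm w)\<^sup>2))) (at 0)"
    unfolding g_def by (intro DERIV_chain dB df dA)
  then have "deriv g 0 = deriv f w * of_real (1 - (norm w)\<^sup>2) / of_real (1 - (norm (f w))\<^sup>2)"
    by (simp add: DERIV_imp_deriv)
  then have "norm (deriv g 0) = norm (deriv f w) * (1 - (norm w)\<^sup>2) / (1 - (norm (f w))\<^sup>2)"
    using fw by (simp add: norm_divide norm_mult del: of_real_diff of_real_power)
  then show ?thesis using n fw by (simp add: divide_le_eq)
qed

text \<open>Radial limits of modulus 1 and dominated convergence give the limit along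
  \<open>radius\<close>; monotonicity of the mean squares extends it to the full limit. This is how
  the boundary values of Theta enter.\<close>

lemma inner_sqmean_tendsto:
  assumes \<Theta>: "inner_function \<Theta>" shows "((\<lambda>r. sqmean \<Theta> r) \<longlongrightarrow> 1) (at_left 1)"
proof -
  have h: "\<Theta> holomorphic_on ball 0 1" and lt: "\<And>z. norm z < 1 \<Longrightarrow> norm (\<Theta> z) < 1"
    and ae: "AE \<zeta> in circle_measure. \<exists>l. ((\<lambda>r::real. \<Theta> (r *\<^sub>R \<zeta>)) \<longlongrightarrow> l) (at_left 1) \<and> norm l = 1"
    using \<Theta> by (auto simp: inner_function_def image_subset_iff)
  have bd: "(norm (\<Theta> (of_real r * cis t)))\<^sup>2 \<le> 1" if "0 < r" "r < 1" for r t
    using lt[of "of_real r * cis t"] that by (simp add: norm_mult abs_square_le_1)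
  have ae2: "AE t in angle. \<exists>l. ((\<lambda>r::real. \<Theta> (r *\<^sub>R cis t)) \<longlongrightarrow> l) (at_left 1) \<and> norm l = 1"
    by (rule AE_distrD[OF _ ae[unfolded circle_measure_def]]) simp
  have L: "(\<lambda>k. sqmean \<Theta> (radius k)) \<longlonglongrightarrow> (\<integral>t. 1 \<partial>angle)" unfolding sqmean_def
  proof (rule integral_dominated_convergence[where w = "\<lambda>_. 1"])
    show "(\<lambda>t. (norm (\<Theta> (of_real (radius k) * cis t)))\<^sup>2) \<in> borel_measurable angle" for k
      using integrable_sqmean[OF h radius(1,2)] by (rule borel_measurable_integrable)
    show "AE t in angle. (\<lambda>k. (norm (\<Theta> (of_real (radius k) * cis t)))\<^sup>2) \<longlonglongrightarrow> 1"
      using ae2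
    proof eventually_elim
      case (elim t)
      then obtain l where l: "((\<lambda>r::real. \<Theta> (r *\<^sub>R cis t)) \<longlongrightarrow> l) (at_left 1)" "norm l = 1" by blast
      have "(\<lambda>k. (norm (\<Theta> (radius k *\<^sub>R cis t)))\<^sup>2) \<longlonglongrightarrow> (norm l)\<^sup>2"
        by (intro tendsto_intros filterlim_compose[OF l(1) radius_at_left])
      then show ?case using l(2) by (simp add: scaleR_conv_of_real)
    qed
  qed (use bd radius in auto)
  obtain l where l: "((\<lambda>r. sqmean \<Theta> r) \<longlongrightarrow> l) (at_left 1)"
  proof -
    have "sqmean \<Theta> r \<le> 1" if r: "0 < r" "r < 1" for r
    proof -
      have "sqmean \<Theta> r \<le> (\<integral>t. 1 \<partial>angle)" unfolding sqmean_def
        by (rule integral_mono[OF integrable_sqmean[OF h r]]) (use bd[OF r] in auto)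
      then show ?thesis using angle.prob_space by simp
    qed
    from mono_bounded_at_left[of "sqmean \<Theta>", OF sqmean_mono[OF h] this] that show thesis by blast
  qed
  have "l = (\<integral>t. 1 \<partial>angle)" by (rule LIMSEQ_unique[OF filterlim_compose[OF l radius_at_left] L])
  then show ?thesis using l angle.prob_space by simp
qed

text \<open>The reproducing kernel of the model space, scaled to have squared norm \<open>1 - \<bar>\<Theta> w\<bar>\<^sup>2\<close>. It is cut off outside
  the disc because the inner product integrates over the whole plane.\<close>

definition model_kernel :: "(complex \<Rightarrow> complex) \<Rightarrow> complex \<Rightarrow> complex \<Rightarrow> complex" where
  "model_kernel \<Theta> w z = (if norm z < 1 then of_real (sqrt (1 - (norm w)\<^sup>2)) * ((1 - cnj (\<Theta> w) * \<Theta> z) / (1 - cnj w * z)) else 0)"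

lemma one_minus_cnj_mult_bounds:
  assumes "norm w < 1" "norm z < 1"
  shows "1 - norm w \<le> norm (1 - cnj w * z)" "1 - norm z \<le> norm (1 - cnj w * z)" "1 - cnj w * z \<noteq> 0"
proof -
  have "1 - norm w * norm z \<le> norm (1 - cnj w * z)"
    using norm_triangle_ineq2[of 1 "cnj w * z"] by (simp add: norm_mult)
  moreover have "norm w * norm z \<le> norm w" "norm w * norm z \<le> norm z"
    using assms by (auto intro: mult_left_le mult_left_le_one_le)
  ultimately show le: "1 - norm w \<le> norm (1 - cnj w * z)" "1 - norm z \<le> norm (1 - cnj w * z)" by linarith+
  show "1 - cnj w * z \<noteq> 0" using le(1) assms by auto
qed

context
  fixes \<Theta> :: "complex \<Rightarrow> complex" and w :: complex
  assumes \<Theta>: "\<Theta> holomorphic_on ball 0 1" "\<And>z. norm z < 1 \<Longrightarrow> norm (\<Theta> z) < 1" and w: "norm w < 1"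
begin

lemma model_kernel_holomorphic: "model_kernel \<Theta> w holomorphic_on ball 0 1"
proof (rule holomorphic_transform)
  show "(\<lambda>z. of_real (sqrt (1 - (norm w)\<^sup>2)) * ((1 - cnj (\<Theta> w) * \<Theta> z) / (1 - cnj w * z))) holomorphic_on ball 0 1"
    by (intro holomorphic_intros \<Theta>) (use one_minus_cnj_mult_bounds[OF w] in auto)
qed (auto simp: model_kernel_def)

lemma model_kernel_numerator_le: "norm z < 1 \<Longrightarrow> norm (1 - cnj (\<Theta> w) * \<Theta> z) \<le> 2"
proof -
  assume z: "norm z < 1"
  have "norm (cnj (\<Theta> w) * \<Theta> z) \<le> 1" using \<Theta>(2)[OF w] \<Theta>(2)[OF z] by (auto simp: norm_mult intro!: mult_le_one)
  then show ?thesis using norm_triangle_ineq4[of 1 "cnj (\<Theta> w) * \<Theta> z"] by simp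
qed

text \<open>The first bound is uniform in \<open>z\<close> and feeds Cauchy's estimates near the
  pole. The second, for \<open>z\<close> in a compact set, tends to 0 as |w| tends to 1, so the
  kernels vanish locally uniformly.\<close>

lemma model_kernel_le:
  assumes z: "norm z < 1"
  shows "norm (model_kernel \<Theta> w z) \<le> 2 * sqrt (1 - (norm w)\<^sup>2) / (1 - norm w)"
    "norm (model_kernel \<Theta> w z) \<le> 2 * sqrt (1 - (norm w)\<^sup>2) / (1 - norm z)"
proof -
  define s where "s = sqrt (1 - (norm w)\<^sup>2)"
  have s: "0 \<le> s" using w by (simp add: s_def abs_square_le_1)
  have e: "norm (model_kernel \<Theta> w z) = s * (norm (1 - cnj (\<Theta> w) * \<Theta> z) / norm (1 - cnj w * z))"
    using z s unfolding model_kernel_def s_def[symmetric] by (simp add: norm_mult norm_divide)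
  have "s * (norm (1 - cnj (\<Theta> w) * \<Theta> z) / norm (1 - cnj w * z)) \<le> s * (2 / d)" if "0 < d" "d \<le> norm (1 - cnj w * z)" for d
    using that s model_kernel_numerator_le[OF z] by (intro mult_left_mono frac_le) auto
  from this[of "1 - norm w"] this[of "1 - norm z"] show
    "norm (model_kernel \<Theta> w z) \<le> 2 * sqrt (1 - (norm w)\<^sup>2) / (1 - norm w)"
    "norm (model_kernel \<Theta> w z) \<le> 2 * sqrt (1 - (norm w)\<^sup>2) / (1 - norm z)"
    using one_minus_cnj_mult_bounds[OF w z] w z unfolding e s_def[symmetric] by (auto simp: mult.commute)
qed

text \<open>On the circle of radius \<open>r\<close> the denominator has modulus |cis t - r w| and
  the numerator is at most 2, so the squared kernel is at most 4 times the Poisson kernel at r w,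
  whose mean is 1.\<close>

lemma model_kernel_sqmean:
  assumes r: "0 < r" "r < 1" shows "sqmean (model_kernel \<Theta> w) r \<le> 4"
proof -
  define v where "v = of_real r * w"
  have v: "norm v < 1" "norm v \<le> norm w" using w r mult_left_le_one_le[of "norm w" r] mult_strict_mono[of r 1 "norm w" 1]
    by (auto simp: v_def norm_mult)
  have v2: "(norm v)\<^sup>2 < 1" "(norm w)\<^sup>2 < 1" "(norm v)\<^sup>2 \<le> (norm w)\<^sup>2" using v w by (auto simp: abs_square_less_1)
  have pt: "(norm (model_kernel \<Theta> w (of_real r * cis t)))\<^sup>2 \<le> 4 * poisson v t" for t
  proof -
    let ?z = "of_real r * cis t"
    have z: "norm ?z < 1" using r by (simp add: norm_mult)
    have n: "norm (1 - cnj w * ?z) = norm (cis t - v)" unfolding norm_cis_diff by (simp add: v_def mult_ac)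
    have p: "0 < norm (cis t - v)" using one_minus_cnj_mult_bounds(3)[OF w z] n by (metis zero_less_norm_iff)
    have "(norm (model_kernel \<Theta> w ?z))\<^sup>2 = (1 - (norm w)\<^sup>2) * ((norm (1 - cnj (\<Theta> w) * \<Theta> ?z))\<^sup>2 / (norm (cis t - v))\<^sup>2)"
      using z v2 unfolding model_kernel_def n[symmetric] by (simp add: norm_mult norm_divide power_mult_distrib power_divide del: of_real_mult)
    also have "\<dots> \<le> (1 - (norm v)\<^sup>2) * (2\<^sup>2 / (norm (cis t - v))\<^sup>2)"
      using v2 model_kernel_numerator_le[OF z] less_imp_le[OF v2(1)] by (intro mult_mono divide_right_mono power_mono) auto
    finally show ?thesis by (simp add: poisson_def mult.commute)
  qed
  have "sqmean (model_kernel \<Theta> w) r \<le> (\<integral>t. 4 * poisson v t \<partial>angle)" unfolding sqmean_def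
    by (rule integral_mono[OF integrable_sqmean[OF model_kernel_holomorphic r] _ pt])
       (intro integrable_angle_continuous continuous_on_mult continuous_on_const continuous_poisson v)
  also have "\<dots> = 4" by (simp add: poisson_integral[OF v(1)])
  finally show ?thesis .
qed

lemma model_kernel_H2: "model_kernel \<Theta> w \<in> H2_disc" "H2_disc_norm (model_kernel \<Theta> w) \<le> 2"
  using H2_disc_norm_le[OF model_kernel_holomorphic, of 2] model_kernel_sqmean by auto

text \<open>Schwarz--Pick controls the contribution of \<open>\<Theta>'\<close> to the derivative of the kernel at its own pole.\<close>

lemma model_kernel_deriv_at_pole:
  assumes d: "0 < \<delta>" "norm (\<Theta> w) \<le> 1 - \<delta>" "1 - \<delta> / 2 \<le> norm w"
  shows "sqrt (1 - (norm w)\<^sup>2) * (\<delta>\<^sup>2 / (8 * (1 - norm w)\<^sup>2)) \<le> norm (deriv (model_kernel \<Theta> w) w)"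
proof -
  define s where "s = sqrt (1 - (norm w)\<^sup>2)"
  define W U where "W = 1 - (norm w)\<^sup>2" and "U = 1 - (norm (\<Theta> w))\<^sup>2"
  have W: "0 < W" using w by (simp add: W_def abs_square_less_1)
  have s0: "0 \<le> s" using W by (simp add: s_def W_def)
  have Ww: "1 - cnj w * w = of_real W" and Uu: "1 - cnj (\<Theta> w) * \<Theta> w = of_real U"
    unfolding W_def U_def of_real_diff complex_norm_square by (simp_all add: mult.commute)
  have dT: "(\<Theta> has_field_derivative deriv \<Theta> w) (at w)" using \<Theta> w by (intro holomorphic_derivI) auto
  have num': "((\<lambda>z. 1 - cnj (\<Theta> w) * \<Theta> z) has_field_derivative - (cnj (\<Theta> w) * deriv \<Theta> w)) (at w)"
    using dT by (auto intro!: derivative_eq_intros)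
  have den': "((\<lambda>z. 1 - cnj w * z) has_field_derivative - cnj w) (at w)" by (auto intro!: derivative_eq_intros)
  have D: "((\<lambda>z. of_real s * ((1 - cnj (\<Theta> w) * \<Theta> z) / (1 - cnj w * z))) has_field_derivative
     of_real s * ((- (cnj (\<Theta> w) * deriv \<Theta> w) * (1 - cnj w * w) - (1 - cnj (\<Theta> w) * \<Theta> w) * (- cnj w)) / ((1 - cnj w * w) * (1 - cnj w * w)))) (at w)"
    by (intro DERIV_cmult DERIV_divide num' den' one_minus_cnj_mult_bounds(3)[OF w w])
  have ev: "eventually (\<lambda>z. z \<in> ball 0 1) (nhds w)" using w by (intro eventually_nhds_in_open) auto
  have "eventually (\<lambda>z. of_real s * ((1 - cnj (\<Theta> w) * \<Theta> z) / (1 - cnj w * z)) = model_kernel \<Theta> w z) (nhds w)"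
    using ev by eventually_elim (simp add: model_kernel_def s_def)
  from DERIV_cong_ev[THEN iffD1, OF refl this refl D]
  have "deriv (model_kernel \<Theta> w) w = of_real s * ((of_real U * cnj w - cnj (\<Theta> w) * deriv \<Theta> w * of_real W) / (of_real W * of_real W))"
    unfolding Ww Uu by (subst DERIV_imp_deriv) (auto simp: algebra_simps)
  then have e: "norm (deriv (model_kernel \<Theta> w) w) = s * (norm (of_real U * cnj w - cnj (\<Theta> w) * deriv \<Theta> w * of_real W) / W\<^sup>2)"
    using W s0 by (simp add: norm_mult norm_divide power2_eq_square)
  have "U * (norm w - norm (\<Theta> w)) \<le> norm (of_real U * cnj w - cnj (\<Theta> w) * deriv \<Theta> w * of_real W)"
  proof -
    have "0 \<le> U" using \<Theta>(2)[OF w] by (simp add: U_def abs_square_le_1)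
    then have "norm (of_real U * cnj w) = U * norm w" by (simp add: norm_mult)
    moreover have "norm (cnj (\<Theta> w) * deriv \<Theta> w * of_real W) = norm (\<Theta> w) * (norm (deriv \<Theta> w) * W)" using W by (simp add: norm_mult)
    moreover have "norm (\<Theta> w) * (norm (deriv \<Theta> w) * W) \<le> norm (\<Theta> w) * U"
      unfolding W_def U_def by (intro mult_left_mono Schwarz_Pick \<Theta> w) auto
    ultimately show ?thesis using norm_triangle_ineq2[of "of_real U * cnj w" "cnj (\<Theta> w) * deriv \<Theta> w * of_real W"]
      by (simp add: algebra_simps)
  qed
  moreover have "\<delta> * (\<delta> / 2) \<le> U * (norm w - norm (\<Theta> w))"
  proof (rule mult_mono)
    have "(norm (\<Theta> w))\<^sup>2 \<le> norm (\<Theta> w) * 1" unfolding power2_eq_square using \<Theta>(2)[OF w] by (intro mult_left_mono) auto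
    then show "\<delta> \<le> U" using d by (simp add: U_def)
    then show "0 \<le> U" using d by simp
  qed (use d in auto)
  ultimately have num: "\<delta>\<^sup>2 / 2 \<le> norm (of_real U * cnj w - cnj (\<Theta> w) * deriv \<Theta> w * of_real W)" by (simp add: power2_eq_square)
  have "W = (1 + norm w) * (1 - norm w)" by (simp add: W_def power2_eq_square algebra_simps)
  also have "\<dots> \<le> 2 * (1 - norm w)" using w by (intro mult_right_mono) auto
  finally have "W\<^sup>2 \<le> (2 * (1 - norm w))\<^sup>2" using W by (intro power_mono) auto
  then have den: "W\<^sup>2 \<le> 4 * (1 - norm w)\<^sup>2" by (simp only: power_mult_distrib) simp
  have "\<delta>\<^sup>2 / (8 * (1 - norm w)\<^sup>2) = (\<delta>\<^sup>2 / 2) / (4 * (1 - norm w)\<^sup>2)" by simp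
  also have "\<dots> \<le> norm (of_real U * cnj w - cnj (\<Theta> w) * deriv \<Theta> w * of_real W) / W\<^sup>2"
    using num den W d by (intro frac_le) auto
  finally show ?thesis unfolding e s_def[symmetric] by (rule mult_left_mono) (use W in \<open>simp add: s_def W_def\<close>)
qed

text \<open>Cauchy's estimate on discs of radius D/4 bounds the second derivative by 64 s / D^3.
  Over the distance delta^2 D / 1024, with 1024 = 64 * 16, the derivative changes by at most s
  delta^2 / (16 D^2), half of its lower bound at the pole. Squaring and s^2 >= D give the
  claim.\<close>

lemma model_kernel_deriv_near_pole:
  assumes d: "0 < \<delta>" "\<delta> \<le> 1" "norm (\<Theta> w) \<le> 1 - \<delta>" "1 - \<delta> / 2 \<le> norm w"
    and z: "norm (z - w) \<le> \<delta>\<^sup>2 / 1024 * (1 - norm w)"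
  shows "\<delta>^4 / (256 * (1 - norm w)^3) \<le> (norm (deriv (model_kernel \<Theta> w) z))\<^sup>2"
proof -
  define D where "D = 1 - norm w"
  define s where "s = sqrt (1 - (norm w)\<^sup>2)"
  have D: "0 < D" using w by (simp add: D_def)
  have s: "0 < s" using w by (simp add: s_def abs_square_less_1)
  let ?K = "model_kernel \<Theta> w"
  have "\<delta>\<^sup>2 \<le> 1" using d by (simp add: power_le_one)
  then have small: "\<delta>\<^sup>2 / 1024 * D \<le> D / 1024" using D by simp
  have zb: "z \<in> cball w (D / 2)" 
  proof -
    have "norm (z - w) \<le> D / 1024" using z small unfolding D_def[symmetric] by (rule order_trans)
    then show ?thesis using D by (simp add: dist_norm norm_minus_commute[of w])
  qed
  have in1: "norm x < 1" if "x \<in> cball w (D / 2)" for x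
    using that norm_triangle_ineq2[of x w] D by (simp add: dist_norm norm_minus_commute D_def)
  have sub: "cball x (D / 4) \<subseteq> ball 0 1" if "x \<in> cball w (D / 2)" for x
  proof
    fix y assume "y \<in> cball x (D / 4)"
    then have "norm (y - x) \<le> D / 4" "norm (x - w) \<le> D / 2" using that by (auto simp: dist_norm norm_minus_commute)
    then have "norm y \<le> norm w + D / 2 + D / 4"
      using norm_triangle_ineq[of "y - x" x] norm_triangle_ineq[of "x - w" w] by simp
    moreover have "norm w = 1 - D" by (simp add: D_def)
    ultimately show "y \<in> ball 0 1" using D by simp
  qed
  have d2: "norm ((deriv ^^ 2) ?K x) \<le> 64 * s / D^3" if x: "x \<in> cball w (D / 2)" for x
  proof -
    have "norm ((deriv ^^ 2) ?K x) \<le> fact 2 * (2 * s / D) / (D / 4)^2"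
    proof (rule Cauchy_inequality)
      show "?K holomorphic_on ball x (D / 4)" using model_kernel_holomorphic sub[OF x] by (meson ball_subset_cball holomorphic_on_subset order_trans)
      show "continuous_on (cball x (D / 4)) ?K"
        using model_kernel_holomorphic sub[OF x] by (meson continuous_on_subset holomorphic_on_imp_continuous_on)
      fix y assume "norm (x - y) = D / 4"
      then have "y \<in> ball 0 1" using sub[OF x] by (auto simp: dist_norm subset_iff)
      then show "norm (?K y) \<le> 2 * s / D" using model_kernel_le(1)[of y] by (simp add: s_def D_def)
    qed (use D in simp)
    also have "\<dots> = 64 * s / D^3" using D by (simp add: fact_numeral power2_eq_square power3_eq_cube)
    finally show ?thesis .
  qed
  have "norm (deriv ?K z - deriv ?K w) \<le> 64 * s / D^3 * norm (z - w)"
  proof (rule field_differentiable_bound[of "cball w (D / 2)" "deriv ?K" "deriv (deriv ?K)"])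
    fix x assume x: "x \<in> cball w (D / 2)"
    have dh: "deriv ?K holomorphic_on ball 0 1" by (rule holomorphic_deriv[OF model_kernel_holomorphic open_ball])
    have "x \<in> ball 0 1" using in1[OF x] by simp
    from has_field_derivative_at_within[OF holomorphic_derivI[OF dh open_ball this]]
    show "(deriv ?K has_field_derivative deriv (deriv ?K) x) (at x within cball w (D / 2))" .
    have "(deriv ^^ 2) ?K x = deriv (deriv ?K) x" by (simp only: numeral_2_eq_2 funpow.simps o_apply id_apply)
    then show "norm (deriv (deriv ?K) x) \<le> 64 * s / D^3" using d2[OF x] by (simp only:)
  qed (use zb D in auto)
  also have "\<dots> \<le> 64 * s / D^3 * (\<delta>\<^sup>2 / 1024 * D)" using z D s by (intro mult_left_mono) (auto simp: D_def)
  also have "\<dots> = s * (\<delta>\<^sup>2 / (16 * D\<^sup>2))" using D by (simp add: power2_eq_square power3_eq_cube)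
  finally have "norm (deriv ?K z - deriv ?K w) \<le> s * (\<delta>\<^sup>2 / (16 * D\<^sup>2))" .
  moreover have "s * (\<delta>\<^sup>2 / (8 * D\<^sup>2)) \<le> norm (deriv ?K w)"
    unfolding s_def D_def by (rule model_kernel_deriv_at_pole) (use d in auto)
  moreover have "s * (\<delta>\<^sup>2 / (8 * D\<^sup>2)) = s * (\<delta>\<^sup>2 / (16 * D\<^sup>2)) + s * (\<delta>\<^sup>2 / (16 * D\<^sup>2))" using D by simp
  ultimately have ge: "s * (\<delta>\<^sup>2 / (16 * D\<^sup>2)) \<le> norm (deriv ?K z)"
    using norm_triangle_ineq2[of "deriv ?K w" "deriv ?K z"] by (simp add: norm_minus_commute)
  have sD: "D \<le> s\<^sup>2"
  proof -
    have "(norm w)\<^sup>2 \<le> norm w * 1" unfolding power2_eq_square using w by (intro mult_left_mono) auto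
    then show ?thesis using w by (simp add: s_def D_def abs_square_le_1)
  qed
  have "\<delta>^4 / (256 * D^3) = D * (\<delta>\<^sup>2 / (16 * D\<^sup>2))\<^sup>2"
    using D by (simp add: power_divide power_mult_distrib power2_eq_square power3_eq_cube power4_eq_xxxx)
  also have "\<dots> \<le> s\<^sup>2 * (\<delta>\<^sup>2 / (16 * D\<^sup>2))\<^sup>2" using sD by (intro mult_right_mono) auto
  also have "\<dots> = (s * (\<delta>\<^sup>2 / (16 * D\<^sup>2)))\<^sup>2" by (simp only: power_mult_distrib)
  also have "\<dots> \<le> (norm (deriv ?K z))\<^sup>2" using ge s by (intro power_mono) auto
  finally show ?thesis unfolding D_def .
qed

end

text \<open>With c = conj(Theta(w)), (1 - c Theta) conj(Theta) = conj(Theta) - c + c (1 -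
  |Theta|^2). Against conj(g) and the Szego kernel the first two terms reproduce values that cancel
  as r tends to 1, and the third, \<open>X\<close>, tends to 0 because Theta is inner.\<close>

lemma model_kernel_in:
  assumes \<Theta>: "inner_function \<Theta>" and w: "norm w < 1"
  shows "model_kernel \<Theta> w \<in> model_space \<Theta>"
proof -
  have h: "\<Theta> holomorphic_on ball 0 1" and lt: "\<And>z. norm z < 1 \<Longrightarrow> norm (\<Theta> z) < 1"
    using \<Theta> by (auto simp: inner_function_def image_subset_iff)
  note Kh = model_kernel_holomorphic[OF h lt w]
  have "H2_disc_inner (model_kernel \<Theta> w) (\<lambda>z. \<Theta> z * g z) = 0" if gH: "g \<in> H2_disc" for g
  proof -
    have gh: "g holomorphic_on ball 0 1" using gH by (simp add: H2_disc_def)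
    define s where "s = complex_of_real (sqrt (1 - (norm w)\<^sup>2))"
    define k where "k = (\<lambda>r t. 1 / (1 - cnj w * (of_real r * cis t)))"
    define X where "X = (\<lambda>r. \<integral>t. k r t * of_real (1 - (norm (\<Theta> (of_real r * cis t)))\<^sup>2) * cnj (g (of_real r * cis t)) \<partial>angle)"
    have int: "(\<integral>\<zeta>. model_kernel \<Theta> w (r *\<^sub>R \<zeta>) * cnj (\<Theta> (r *\<^sub>R \<zeta>) * g (r *\<^sub>R \<zeta>)) \<partial>circle_measure)
       = s * (cnj (\<Theta> (of_real (r\<^sup>2) * w) * g (of_real (r\<^sup>2) * w)) - cnj (\<Theta> w) * cnj (g (of_real (r\<^sup>2) * w)) + cnj (\<Theta> w) * X r)"
      if r: "0 < r" "r < 1" for r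
    proof -
      have nz: "norm (of_real r * cis t) < 1" for t using r by (simp add: norm_mult)
      have cc: "continuous_on UNIV (\<lambda>t. q (of_real r * cis t))" if "q holomorphic_on ball 0 1" for q
        by (rule holomorphic_continuous_cis[OF that]) (use r in auto)
      have ck: "continuous_on UNIV (k r)" unfolding k_def
        by (intro continuous_intros) (use one_minus_cnj_mult_bounds(3)[OF w nz] in auto)
      have eq: "model_kernel \<Theta> w (r *\<^sub>R \<zeta>) * cnj (\<Theta> (r *\<^sub>R \<zeta>) * g (r *\<^sub>R \<zeta>))
          = indicator (ball 0 (1/r)) \<zeta> *\<^sub>R (model_kernel \<Theta> w (r *\<^sub>R \<zeta>) * cnj (\<Theta> (r *\<^sub>R \<zeta>) * g (r *\<^sub>R \<zeta>)))" for \<zeta>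
        using r by (auto simp: model_kernel_def indicator_def field_simps)
      have c: "continuous_on (ball 0 (1/r)) (\<lambda>\<zeta>. model_kernel \<Theta> w (r *\<^sub>R \<zeta>) * cnj (\<Theta> (r *\<^sub>R \<zeta>) * g (r *\<^sub>R \<zeta>)))"
        by (intro continuous_intros continuous_on_compose2[OF holomorphic_on_imp_continuous_on[OF Kh]]
              continuous_on_compose2[OF holomorphic_on_imp_continuous_on[OF h]] continuous_on_compose2[OF holomorphic_on_imp_continuous_on[OF gh]])
           (use r in \<open>auto simp: field_simps\<close>)
      have m: "(\<lambda>\<zeta>. model_kernel \<Theta> w (r *\<^sub>R \<zeta>) * cnj (\<Theta> (r *\<^sub>R \<zeta>) * g (r *\<^sub>R \<zeta>))) \<in> borel_measurable borel"
        by (subst eq[abs_def]) (rule borel_measurable_continuous_on_indicator[OF _ c], simp)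
      \<comment> \<open>The argument \<open>r\<^sup>2 * w\<close> collects one factor r from the
        kernel and one from the function, both evaluated on the circle of radius r.\<close>
      have szego: "(\<integral>t. k r t * cnj (q (of_real r * cis t)) \<partial>angle) = cnj (q (of_real (r\<^sup>2) * w))" if q: "q holomorphic_on ball 0 1" for q
      proof -
        have qh: "(\<lambda>z. q (of_real r * z)) holomorphic_on ball 0 (1/r)"
          by (intro holomorphic_on_compose_gen[OF _ q, unfolded o_def] holomorphic_intros)
             (use r in \<open>auto simp: norm_mult field_simps\<close>)
        have rw: "norm (of_real r * w) < 1" using w r mult_strict_mono[of r 1 "norm w" 1] by (simp add: norm_mult)
        have "(\<integral>t. k r t * cnj (q (of_real r * cis t)) \<partial>angle) = (\<integral>t. cnj (q (of_real r * cis t) / (1 - (of_real r * w) * cnj (cis t))) \<partial>angle)"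
          by (rule Bochner_Integration.integral_cong) (auto simp: k_def mult_ac)
        also have "\<dots> = cnj (\<integral>t. q (of_real r * cis t) / (1 - (of_real r * w) * cnj (cis t)) \<partial>angle)" by (rule Bochner_Integration.integral_cnj)
        also have "(\<integral>t. q (of_real r * cis t) / (1 - (of_real r * w) * cnj (cis t)) \<partial>angle) = q (of_real r * (of_real r * w))"
          by (rule angle_Cauchy[OF qh _ rw]) (use r in simp)
        finally show ?thesis by (simp add: power2_eq_square mult.assoc)
      qed
      have "(\<integral>\<zeta>. model_kernel \<Theta> w (r *\<^sub>R \<zeta>) * cnj (\<Theta> (r *\<^sub>R \<zeta>) * g (r *\<^sub>R \<zeta>)) \<partial>circle_measure)
        = (\<integral>t. model_kernel \<Theta> w (r *\<^sub>R cis t) * cnj (\<Theta> (r *\<^sub>R cis t) * g (r *\<^sub>R cis t)) \<partial>angle)"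
        unfolding circle_measure_def by (subst integral_distr) (use m in auto)
      also have "\<dots> = (\<integral>t. s * (k r t * cnj (\<Theta> (of_real r * cis t) * g (of_real r * cis t)) - cnj (\<Theta> w) * (k r t * cnj (g (of_real r * cis t)))
          + cnj (\<Theta> w) * (k r t * of_real (1 - (norm (\<Theta> (of_real r * cis t)))\<^sup>2) * cnj (g (of_real r * cis t)))) \<partial>angle)"
      proof (rule Bochner_Integration.integral_cong[OF refl])
        fix t
        show "model_kernel \<Theta> w (r *\<^sub>R cis t) * cnj (\<Theta> (r *\<^sub>R cis t) * g (r *\<^sub>R cis t)) =
          s * (k r t * cnj (\<Theta> (of_real r * cis t) * g (of_real r * cis t)) - cnj (\<Theta> w) * (k r t * cnj (g (of_real r * cis t)))
          + cnj (\<Theta> w) * (k r t * of_real (1 - (norm (\<Theta> (of_real r * cis t)))\<^sup>2) * cnj (g (of_real r * cis t))))"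
          using nz[of t] unfolding of_real_diff complex_norm_square model_kernel_def s_def k_def scaleR_conv_of_real
          by (simp add: algebra_simps diff_divide_distrib add_divide_distrib)
      qed
      also have "\<dots> = s * ((\<integral>t. k r t * cnj (\<Theta> (of_real r * cis t) * g (of_real r * cis t)) \<partial>angle) - cnj (\<Theta> w) * (\<integral>t. k r t * cnj (g (of_real r * cis t)) \<partial>angle)
          + cnj (\<Theta> w) * X r)"
      proof -
        have i: "integrable angle (\<lambda>t. k r t * cnj (\<Theta> (of_real r * cis t) * g (of_real r * cis t)))"
          "integrable angle (\<lambda>t. k r t * cnj (g (of_real r * cis t)))"
          "integrable angle (\<lambda>t. k r t * of_real (1 - (norm (\<Theta> (of_real r * cis t)))\<^sup>2) * cnj (g (of_real r * cis t)))"
          by (intro integrable_angle_continuous continuous_intros ck cc h gh)+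
        then show ?thesis unfolding X_def
          by (simp only: Bochner_Integration.integral_add Bochner_Integration.integral_diff Bochner_Integration.integrable_add
              Bochner_Integration.integrable_diff integrable_mult_right integral_mult_right_zero)
      qed
      finally show ?thesis
        using szego[of "\<lambda>z. \<Theta> z * g z"] szego[OF gh] h gh by (simp add: holomorphic_on_mult)
    qed
    have Xb: "norm (X r) \<le> 1 / (1 - norm w) * sqrt ((1 - sqmean \<Theta> r) * (H2_disc_norm g)\<^sup>2)" if r: "0 < r" "r < 1" for r
    proof -
      have nz: "norm (of_real r * cis t) < 1" for t using r by (simp add: norm_mult)
      have cc: "continuous_on UNIV (\<lambda>t. q (of_real r * cis t))" if "q holomorphic_on ball 0 1" for q
        by (rule holomorphic_continuous_cis[OF that]) (use r in auto)
      define a b where "a = (\<lambda>t. 1 - (norm (\<Theta> (of_real r * cis t)))\<^sup>2)" and "b = (\<lambda>t. norm (g (of_real r * cis t)))"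
      have a: "0 \<le> a t" "a t \<le> 1" for t using lt[OF nz[of t]] by (auto simp: a_def abs_square_le_1)
      have ca: "continuous_on UNIV a" "continuous_on UNIV b" unfolding a_def b_def by (intro continuous_intros cc h gh)+
      have ia: "integrable angle a" "integrable angle (\<lambda>t. (a t)\<^sup>2)" "integrable angle (\<lambda>t. a t * b t)"
        by (intro integrable_angle_continuous continuous_intros ca)+
      have "norm (X r) \<le> (\<integral>t. 1 / (1 - norm w) * (a t * b t) \<partial>angle)"
        unfolding X_def
      proof (rule order_trans[OF integral_norm_bound], rule integral_mono')
        show "integrable angle (\<lambda>t. 1 / (1 - norm w) * (a t * b t))" using ia(3) by (rule integrable_mult_right)
        fix t
        have "norm (k r t) \<le> 1 / (1 - norm w)"
          unfolding k_def using one_minus_cnj_mult_bounds[OF w nz[of t]] w by (simp add: norm_divide frac_le)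
        then have "norm (k r t) * (a t * b t) \<le> 1 / (1 - norm w) * (a t * b t)" using a by (intro mult_right_mono) (auto simp: b_def)
        moreover have "norm (k r t * of_real (1 - (norm (\<Theta> (of_real r * cis t)))\<^sup>2) * cnj (g (of_real r * cis t))) = norm (k r t) * (a t * b t)"
          unfolding norm_mult norm_of_real using a(1)[of t] by (simp add: a_def b_def)
        ultimately show "norm (k r t * of_real (1 - (norm (\<Theta> (of_real r * cis t)))\<^sup>2) * cnj (g (of_real r * cis t))) \<le> 1 / (1 - norm w) * (a t * b t)" by simp
        show "0 \<le> 1 / (1 - norm w) * (a t * b t)" using a w by (simp add: b_def)
      qed
      also have "\<dots> = 1 / (1 - norm w) * (\<integral>t. a t * b t \<partial>angle)" by (rule integral_mult_right_zero)
      also have "\<dots> \<le> 1 / (1 - norm w) * sqrt ((1 - sqmean \<Theta> r) * (H2_disc_norm g)\<^sup>2)"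
      proof (rule mult_left_mono)
        have i\<Theta>: "integrable angle (\<lambda>t. (norm (\<Theta> (of_real r * cis t)))\<^sup>2)" by (rule integrable_sqmean[OF h r])
        \<comment> \<open>Since 0 <= a <= 1, the square is at most a itself, whose mean 1 -
          \<open>sqmean \<Theta> r\<close> tends to 0.\<close>
        have "(\<integral>t. (a t)\<^sup>2 \<partial>angle) \<le> (\<integral>t. a t \<partial>angle)"
          by (rule integral_mono[OF ia(2,1)]) (use a in \<open>auto simp: power2_eq_square intro: mult_left_le\<close>)
        also have "\<dots> = 1 - sqmean \<Theta> r" unfolding a_def sqmean_def using i\<Theta> angle.prob_space by simp
        finally have a2: "(\<integral>t. (a t)\<^sup>2 \<partial>angle) \<le> 1 - sqmean \<Theta> r" .
        have "(\<integral>t. a t * b t \<partial>angle)\<^sup>2 \<le> (\<integral>t. (a t)\<^sup>2 \<partial>angle) * (\<integral>t. (b t)\<^sup>2 \<partial>angle)" by (rule angle_Cauchy_Schwarz[OF ca])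
        also have "(\<integral>t. (b t)\<^sup>2 \<partial>angle) = sqmean g r" by (simp add: b_def sqmean_def)
        also have "(\<integral>t. (a t)\<^sup>2 \<partial>angle) * sqmean g r \<le> (1 - sqmean \<Theta> r) * (H2_disc_norm g)\<^sup>2"
        proof (rule mult_mono[OF a2 sqmean_le_H2_norm[OF gH r] _ sqmean_nonneg])
          have "0 \<le> (\<integral>t. (a t)\<^sup>2 \<partial>angle)" by (rule integral_nonneg_AE) simp
          then show "0 \<le> 1 - sqmean \<Theta> r" using a2 by (rule order_trans)
        qed
        finally show "(\<integral>t. a t * b t \<partial>angle) \<le> sqrt ((1 - sqmean \<Theta> r) * (H2_disc_norm g)\<^sup>2)" by (rule real_le_rsqrt)
      qed (use w in simp)
      finally show ?thesis .
    qed
    have X0: "(X \<longlongrightarrow> 0) (at_left 1)"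
    proof (rule tendsto_norm_zero_cancel, rule tendsto_sandwich)
      show "\<forall>\<^sub>F r in at_left 1. 0 \<le> norm (X r)" by simp
      show "\<forall>\<^sub>F r in at_left 1. norm (X r) \<le> 1 / (1 - norm w) * sqrt ((1 - sqmean \<Theta> r) * (H2_disc_norm g)\<^sup>2)"
        using eventually_at_left_1 by eventually_elim (use Xb in auto)
      have "((\<lambda>r. 1 / (1 - norm w) * sqrt ((1 - sqmean \<Theta> r) * (H2_disc_norm g)\<^sup>2)) \<longlongrightarrow> 1 / (1 - norm w) * sqrt ((1 - 1) * (H2_disc_norm g)\<^sup>2)) (at_left 1)"
        by (intro tendsto_intros inner_sqmean_tendsto[OF \<Theta>])
      then show "((\<lambda>r. 1 / (1 - norm w) * sqrt ((1 - sqmean \<Theta> r) * (H2_disc_norm g)\<^sup>2)) \<longlongrightarrow> 0) (at_left 1)" by simp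
    qed simp
    have lim: "((\<lambda>r. q (of_real (r\<^sup>2) * w)) \<longlongrightarrow> q w) (at_left (1::real))" if "q holomorphic_on ball 0 1" for q :: "complex \<Rightarrow> complex"
    proof -
      have "isCont q w" using that w by (intro field_differentiable_imp_continuous_at holomorphic_on_imp_differentiable_at[of q "ball 0 1"]) auto
      moreover have "((\<lambda>r::real. complex_of_real (r\<^sup>2) * w) \<longlongrightarrow> of_real (1\<^sup>2) * w) (at_left 1)" by (intro tendsto_intros)
      ultimately show ?thesis using isCont_tendsto_compose by fastforce
    qed
    have L: "((\<lambda>r. s * (cnj (\<Theta> (of_real (r\<^sup>2) * w) * g (of_real (r\<^sup>2) * w)) - cnj (\<Theta> w) * cnj (g (of_real (r\<^sup>2) * w)) + cnj (\<Theta> w) * X r))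
        \<longlongrightarrow> s * (cnj (\<Theta> w * g w) - cnj (\<Theta> w) * cnj (g w) + cnj (\<Theta> w) * 0)) (at_left 1)"
      by (intro tendsto_intros lim h gh X0)
    have "((\<lambda>r. \<integral>\<zeta>. model_kernel \<Theta> w (r *\<^sub>R \<zeta>) * cnj (\<Theta> (r *\<^sub>R \<zeta>) * g (r *\<^sub>R \<zeta>)) \<partial>circle_measure) \<longlongrightarrow> 0) (at_left 1)"
    proof (rule Lim_transform_eventually)
      show "((\<lambda>r. s * (cnj (\<Theta> (of_real (r\<^sup>2) * w) * g (of_real (r\<^sup>2) * w)) - cnj (\<Theta> w) * cnj (g (of_real (r\<^sup>2) * w)) + cnj (\<Theta> w) * X r)) \<longlongrightarrow> 0) (at_left 1)"
        using L by simp
      show "\<forall>\<^sub>F r in at_left 1. s * (cnj (\<Theta> (of_real (r\<^sup>2) * w) * g (of_real (r\<^sup>2) * w)) - cnj (\<Theta> w) * cnj (g (of_real (r\<^sup>2) * w)) + cnj (\<Theta> w) * X r)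
        = (\<integral>\<zeta>. model_kernel \<Theta> w (r *\<^sub>R \<zeta>) * cnj (\<Theta> (r *\<^sub>R \<zeta>) * g (r *\<^sub>R \<zeta>)) \<partial>circle_measure)"
        using eventually_at_left_1 by eventually_elim (use int in auto)
    qed
    then show ?thesis unfolding H2_disc_inner_def by (intro tendsto_Lim) simp_all
  qed
  then show ?thesis using model_kernel_H2(1)[OF h lt w] by (simp add: model_space_def)
qed

section \<open>Compactness and vanishing\<close>

lemma tendsto_boundary_iff:
  fixes F :: "complex \<Rightarrow> ennreal"
  shows "(F \<longlongrightarrow> 0) (filtercomap norm (at_left (1::real)))
    \<longleftrightarrow> (\<forall>e>0. \<exists>R<1. \<forall>w. R < norm w \<longrightarrow> norm w < 1 \<longrightarrow> F w \<le> ennreal e)"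
proof safe
  fix e :: real assume lim: "(F \<longlongrightarrow> 0) (filtercomap norm (at_left 1))" and e: "e > 0"
  have "eventually (\<lambda>w. F w < ennreal e) (filtercomap norm (at_left 1))"
    by (rule order_tendstoD(2)[OF lim]) (use e in simp)
  then obtain Q where Q: "eventually Q (at_left (1::real))" "\<And>w. Q (norm w) \<Longrightarrow> F w < ennreal e"
    by (auto simp: eventually_filtercomap)
  from Q(1) obtain R where "R < 1" "\<And>y. R < y \<Longrightarrow> y < 1 \<Longrightarrow> Q y" by (auto simp: eventually_at_left_field)
  with Q(2) show "\<exists>R<1. \<forall>w. R < norm w \<longrightarrow> norm w < 1 \<longrightarrow> F w \<le> ennreal e" by (meson less_imp_le)
next
  assume *: "\<forall>e>0. \<exists>R<1. \<forall>w. R < norm w \<longrightarrow> norm w < 1 \<longrightarrow> F w \<le> ennreal e"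
  show "(F \<longlongrightarrow> 0) (filtercomap norm (at_left (1::real)))"
  proof (rule order_tendstoI)
    fix a :: ennreal assume "0 < a"
    then obtain b where b: "0 < b" "b < a" using dense by blast
    define e where "e = enn2real b"
    have be: "b = ennreal e" using b(2) by (simp add: e_def top.not_eq_extremum[symmetric] order.strict_implies_not_eq[OF less_le_trans[OF b(2) top_greatest]])
    then have "e > 0" using b(1) by (cases "e > 0") (auto simp: ennreal_neg)
    with * obtain R where R: "R < 1" "\<And>w. R < norm w \<Longrightarrow> norm w < 1 \<Longrightarrow> F w \<le> ennreal e" by blast
    show "\<forall>\<^sub>F w in filtercomap norm (at_left (1::real)). F w < a"
      unfolding eventually_filtercomap eventually_at_left_field
      using R b(2) unfolding be by (intro exI[of _ "\<lambda>y. R < y \<and> y < 1"]) (auto intro: le_less_trans)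
  qed simp
qed

section \<open>Triangle-type estimates for means over the torus\<close>

lemma compact_torus: "compact (torus :: (complex ^ 'n::finite) set)"
proof -
  have "norm \<zeta> \<le> CARD('n)" if "\<zeta> \<in> torus" for \<zeta> :: "complex ^ 'n"
  proof -
    have "norm \<zeta> \<le> (\<Sum>i\<in>UNIV. norm (\<zeta> $ i))" unfolding norm_vec_def by (rule L2_set_le_sum) simp
    also have "\<dots> = CARD('n)" using that by (simp add: torus_def)
    finally show ?thesis .
  qed
  then have "bounded (torus :: (complex ^ 'n) set)" by (rule boundedI)
  then show ?thesis using closed_torus compact_eq_bounded_closed by blast
qed

lemma scaleR_torus_polydisc: "\<zeta> \<in> torus \<Longrightarrow> 0 < r \<Longrightarrow> r < 1 \<Longrightarrow> r *\<^sub>R \<zeta> \<in> polydisc"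
  by (auto simp: torus_def polydisc_def)

text \<open>From (g + h)^2 <= 2 g^2 + 2 h^2. Working with squared means and a factor 2 replaces
  Minkowski's inequality, and the pointwise hypothesis is confined to the polydisc, where the
  functions are specified.\<close>

lemma torus_mean_triangle:
  fixes F G H :: "complex ^ 'n::finite \<Rightarrow> complex"
  assumes G: "continuous_on polydisc G" and H: "continuous_on polydisc H" and r: "0 < r" "r < 1"
    and le: "\<And>z. z \<in> polydisc \<Longrightarrow> norm (F z) \<le> norm (G z) + norm (H z)"
  shows "(\<integral>\<^sup>+\<zeta>. ennreal ((norm (F (r *\<^sub>R \<zeta>)))\<^sup>2) \<partial>torus_measure)
    \<le> 2 * (\<integral>\<^sup>+\<zeta>. ennreal ((norm (G (r *\<^sub>R \<zeta>)))\<^sup>2) \<partial>torus_measure) + 2 * (\<integral>\<^sup>+\<zeta>. ennreal ((norm (H (r *\<^sub>R \<zeta>)))\<^sup>2) \<partial>torus_measure)"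
proof -
  define q where "q = (\<lambda>(K :: complex ^ 'n \<Rightarrow> complex) \<zeta>. ennreal (indicator torus \<zeta> *\<^sub>R (norm (K (r *\<^sub>R \<zeta>)))\<^sup>2))"
  have q: "q K \<in> borel_measurable torus_measure" if "continuous_on polydisc K" for K
  proof -
    have "continuous_on torus (\<lambda>\<zeta>. (norm (K (r *\<^sub>R \<zeta>)))\<^sup>2)"
      by (intro continuous_intros continuous_on_compose2[OF that]) (use r scaleR_torus_polydisc in auto)
    from borel_measurable_continuous_on_indicator[OF torus_borel this]
    have "q K \<in> borel_measurable borel" unfolding q_def by measurable
    then show ?thesis by simp
  qed
  have e: "(\<integral>\<^sup>+\<zeta>. ennreal ((norm (K (r *\<^sub>R \<zeta>)))\<^sup>2) \<partial>torus_measure) = (\<integral>\<^sup>+\<zeta>. q K \<zeta> \<partial>torus_measure)" for K :: "complex ^ 'n \<Rightarrow> complex"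
    by (rule nn_integral_cong_AE) (use AE_torus in \<open>eventually_elim, simp add: q_def\<close>)
  have "(\<integral>\<^sup>+\<zeta>. ennreal ((norm (F (r *\<^sub>R \<zeta>)))\<^sup>2) \<partial>torus_measure) \<le> (\<integral>\<^sup>+\<zeta>. 2 * q G \<zeta> + 2 * q H \<zeta> \<partial>torus_measure)"
  proof (rule nn_integral_mono_AE)
    show "AE \<zeta> in torus_measure. ennreal ((norm (F (r *\<^sub>R \<zeta>)))\<^sup>2) \<le> 2 * q G \<zeta> + 2 * q H \<zeta>"
      using AE_torus
    proof eventually_elim
      case (elim \<zeta>)
      define g h where "g = norm (G (r *\<^sub>R \<zeta>))" and "h = norm (H (r *\<^sub>R \<zeta>))"
      have gh: "0 \<le> g" "0 \<le> h" by (auto simp: g_def h_def)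
      have "(norm (F (r *\<^sub>R \<zeta>)))\<^sup>2 \<le> (g + h)\<^sup>2"
        unfolding g_def h_def by (intro power_mono le scaleR_torus_polydisc[OF elim r]) auto
      also have "\<dots> \<le> 2 * g\<^sup>2 + 2 * h\<^sup>2" using zero_le_power2[of "g - h"] by (simp add: power2_eq_square algebra_simps)
      finally have "ennreal ((norm (F (r *\<^sub>R \<zeta>)))\<^sup>2) \<le> ennreal (2 * g\<^sup>2 + 2 * h\<^sup>2)" by (rule ennreal_leI)
      also have "\<dots> = 2 * ennreal (g\<^sup>2) + 2 * ennreal (h\<^sup>2)" by (simp add: ennreal_mult)
      finally show ?case using elim by (simp add: q_def g_def h_def)
    qed
  qed
  also have "\<dots> = 2 * (\<integral>\<^sup>+\<zeta>. q G \<zeta> \<partial>torus_measure) + 2 * (\<integral>\<^sup>+\<zeta>. q H \<zeta> \<partial>torus_measure)"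
    using q[OF G] q[OF H] by (subst nn_integral_add) (auto simp: nn_integral_cmult)
  finally show ?thesis unfolding e .
qed

lemma torus_mean_le_means:
  "0 < r \<Longrightarrow> r < 1 \<Longrightarrow> (\<integral>\<^sup>+\<zeta>. ennreal ((norm (F (r *\<^sub>R \<zeta>)))\<^sup>2) \<partial>torus_measure) \<le> H2_poly_means F"
  unfolding H2_poly_means_def by (rule SUP_upper) simp

lemma H2_poly_means_triangle:
  fixes F G H :: "complex ^ 'n::finite \<Rightarrow> complex"
  assumes G: "continuous_on polydisc G" and H: "continuous_on polydisc H"
    and le: "\<And>z. z \<in> polydisc \<Longrightarrow> norm (F z) \<le> norm (G z) + norm (H z)"
  shows "H2_poly_means F \<le> 2 * H2_poly_means G + 2 * H2_poly_means H"
  unfolding H2_poly_means_def[of F]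
proof (rule SUP_least)
  fix r :: real assume "r \<in> {0<..<1}"
  then have r: "0 < r" "r < 1" by auto
  note torus_mean_triangle[OF G H r le]
  also have "2 * (\<integral>\<^sup>+\<zeta>. ennreal ((norm (G (r *\<^sub>R \<zeta>)))\<^sup>2) \<partial>torus_measure) + 2 * (\<integral>\<^sup>+\<zeta>. ennreal ((norm (H (r *\<^sub>R \<zeta>)))\<^sup>2) \<partial>torus_measure)
     \<le> 2 * H2_poly_means G + 2 * H2_poly_means H"
    by (intro add_mono mult_left_mono torus_mean_le_means r) auto
  finally show "(\<integral>\<^sup>+\<zeta>. ennreal ((norm (F (r *\<^sub>R \<zeta>)))\<^sup>2) \<partial>torus_measure) \<le> 2 * H2_poly_means G + 2 * H2_poly_means H" by simp
qed

lemma torus_mean_bounded: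
  fixes F :: "complex ^ 'n::finite \<Rightarrow> complex"
  assumes "\<And>\<zeta>. \<zeta> \<in> torus \<Longrightarrow> norm (F (r *\<^sub>R \<zeta>)) \<le> b"
  shows "(\<integral>\<^sup>+\<zeta>. ennreal ((norm (F (r *\<^sub>R \<zeta>)))\<^sup>2) \<partial>torus_measure) \<le> ennreal (b\<^sup>2)"
proof -
  have "(\<integral>\<^sup>+\<zeta>. ennreal ((norm (F (r *\<^sub>R \<zeta>)))\<^sup>2) \<partial>torus_measure) \<le> (\<integral>\<^sup>+\<zeta>. ennreal (b\<^sup>2) \<partial>(torus_measure :: (complex ^ 'n) measure))"
    by (rule nn_integral_mono_AE)
       (use AE_torus in \<open>eventually_elim, auto intro!: ennreal_leI power_mono assms\<close>)
  then show ?thesis by simp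
qed

lemma H2_poly_means_eq_norm:
  assumes "H2_poly_means F < \<infinity>" shows "H2_poly_means F = ennreal ((H2_poly_norm F)\<^sup>2)"
  using assms by (simp add: H2_poly_norm_def)

section \<open>From compactness to vanishing\<close>

context polydisc_self_map
begin

lemma radial_bound:
  assumes r: "0 < r" "r < 1"
  obtains q where "q < 1" "\<And>\<zeta>. \<zeta> \<in> torus \<Longrightarrow> norm (\<phi> (r *\<^sub>R \<zeta>)) \<le> q"
proof -
  have c: "continuous_on torus (\<lambda>\<zeta>. norm (\<phi> (r *\<^sub>R \<zeta>)))"
    by (intro continuous_intros continuous_on_compose2[OF cont]) (use r scaleR_torus_polydisc in auto)
  have "(\<chi> i. 1) \<in> (torus :: (complex ^ 'n) set)" by (simp add: torus_def)
  then obtain \<zeta>0 where "\<zeta>0 \<in> torus" "\<And>\<zeta>. \<zeta> \<in> torus \<Longrightarrow> norm (\<phi> (r *\<^sub>R \<zeta>)) \<le> norm (\<phi> (r *\<^sub>R \<zeta>0))"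
    using continuous_attains_sup[OF compact_torus _ c] by blast
  moreover have "norm (\<phi> (r *\<^sub>R \<zeta>0)) < 1" using maps scaleR_torus_polydisc[OF \<open>\<zeta>0 \<in> torus\<close> r] by auto
  ultimately show thesis using that by blast
qed

lemma compact_imp_vanishing:
  assumes \<Theta>: "inner_function \<Theta>" and comp: "compact_composition \<Theta> \<phi>" and e: "e > 0"
  shows "\<exists>R<1. \<forall>w. R < norm w \<longrightarrow> norm w < 1 \<longrightarrow> counting \<phi> w * ennreal ((1 - norm (\<Theta> w)) / (1 - norm w)) \<le> ennreal e"
proof (rule ccontr)
  assume neg: "\<not> ?thesis"
  have h: "\<Theta> holomorphic_on ball 0 1" and lt: "\<And>z. norm z < 1 \<Longrightarrow> norm (\<Theta> z) < 1"
    using \<Theta> by (auto simp: inner_function_def image_subset_iff)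
  obtain C where C: "C > 0" "\<And>w::complex. (1 + norm (\<phi> 0)) / 2 \<le> norm w \<Longrightarrow> norm w < 1 \<Longrightarrow> counting \<phi> w \<le> ennreal (C * (1 - norm w))"
    using counting_linear_bound by blast
  define R0 where "R0 = (1 + norm (\<phi> 0)) / 2"
  have R0: "R0 < 1" "norm (\<phi> 0) < R0" using norm_phi0 by (auto simp: R0_def)
  have "\<forall>k. \<exists>w. max (radius k) R0 < norm w \<and> norm w < 1 \<and> ennreal e < counting \<phi> w * ennreal ((1 - norm (\<Theta> w)) / (1 - norm w))"
  proof
    fix k
    have "max (radius k) R0 < 1" using radius(2)[of k] R0 by simp
    with neg show "\<exists>w. max (radius k) R0 < norm w \<and> norm w < 1 \<and> ennreal e < counting \<phi> w * ennreal ((1 - norm (\<Theta> w)) / (1 - norm w))"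
      by (meson not_le)
  qed
  then obtain W where W: "\<And>k. radius k < norm (W k)" "\<And>k. R0 < norm (W k)" "\<And>k. norm (W k) < 1"
    and Wbig: "\<And>k. ennreal e < counting \<phi> (W k) * ennreal ((1 - norm (\<Theta> (W k))) / (1 - norm (W k)))"
    by (metis max_less_iff_conj)
  have W1: "(\<lambda>k. norm (W k)) \<longlonglongrightarrow> 1"
    by (rule tendsto_sandwich[OF _ _ radius_tendsto tendsto_const]) (auto intro: always_eventually less_imp_le W)
  define \<delta> where "\<delta> = min 1 (e / C)"
  have \<delta>: "0 < \<delta>" "\<delta> \<le> 1" using C e by (auto simp: \<delta>_def)
  \<comment> \<open>Failure of (i) reads e < c (1 - |Theta|) / (1 - |W k|), with c the counting
    function at W k. Inserting c <= C (1 - |W k|) keeps Theta away from the circle by e/C; inserting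
    1 - |Theta| <= 1 bounds c from below. The minimum with 1 in \<open>\<delta>\<close> is for the
    kernel estimates.\<close>
  have main: "norm (\<Theta> (W k)) \<le> 1 - \<delta> \<and> ennreal (e * (1 - norm (W k))) \<le> counting \<phi> (W k)" for k
  proof -
    let ?w = "W k"
    have le: "counting \<phi> ?w \<le> ennreal (C * (1 - norm ?w))" using C(2) W(2,3)[of k] by (simp add: R0_def)
    define c where "c = enn2real (counting \<phi> ?w)"
    have "counting \<phi> ?w < \<infinity>" using le by (simp add: le_less_trans[OF le ennreal_less_top])
    then have ce: "counting \<phi> ?w = ennreal c" by (simp add: c_def)
    have c0: "0 \<le> c" by (simp add: c_def)
    have cC: "c \<le> C * (1 - norm ?w)" using le unfolding ce using C(1) W(3)[of k] by (simp add: ennreal_le_iff)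
    have d: "0 < 1 - norm ?w" using W(3)[of k] by simp
    have u: "0 < 1 - norm (\<Theta> ?w)" using lt[OF W(3)] by simp
    have "ennreal e < ennreal (c * ((1 - norm (\<Theta> ?w)) / (1 - norm ?w)))"
      using Wbig[of k] unfolding ce ennreal_mult'[OF c0] .
    then have big: "e < c * ((1 - norm (\<Theta> ?w)) / (1 - norm ?w))" using e by (simp add: ennreal_less_iff)
    have "c * ((1 - norm (\<Theta> ?w)) / (1 - norm ?w)) \<le> C * (1 - norm ?w) * ((1 - norm (\<Theta> ?w)) / (1 - norm ?w))"
      using cC d u by (intro mult_right_mono) auto
    also have "\<dots> = C * (1 - norm (\<Theta> ?w))" using d by simp
    finally have "e \<le> (1 - norm (\<Theta> ?w)) * C" using big by (simp only: mult.commute[of C])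
    then have "e / C \<le> 1 - norm (\<Theta> ?w)" using C(1) by (simp only: pos_divide_le_eq)
    then have 1: "norm (\<Theta> ?w) \<le> 1 - \<delta>" by (simp add: \<delta>_def)
    have "c * ((1 - norm (\<Theta> ?w)) / (1 - norm ?w)) \<le> c * (1 / (1 - norm ?w))"
      using c0 d u by (intro mult_left_mono divide_right_mono) auto
    then have "e < c / (1 - norm ?w)" using big by simp
    then have "e * (1 - norm ?w) \<le> c" using d by (simp add: pos_less_divide_eq)
    then show ?thesis using 1 unfolding ce by (auto intro: ennreal_leI)
  qed
  define f where "f = (\<lambda>k. model_kernel \<Theta> (W k))"
  have fh: "f k holomorphic_on ball 0 1" for k unfolding f_def by (rule model_kernel_holomorphic[OF h lt W(3)])
  \<comment> \<open>This is 2 kappa rho^2 times e D, with kappa = delta^4 / (256 D^3) and rho =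
    delta^2 D / 1024: the powers of D cancel and 134217728 is 2^27.\<close>
  define \<eta> where "\<eta> = \<delta>^8 * e / 134217728"
  have \<eta>: "0 < \<eta>" using \<delta> e by (simp add: \<eta>_def)
  have lower: "\<forall>\<^sub>F k in sequentially. ennreal \<eta> \<le> H2_poly_means (f k \<circ> \<phi>)"
  proof -
    have "\<forall>\<^sub>F k in sequentially. 1 - \<delta> / 2 < norm (W k)" by (rule order_tendstoD(1)[OF W1]) (use \<delta> in simp)
    then show ?thesis
    proof eventually_elim
      case (elim k)
      define D where "D = 1 - norm (W k)"
      have D: "0 < D" "norm (W k) = 1 - D" using W(3)[of k] by (auto simp: D_def)
      define \<kappa> \<rho> where "\<kappa> = \<delta>^4 / (256 * D^3)" and "\<rho> = \<delta>\<^sup>2 / 1024 * D"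
      have "\<delta>\<^sup>2 \<le> 1" using \<delta> by (simp add: power_le_one)
      then have "\<rho> \<le> 1 / 1024 * D" unfolding \<rho>_def using D by (intro mult_right_mono) auto
      also have "\<dots> \<le> norm (W k) - norm (\<phi> 0)" using W(2)[of k] D unfolding R0_def by simp
      also have "\<dots> \<le> norm (\<phi> 0 - W k)" by (metis norm_minus_commute norm_triangle_ineq2)
      finally have \<rho>: "\<rho> \<le> norm (\<phi> 0 - W k)" .
      have "ennreal (2 * (\<kappa> * \<rho>\<^sup>2)) * counting \<phi> (W k) \<le> H2_poly_means (f k \<circ> \<phi>)"
      proof (rule composition_mean_ge[OF fh _ \<rho>])
        show "0 < \<rho>" "0 \<le> \<kappa>" using D \<delta> by (auto simp: \<rho>_def \<kappa>_def)
        fix z assume "norm (z - W k) \<le> \<rho>"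
        then show "\<kappa> \<le> (norm (deriv (f k) z))\<^sup>2"
          unfolding f_def \<kappa>_def \<rho>_def D_def
          by (intro model_kernel_deriv_near_pole[OF h lt W(3)] \<delta>) (use main[of k] elim in auto)
      qed
      moreover have "ennreal \<eta> \<le> ennreal (2 * (\<kappa> * \<rho>\<^sup>2)) * counting \<phi> (W k)"
      proof -
        have "\<eta> = (2 * (\<kappa> * \<rho>\<^sup>2)) * (e * D)"
          using D by (simp add: \<eta>_def \<kappa>_def \<rho>_def power_mult_distrib power_divide power_mult[symmetric] power2_eq_square power3_eq_cube eval_nat_numeral)
        then have "ennreal \<eta> = ennreal (2 * (\<kappa> * \<rho>\<^sup>2)) * ennreal (e * D)"
        proof -
          have "0 \<le> 2 * (\<kappa> * \<rho>\<^sup>2)" using D by (simp add: \<kappa>_def)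
          then show ?thesis using \<open>\<eta> = (2 * (\<kappa> * \<rho>\<^sup>2)) * (e * D)\<close> by (simp only: ennreal_mult')
        qed
        also have "\<dots> \<le> ennreal (2 * (\<kappa> * \<rho>\<^sup>2)) * counting \<phi> (W k)"
          using main[of k] by (intro mult_left_mono) (auto simp: D_def)
        finally show ?thesis .
      qed
      ultimately show ?case by simp
    qed
  qed
  have fm: "f k \<in> model_space \<Theta>" for k unfolding f_def by (rule model_kernel_in[OF \<Theta> W(3)])
  have fn: "H2_disc_norm (f k) \<le> 2" for k unfolding f_def by (rule model_kernel_H2(2)[OF h lt W(3)])
  obtain s G where s: "strict_mono s" and G: "G \<in> H2_poly"
    and conv: "(\<lambda>k. H2_poly_norm (\<lambda>z. f (s k) (\<phi> z) - G z)) \<longlonglongrightarrow> 0"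
    using comp fm fn unfolding compact_composition_def by blast
  have fp: "f k \<circ> \<phi> \<in> H2_poly" for k using comp fm unfolding compact_composition_def by blast
  have cf: "continuous_on polydisc (f k \<circ> \<phi>)" for k by (rule holomorphic_pd_continuous[OF holomorphic_pd_compose[OF fh]])
  have cG: "continuous_on polydisc G" using G by (auto simp: H2_poly_def intro: holomorphic_pd_continuous)
  define d where "d = (\<lambda>k z. f (s k) (\<phi> z) - G z)"
  have cd: "continuous_on polydisc (d k)" for k
    unfolding d_def using cf[of "s k"] cG by (intro continuous_intros) (simp_all add: o_def)
  have dfin: "H2_poly_means (d k) < \<infinity>" for k
  proof -
    have "H2_poly_means (d k) \<le> 2 * H2_poly_means (f (s k) \<circ> \<phi>) + 2 * H2_poly_means G"
      by (rule H2_poly_means_triangle[OF cf cG]) (auto simp: d_def norm_triangle_ineq4)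
    also have "\<dots> < \<infinity>" using fp[of "s k"] G by (auto simp: H2_poly_def ennreal_mult_less_top)
    finally show ?thesis .
  qed
  have d0: "(\<lambda>k. H2_poly_means (d k)) \<longlonglongrightarrow> 0"
  proof -
    have "(\<lambda>k. ennreal ((H2_poly_norm (d k))\<^sup>2)) \<longlonglongrightarrow> ennreal (0\<^sup>2)"
      unfolding d_def by (intro tendsto_intros conv)
    then show ?thesis by (simp add: H2_poly_means_eq_norm[OF dfin])
  qed
  \<comment> \<open>The limit supplied by compactness must be 0: on a fixed torus of radius r the
    values of phi stay in a compact part of the disc, where the kernels tend to 0 uniformly, while
    the distances to \<open>G\<close> tend to 0.\<close>
  have G0: "(\<integral>\<^sup>+\<zeta>. ennreal ((norm (G (r *\<^sub>R \<zeta>)))\<^sup>2) \<partial>torus_measure) = 0" if r: "0 < r" "r < 1" for r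
  proof -
    obtain q where q: "q < 1" "\<And>\<zeta>. \<zeta> \<in> torus \<Longrightarrow> norm (\<phi> (r *\<^sub>R \<zeta>)) \<le> q" by (rule radial_bound[OF r]) blast
    define b where "b = (\<lambda>k. 2 * sqrt (1 - (norm (W (s k)))\<^sup>2) / (1 - q))"
    have "(\<integral>\<^sup>+\<zeta>. ennreal ((norm (G (r *\<^sub>R \<zeta>)))\<^sup>2) \<partial>torus_measure) \<le> 2 * ennreal ((b k)\<^sup>2) + 2 * H2_poly_means (d k)" for k
    proof -
      have "(\<integral>\<^sup>+\<zeta>. ennreal ((norm (G (r *\<^sub>R \<zeta>)))\<^sup>2) \<partial>torus_measure)
        \<le> 2 * (\<integral>\<^sup>+\<zeta>. ennreal ((norm ((f (s k) \<circ> \<phi>) (r *\<^sub>R \<zeta>)))\<^sup>2) \<partial>torus_measure) + 2 * (\<integral>\<^sup>+\<zeta>. ennreal ((norm (d k (r *\<^sub>R \<zeta>)))\<^sup>2) \<partial>torus_measure)"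
      proof (rule torus_mean_triangle[OF cf cd r])
        show "norm (G z) \<le> norm ((f (s k) \<circ> \<phi>) z) + norm (d k z)" for z
          using norm_triangle_ineq4[of "f (s k) (\<phi> z)" "d k z"] by (simp add: d_def)
      qed
      also have "\<dots> \<le> 2 * ennreal ((b k)\<^sup>2) + 2 * H2_poly_means (d k)"
      proof (intro add_mono mult_left_mono torus_mean_le_means[OF r] torus_mean_bounded)
        fix \<zeta> :: "complex ^ 'n" assume z: "\<zeta> \<in> torus"
        have n1: "norm (\<phi> (r *\<^sub>R \<zeta>)) < 1" using q(2)[OF z] q(1) by simp
        have "norm (f (s k) (\<phi> (r *\<^sub>R \<zeta>))) \<le> 2 * sqrt (1 - (norm (W (s k)))\<^sup>2) / (1 - norm (\<phi> (r *\<^sub>R \<zeta>)))"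
          unfolding f_def by (rule model_kernel_le(2)[OF h lt W(3) n1])
        also have "\<dots> \<le> b k" unfolding b_def using q(1) q(2)[OF z] n1 W(3)[of "s k"]
          by (intro divide_left_mono) (auto simp: abs_square_le_1)
        finally show "norm ((f (s k) \<circ> \<phi>) (r *\<^sub>R \<zeta>)) \<le> b k" by simp
      qed auto
      finally show ?thesis .
    qed
    moreover have "(\<lambda>k. 2 * ennreal ((b k)\<^sup>2) + 2 * H2_poly_means (d k)) \<longlonglongrightarrow> 2 * ennreal (0\<^sup>2) + 2 * 0"
    proof (intro tendsto_intros d0)
      have "(\<lambda>k. norm (W (s k))) \<longlonglongrightarrow> 1" using LIMSEQ_subseq_LIMSEQ[OF W1 s] by (simp add: o_def)
      then have "b \<longlonglongrightarrow> 2 * sqrt (1 - 1\<^sup>2) / (1 - q)" unfolding b_def using q(1) by (intro tendsto_intros) auto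
      then show "b \<longlonglongrightarrow> 0" by simp
    qed auto
    ultimately have "(\<integral>\<^sup>+\<zeta>. ennreal ((norm (G (r *\<^sub>R \<zeta>)))\<^sup>2) \<partial>torus_measure) \<le> 2 * ennreal (0\<^sup>2) + 2 * 0"
      by (intro LIMSEQ_le_const) auto
    then show ?thesis by simp
  qed
  have G0': "H2_poly_means G = 0" 
  proof -
    have "H2_poly_means G \<le> 0" unfolding H2_poly_means_def by (rule SUP_least) (simp add: G0)
    then show ?thesis by simp
  qed
  have up: "H2_poly_means (f (s k) \<circ> \<phi>) \<le> 2 * H2_poly_means (d k)" for k
  proof -
    have "H2_poly_means (f (s k) \<circ> \<phi>) \<le> 2 * H2_poly_means (d k) + 2 * H2_poly_means G"
    proof (rule H2_poly_means_triangle[OF cd cG])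
      show "norm ((f (s k) \<circ> \<phi>) z) \<le> norm (d k z) + norm (G z)" for z
        using norm_triangle_ineq[of "d k z" "G z"] by (simp add: d_def)
    qed
    then show ?thesis by (simp add: G0')
  qed
  have "(\<lambda>k. 2 * H2_poly_means (d k)) \<longlonglongrightarrow> 2 * 0" by (intro tendsto_intros d0) auto
  then have "\<forall>\<^sub>F k in sequentially. 2 * H2_poly_means (d k) < ennreal \<eta>" by (rule order_tendstoD(2)) (use \<eta> in simp)
  moreover have "\<forall>\<^sub>F k in sequentially. ennreal \<eta> \<le> H2_poly_means (f (s k) \<circ> \<phi>)"
    using eventually_compose_filterlim[OF lower filterlim_subseq[OF s]] .
  ultimately have "\<forall>\<^sub>F k in sequentially. False"
  proof eventually_elim
    case (elim k)
    then show ?case using up[of k] by (meson leD le_less_trans order_trans)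
  qed
  then show False by simp
qed

end

section \<open>From vanishing to compactness\<close>

lemma deriv_bound_disc:
  assumes h: "h holomorphic_on ball 0 1" and R: "R < R'" "R' < 1"
    and b: "\<And>z. norm z \<le> R' \<Longrightarrow> norm (h z) \<le> b" and z: "norm z \<le> R"
  shows "norm (deriv h z) \<le> b / (R' - R)"
proof -
  have sub: "norm y \<le> R'" if "y \<in> cball z (R' - R)" for y
    using that norm_triangle_ineq[of "y - z" z] z by (simp add: dist_norm norm_minus_commute)
  then have sub': "cball z (R' - R) \<subseteq> ball 0 1" using R by fastforce
  have "norm ((deriv ^^ 1) h z) \<le> fact 1 * b / (R' - R) ^ 1"
  proof (rule Cauchy_inequality)
    show "h holomorphic_on ball z (R' - R)" by (rule holomorphic_on_subset[OF h]) (use sub' in auto)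
    show "continuous_on (cball z (R' - R)) h"
      by (rule continuous_on_subset[OF holomorphic_on_imp_continuous_on[OF h] sub'])
    show "norm (h x) \<le> b" if "norm (z - x) = R' - R" for x
      by (rule b, rule sub) (use that in \<open>simp add: dist_norm\<close>)
  qed (use R in simp)
  then show ?thesis by simp
qed

text \<open>Cauchy's formula on the circle of radius (1 + |z|)/2, where the kernel is at most 2 / (1
  - |z|), with |f| <= 1 + |f|^2. The bound is not linear in f, but it gives the local boundedness
  that Montel's theorem asks for.\<close>

lemma H2_disc_pointwise:
  assumes f: "f \<in> H2_disc" and z: "norm z < 1"
  shows "norm (f z) \<le> (1 + (H2_disc_norm f)\<^sup>2) * (2 / (1 - norm z))"
proof -
  have fh: "f holomorphic_on ball 0 1" using f by (simp add: H2_disc_def)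
  define q r where "q = norm z" and "r = (1 + q) / 2"
  have q: "0 \<le> q" "q < 1" and r: "0 < r" "r < 1" using z by (auto simp: q_def r_def field_simps intro: add_pos_nonneg)
  define x where "x = z / of_real r"
  have nx: "norm x = q / r" using r by (simp add: x_def q_def norm_divide)
  have x: "1 - norm x \<ge> (1 - q) / 2"
  proof -
    have "1 - q / r = (1 - q) / (1 + q)" using q by (simp add: r_def field_simps)
    moreover have "(1 - q) / 2 \<le> (1 - q) / (1 + q)" using q by (intro divide_left_mono) auto
    ultimately show ?thesis unfolding nx by simp
  qed
  then have x1: "norm x < 1" using q by simp
  have hol: "(\<lambda>y. f (of_real r * y)) holomorphic_on ball 0 (1/r)"
    by (intro holomorphic_on_compose_gen[OF _ fh, unfolded o_def] holomorphic_intros)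
       (use r in \<open>auto simp: norm_mult field_simps\<close>)
  have cf: "continuous_on UNIV (\<lambda>t. f (of_real r * cis t))" by (rule holomorphic_continuous_cis[OF fh]) (use r in auto)
  have "f z = (\<integral>t. f (of_real r * cis t) / (1 - x * cnj (cis t)) \<partial>angle)"
    using angle_Cauchy[OF hol _ x1] r by (simp add: x_def)
  also have "norm \<dots> \<le> (\<integral>t. (1 + (norm (f (of_real r * cis t)))\<^sup>2) * (2 / (1 - q)) \<partial>angle)"
  proof (rule order_trans[OF integral_norm_bound], rule integral_mono')
    show "integrable angle (\<lambda>t. (1 + (norm (f (of_real r * cis t)))\<^sup>2) * (2 / (1 - q)))"
      by (intro integrable_angle_continuous continuous_on_mult continuous_on_const continuous_on_add continuous_on_power continuous_on_norm cf)
    fix t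
    have "(1 - q) / 2 \<le> norm (1 - x * cnj (cis t))"
      using norm_triangle_ineq2[of 1 "x * cnj (cis t)"] x by (simp add: norm_mult)
    then have "norm (f (of_real r * cis t)) / norm (1 - x * cnj (cis t)) \<le> (1 + (norm (f (of_real r * cis t)))\<^sup>2) / ((1 - q) / 2)"
      using q norm_le_one_plus_square[of "norm (f (of_real r * cis t))"] by (intro frac_le) auto
    then show "norm (f (of_real r * cis t) / (1 - x * cnj (cis t))) \<le> (1 + (norm (f (of_real r * cis t)))\<^sup>2) * (2 / (1 - q))"
      by (simp add: norm_divide)
    show "0 \<le> (1 + (norm (f (of_real r * cis t)))\<^sup>2) * (2 / (1 - q))" using q by simp
  qed
  also have "\<dots> = (1 + sqmean f r) * (2 / (1 - q))"
    using integrable_sqmean[OF fh r] angle.prob_space by (simp add: sqmean_def del: times_divide_eq_right)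
  also have "\<dots> \<le> (1 + (H2_disc_norm f)\<^sup>2) * (2 / (1 - q))"
    using sqmean_le_H2_norm[OF f r] q by (intro mult_right_mono) auto
  finally show ?thesis unfolding q_def .
qed

context polydisc_self_map
begin

text \<open>Where \<open>1 - \<bar>\<Theta>\<bar>\<^sup>2\<close> is small the linear bound on the counting function suffices; elsewhere the hypothesis
  gives smallness directly.\<close>

lemma counting_weighted_small:
  assumes lt: "\<And>z. norm z < 1 \<Longrightarrow> norm (\<Theta> z) < 1"
    and van: "\<And>e. e > 0 \<Longrightarrow> \<exists>R<1. \<forall>w. R < norm w \<longrightarrow> norm w < 1 \<longrightarrow> counting \<phi> w * ennreal ((1 - norm (\<Theta> w)) / (1 - norm w)) \<le> ennreal e"
    and \<eta>: "\<eta> > 0"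
  shows "\<exists>R<1. norm (\<phi> 0) \<le> R \<and> (\<forall>w. R < norm w \<longrightarrow> norm w < 1 \<longrightarrow>
    counting \<phi> w \<le> ennreal (\<eta> * ((1 - (norm (\<Theta> w))\<^sup>2) powr (-1/4) * ln (1 / norm w))))"
proof -
  obtain C where C: "C > 0" "\<And>w::complex. (1 + norm (\<phi> 0)) / 2 \<le> norm w \<Longrightarrow> norm w < 1 \<Longrightarrow> counting \<phi> w \<le> ennreal (C * (1 - norm w))"
    using counting_linear_bound by blast
  \<comment> \<open>The value of u at which C u^(1/4) = eta. Below it the linear bound C (1 - |w|)
    is already within eta u^(-1/4) (1 - |w|); above it 1 - |Theta| >= t/2, so smallness e = eta t /
    2 yields eta (1 - |w|).\<close>
  define t where "t = (\<eta> / C) powr 4"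
  have t: "t > 0" using \<eta> C by (simp add: t_def)
  have t4: "t powr (1/4) = \<eta> / C" unfolding t_def powr_powr using \<eta> C by simp
  define e where "e = \<eta> * t / 2"
  have e: "e > 0" using \<eta> t by (simp add: e_def)
  obtain R1 where R1: "R1 < 1" "\<And>w. R1 < norm w \<Longrightarrow> norm w < 1 \<Longrightarrow> counting \<phi> w * ennreal ((1 - norm (\<Theta> w)) / (1 - norm w)) \<le> ennreal e"
    using van[OF e] by blast
  show ?thesis
  proof (intro exI[of _ "max R1 ((1 + norm (\<phi> 0)) / 2)"] conjI allI impI)
    fix w :: complex assume "max R1 ((1 + norm (\<phi> 0)) / 2) < norm w" and w1: "norm w < 1"
    then have w: "R1 < norm w" "(1 + norm (\<phi> 0)) / 2 \<le> norm w" by auto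
    have w0: "norm w > 0" by (rule less_le_trans[OF _ w(2)]) (simp add: add_pos_nonneg)
    define d where "d = 1 - norm w"
    have d: "d > 0" using w1 by (simp add: d_def)
    have dl: "d \<le> ln (1 / norm w)" using ln_le_minus_one[OF w0] w0 by (simp add: d_def ln_div)
    define u where "u = 1 - (norm (\<Theta> w))\<^sup>2"
    have u: "0 < u" "u \<le> 1" using lt[OF w1] by (auto simp: u_def abs_square_less_1)
    have le: "counting \<phi> w \<le> ennreal (C * d)" unfolding d_def by (rule C(2)[OF w(2) w1])
    define c where "c = enn2real (counting \<phi> w)"
    have "counting \<phi> w < \<infinity>" by (simp add: le_less_trans[OF le ennreal_less_top])
    then have ce: "counting \<phi> w = ennreal c" by (simp add: c_def)
    have c0: "0 \<le> c" by (simp add: c_def)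
    have cC: "c \<le> C * d" using le unfolding ce using C(1) d by (simp add: ennreal_le_iff)
    have "ennreal (c * ((1 - norm (\<Theta> w)) / (1 - norm w))) \<le> ennreal e"
      using R1(2)[OF w(1) w1] unfolding ce ennreal_mult'[OF c0] .
    then have small: "c * ((1 - norm (\<Theta> w)) / d) \<le> e" using e by (simp add: ennreal_le_iff d_def)
    have "c \<le> \<eta> * (u powr (-1/4) * d)"
    proof (cases "u \<le> t")
      case True
      have "C * u powr (1/4) \<le> C * t powr (1/4)" using True u C by (intro mult_left_mono powr_mono2) auto
      then have "C * u powr (1/4) \<le> \<eta>" using C t4 by simp
      moreover have "u powr (1/4) * u powr (-1/4) = 1" using u by (simp flip: powr_add)
      ultimately have "C = C * u powr (1/4) * u powr (-1/4)" by (simp add: mult.assoc)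
      also have "\<dots> \<le> \<eta> * u powr (-1/4)" using \<open>C * u powr (1/4) \<le> \<eta>\<close> by (intro mult_right_mono) auto
      finally have "C * d \<le> \<eta> * u powr (-1/4) * d" using d by (intro mult_right_mono) auto
      then show ?thesis using cC by (simp add: mult.assoc)
    next
      case False
      have "u = (1 + norm (\<Theta> w)) * (1 - norm (\<Theta> w))" by (simp add: u_def power2_eq_square algebra_simps)
      also have "\<dots> \<le> 2 * (1 - norm (\<Theta> w))" using lt[OF w1] by (intro mult_right_mono) auto
      finally have "t / 2 \<le> 1 - norm (\<Theta> w)" using False by simp
      then have "c * ((t / 2) / d) \<le> c * ((1 - norm (\<Theta> w)) / d)" using c0 d by (intro mult_left_mono divide_right_mono) auto
      with small have "c * ((t / 2) / d) \<le> e" by simp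
      then have "c * ((t / 2) / d) \<le> \<eta> * d * ((t / 2) / d)" using d by (simp add: e_def)
      then have "c \<le> \<eta> * d" using t d by (subst (asm) mult_le_cancel_right_pos) auto
      also have "\<dots> = \<eta> * (1 powr (-1/4) * d)" by simp
      also have "\<dots> \<le> \<eta> * (u powr (-1/4) * d)"
        using u d \<eta> by (intro mult_left_mono mult_right_mono powr_mono2') auto
      finally show ?thesis .
    qed
    also have "\<dots> \<le> \<eta> * (u powr (-1/4) * ln (1 / norm w))" using dl \<eta> by (intro mult_left_mono) auto
    finally show "counting \<phi> w \<le> ennreal (\<eta> * ((1 - (norm (\<Theta> w))\<^sup>2) powr (-1/4) * ln (1 / norm w)))"
      unfolding ce u_def by (rule ennreal_leI)
  qed (use R1 norm_phi0 in \<open>auto simp: max_def\<close>)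
qed

text \<open>The area integral is split at |w| = R. Inside, |f'| <= S and the counting function is at
  most ln (2/|p - w|) with p = phi(0); this logarithm integrates over the ball of radius 2 about p,
  which contains the disc, to 4 c0. Outside, smallness of the counting function and the weighted
  area estimate give the term 88 eta.\<close>

lemma composition_bound:
  assumes \<Theta>: "\<Theta> holomorphic_on ball 0 1" "\<And>z. norm z < 1 \<Longrightarrow> norm (\<Theta> z) < 1" and f: "f \<in> fourier_model_space \<Theta>"
    and small: "\<And>w. R < norm w \<Longrightarrow> norm w < 1 \<Longrightarrow> counting \<phi> w \<le> ennreal (\<eta> * ((1 - (norm (\<Theta> w))\<^sup>2) powr (-1/4) * ln (1 / norm w)))"
    and S: "\<And>z. norm z \<le> R \<Longrightarrow> norm (deriv f z) \<le> S" and \<eta>: "0 \<le> \<eta>"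
  shows "H2_poly_means (f \<circ> \<phi>) \<le> ennreal ((norm (f (\<phi> 0)))\<^sup>2 + 4 * S\<^sup>2 + 88 * \<eta> * (H2_disc_norm f)\<^sup>2)"
proof (rule H2_poly_means_le)
  have fh: "f holomorphic_on ball 0 1" using f by (simp add: fourier_model_space_def H2_disc_def)
  show "holomorphic_pd (f \<circ> \<phi>)" by (rule holomorphic_pd_compose[OF fh])
  define p where "p = \<phi> 0"
  define A where "A = (\<lambda>w. ennreal (ln (2 / norm (p - w))) * indicator (ball p 2) w)"
  define D where "D = (\<lambda>w. (norm (deriv f w))\<^sup>2 * (1 - (norm (\<Theta> w))\<^sup>2) powr (-1/4))"
  define B where "B = (\<lambda>w. ennreal (D w * ln (1 / norm w)) * indicator (ball 0 1) w)"
  have [measurable]: "A \<in> borel_measurable lborel" unfolding A_def by measurable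
  have nz: "1 - (norm (\<Theta> z))\<^sup>2 \<noteq> 0" if "norm z < 1" for z
    using \<Theta>(2)[OF that] abs_square_less_1[of "norm (\<Theta> z)"] by auto
  have cD: "continuous_on (ball 0 1) D" unfolding D_def
    by (intro continuous_intros holomorphic_on_imp_continuous_on holomorphic_deriv fh \<Theta>) (use nz in auto)
  have mD: "(\<lambda>w. indicator (ball 0 1) w *\<^sub>R D w) \<in> borel_measurable borel"
    by (rule borel_measurable_continuous_on_indicator[OF _ cD]) simp
  have Beq: "B = (\<lambda>w. ennreal ((indicator (ball 0 1) w *\<^sub>R D w) * ln (1 / norm w)))"
    by (auto simp: B_def indicator_def fun_eq_iff)
  have [measurable]: "B \<in> borel_measurable lborel" unfolding Beq using mD by measurable
  have IA: "(\<integral>\<^sup>+w. A w \<partial>lborel) = ennreal (c0 * 2\<^sup>2)" unfolding A_def by (rule log_area_scaled) simp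
  have IB: "(\<integral>\<^sup>+w. B w \<partial>lborel) \<le> ennreal (88 * c0 * (H2_disc_norm f)\<^sup>2)"
    unfolding B_def D_def by (rule weighted_derivative_bound[OF \<Theta> f])
  fix k
  have "(\<integral>\<^sup>+w. ennreal ((norm (deriv f w))\<^sup>2) * indicator (ball 0 1) w * mean_counting \<phi> k w \<partial>lborel)
     \<le> (\<integral>\<^sup>+w. ennreal (S\<^sup>2) * A w + ennreal \<eta> * B w \<partial>lborel)"
  proof (rule nn_integral_mono_AE)
    show "AE w in lborel. ennreal ((norm (deriv f w))\<^sup>2) * indicator (ball 0 1) w * mean_counting \<phi> k w \<le> ennreal (S\<^sup>2) * A w + ennreal \<eta> * B w"
      using AE_lborel_singleton[of p]
    proof eventually_elim
      case (elim w)
      show ?case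
      proof (cases "norm w < 1")
        case w1: True
        show ?thesis
        proof (cases "norm w \<le> R")
          case True
          have pw: "norm (p - w) > 0" "norm (p - w) < 2"
            using elim norm_triangle_ineq4[of p w] w1 norm_phi0 by (auto simp: p_def)
          have "norm (1 - cnj w * p) \<le> 2"
          proof -
            have "norm (cnj w * p) \<le> 1" using w1 norm_phi0 by (auto simp: norm_mult p_def intro!: mult_le_one)
            then show ?thesis using norm_triangle_ineq4[of 1 "cnj w * p"] by simp
          qed
          moreover have "0 < norm (1 - cnj w * p)" using one_minus_cnj_mult_bounds(3)[OF w1 norm_phi0] by (simp add: p_def)
          ultimately have "ln (norm (1 - cnj w * p) / norm (p - w)) \<le> ln (2 / norm (p - w))"
            using pw by (subst ln_le_cancel_iff) (auto intro: divide_right_mono)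
          moreover have "mean_counting \<phi> k w \<le> ennreal (ln (norm (1 - cnj w * p) / norm (p - w)))"
            using order_trans[OF mean_counting_le counting_le[of w]] elim w1 by (simp add: p_def)
          ultimately have "mean_counting \<phi> k w \<le> A w"
            using pw by (auto simp: A_def dist_norm intro: order_trans ennreal_leI)
          moreover have "ennreal ((norm (deriv f w))\<^sup>2) \<le> ennreal (S\<^sup>2)" by (intro ennreal_leI power_mono S True) auto
          ultimately have "ennreal ((norm (deriv f w))\<^sup>2) * mean_counting \<phi> k w \<le> ennreal (S\<^sup>2) * A w" by (intro mult_mono) auto
          from add_increasing2[OF zero_le this, of "ennreal \<eta> * B w"] show ?thesis using w1 by simp
        next
          case False
          have D0: "0 \<le> (norm (deriv f w))\<^sup>2" by simp
          have "ennreal ((norm (deriv f w))\<^sup>2) * mean_counting \<phi> k w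
             \<le> ennreal ((norm (deriv f w))\<^sup>2) * ennreal (\<eta> * ((1 - (norm (\<Theta> w))\<^sup>2) powr (-1/4) * ln (1 / norm w)))"
            by (intro mult_left_mono order_trans[OF mean_counting_le small]) (use False w1 in auto)
          also have "\<dots> = ennreal (\<eta> * (D w * ln (1 / norm w)))"
            unfolding ennreal_mult'[OF D0, symmetric] by (simp add: D_def mult_ac)
          also have "\<dots> = ennreal \<eta> * B w" using w1 unfolding ennreal_mult'[OF \<eta>] by (simp add: B_def)
          finally have "ennreal ((norm (deriv f w))\<^sup>2) * mean_counting \<phi> k w \<le> ennreal \<eta> * B w" .
          from add_increasing[OF zero_le this, of "ennreal (S\<^sup>2) * A w"] show ?thesis using w1 by simp
        qed
      qed simp
    qed
  qed
  also have "\<dots> = ennreal (S\<^sup>2) * (\<integral>\<^sup>+w. A w \<partial>lborel) + ennreal \<eta> * (\<integral>\<^sup>+w. B w \<partial>lborel)"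
    by (subst nn_integral_add) (auto simp: nn_integral_cmult)
  also have "\<dots> \<le> ennreal (S\<^sup>2) * ennreal (c0 * 2\<^sup>2) + ennreal \<eta> * ennreal (88 * c0 * (H2_disc_norm f)\<^sup>2)"
    unfolding IA by (intro add_left_mono mult_left_mono IB) auto
  also have "\<dots> = ennreal (c0 * (4 * S\<^sup>2 + 88 * \<eta> * (H2_disc_norm f)\<^sup>2))"
    using c0_pos \<eta> by (simp add: ennreal_mult'[symmetric] ennreal_plus[symmetric] algebra_simps del: ennreal_plus)
  finally have I: "(\<integral>\<^sup>+w. ennreal ((norm (deriv f w))\<^sup>2) * indicator (ball 0 1) w * mean_counting \<phi> k w \<partial>lborel)
    \<le> ennreal (c0 * (4 * S\<^sup>2 + 88 * \<eta> * (H2_disc_norm f)\<^sup>2))" .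
  have "(\<integral>\<^sup>+\<zeta>. ennreal ((norm (f (\<phi> (radius k *\<^sub>R \<zeta>))))\<^sup>2) \<partial>torus_measure)
    \<le> ennreal ((norm (f (\<phi> 0)))\<^sup>2) + ennreal (1/c0) * ennreal (c0 * (4 * S\<^sup>2 + 88 * \<eta> * (H2_disc_norm f)\<^sup>2))"
    by (rule order_trans[OF composition_mean_le[OF fh]]) (intro add_left_mono mult_left_mono I, auto)
  also have "ennreal (1/c0) * ennreal (c0 * (4 * S\<^sup>2 + 88 * \<eta> * (H2_disc_norm f)\<^sup>2)) = ennreal (4 * S\<^sup>2 + 88 * \<eta> * (H2_disc_norm f)\<^sup>2)"
    using c0_pos by (subst ennreal_mult'[symmetric]) auto
  also have "ennreal ((norm (f (\<phi> 0)))\<^sup>2) + ennreal (4 * S\<^sup>2 + 88 * \<eta> * (H2_disc_norm f)\<^sup>2)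
    = ennreal ((norm (f (\<phi> 0)))\<^sup>2 + 4 * S\<^sup>2 + 88 * \<eta> * (H2_disc_norm f)\<^sup>2)"
    using \<eta> by (subst ennreal_plus[symmetric]) (auto simp: add.assoc)
  finally show "(\<integral>\<^sup>+\<zeta>. ennreal ((norm ((f \<circ> \<phi>) (radius k *\<^sub>R \<zeta>)))\<^sup>2) \<partial>torus_measure)
    \<le> ennreal ((norm (f (\<phi> 0)))\<^sup>2 + 4 * S\<^sup>2 + 88 * \<eta> * (H2_disc_norm f)\<^sup>2)" by simp
qed

lemma vanishing_imp_compact:
  assumes \<Theta>: "\<Theta> holomorphic_on ball 0 1" "\<And>z. norm z < 1 \<Longrightarrow> norm (\<Theta> z) < 1"
    and van: "\<And>e. e > 0 \<Longrightarrow> \<exists>R<1. \<forall>w. R < norm w \<longrightarrow> norm w < 1 \<longrightarrow> counting \<phi> w * ennreal ((1 - norm (\<Theta> w)) / (1 - norm w)) \<le> ennreal e"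
  shows "compact_composition \<Theta> \<phi>"
  unfolding compact_composition_def
proof (intro conjI ballI allI impI)
  note sub = model_space_subset_fourier[OF \<Theta>]
  have small_counting: "\<exists>R<1. norm (\<phi> 0) \<le> R \<and> (\<forall>w. R < norm w \<longrightarrow> norm w < 1 \<longrightarrow>
    counting \<phi> w \<le> ennreal (\<eta> * ((1 - (norm (\<Theta> w))\<^sup>2) powr (-1/4) * ln (1 / norm w))))" if "\<eta> > 0" for \<eta>
    by (rule counting_weighted_small[OF \<Theta>(2) van that])
  show bounded: "f \<circ> \<phi> \<in> H2_poly" if f: "f \<in> model_space \<Theta>" for f
  proof -
    have fh: "f holomorphic_on ball 0 1" using f by (simp add: model_space_def H2_disc_def)
    obtain R where R: "R < 1" "norm (\<phi> 0) \<le> R"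
      "\<And>w. R < norm w \<Longrightarrow> norm w < 1 \<Longrightarrow> counting \<phi> w \<le> ennreal (1 * ((1 - (norm (\<Theta> w))\<^sup>2) powr (-1/4) * ln (1 / norm w)))"
      using small_counting[OF zero_less_one] by blast
    have "compact (deriv f ` cball 0 R)"
      by (intro compact_continuous_image continuous_on_subset[OF holomorphic_on_imp_continuous_on[OF holomorphic_deriv[OF fh open_ball]]])
         (use R in auto)
    then have "bounded (deriv f ` cball 0 R)" by (rule compact_imp_bounded)
    then obtain S where "\<And>y. y \<in> deriv f ` cball 0 R \<Longrightarrow> norm y \<le> S" unfolding bounded_iff by blast
    then have S: "norm (deriv f z) \<le> S" if "norm z \<le> R" for z using that by simp
    have "H2_poly_means (f \<circ> \<phi>) \<le> ennreal ((norm (f (\<phi> 0)))\<^sup>2 + 4 * S\<^sup>2 + 88 * 1 * (H2_disc_norm f)\<^sup>2)"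
      by (rule composition_bound[OF \<Theta> _ R(3) S]) (use sub f in auto)
    then have "H2_poly_means (f \<circ> \<phi>) < \<infinity>" by (rule le_less_trans) simp
    then show ?thesis by (simp add: H2_poly_def holomorphic_pd_compose[OF fh])
  qed
  fix fs :: "nat \<Rightarrow> complex \<Rightarrow> complex"
  assume "(\<forall>k. fs k \<in> model_space \<Theta>) \<and> (\<exists>B. \<forall>k. H2_disc_norm (fs k) \<le> B)"
  then obtain B where fm: "\<And>k. fs k \<in> model_space \<Theta>" and B: "\<And>k. H2_disc_norm (fs k) \<le> B" by blast
  have B0: "0 \<le> B" using B[of 0] by (rule order_trans[rotated]) (simp add: H2_disc_norm_def)
  have fF: "fs k \<in> fourier_model_space \<Theta>" for k using fm sub by blast
  have fH: "fs k \<in> H2_disc" for k using fm by (simp add: model_space_def)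
  have fh: "fs k holomorphic_on ball 0 1" for k using fH by (simp add: H2_disc_def)
  have loc: "\<exists>M. \<forall>h\<in>range fs. \<forall>z\<in>K. norm (h z) \<le> M" if K: "compact K" "K \<subseteq> ball 0 1" for K
  proof (cases "K = {}")
    case False
    obtain x where x: "x \<in> K" "\<And>z. z \<in> K \<Longrightarrow> norm z \<le> norm x"
      using continuous_attains_sup[OF K(1) False, of norm] by (auto intro: continuous_intros)
    have x1: "norm x < 1" using x(1) K(2) by auto
    have "norm (fs k z) \<le> (1 + B\<^sup>2) * (2 / (1 - norm x))" if z: "z \<in> K" for k z
    proof -
      have "norm z < 1" using x(2)[OF z] x1 by simp
      note H2_disc_pointwise[OF fH this, of k]
      also have "(1 + (H2_disc_norm (fs k))\<^sup>2) * (2 / (1 - norm z)) \<le> (1 + B\<^sup>2) * (2 / (1 - norm x))"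
        using x(2)[OF z] x1 B[of k] B0 by (intro mult_mono add_left_mono power_mono divide_left_mono) (auto simp: H2_disc_norm_def)
      finally show ?thesis .
    qed
    then show ?thesis by auto
  qed auto
  obtain g s where gh: "g holomorphic_on ball 0 1" and s: "strict_mono (s :: nat \<Rightarrow> nat)"
    and unif: "\<And>K. compact K \<Longrightarrow> K \<subseteq> ball 0 1 \<Longrightarrow> uniform_limit K (fs \<circ> s) g sequentially"
  proof (rule Montel[of "ball 0 1" "range fs" fs])
    show "h holomorphic_on ball 0 1" if "h \<in> range fs" for h using that fh by auto
    show "\<exists>M. \<forall>h\<in>range fs. \<forall>z\<in>K. norm (h z) \<le> M" if "compact K" "K \<subseteq> ball 0 1" for K by (rule loc[OF that])
    fix g and s :: "nat \<Rightarrow> nat"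
    assume "g holomorphic_on ball 0 1" "strict_mono s"
      "\<And>K. compact K \<Longrightarrow> K \<subseteq> ball 0 1 \<Longrightarrow> uniform_limit K (fs \<circ> s) g sequentially"
    then show thesis by (rule that)
  qed simp_all
  define G where "G = g \<circ> \<phi>"
  have Gp: "holomorphic_pd G" unfolding G_def by (rule holomorphic_pd_compose[OF gh])
  have cG: "continuous_on polydisc G" by (rule holomorphic_pd_continuous[OF Gp])
  have cf: "continuous_on polydisc (fs k \<circ> \<phi>)" for k by (rule holomorphic_pd_continuous[OF holomorphic_pd_compose[OF fh]])
  define d where "d = (\<lambda>k z. fs (s k) (\<phi> z) - G z)"
  have small: "\<forall>\<^sub>F k in sequentially. H2_poly_means (d k) \<le> ennreal e" if e: "e > 0" for e
  proof -
    \<comment> \<open>Differences of two members of the sequence have norm at most 2 B, hence the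
      square; the summand 1 keeps the divisor positive when B = 0.\<close>
    define X where "X = 88 * (2 * B)\<^sup>2 + 1"
    have den: "0 < X" by (simp add: X_def add_nonneg_pos)
    define \<eta> where "\<eta> = e / (8 * X)"
    have \<eta>: "\<eta> > 0" using e den by (simp add: \<eta>_def)
    have \<eta>le: "88 * \<eta> * (2 * B)\<^sup>2 \<le> e / 8"
    proof -
      have "88 * \<eta> * (2 * B)\<^sup>2 = \<eta> * (88 * (2 * B)\<^sup>2)" by simp
      also have "\<dots> \<le> \<eta> * X" unfolding X_def using \<eta> by (intro mult_left_mono) auto
      also have "\<dots> = e / 8" using den unfolding \<eta>_def by simp
      finally show ?thesis .
    qed
    obtain R where R: "R < 1" "norm (\<phi> 0) \<le> R"
      "\<And>w. R < norm w \<Longrightarrow> norm w < 1 \<Longrightarrow> counting \<phi> w \<le> ennreal (\<eta> * ((1 - (norm (\<Theta> w))\<^sup>2) powr (-1/4) * ln (1 / norm w)))"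
      using small_counting[OF \<eta>] by blast
    define R' where "R' = (1 + R) / 2"
    have R': "R < R'" "R' < 1" using R by (auto simp: R'_def)
    define Q where "Q = 1 + 4 / (R' - R)\<^sup>2"
    have Q: "0 < Q" using R' by (simp add: Q_def add_pos_nonneg)
    \<comment> \<open>Chosen so that the value at phi(0), at most b, and the derivative on |z| <= R,
      at most b / (R' - R) by Cauchy, together contribute b^2 + 4 (b / (R' - R))^2 = e/8. That
      phi(0) lies within radius R brings its value under the same uniform bound.\<close>
    define b where "b = sqrt (e / (8 * Q))"
    have b: "b > 0" "b\<^sup>2 * Q = e / 8" using e Q by (auto simp: b_def)
    have "uniform_limit (cball 0 R') (fs \<circ> s) g sequentially" by (rule unif) (use R' in auto)
    then have "\<forall>\<^sub>F k in sequentially. \<forall>z\<in>cball 0 R'. dist ((fs \<circ> s) k z) (g z) < b / 2"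
      by (rule uniform_limitD) (use b in simp)
    then obtain N where "\<And>k z. k \<ge> N \<Longrightarrow> z \<in> cball 0 R' \<Longrightarrow> dist ((fs \<circ> s) k z) (g z) < b / 2"
      unfolding eventually_sequentially by blast
    then have N: "norm (fs (s k) z - g z) < b / 2" if "k \<ge> N" "norm z \<le> R'" for k z
      using that by (simp add: dist_norm)
    \<comment> \<open>The difference of two kernels of the sequence's span is handled in
      \<open>fourier_model_space\<close>, where closure under differences holds; the two halves of
      the bound are e/8 each.\<close>
    have cauchy: "H2_poly_means ((\<lambda>z. fs (s k) z - fs (s l) z) \<circ> \<phi>) \<le> ennreal (e / 4)" if kl: "k \<ge> N" "l \<ge> N" for k l
    proof -
      let ?h = "\<lambda>z. fs (s k) z - fs (s l) z"
      have hb: "norm (?h z) \<le> b" if "norm z \<le> R'" for z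
        using N[OF kl(1) that] N[OF kl(2) that] norm_triangle_ineq4[of "fs (s k) z - g z" "fs (s l) z - g z"] by simp
      have hh: "?h holomorphic_on ball 0 1" by (intro holomorphic_intros fh)
      note hF = fourier_model_space_diff[OF \<Theta>(1) fF fF B B B0, of "s k" "s l"]
      have "H2_poly_means (?h \<circ> \<phi>) \<le> ennreal ((norm (?h (\<phi> 0)))\<^sup>2 + 4 * (b / (R' - R))\<^sup>2 + 88 * \<eta> * (H2_disc_norm ?h)\<^sup>2)"
        by (rule composition_bound[OF \<Theta> hF(1) R(3)]) (use deriv_bound_disc[OF hh R' hb] \<eta> in auto)
      also have "\<dots> \<le> ennreal (e / 4)"
      proof (rule ennreal_leI)
        have "(norm (?h (\<phi> 0)))\<^sup>2 \<le> b\<^sup>2" using hb[of "\<phi> 0"] R(2) R' by (intro power_mono) auto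
        moreover have "4 * (b / (R' - R))\<^sup>2 = b\<^sup>2 * (4 / (R' - R)\<^sup>2)" by (simp add: power_divide)
        moreover have "88 * \<eta> * (H2_disc_norm ?h)\<^sup>2 \<le> 88 * \<eta> * (2 * B)\<^sup>2"
          using hF(2) \<eta> by (intro mult_left_mono power_mono) (auto simp: H2_disc_norm_def)
        moreover have "b\<^sup>2 + b\<^sup>2 * (4 / (R' - R)\<^sup>2) = e / 8" using b(2) by (simp add: Q_def distrib_left)
        ultimately show "(norm (?h (\<phi> 0)))\<^sup>2 + 4 * (b / (R' - R))\<^sup>2 + 88 * \<eta> * (H2_disc_norm ?h)\<^sup>2 \<le> e / 4"
          using \<eta>le by linarith
      qed
      finally show ?thesis .
    qed
    have "H2_poly_means (d k) \<le> ennreal e" if k: "k \<ge> N" for k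
      unfolding H2_poly_means_def
    proof (rule SUP_least)
      fix r :: real assume "r \<in> {0<..<1}"
      then have r: "0 < r" "r < 1" by auto
      \<comment> \<open>The Cauchy estimate passes to the limit one radius at a time: with r fixed,
        phi stays within radius q on the torus, so some later member of the sequence is uniformly
        within sqrt (e/4) of \<open>g\<close> there. The index may depend on r, because the Cauchy
        bound does not.\<close>
      obtain q where q: "q < 1" "\<And>\<zeta>. \<zeta> \<in> torus \<Longrightarrow> norm (\<phi> (r *\<^sub>R \<zeta>)) \<le> q" by (rule radial_bound[OF r]) blast
      have "uniform_limit (cball 0 q) (fs \<circ> s) g sequentially" by (rule unif) (use q in auto)
      then have "\<forall>\<^sub>F l in sequentially. \<forall>z\<in>cball 0 q. dist ((fs \<circ> s) l z) (g z) < sqrt (e / 4)"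
        by (rule uniform_limitD) (use e in simp)
      then have "\<forall>\<^sub>F l in sequentially. l \<ge> N \<and> (\<forall>z\<in>cball 0 q. dist ((fs \<circ> s) l z) (g z) < sqrt (e / 4))"
        by (intro eventually_conj eventually_ge_at_top)
      then obtain l where l: "l \<ge> N" "\<And>z. norm z \<le> q \<Longrightarrow> norm (fs (s l) z - g z) < sqrt (e / 4)"
        by (auto simp: eventually_sequentially dist_norm)
      have cd: "continuous_on polydisc (d l)"
        unfolding d_def using cf[of "s l"] cG by (intro continuous_intros) (simp_all add: o_def)
      have ch: "continuous_on polydisc ((\<lambda>z. fs (s k) z - fs (s l) z) \<circ> \<phi>)"
        unfolding o_def using cf[of "s l"] cf[of "s k"] by (intro continuous_intros) (simp_all add: o_def)
      have "(\<integral>\<^sup>+\<zeta>. ennreal ((norm (d k (r *\<^sub>R \<zeta>)))\<^sup>2) \<partial>torus_measure)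
        \<le> 2 * (\<integral>\<^sup>+\<zeta>. ennreal ((norm (((\<lambda>z. fs (s k) z - fs (s l) z) \<circ> \<phi>) (r *\<^sub>R \<zeta>)))\<^sup>2) \<partial>torus_measure)
          + 2 * (\<integral>\<^sup>+\<zeta>. ennreal ((norm (d l (r *\<^sub>R \<zeta>)))\<^sup>2) \<partial>torus_measure)"
      proof (rule torus_mean_triangle[OF ch cd r])
        show "norm (d k z) \<le> norm (((\<lambda>z. fs (s k) z - fs (s l) z) \<circ> \<phi>) z) + norm (d l z)" for z
          using norm_triangle_ineq[of "fs (s k) (\<phi> z) - fs (s l) (\<phi> z)" "d l z"] by (simp add: d_def)
      qed
      also have "\<dots> \<le> 2 * ennreal (e / 4) + 2 * ennreal ((sqrt (e / 4))\<^sup>2)"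
      proof (intro add_mono mult_left_mono torus_mean_bounded)
        show "(\<integral>\<^sup>+\<zeta>. ennreal ((norm (((\<lambda>z. fs (s k) z - fs (s l) z) \<circ> \<phi>) (r *\<^sub>R \<zeta>)))\<^sup>2) \<partial>torus_measure) \<le> ennreal (e / 4)"
          by (rule order_trans[OF torus_mean_le_means[OF r] cauchy[OF k l(1)]])
        show "norm (d l (r *\<^sub>R \<zeta>)) \<le> sqrt (e / 4)" if "\<zeta> \<in> torus" for \<zeta> :: "complex ^ 'n"
          using l(2)[OF q(2)[OF that]] by (simp add: d_def G_def)
      qed auto
      also have "\<dots> = ennreal (2 * (e / 4) + 2 * (e / 4))"
      proof -
        have two: "2 * ennreal x = ennreal (2 * x)" for x using ennreal_mult'[of 2 x] by simp
        have "(sqrt (e / 4))\<^sup>2 = e / 4" using e by simp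
        then show ?thesis unfolding two using e by (simp only: ennreal_plus[symmetric])
      qed
      also have "\<dots> = ennreal e" by simp
      finally show "(\<integral>\<^sup>+\<zeta>. ennreal ((norm (d k (r *\<^sub>R \<zeta>)))\<^sup>2) \<partial>torus_measure) \<le> ennreal e" .
    qed
    then show ?thesis by (auto simp: eventually_sequentially)
  qed
  have "G \<in> H2_poly"
  proof -
    from small[OF zero_less_one] obtain k where k: "H2_poly_means (d k) \<le> ennreal 1" by (auto simp: eventually_sequentially)
    have cd: "continuous_on polydisc (d k)"
      unfolding d_def using cf[of "s k"] cG by (intro continuous_intros) (simp_all add: o_def)
    have "H2_poly_means G \<le> 2 * H2_poly_means (fs (s k) \<circ> \<phi>) + 2 * H2_poly_means (d k)"
    proof (rule H2_poly_means_triangle[OF cf cd])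
      show "norm (G z) \<le> norm ((fs (s k) \<circ> \<phi>) z) + norm (d k z)" for z
        using norm_triangle_ineq4[of "fs (s k) (\<phi> z)" "d k z"] by (simp add: d_def)
    qed
    also have "\<dots> < \<infinity>"
      using bounded[OF fm, of "s k"] le_less_trans[OF k ennreal_less_top] by (auto simp: H2_poly_def ennreal_mult_less_top)
    finally show ?thesis using Gp by (simp add: H2_poly_def)
  qed
  moreover have "(\<lambda>k. H2_poly_norm (d k)) \<longlonglongrightarrow> 0"
  proof (rule tendstoI)
    fix e :: real assume e: "e > 0"
    have "\<forall>\<^sub>F k in sequentially. H2_poly_means (d k) \<le> ennreal ((e / 2)\<^sup>2)" by (rule small) (use e in simp)
    then show "\<forall>\<^sub>F k in sequentially. dist (H2_poly_norm (d k)) 0 < e"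
    proof eventually_elim
      case (elim k)
      have "enn2real (H2_poly_means (d k)) \<le> (e / 2)\<^sup>2" using elim by (rule enn2real_leI[rotated]) simp
      then have "H2_poly_norm (d k) \<le> sqrt ((e / 2)\<^sup>2)" unfolding H2_poly_norm_def by (rule real_sqrt_le_mono)
      moreover have "0 \<le> H2_poly_norm (d k)" by (simp add: H2_poly_norm_def)
      ultimately show ?case using e by (simp add: dist_real_def)
    qed
  qed
  ultimately show "\<exists>s G. strict_mono s \<and> G \<in> H2_poly \<and> (\<lambda>k. H2_poly_norm (\<lambda>z. fs (s k) (\<phi> z) - G z)) \<longlonglongrightarrow> 0"
    using s unfolding d_def by blast
qed

end

theorem theorem3p1:
  fixes \<phi> :: "complex ^ 'n \<Rightarrow> complex" and \<Theta> :: "complex \<Rightarrow> complex"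
  assumes "holomorphic_pd \<phi>"
    and "\<phi> ` polydisc \<subseteq> ball 0 1"
    and "inner_function \<Theta>"
    and "infinite_dim_on_disc (model_space \<Theta>)"
  shows "((\<lambda>w. \<integral>\<^sup>+ \<zeta>. nevanlinna (slice \<phi> \<zeta>) w * ennreal ((1 - norm (\<Theta> w)) / (1 - norm w))
              \<partial>torus_measure) \<longlongrightarrow> 0) (filtercomap norm (at_left 1))
         \<longleftrightarrow> compact_composition \<Theta> \<phi>"
proof -
  interpret polydisc_self_map \<phi> using assms by unfold_locales
  have \<Theta>: "\<Theta> holomorphic_on ball 0 1" "\<And>z. norm z < 1 \<Longrightarrow> norm (\<Theta> z) < 1"
    using assms(3) by (auto simp: inner_function_def image_subset_iff)
  let ?L = "\<lambda>w. \<integral>\<^sup>+ \<zeta>. nevanlinna (slice \<phi> \<zeta>) w * ennreal ((1 - norm (\<Theta> w)) / (1 - norm w)) \<partial>torus_measure"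
  let ?N = "\<lambda>w. counting \<phi> w * ennreal ((1 - norm (\<Theta> w)) / (1 - norm w))"
  \<comment> \<open>The two averages are identified off the point phi(0), which is avoided once |w|
    exceeds |phi(0)|.\<close>
  have "eventually (\<lambda>w. norm (\<phi> 0) < norm w) (filtercomap norm (at_left (1::real)) :: complex filter)"
    by (rule eventually_filtercomapI) (use norm_phi0 in \<open>auto simp: eventually_at_left_field\<close>)
  then have "eventually (\<lambda>w. ?L w = ?N w) (filtercomap norm (at_left (1::real)))"
    by eventually_elim (auto intro!: nevanlinna_slices)
  then have "(?L \<longlongrightarrow> 0) (filtercomap norm (at_left 1)) \<longleftrightarrow> (?N \<longlongrightarrow> 0) (filtercomap norm (at_left 1))"
    by (rule tendsto_cong)
  also have "\<dots> \<longleftrightarrow> compact_composition \<Theta> \<phi>"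
    unfolding tendsto_boundary_iff
    using compact_imp_vanishing[OF assms(3)] vanishing_imp_compact[OF \<Theta>] by blast
  finally show ?thesis .
qed

end
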